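(* Let $d,r\in\mathbb N$ and $1\le q<p<\infty$. Let $(A_m)$ be linear operators in $\tilde L_q(\mathbb I^d)$ with $\operatorname{rank}A_m\le m$, given by truncations of the Fourier series on certain hyperbolic crosses, such that $\|f-A_mf\|_{\tilde L_q(\mathbb I^d)}\ll m^{-r}(\log m)^{(d-1)r}\|f\|_{\tilde W^r_p(\mathbb I^d)}$ for all $f\in\tilde W^r_p(\mathbb I^d)$. Then for any real $n\ge1$, based on these operators one can construct a linear operator $A_n^\mu$ in $L_q(\mathbb R^d;\mu)$ of rank $\le n$, of the assembled form $$(A_n^\mu f)(\boldsymbol x)=\sum_{|\boldsymbol k|<\xi_n}\big(A_{\theta,n_{\boldsymbol k}}\tilde f_{\theta,\boldsymbol k}\big)(\boldsymbol x-\boldsymbol k)$$ (for a fixed $1<\theta<2$, notation in the context), so that $$\sup_{f\in\boldsymbol W^r_p(\mathbb R^d;\mu)}\|f-A_n^\mu(f)\|_{L_q(\mathbb R^d;\mu)}\asymp\lambda_n\big(\boldsymbol W^r_p(\mathbb R^d;\mu),L_q(\mathbb R^d;\mu)\big)\asymp d_n\big(\boldsymbol W^r_p(\mathbb R^d;\mu),L_q(\mathbb R^d;\mu)\big)\asymp n^{-r}(\log n)^{(d-1)r}.$$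
   Context: Fix $\lambda>1$, $a>0$, $b\in\mathbb R$. Let $w(x)=\exp(-a|x|^\lambda+b)$ for $x\in\mathbb R$, $w(\boldsymbol x)=\prod_{i=1}^dw(x_i)$ for $\boldsymbol x\in\mathbb R^d$, and let $\mu$ be the measure on $\mathbb R^d$ with density $w$. $L_p(\mathbb R^d;\mu)$ has norm $(\int|f|^pw\,d\boldsymbol x)^{1/p}$. $W^r_p(\mathbb R^d;\mu)$ is the space of $f\in L_p(\mathbb R^d;\mu)$ whose weak derivatives $D^{\boldsymbol k}f$ lie in $L_p(\mathbb R^d;\mu)$ for all $\boldsymbol k\in\mathbb N_0^d$ with $|\boldsymbol k|_\infty\le r$, with norm $\big(\sum_{|\boldsymbol k|_\infty\le r}\|D^{\boldsymbol k}f\|^p_{L_p(\mathbb R^d;\mu)}\big)^{1/p}$; $\boldsymbol W^r_p(\mathbb R^d;\mu)$ is its unit ball. $W^r_p(\Omega)$ denotes the analogous unweighted space (weight $1$) on $\Omega$. Widths: $d_n(\boldsymbol W,X)=\inf_{L}\sup_{f\in\boldsymbol W}\inf_{g\in L}\|f-g\|_X$ over linear subspaces $L\subset X$ of dimension at most $n$; $\lambda_n(\boldsymbol W,X)=\inf_{A}\sup_{f\in\boldsymbol W}\|f-A(f)\|_X$ over linear operators $A$ in $X$ of rank at most $n$. For real $n\ge1$, the index $n$ means $\lfloor n\rfloor$. Periodic spaces: $\mathbb I^d=[-\frac12,\frac12]^d$, $\mathbb I^d_\theta=[-\frac\theta2,\frac\theta2]^d$, $\mathbb I^d_{\theta,\boldsymbol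 k}=\boldsymbol k+\mathbb I^d_\theta$. $\tilde L_q(\mathbb I^d)$, $\tilde W^r_p(\mathbb I^d)$ are the subspaces of $L_q(\mathbb I^d)$, $W^r_p(\mathbb I^d)$ of functions extendable to $\mathbb R^d$ as functions $1$-periodic in each variable (for $\tilde W^r_p$, the extension being locally in $W^r_p$); $\tilde L_q(\mathbb I^d_\theta)$, $\tilde W^r_p(\mathbb I_\theta^d)$ are defined likewise with period $\theta$. Construction: $A_m:=A_{\lfloor m\rfloor}$ for real $m\ge1$ and $A_m:=0$ for $m<1$. $(A_{\theta,m}f)(\boldsymbol x):=\big(A_m(f(\theta\,\cdot))\big)(\boldsymbol x/\theta)$. Let $\{\varphi_{\boldsymbol k}\}_{\boldsymbol k\in\mathbb Z^d}\subset C_0^\infty(\mathbb R^d)$ be a partition of unity: $0\le\varphi_{\boldsymbol k}\le1$, $\operatorname{supp}\varphi_{\boldsymbol k}$ is in the interior of $\mathbb I^d_{\theta,\boldsymbol k}$, $\sum_{\boldsymbol k}\varphi_{\boldsymbol k}=1$, and $\|\varphi_{\boldsymbol k}\|_{W^r_p(\mathbb I^d_{\theta,\boldsymbol k})}\le C_{r,d,\theta}$. For $f$ on $\mathbb R^d$, $\tilde f_{\theta,\boldsymbol k}(\boldsymbol x):=f(\boldsymbol x+\boldsymbol k)\varphi_{\boldsymbol k}(\boldsymbol x+\boldsymbol k)$, $\boldsymbol x\in\mathbb I^d_\theta$; each summand $(A_{\theta,n_{\boldsymbol k}}\tilde f_{\theta,\boldsymbol k})(\cdot-\boldsymbol k)$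 is taken on $\mathbb I^d_{\theta,\boldsymbol k}$ and extended by $0$. With $\alpha=r$, $|\cdot|$ the Euclidean norm and a sufficiently small constant $\delta>0$ independent of $n$ and $f$: $\xi_n=(\delta^{-1}\lambda\alpha\log n)^{1/\lambda}$, $n_{\boldsymbol k}=\varrho\, n\,e^{-\frac{a\delta}{\alpha}|\boldsymbol k|^\lambda}$ for $|\boldsymbol k|<\xi_n$, where $\varrho^{-1}=\frac{2(2\pi)^{(d-1)/2}}{d!!}\sum_{s=0}^\infty s^de^{-\frac{a\delta}{\alpha}s^\lambda}$. $\ll$ and $\asymp$ denote inequality, respectively two-sided inequality, up to positive constants independent of $n,m,f$; in these bounds $\log n$, $\log m$ are read as $\max\{1,\log n\}$, $\max\{1,\log m\}$. *)

theory Defs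
  imports "HOL-Analysis.Analysis"
begin

text \<open>
  Functions are complex valued. Elements of an \<open>L\<^sub>p\<close> space are represented by measurable functions;
  identification up to null sets is made explicit through \<open>AE\<close> in the notions below.
\<close>

definition Lp :: "real \<Rightarrow> 'a measure \<Rightarrow> ('a \<Rightarrow> complex) set" where
  "Lp p M = {f \<in> borel_measurable M. integrable M (\<lambda>x. norm (f x) powr p)}"

definition Lp_norm :: "real \<Rightarrow> 'a measure \<Rightarrow> ('a \<Rightarrow> complex) \<Rightarrow> real" where
  "Lp_norm p M f = (LINT x|M. norm (f x) powr p) powr (1 / p)"

definition weight :: "real \<Rightarrow> real \<Rightarrow> real \<Rightarrow> real \<Rightarrow> real" where
  "weight lam a b x = exp (- a * \<bar>x\<bar> powr lam + b)"

definition weight_measure :: "real \<Rightarrow> real \<Rightarrow> real \<Rightarrow> (real ^ 'd) measure" where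
  "weight_measure lam a b = density lborel (\<lambda>x. ennreal (\<Prod>i\<in>UNIV. weight lam a b (x $ i)))"

definition leb_on :: "(real ^ 'd) set \<Rightarrow> (real ^ 'd) measure" where
  "leb_on S = restrict_space lborel S"

definition partial_deriv :: "'d \<Rightarrow> (real ^ 'd \<Rightarrow> real) \<Rightarrow> real ^ 'd \<Rightarrow> real" where
  "partial_deriv i g x = deriv (\<lambda>t. g (x + t *\<^sub>R axis i 1)) 0"

definition iter_partial :: "'d list \<Rightarrow> (real ^ 'd \<Rightarrow> real) \<Rightarrow> real ^ 'd \<Rightarrow> real" where
  "iter_partial js g = foldr partial_deriv js g"

definition smooth :: "(real ^ 'd \<Rightarrow> real) \<Rightarrow> bool" where
  "smooth g \<longleftrightarrow>
     (\<forall>js. continuous_on UNIV (iter_partial js g) \<and>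
       (\<forall>i x. (\<lambda>t. iter_partial js g (x + t *\<^sub>R axis i 1)) field_differentiable (at 0)))"

definition test_function :: "(real ^ 'd) set \<Rightarrow> (real ^ 'd \<Rightarrow> real) \<Rightarrow> bool" where
  "test_function U g \<longleftrightarrow>
     smooth g \<and> compact (closure {x. g x \<noteq> 0}) \<and> closure {x. g x \<noteq> 0} \<subseteq> U"

definition locally_integrable :: "(real ^ 'd) set \<Rightarrow> (real ^ 'd \<Rightarrow> complex) \<Rightarrow> bool" where
  "locally_integrable U f \<longleftrightarrow> (\<forall>K. compact K \<and> K \<subseteq> U \<longrightarrow> set_integrable lborel K f)"

text \<open>
  The index type carries no order, so the derivative of order \<open>k\<close> of a test function is taken along
  every list of coordinates containing each \<open>i\<close> exactly \<open>k $ i\<close> times; by Schwarz's theorem the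
  order of the list does not matter.
\<close>

definition has_weak_deriv ::
    "(real ^ 'd) set \<Rightarrow> nat ^ 'd \<Rightarrow> (real ^ 'd \<Rightarrow> complex) \<Rightarrow> (real ^ 'd \<Rightarrow> complex) \<Rightarrow> bool" where
  "has_weak_deriv U k f g \<longleftrightarrow>
     locally_integrable U f \<and> locally_integrable U g \<and>
     (\<forall>\<phi> js. test_function U \<phi> \<and> (\<forall>i. count_list js i = k $ i) \<longrightarrow>
       (LINT x:U|lborel. f x * of_real (iter_partial js \<phi> x)) =
       (- 1) ^ (\<Sum>i\<in>UNIV. k $ i) * (LINT x:U|lborel. g x * of_real (\<phi> x)))"

text \<open>
  \<open>M\<close> is a measure whose space is the domain; weak derivatives are taken with respect to
  Lebesgue measure in the interior of the domain.
\<close>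

definition sobolev :: "nat \<Rightarrow> real \<Rightarrow> (real ^ 'd) measure \<Rightarrow> (real ^ 'd \<Rightarrow> complex) set" where
  "sobolev r p M =
     {f \<in> Lp p M. \<forall>k. (\<forall>i. k $ i \<le> r) \<longrightarrow> (\<exists>g \<in> Lp p M. has_weak_deriv (interior (space M)) k f g)}"

definition weak_deriv ::
    "real \<Rightarrow> (real ^ 'd) measure \<Rightarrow> nat ^ 'd \<Rightarrow> (real ^ 'd \<Rightarrow> complex) \<Rightarrow> real ^ 'd \<Rightarrow> complex" where
  "weak_deriv p M k f = (SOME g. g \<in> Lp p M \<and> has_weak_deriv (interior (space M)) k f g)"

definition sobolev_norm :: "nat \<Rightarrow> real \<Rightarrow> (real ^ 'd) measure \<Rightarrow> (real ^ 'd \<Rightarrow> complex) \<Rightarrow> real" where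
  "sobolev_norm r p M f =
     (\<Sum>k | \<forall>i. k $ i \<le> r. Lp_norm p M (weak_deriv p M k f) powr p) powr (1 / p)"

definition sobolev_ball :: "nat \<Rightarrow> real \<Rightarrow> (real ^ 'd) measure \<Rightarrow> (real ^ 'd \<Rightarrow> complex) set" where
  "sobolev_ball r p M = {f \<in> sobolev r p M. sobolev_norm r p M f \<le> 1}"

definition int_vec :: "int ^ 'd \<Rightarrow> real ^ 'd" where
  "int_vec k = (\<chi> i. of_int (k $ i))"

definition cube :: "real \<Rightarrow> real ^ 'd \<Rightarrow> (real ^ 'd) set" where
  "cube \<theta> c = {x. \<forall>i. \<bar>x $ i - c $ i\<bar> \<le> \<theta> / 2}"

definition periodic :: "real \<Rightarrow> (real ^ 'd \<Rightarrow> complex) \<Rightarrow> bool" where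
  "periodic \<theta> F \<longleftrightarrow> (\<forall>x i. F (x + \<theta> *\<^sub>R axis i 1) = F x)"

definition Lp_per :: "real \<Rightarrow> real \<Rightarrow> (real ^ 'd \<Rightarrow> complex) set" where
  "Lp_per \<theta> q =
     {f \<in> Lp q (leb_on (cube \<theta> 0)). \<exists>F. periodic \<theta> F \<and> (AE x in leb_on (cube \<theta> 0). F x = f x)}"

definition sobolev_per :: "real \<Rightarrow> nat \<Rightarrow> real \<Rightarrow> (real ^ 'd \<Rightarrow> complex) set" where
  "sobolev_per \<theta> r p =
     {f \<in> sobolev r p (leb_on (cube \<theta> 0)).
        \<exists>F. periodic \<theta> F \<and> (AE x in leb_on (cube \<theta> 0). F x = f x) \<and>
            (\<forall>U. open U \<and> bounded U \<longrightarrow> F \<in> sobolev r p (leb_on U))}"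

definition linear_operator ::
    "'a measure \<Rightarrow> ('a \<Rightarrow> complex) set \<Rightarrow> (('a \<Rightarrow> complex) \<Rightarrow> 'a \<Rightarrow> complex) \<Rightarrow> bool" where
  "linear_operator M X A \<longleftrightarrow>
     (\<forall>f\<in>X. A f \<in> X) \<and>
     (\<forall>f\<in>X. \<forall>g\<in>X. (AE x in M. f x = g x) \<longrightarrow> (AE x in M. A f x = A g x)) \<and>
     (\<forall>f\<in>X. \<forall>g\<in>X. AE x in M. A (\<lambda>y. f y + g y) x = A f x + A g x) \<and>
     (\<forall>f\<in>X. \<forall>c. AE x in M. A (\<lambda>y. c * f y) x = c * A f x)"

definition dim_at_most :: "'a measure \<Rightarrow> nat \<Rightarrow> ('a \<Rightarrow> complex) set \<Rightarrow> bool" where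
  "dim_at_most M n L \<longleftrightarrow>
     (\<exists>B. B \<subseteq> L \<and> finite B \<and> card B \<le> n \<and> (\<forall>g\<in>L. \<exists>c. AE x in M. g x = (\<Sum>h\<in>B. c h * h x)))"

definition rank_le ::
    "'a measure \<Rightarrow> ('a \<Rightarrow> complex) set \<Rightarrow> nat \<Rightarrow> (('a \<Rightarrow> complex) \<Rightarrow> 'a \<Rightarrow> complex) \<Rightarrow> bool" where
  "rank_le M X n A \<longleftrightarrow> dim_at_most M n (A ` X)"

definition linear_subspace :: "('a \<Rightarrow> complex) set \<Rightarrow> ('a \<Rightarrow> complex) set \<Rightarrow> bool" where
  "linear_subspace X L \<longleftrightarrow>
     L \<subseteq> X \<and> (\<lambda>_. 0) \<in> L \<and> (\<forall>f\<in>L. \<forall>g\<in>L. (\<lambda>x. f x + g x) \<in> L) \<and> (\<forall>f\<in>L. \<forall>c. (\<lambda>x. c * f x) \<in> L)"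

definition op_error ::
    "('a \<Rightarrow> complex) set \<Rightarrow> real \<Rightarrow> 'a measure \<Rightarrow> (('a \<Rightarrow> complex) \<Rightarrow> 'a \<Rightarrow> complex) \<Rightarrow> ennreal" where
  "op_error W q M A = (SUP f\<in>W. ennreal (Lp_norm q M (\<lambda>x. f x - A f x)))"

definition linear_width :: "nat \<Rightarrow> ('a \<Rightarrow> complex) set \<Rightarrow> real \<Rightarrow> 'a measure \<Rightarrow> ennreal" where
  "linear_width n W q M =
     (INF A \<in> {A. linear_operator M (Lp q M) A \<and> rank_le M (Lp q M) n A}. op_error W q M A)"

definition kolmogorov_width :: "nat \<Rightarrow> ('a \<Rightarrow> complex) set \<Rightarrow> real \<Rightarrow> 'a measure \<Rightarrow> ennreal" where
  "kolmogorov_width n W q M =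
     (INF L \<in> {L. linear_subspace (Lp q M) L \<and> dim_at_most M n L}.
        SUP f\<in>W. INF g\<in>L. ennreal (Lp_norm q M (\<lambda>x. f x - g x)))"

definition asymp_eq :: "(real \<Rightarrow> ennreal) \<Rightarrow> (real \<Rightarrow> ennreal) \<Rightarrow> bool" where
  "asymp_eq F G \<longleftrightarrow>
     (\<exists>c C. c > 0 \<and> C > 0 \<and> (\<forall>n\<ge>1. ennreal c * G n \<le> F n \<and> F n \<le> ennreal C * G n))"

definition rate :: "nat \<Rightarrow> nat \<Rightarrow> real \<Rightarrow> real" where
  "rate d r n = n powr (- real r) * max 1 (ln n) ^ ((d - 1) * r)"

definition fourier_coeff :: "(real ^ 'd \<Rightarrow> complex) \<Rightarrow> int ^ 'd \<Rightarrow> complex" where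
  "fourier_coeff f s = (LINT y:cube 1 0|lborel. f y * cis (- 2 * pi * (int_vec s \<bullet> y)))"

definition fourier_truncation :: "(int ^ 'd) set \<Rightarrow> (real ^ 'd \<Rightarrow> complex) \<Rightarrow> real ^ 'd \<Rightarrow> complex" where
  "fourier_truncation G f x = (\<Sum>s\<in>G. fourier_coeff f s * cis (2 * pi * (int_vec s \<bullet> x)))"

text \<open>
  Both usual shapes are admitted: the hyperbolic cross \<open>\<Prod>\<^sub>i max 1 \<bar>s\<^sub>i\<bar> \<le> N\<close> and the step hyperbolic
  cross, the union over \<open>\<bar>u\<bar>\<^sub>1 \<le> N\<close> of the dyadic blocks \<open>\<lfloor>2 ^ (u\<^sub>i - 1)\<rfloor> \<le> \<bar>s\<^sub>i\<bar> < 2 ^ u\<^sub>i\<close>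
  (for \<open>u\<^sub>i = 0\<close> the lower bound is \<open>0\<close>, which the truncating division \<open>2 ^ u\<^sub>i div 2\<close> reproduces).
  In the first form \<open>N\<close> may be below 1, which gives the empty set.
\<close>

definition hyperbolic_cross :: "(int ^ 'd) set \<Rightarrow> bool" where
  "hyperbolic_cross G \<longleftrightarrow>
     (\<exists>N::real. G = {s. (\<Prod>i\<in>UNIV. max 1 \<bar>real_of_int (s $ i)\<bar>) \<le> N}) \<or>
     (\<exists>N::nat. G = {s. \<exists>u :: nat ^ 'd. (\<Sum>i\<in>UNIV. u $ i) \<le> N \<and>
                      (\<forall>i. 2 ^ (u $ i) div 2 \<le> \<bar>s $ i\<bar> \<and> \<bar>s $ i\<bar> < 2 ^ (u $ i))})"

definition op_at_real ::
    "(nat \<Rightarrow> (real ^ 'd \<Rightarrow> complex) \<Rightarrow> real ^ 'd \<Rightarrow> complex) \<Rightarrow>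
     real \<Rightarrow> (real ^ 'd \<Rightarrow> complex) \<Rightarrow> real ^ 'd \<Rightarrow> complex" where
  "op_at_real A m f = (if m < 1 then (\<lambda>_. 0) else A (nat \<lfloor>m\<rfloor>) f)"

definition dilated_op ::
    "(nat \<Rightarrow> (real ^ 'd \<Rightarrow> complex) \<Rightarrow> real ^ 'd \<Rightarrow> complex) \<Rightarrow>
     real \<Rightarrow> real \<Rightarrow> (real ^ 'd \<Rightarrow> complex) \<Rightarrow> real ^ 'd \<Rightarrow> complex" where
  "dilated_op A \<theta> m f x = op_at_real A m (\<lambda>y. f (\<theta> *\<^sub>R y)) ((1 / \<theta>) *\<^sub>R x)"

definition smooth_partition ::
    "nat \<Rightarrow> real \<Rightarrow> real \<Rightarrow> (int ^ 'd \<Rightarrow> real ^ 'd \<Rightarrow> real) \<Rightarrow> bool" where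
  "smooth_partition r p \<theta> \<phi> \<longleftrightarrow>
     (\<forall>k. test_function (interior (cube \<theta> (int_vec k))) (\<phi> k)) \<and>
     (\<forall>k x. 0 \<le> \<phi> k x \<and> \<phi> k x \<le> 1) \<and>
     (\<forall>x. ((\<lambda>k. \<phi> k x) has_sum 1) UNIV) \<and>
     (\<exists>C. \<forall>k. sobolev_norm r p (leb_on (cube \<theta> (int_vec k))) (\<lambda>x. of_real (\<phi> k x)) \<le> C)"

definition localized ::
    "(int ^ 'd \<Rightarrow> real ^ 'd \<Rightarrow> real) \<Rightarrow> int ^ 'd \<Rightarrow> (real ^ 'd \<Rightarrow> complex) \<Rightarrow> real ^ 'd \<Rightarrow> complex" where
  "localized \<phi> k f x = f (x + int_vec k) * of_real (\<phi> k (x + int_vec k))"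

fun double_fact :: "nat \<Rightarrow> nat" where
  "double_fact 0 = 1"
| "double_fact (Suc 0) = 1"
| "double_fact (Suc (Suc n)) = Suc (Suc n) * double_fact n"

text \<open>
  The convention that logarithms are cut off below at 1 belongs to the error bounds (\<open>rate\<close>) only; the
  truncation radius \<open>xi\<close> uses the plain logarithm, so \<open>assembled_op\<close> is the zero operator at \<open>n = 1\<close>.
  The smoothness parameter \<open>\<alpha>\<close> of the construction is \<open>r\<close>.
\<close>

definition xi :: "real \<Rightarrow> nat \<Rightarrow> real \<Rightarrow> real \<Rightarrow> real" where
  "xi lam r \<delta> n = (lam * real r * ln n / \<delta>) powr (1 / lam)"

definition rho :: "nat \<Rightarrow> real \<Rightarrow> real \<Rightarrow> nat \<Rightarrow> real \<Rightarrow> real" where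
  "rho d lam a r \<delta> =
     inverse (2 * (2 * pi) powr ((real d - 1) / 2) / real (double_fact d) *
       (\<Sum>s. real s ^ d * exp (- (a * \<delta> / real r) * real s powr lam)))"

definition local_rank :: "real \<Rightarrow> real \<Rightarrow> nat \<Rightarrow> real \<Rightarrow> real \<Rightarrow> int ^ 'd \<Rightarrow> real" where
  "local_rank lam a r \<delta> n k =
     rho CARD('d) lam a r \<delta> * n * exp (- (a * \<delta> / real r) * norm (int_vec k) powr lam)"

definition assembled_op ::
    "(nat \<Rightarrow> (real ^ 'd \<Rightarrow> complex) \<Rightarrow> real ^ 'd \<Rightarrow> complex) \<Rightarrow>
     (int ^ 'd \<Rightarrow> real ^ 'd \<Rightarrow> real) \<Rightarrow> real \<Rightarrow> real \<Rightarrow> real \<Rightarrow> nat \<Rightarrow> real \<Rightarrow>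
     real \<Rightarrow> (real ^ 'd \<Rightarrow> complex) \<Rightarrow> real ^ 'd \<Rightarrow> complex" where
  "assembled_op A \<phi> \<theta> lam a r \<delta> n f x =
     (\<Sum>k | norm (int_vec k) < xi lam r \<delta> n.
        indicator (cube \<theta> (int_vec k)) x *
        dilated_op A \<theta> (local_rank lam a r \<delta> n k) (localized \<phi> k f) (x - int_vec k))"

end

theory Submission
  imports Defs "HOL-Library.Function_Algebras"
begin

text \<open>
  Everything follows from \<open>c \<cdot> rate \<le> d\<^sub>n\<close> and an upper bound \<open>C \<cdot> rate\<close> for the error of the assembled
  operator, since \<open>d\<^sub>n \<le> \<lambda>\<^sub>n\<close> and \<open>\<lambda>\<^sub>n\<close> is at most that error.

  Upper bound: \<open>\<phi>\<^sub>k\<close> is controlled only in the Sobolev norm, not in \<open>C\<^sup>r\<close>. To bound \<open>f \<phi>\<^sub>k\<close> by the mass of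
  the derivatives of \<open>f\<close> near \<open>k\<close>, each term of the Leibniz rule is averaged over unit segments in the
  variables in which \<open>f\<close> carries fewer than \<open>r\<close> derivatives. The losses from the weight and from
  \<open>n\<^sub>k < n\<close> are absorbed because \<open>q < p\<close> and \<open>\<delta>\<close> is small.

  Lower bound: for most signs, a polynomial with coefficients \<open>\<plusminus>1\<close> on the \<open>N\<close> points \<open>\<Prod>k\<^sub>i \<le> M\<close> has
  Sobolev norm \<open>\<lless> M\<^sup>r \<surd>N\<close> and \<open>L\<^sub>4\<close> norm \<open>\<lless> \<surd>N\<close> (Khintchine). Exponentially many of them are
  \<open>\<surd>N\<close>-separated in \<open>L\<^sub>1\<close> of the unit cube, so a volume comparison rules out approximation from
  dimension \<open>\<lless> N\<close>.
\<close>

text \<open>The Sobolev norm is defined through weak derivatives picked by choice, so it can be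
  evaluated only once weak derivatives are known to be unique almost everywhere; the cutoffs for
  that proof are dilates of the given partition of unity itself. The parameter \<delta> is small for
  two unrelated reasons. With X = (a \<delta> / r)^(-1/lam), the number \<open>rho\<close> is the
  inverse of a series of order at least X^(d+1), which has to dominate a lattice sum of order at
  most X^d; this needs X large. And the factor exp((a + 1) \<delta> |k|^lam) lost on the cube at k
  has to be beaten by the gap 1 - q/p between the powers of the weight. The lower bound works in L_1
  of one cube because the weighted L_q norm dominates it for every q >= 1, so one argument serves
  all q. Only frequencies with positive entries are used: then the factors of all mixed derivatives
  of order at most r are bounded by a constant times M^r. Operators are linear, and ranks are
  finite, only modulo null sets; this shapes the statements about rank and subspaces.\<close>

abbreviation (input) borel_fun :: "('a::topological_space \<Rightarrow> 'b::topological_space) set" where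
  "borel_fun \<equiv> borel_measurable borel"

abbreviation (input) unit_cube :: "(real ^ 'd) measure" where "unit_cube \<equiv> leb_on (cube 1 0)"

abbreviation (input) ramp :: "real \<Rightarrow> real" where "ramp t \<equiv> (1 - t) * indicator {0..1} t"

abbreviation (input) absc :: "int ^ 'd \<Rightarrow> 'd \<Rightarrow> real" where "absc k i \<equiv> real_of_int \<bar>k $ i\<bar>"

abbreviation (input) capped_rate :: "nat \<Rightarrow> nat \<Rightarrow> real \<Rightarrow> real" where
  "capped_rate d r m \<equiv> if m < 1 then 1 else rate d r (real (nat \<lfloor>m\<rfloor>))"

lemmas L_integrable_add = Bochner_Integration.integrable_add
  and L_integrable_diff = Bochner_Integration.integrable_diff
  and L_integrable_sum = Bochner_Integration.integrable_sum
  and L_integral_sum = Bochner_Integration.integral_sum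
  and L_integral_add = Bochner_Integration.integral_add

section \<open>Test functions and weak derivatives\<close>

lemma iter_partial_Nil [simp]: "iter_partial [] g = g"
  by (simp add: iter_partial_def)

lemma iter_partial_Cons [simp]: "iter_partial (i # js) g = partial_deriv i (iter_partial js g)"
  by (simp add: iter_partial_def)

lemma iter_partial_append: "iter_partial (us @ vs) g = iter_partial us (iter_partial vs g)"
  by (simp add: iter_partial_def)

lemma smooth_iter_partial: "smooth g \<Longrightarrow> smooth (iter_partial js g)"
  unfolding smooth_def by (simp add: iter_partial_append[symmetric])

lemma smooth_partial_deriv: "smooth g \<Longrightarrow> smooth (partial_deriv i g)"
  using smooth_iter_partial[of g "[i]"] by simp

lemma smooth_continuous: "smooth g \<Longrightarrow> continuous_on A g"
  unfolding smooth_def by (metis continuous_on_subset iter_partial_Nil subset_UNIV)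

lemma partial_derivI:
  "((\<lambda>t. g (x + t *\<^sub>R axis i 1)) has_real_derivative D) (at 0) \<Longrightarrow> partial_deriv i g x = D"
  by (simp add: partial_deriv_def DERIV_imp_deriv)

lemma smooth_has_real_derivative:
  assumes "smooth g"
  shows "((\<lambda>t. g (x + t *\<^sub>R axis i 1)) has_real_derivative
           partial_deriv i g (x + t *\<^sub>R axis i 1)) (at t)"
proof -
  let ?y = "x + t *\<^sub>R axis i 1"
  have "(\<lambda>s. g (?y + s *\<^sub>R axis i 1)) field_differentiable at 0"
    using assms unfolding smooth_def by (metis iter_partial_Nil)
  then have "((\<lambda>s. g (?y + s *\<^sub>R axis i 1)) has_real_derivative partial_deriv i g ?y) (at 0)"
    unfolding partial_deriv_def using DERIV_deriv_iff_field_differentiable by blast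
  then have "((\<lambda>s. g (?y + (s + - t) *\<^sub>R axis i 1)) has_real_derivative partial_deriv i g ?y) (at t)"
    by (subst DERIV_shift[of "\<lambda>s. g (?y + s *\<^sub>R axis i 1)", symmetric]) simp
  then show ?thesis by (simp add: algebra_simps)
qed

lemma smooth_has_real_derivative_0:
  assumes "smooth g"
  shows "((\<lambda>t. g (x + t *\<^sub>R axis i 1)) has_real_derivative partial_deriv i g x) (at 0)"
  using smooth_has_real_derivative[OF assms, of x i 0] by simp

text \<open>Smoothness speaks about all derivative lists at once. A class of functions closed under
  partial derivatives serves as an invariant and replaces explicit formulas for iterated
  derivatives.\<close>

lemma smooth_coinduct:
  assumes "P g"
    and cont: "\<And>h. P h \<Longrightarrow> continuous_on UNIV h"
    and diff: "\<And>h i x. P h \<Longrightarrow> (\<lambda>t. h (x + t *\<^sub>R axis i 1)) field_differentiable at 0"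
    and step: "\<And>h i. P h \<Longrightarrow> P (partial_deriv i h)"
  shows "smooth g"
proof -
  have "P (iter_partial js g)" for js
    by (induction js) (use assms in auto)
  then show ?thesis unfolding smooth_def using cont diff by blast
qed

lemma partial_deriv_affine:
  assumes "smooth h"
  shows "partial_deriv i (\<lambda>x. c * h (s *\<^sub>R x + y)) x = (c * s) * partial_deriv i h (s *\<^sub>R x + y)"
    and "(\<lambda>t. c * h (s *\<^sub>R (x + t *\<^sub>R axis i 1) + y)) field_differentiable at 0"
proof -
  have "((\<lambda>t. h ((s *\<^sub>R x + y) + (s * t) *\<^sub>R axis i 1)) has_real_derivative
          partial_deriv i h (s *\<^sub>R x + y) * s) (at 0)"
    by (rule DERIV_chain'[where f="\<lambda>t. s * t" and g="\<lambda>t. h ((s *\<^sub>R x + y) + t *\<^sub>R axis i 1)"])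
      (use smooth_has_real_derivative_0[OF assms] in \<open>auto intro!: derivative_eq_intros\<close>)
  then have "((\<lambda>t. h (s *\<^sub>R (x + t *\<^sub>R axis i 1) + y)) has_real_derivative
          partial_deriv i h (s *\<^sub>R x + y) * s) (at 0)"
    by (simp add: algebra_simps)
  from DERIV_cmult[OF this, of c]
  have *: "((\<lambda>t. c * h (s *\<^sub>R (x + t *\<^sub>R axis i 1) + y)) has_real_derivative
          (c * s) * partial_deriv i h (s *\<^sub>R x + y)) (at 0)" by (simp add: mult_ac)
  show "partial_deriv i (\<lambda>x. c * h (s *\<^sub>R x + y)) x = (c * s) * partial_deriv i h (s *\<^sub>R x + y)"
    by (rule partial_derivI[OF *])
  show "(\<lambda>t. c * h (s *\<^sub>R (x + t *\<^sub>R axis i 1) + y)) field_differentiable at 0"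
    using * field_differentiable_def by blast
qed

lemma continuous_on_affine_comp:
  assumes "continuous_on UNIV h"
  shows "continuous_on A (\<lambda>x::'a::real_normed_vector. h (s *\<^sub>R x + y))"
  by (rule continuous_on_compose2[OF assms]) (auto intro!: continuous_intros)

lemma smooth_affine:
  assumes "smooth h"
  shows "smooth (\<lambda>x. c * h (s *\<^sub>R x + y))"
\<comment> \<open>The free scalar c in the invariant collects one factor s per derivative.\<close>
proof (rule smooth_coinduct[where P="\<lambda>u. \<exists>c h. smooth h \<and> u = (\<lambda>x. c * h (s *\<^sub>R x + y))"])
  show "\<exists>c' h'. smooth h' \<and> (\<lambda>x. c * h (s *\<^sub>R x + y)) = (\<lambda>x. c' * h' (s *\<^sub>R x + y))"
    using assms by blast
next
  fix u :: "real ^ 'a \<Rightarrow> real" and i x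
  assume "\<exists>c h. smooth h \<and> u = (\<lambda>x. c * h (s *\<^sub>R x + y))"
  then obtain c h where h: "smooth h" and u: "u = (\<lambda>x. c * h (s *\<^sub>R x + y))" by blast
  show "continuous_on UNIV u"
    unfolding u by (intro continuous_intros continuous_on_affine_comp smooth_continuous h)
  show "(\<lambda>t. u (x + t *\<^sub>R axis i 1)) field_differentiable at 0"
    unfolding u by (rule partial_deriv_affine(2)[OF h])
  have "partial_deriv i u = (\<lambda>x. (c * s) * partial_deriv i h (s *\<^sub>R x + y))"
    unfolding u by (rule ext, rule partial_deriv_affine(1)[OF h])
  then show "\<exists>c h. smooth h \<and> partial_deriv i u = (\<lambda>x. c * h (s *\<^sub>R x + y))"
    using smooth_partial_deriv[OF h] by blast
qed

lemma iter_partial_affine: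
  assumes "smooth h"
  shows "iter_partial js (\<lambda>x. h (s *\<^sub>R x + y)) = (\<lambda>x. s ^ length js * iter_partial js h (s *\<^sub>R x + y))"
proof (induction js)
  case (Cons i js)
  show ?case
    by (rule ext) (simp add: Cons partial_deriv_affine(1)[OF smooth_iter_partial[OF assms]] mult_ac)
qed simp

lemma partial_deriv_add:
  assumes "smooth f" "smooth g"
  shows "partial_deriv i (\<lambda>x. f x + g x) x = partial_deriv i f x + partial_deriv i g x"
    and "(\<lambda>t. f (x + t *\<^sub>R axis i 1) + g (x + t *\<^sub>R axis i 1)) field_differentiable at 0"
proof -
  note * = DERIV_add[OF smooth_has_real_derivative_0[OF assms(1), of x i] smooth_has_real_derivative_0[OF assms(2), of x i]]
  show "partial_deriv i (\<lambda>x. f x + g x) x = partial_deriv i f x + partial_deriv i g x"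
    by (rule partial_derivI[OF *])
  show "(\<lambda>t. f (x + t *\<^sub>R axis i 1) + g (x + t *\<^sub>R axis i 1)) field_differentiable at 0"
    using * field_differentiable_def by blast
qed

lemma smooth_add:
  assumes "smooth f" "smooth g"
  shows "smooth (\<lambda>x. f x + g x)"
proof (rule smooth_coinduct[where P="\<lambda>u. \<exists>f g. smooth f \<and> smooth g \<and> u = (\<lambda>x. f x + g x)"])
  fix u :: "real ^ 'a \<Rightarrow> real" and i x
  assume "\<exists>f g. smooth f \<and> smooth g \<and> u = (\<lambda>x. f x + g x)"
  then obtain f g where h: "smooth f" "smooth g" and u: "u = (\<lambda>x. f x + g x)" by blast
  show "continuous_on UNIV u"
    unfolding u by (intro continuous_intros smooth_continuous h)
  show "(\<lambda>t. u (x + t *\<^sub>R axis i 1)) field_differentiable at 0"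
    unfolding u by (rule partial_deriv_add(2)[OF h])
  have "partial_deriv i u = (\<lambda>x. partial_deriv i f x + partial_deriv i g x)"
    unfolding u by (rule ext, rule partial_deriv_add(1)[OF h])
  then show "\<exists>f g. smooth f \<and> smooth g \<and> partial_deriv i u = (\<lambda>x. f x + g x)"
    using smooth_partial_deriv h by blast
qed (use assms in blast)

lemma smooth_zero: "smooth (\<lambda>_. 0)"
proof (rule smooth_coinduct[where P="\<lambda>u. u = (\<lambda>_. 0)"])
  fix h :: "real ^ 'a \<Rightarrow> real" and i assume h: "h = (\<lambda>_. 0)"
  show "partial_deriv i h = (\<lambda>_. 0)"
    unfolding h by (rule ext, rule partial_derivI) (auto intro!: derivative_eq_intros)
qed auto

lemma smooth_sum:
  assumes "\<And>k. k \<in> F \<Longrightarrow> smooth (f k)"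
  shows "smooth (\<lambda>x. \<Sum>k\<in>F. f k x)"
  using assms by (induction F rule: infinite_finite_induct) (auto intro: smooth_zero smooth_add)

text \<open>The derivative of a product is a sum of two products, so products alone are not closed
  under partial derivatives; their closure under sums is, and is the invariant for
  \<open>smooth_coinduct\<close>.\<close>

inductive product_sum :: "(real ^ 'd \<Rightarrow> real) \<Rightarrow> bool" where
  mult: "smooth f \<Longrightarrow> smooth g \<Longrightarrow> product_sum (\<lambda>x. f x * g x)"
| add: "product_sum u \<Longrightarrow> product_sum v \<Longrightarrow> product_sum (\<lambda>x. u x + v x)"

lemma partial_deriv_mult:
  assumes "smooth f" "smooth g"
  shows "partial_deriv i (\<lambda>x. f x * g x) x = partial_deriv i f x * g x + f x * partial_deriv i g x"
    and "((\<lambda>t. f (x + t *\<^sub>R axis i 1) * g (x + t *\<^sub>R axis i 1)) has_real_derivative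
      partial_deriv i f x * g x + f x * partial_deriv i g x) (at 0)"
proof -
  show *: "((\<lambda>t. f (x + t *\<^sub>R axis i 1) * g (x + t *\<^sub>R axis i 1)) has_real_derivative
      partial_deriv i f x * g x + f x * partial_deriv i g x) (at 0)"
    using DERIV_mult[OF smooth_has_real_derivative_0[OF assms(1), of x i] smooth_has_real_derivative_0[OF assms(2), of x i]]
    by (simp add: mult_ac)
  show "partial_deriv i (\<lambda>x. f x * g x) x = partial_deriv i f x * g x + f x * partial_deriv i g x"
    by (rule partial_derivI[OF *])
qed

lemma product_sum_step:
  assumes "product_sum u"
  shows "continuous_on UNIV u \<and> (\<forall>i. product_sum (partial_deriv i u) \<and>
    (\<forall>x. ((\<lambda>t. u (x + t *\<^sub>R axis i 1)) has_real_derivative partial_deriv i u x) (at 0)))"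
  using assms
proof induction
  case (mult f g)
  have eq: "partial_deriv i (\<lambda>x. f x * g x) = (\<lambda>x. partial_deriv i f x * g x + f x * partial_deriv i g x)" for i
    by (rule ext, rule partial_deriv_mult(1)[OF mult])
  show ?case
    unfolding eq
    by (intro conjI allI product_sum.intros smooth_partial_deriv mult partial_deriv_mult(2)
        continuous_intros smooth_continuous)
next
  case (add u v)
  have d: "((\<lambda>t. u (x + t *\<^sub>R axis i 1) + v (x + t *\<^sub>R axis i 1)) has_real_derivative
      partial_deriv i u x + partial_deriv i v x) (at 0)" for i x
    using add.IH by (intro DERIV_add) auto
  have eq: "partial_deriv i (\<lambda>x. u x + v x) = (\<lambda>x. partial_deriv i u x + partial_deriv i v x)" for i
    by (rule ext, rule partial_derivI[OF d])
  show ?case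
    unfolding eq using d add.IH by (intro conjI allI product_sum.intros continuous_intros) blast+
qed

lemma smooth_mult:
  assumes "smooth f" "smooth g"
  shows "smooth (\<lambda>x. f x * g x)"
proof (rule smooth_coinduct[where P=product_sum])
  fix h :: "real ^ 'a \<Rightarrow> real" and i x
  assume h: "product_sum h"
  note * = product_sum_step[OF h]
  show "continuous_on UNIV h" using * by blast
  show "product_sum (partial_deriv i h)" using * by blast
  show "(\<lambda>t. h (x + t *\<^sub>R axis i 1)) field_differentiable at 0"
    using * unfolding field_differentiable_def by blast
qed (rule product_sum.mult[OF assms])

section \<open>Symmetry of mixed derivatives\<close>

lemma mixed_difference:
  assumes g: "smooth g" and h: "0 < h"
  shows "\<exists>s t. 0 < s \<and> s < h \<and> 0 < t \<and> t < h \<and>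
    g (x + h *\<^sub>R axis i 1 + h *\<^sub>R axis j 1) - g (x + h *\<^sub>R axis i 1) - g (x + h *\<^sub>R axis j 1) + g x
      = h * h * partial_deriv j (partial_deriv i g) (x + s *\<^sub>R axis i 1 + t *\<^sub>R axis j 1)"
proof -
  let ?u = "\<lambda>s. g ((x + h *\<^sub>R axis j 1) + s *\<^sub>R axis i 1) - g (x + s *\<^sub>R axis i 1)"
  let ?v = "\<lambda>s t. partial_deriv i g ((x + s *\<^sub>R axis i 1) + t *\<^sub>R axis j 1)"
  have "\<exists>s>0. s < h \<and> ?u h - ?u 0 = (h - 0) *
      (partial_deriv i g ((x + h *\<^sub>R axis j 1) + s *\<^sub>R axis i 1) - partial_deriv i g (x + s *\<^sub>R axis i 1))"
    by (rule MVT2[OF h]) (intro DERIV_diff smooth_has_real_derivative g)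
  then obtain s where s: "0 < s" "s < h" and us: "?u h - ?u 0 = h * (?v s h - ?v s 0)"
    by (auto simp: algebra_simps)
  have "\<exists>t>0. t < h \<and> ?v s h - ?v s 0 = (h - 0) *
      partial_deriv j (partial_deriv i g) ((x + s *\<^sub>R axis i 1) + t *\<^sub>R axis j 1)"
    by (rule MVT2[OF h]) (intro smooth_has_real_derivative smooth_partial_deriv g)
  then obtain t where "0 < t" "t < h" "?v s h - ?v s 0 =
      h * partial_deriv j (partial_deriv i g) ((x + s *\<^sub>R axis i 1) + t *\<^sub>R axis j 1)"
    by auto
  then show ?thesis using s us
    by (intro exI[of _ s] exI[of _ t]) (auto simp: algebra_simps)
qed

text \<open>The same second difference equals, by the mean value theorem in either order, h^2 times
  each of the two mixed derivatives at points within 2 h of x. Continuity of both at x then excludes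
  a gap between them.\<close>

lemma partial_deriv_commute:
  assumes g: "smooth g"
  shows "partial_deriv i (partial_deriv j g) = partial_deriv j (partial_deriv i g)"
proof (rule ext, rule ccontr)
  fix x assume ne: "partial_deriv i (partial_deriv j g) x \<noteq> partial_deriv j (partial_deriv i g) x"
  let ?a = "partial_deriv i (partial_deriv j g)" and ?b = "partial_deriv j (partial_deriv i g)"
  \<comment> \<open>Half the gap, so that no common value lies within e of both derivatives at
    x.\<close>
  define e where "e = \<bar>?a x - ?b x\<bar> / 2"
  have e: "e > 0" using ne by (simp add: e_def)
  have "continuous (at x) ?a" "continuous (at x) ?b"
    using smooth_continuous[OF smooth_partial_deriv[OF smooth_partial_deriv[OF g]], of UNIV]
    by (auto simp: continuous_on_eq_continuous_at)
  then obtain d1 d2 where d: "d1 > 0" "\<And>y. dist y x < d1 \<Longrightarrow> dist (?a y) (?a x) < e"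
     "d2 > 0" "\<And>y. dist y x < d2 \<Longrightarrow> dist (?b y) (?b x) < e"
    using e unfolding continuous_at_eps_delta by metis
  define h where "h = min d1 d2 / 3"
  have h: "h > 0" "2 * h < d1" "2 * h < d2" using d by (auto simp: h_def)
  have near: "dist (x + s *\<^sub>R axis k 1 + t *\<^sub>R axis l 1) x \<le> 2 * h"
    if "0 < s" "s < h" "0 < t" "t < h" for s t and k l :: 'a
  proof -
    have "norm (s *\<^sub>R axis k (1::real) + t *\<^sub>R axis l 1) \<le> \<bar>s\<bar> + \<bar>t\<bar>"
      by (rule order_trans[OF norm_triangle_ineq]) simp
    then show ?thesis using that by (simp add: dist_norm add.assoc)
  qed
  obtain s t where st: "0 < s" "s < h" "0 < t" "t < h"
    "g (x + h *\<^sub>R axis i 1 + h *\<^sub>R axis j 1) - g (x + h *\<^sub>R axis i 1) - g (x + h *\<^sub>R axis j 1) + g x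
      = h * h * ?b (x + s *\<^sub>R axis i 1 + t *\<^sub>R axis j 1)"
    using mixed_difference[OF g h(1), of x i j] by blast
  obtain s' t' where st': "0 < s'" "s' < h" "0 < t'" "t' < h"
    "g (x + h *\<^sub>R axis j 1 + h *\<^sub>R axis i 1) - g (x + h *\<^sub>R axis j 1) - g (x + h *\<^sub>R axis i 1) + g x
      = h * h * ?a (x + s' *\<^sub>R axis j 1 + t' *\<^sub>R axis i 1)"
    using mixed_difference[OF g h(1), of x j i] by blast
  have "h * h * ?b (x + s *\<^sub>R axis i 1 + t *\<^sub>R axis j 1) = h * h * ?a (x + s' *\<^sub>R axis j 1 + t' *\<^sub>R axis i 1)"
    using st(5) st'(5) by (simp add: algebra_simps)
  then have "?b (x + s *\<^sub>R axis i 1 + t *\<^sub>R axis j 1) = ?a (x + s' *\<^sub>R axis j 1 + t' *\<^sub>R axis i 1)"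
    using h by simp
  moreover have "dist (?b (x + s *\<^sub>R axis i 1 + t *\<^sub>R axis j 1)) (?b x) < e"
    using near[OF st(1-4), of i j] h by (intro d) auto
  moreover have "dist (?a (x + s' *\<^sub>R axis j 1 + t' *\<^sub>R axis i 1)) (?a x) < e"
    using near[OF st'(1-4), of j i] h by (intro d) auto
  ultimately have "\<bar>?a x - ?b x\<bar> < 2 * e" by (auto simp: dist_real_def)
  then show False by (simp add: e_def)
qed

lemma iter_partial_move:
  assumes "smooth g"
  shows "iter_partial (us @ i # vs) g = iter_partial (i # us @ vs) g"
proof (induction us)
  case (Cons j us)
  have "iter_partial ((j # us) @ i # vs) g = partial_deriv j (partial_deriv i (iter_partial (us @ vs) g))"
    using Cons by simp
  also have "\<dots> = iter_partial (i # (j # us) @ vs) g"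
    by (simp add: partial_deriv_commute[OF smooth_iter_partial[OF assms]])
  finally show ?case .
qed simp

text \<open>The head of the first list occurs somewhere in the second and is moved to its front by
  commutation; the tails then have equal counts.\<close>

lemma iter_partial_perm:
  assumes "smooth g" "\<And>i. count_list us i = count_list vs i"
  shows "iter_partial us g = iter_partial vs g"
  using assms(2)
proof (induction us arbitrary: vs)
  case Nil
  then have "count_list vs i = 0" for i by simp
  then have "vs = []" by (cases vs) (force split: if_splits)+
  then show ?case by simp
next
  case (Cons i us)
  have "count_list vs i \<noteq> 0" using Cons.prems[of i] by simp
  then have "i \<in> set vs" by (simp add: count_list_0_iff)
  then obtain a b where vs: "vs = a @ i # b" by (meson split_list)
  have "iter_partial us g = iter_partial (a @ b) g"
  proof (rule Cons.IH)
    fix k show "count_list us k = count_list (a @ b) k"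
      using Cons.prems[of k] by (auto simp: vs split: if_splits)
  qed
  then show ?case using iter_partial_move[OF assms(1), of a i b] by (simp add: vs)
qed

section \<open>Supports and test functions\<close>

lemma smooth_borel: "smooth g \<Longrightarrow> g \<in> borel_fun"
  by (rule borel_measurable_continuous_onI) (rule smooth_continuous)

lemma partial_deriv_support:
  "{x. partial_deriv i g x \<noteq> 0} \<subseteq> closure {x. g x \<noteq> 0}"
proof
  fix x assume x: "x \<in> {x. partial_deriv i g x \<noteq> 0}"
  show "x \<in> closure {x. g x \<noteq> 0}"
  proof (rule ccontr)
    assume "x \<notin> closure {x. g x \<noteq> 0}"
    then have op: "open (- closure {x. g x \<noteq> 0})" and xin: "x \<in> - closure {x. g x \<noteq> 0}" by auto
    have lim: "((\<lambda>t::real. x + t *\<^sub>R axis i 1) \<longlongrightarrow> x + 0 *\<^sub>R axis i 1) (at 0)"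
      by (intro tendsto_intros)
    have ev: "\<forall>\<^sub>F t in at 0. x + t *\<^sub>R axis i 1 \<in> - closure {x. g x \<noteq> 0}"
      using topological_tendstoD[OF lim op] xin by simp
    have "\<forall>\<^sub>F t in nhds 0. g (x + t *\<^sub>R axis i 1) = 0"
      unfolding eventually_nhds_conv_at
    proof
      show "\<forall>\<^sub>F t in at 0. g (x + t *\<^sub>R axis i 1) = 0"
        using ev by (rule eventually_mono) (use closure_subset[of "{x. g x \<noteq> 0}"] in blast)
      show "g (x + 0 *\<^sub>R axis i 1) = 0" using xin closure_subset[of "{x. g x \<noteq> 0}"] by auto
    qed
    then have "((\<lambda>t. g (x + t *\<^sub>R axis i 1)) has_real_derivative 0) (at 0)"
      by (subst DERIV_cong_ev[where g="\<lambda>_. 0" and y=0 and v=0]) auto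
    then show False using x partial_derivI[of g x i 0] by simp
  qed
qed

lemma iter_partial_support:
  "closure {x. iter_partial js g x \<noteq> 0} \<subseteq> closure {x. g x \<noteq> 0}"
proof (induction js)
  case (Cons i js)
  then show ?case using partial_deriv_support[of i "iter_partial js g"]
    by (simp) (meson closed_closure closure_minimal order_trans)
qed simp

lemma iter_partial_eq_0:
  assumes "closure {x. g x \<noteq> 0} \<subseteq> U" "x \<notin> U"
  shows "iter_partial js g x = 0"
  using assms iter_partial_support[of js g] closure_subset[of "{x. iter_partial js g x \<noteq> 0}"] by blast

lemma test_functionI:
  assumes "smooth g" "compact K" "K \<subseteq> U" "\<And>x. x \<notin> K \<Longrightarrow> g x = 0"
  shows "test_function U g"
proof -
  have "closure {x. g x \<noteq> 0} \<subseteq> K"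
    using assms by (intro closure_minimal compact_imp_closed) auto
  then show ?thesis unfolding test_function_def
    using assms compact_Int_closed[OF \<open>compact K\<close> closed_closure, of "{x. g x \<noteq> 0}"]
    by (auto simp: inf.absorb2)
qed

lemma test_functionE:
  assumes "test_function U g"
  obtains K where "compact K" "K \<subseteq> U" "\<And>x js. x \<notin> K \<Longrightarrow> iter_partial js g x = 0"
  using assms iter_partial_eq_0[of g "closure {x. g x \<noteq> 0}"] unfolding test_function_def by blast

lemma test_function_smooth: "test_function U g \<Longrightarrow> smooth g"
  by (simp add: test_function_def)

lemma test_function_iter_partial:
  assumes "test_function U g" shows "test_function U (iter_partial js g)"
proof -
  obtain K where "compact K" "K \<subseteq> U" "\<And>x js. x \<notin> K \<Longrightarrow> iter_partial js g x = 0"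
    using test_functionE[OF assms] by metis
  then show ?thesis
    using assms by (intro test_functionI[of _ K]) (auto simp: test_function_smooth smooth_iter_partial)
qed

lemma test_function_partial_deriv:
  "test_function U g \<Longrightarrow> test_function U (partial_deriv i g)"
  using test_function_iter_partial[of U g "[i]"] by simp

lemma test_function_mono: "test_function U g \<Longrightarrow> U \<subseteq> V \<Longrightarrow> test_function V g"
  unfolding test_function_def by auto

lemma test_function_mult:
  assumes "test_function U g" "smooth h"
  shows "test_function U (\<lambda>x. h x * g x)"
proof -
  obtain K where K: "compact K" "K \<subseteq> U" "\<And>x js. x \<notin> K \<Longrightarrow> iter_partial js g x = 0"
    using test_functionE[OF assms(1)] by metis
  then show ?thesis
    using assms K(3)[of _ "[]"] by (intro test_functionI[of _ K]) (auto simp: test_function_smooth smooth_mult)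
qed

lemma test_function_affine:
  assumes "test_function UNIV g" "s \<noteq> 0"
  shows "test_function UNIV (\<lambda>x. g (s *\<^sub>R x + y))"
proof -
  obtain K where K: "compact K" "K \<subseteq> UNIV" "\<And>x js. x \<notin> K \<Longrightarrow> iter_partial js g x = 0"
    using test_functionE[OF assms(1)] by metis
  let ?K = "(\<lambda>x. (1/s) *\<^sub>R (x - y)) ` K"
  have "compact ?K" by (intro compact_continuous_image continuous_intros K)
  moreover have "g (s *\<^sub>R x + y) = 0" if "x \<notin> ?K" for x
  proof -
    have "s *\<^sub>R x + y \<notin> K"
    proof
      assume "s *\<^sub>R x + y \<in> K"
      then have "(1/s) *\<^sub>R ((s *\<^sub>R x + y) - y) \<in> ?K" by blast
      then show False using that \<open>s \<noteq> 0\<close> by simp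
    qed
    then show ?thesis using K(3)[of _ "[]"] by simp
  qed
  ultimately show ?thesis
    using smooth_affine[OF test_function_smooth[OF assms(1)], of 1 s y] by (intro test_functionI) auto
qed

lemma test_function_translate:
  assumes "test_function UNIV g"
  shows "test_function UNIV (\<lambda>x. g (x + y))"
  using test_function_affine[OF assms, of 1 y] by simp

section \<open>Affine substitutions in Lebesgue integrals\<close>

lemma nn_integral_lborel_affine:
  fixes f :: "'a::euclidean_space \<Rightarrow> ennreal"
  assumes [measurable]: "f \<in> borel_fun" and s: "s \<noteq> 0"
  shows "(\<integral>\<^sup>+x. f x \<partial>lborel) = ennreal (\<bar>s\<bar> ^ DIM('a)) * (\<integral>\<^sup>+x. f (y + s *\<^sub>R x) \<partial>lborel)"
proof -
  have [measurable]: "(\<lambda>x. y + s *\<^sub>R x) \<in> borel_fun" by simp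
  show ?thesis
    by (subst lborel_affine[OF s, of y])
      (simp add: nn_integral_density nn_integral_distr nn_integral_cmult)
qed

lemma nn_integral_lborel_translate:
  fixes f :: "'a::euclidean_space \<Rightarrow> ennreal"
  assumes "f \<in> borel_fun"
  shows "(\<integral>\<^sup>+x. f (x + y) \<partial>lborel) = (\<integral>\<^sup>+x. f x \<partial>lborel)"
  using nn_integral_lborel_affine[OF assms, of 1 y] by (simp add: add.commute)

lemma integral_lborel_affine:
  fixes f :: "'a::euclidean_space \<Rightarrow> 'b::{banach, second_countable_topology}"
  assumes [measurable]: "f \<in> borel_fun" and s: "s \<noteq> 0"
  shows "(LINT x|lborel. f x) = (\<bar>s\<bar> ^ DIM('a)) *\<^sub>R (LINT x|lborel. f (y + s *\<^sub>R x))"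
proof -
  have [measurable]: "(\<lambda>x. y + s *\<^sub>R x) \<in> borel_fun" by simp
  show ?thesis
    by (subst lborel_affine[OF s, of y])
      (simp add: integral_density integral_distr)
qed

lemma integral_lborel_translate:
  fixes f :: "'a::euclidean_space \<Rightarrow> 'b::{banach, second_countable_topology}"
  assumes "f \<in> borel_fun"
  shows "(LINT x|lborel. f (x + y)) = (LINT x|lborel. f x)"
  using integral_lborel_affine[OF assms, of 1 y] by (simp add: add.commute)

lemma AE_lborel_affine:
  fixes P :: "'a::euclidean_space \<Rightarrow> bool"
  assumes s: "s \<noteq> 0" and P: "AE x in lborel. P x"
  shows "AE x in lborel. P (y + s *\<^sub>R x)"
proof -
  from P obtain N where N: "N \<in> null_sets lborel" "{x. \<not> P x} \<subseteq> N"
    by (auto simp: eventually_ae_filter)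
  then have [measurable]: "N \<in> sets borel" by auto
  have "ennreal (\<bar>s\<bar> ^ DIM('a)) * (\<integral>\<^sup>+x. indicator N (y + s *\<^sub>R x) \<partial>lborel) = (\<integral>\<^sup>+x. indicator N x \<partial>lborel)"
    by (rule nn_integral_lborel_affine[symmetric]) (use s in auto)
  also have "\<dots> = 0" using N by (simp add: null_sets_def)
  finally have "(\<integral>\<^sup>+x. indicator N (y + s *\<^sub>R x) \<partial>lborel) = 0" using s by simp
  then have "AE x in lborel. indicator N (y + s *\<^sub>R x) = (0::ennreal)"
    by (subst (asm) nn_integral_0_iff_AE) auto
  then show ?thesis by eventually_elim (use N(2) in \<open>auto split: split_indicator_asm\<close>)
qed

section \<open>Local integrability and weak derivatives\<close>

lemma locally_integrable_mono: "locally_integrable U f \<Longrightarrow> V \<subseteq> U \<Longrightarrow> locally_integrable V f"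
  unfolding locally_integrable_def by auto

text \<open>f is not assumed measurable on the whole space, only integrable over compact subsets of
  U. The product is therefore rewritten with f cut off to K, outside of which h vanishes.\<close>

lemma locally_integrable_mult:
  fixes f h :: "real ^ 'd \<Rightarrow> complex"
  assumes f: "locally_integrable U f" and K: "compact K" "K \<subseteq> U"
    and h[measurable]: "h \<in> borel_fun"
    and B: "\<And>x. norm (h x) \<le> B" and out: "\<And>x. x \<notin> K \<Longrightarrow> h x = 0"
  shows "integrable lborel (\<lambda>x. f x * h x)"
proof -
  have i: "integrable lborel (\<lambda>x. indicator K x *\<^sub>R f x)"
    using f K unfolding locally_integrable_def set_integrable_def by auto
  then have [measurable]: "(\<lambda>x. indicator K x *\<^sub>R f x) \<in> borel_fun"
    using borel_measurable_integrable by force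
  have "integrable lborel (\<lambda>x. (indicator K x *\<^sub>R f x) * h x)"
  proof (rule Bochner_Integration.integrable_bound)
    show "integrable lborel (\<lambda>x. B * norm (indicator K x *\<^sub>R f x))"
      using i by (intro integrable_mult_right integrable_norm)
    show "AE x in lborel. norm (indicator K x *\<^sub>R f x * h x) \<le> norm (B * norm (indicator K x *\<^sub>R f x))"
    proof (rule AE_I2)
      fix x
      have "norm (indicator K x *\<^sub>R f x * h x) = norm (h x) * norm (indicator K x *\<^sub>R f x)"
        by (simp add: norm_mult mult_ac)
      also have "\<dots> \<le> B * norm (indicator K x *\<^sub>R f x)" by (rule mult_right_mono[OF B]) simp
      finally show "norm (indicator K x *\<^sub>R f x * h x) \<le> norm (B * norm (indicator K x *\<^sub>R f x))"
        by simp
    qed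
    show "(\<lambda>x. (indicator K x *\<^sub>R f x) * h x) \<in> borel_measurable lborel" by measurable
  qed
  moreover have "(\<lambda>x. (indicator K x *\<^sub>R f x) * h x) = (\<lambda>x. f x * h x)"
    using out by (auto simp: fun_eq_iff indicator_def)
  ultimately show ?thesis by simp
qed

lemma test_function_bounded:
  assumes "test_function U g"
  obtains B where "\<And>x. norm (g x) \<le> B"
proof -
  obtain K where K: "compact K" "K \<subseteq> U" "\<And>x js. x \<notin> K \<Longrightarrow> iter_partial js g x = 0"
    using test_functionE[OF assms] by metis
  have "bounded (g ` K)"
    by (intro compact_imp_bounded compact_continuous_image smooth_continuous test_function_smooth[OF assms] K)
  then obtain B where B: "\<And>x. x \<in> K \<Longrightarrow> norm (g x) \<le> B" unfolding bounded_iff by auto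
  show ?thesis
  proof
    fix x show "norm (g x) \<le> max B 0"
      using B[of x] K(3)[of x "[]"] by (cases "x \<in> K") auto
  qed
qed

lemma integrable_mult_test:
  assumes f: "locally_integrable U f" and g: "test_function U g"
  shows "integrable lborel (\<lambda>x. f x * complex_of_real (g x))"
proof -
  obtain K where K: "compact K" "K \<subseteq> U" "\<And>x js. x \<notin> K \<Longrightarrow> iter_partial js g x = 0"
    using test_functionE[OF g] by metis
  obtain B where B: "\<And>x. norm (g x) \<le> B" using test_function_bounded[OF g] by blast
  have [measurable]: "g \<in> borel_fun" using g by (intro smooth_borel test_function_smooth)
  show ?thesis
    by (rule locally_integrable_mult[OF f K(1,2)]) (use B K(3)[of _ "[]"] in auto)
qed

text \<open>Test functions vanish off U, so weak derivatives in U can be handled with integrals over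
  the whole space, whatever f does outside U.\<close>

lemma set_integral_test:
  assumes g: "test_function U g"
  shows "(LINT x:U|lborel. f x * complex_of_real (iter_partial js g x)) = (LINT x|lborel. f x * of_real (iter_partial js g x))"
proof -
  obtain K where K: "compact K" "K \<subseteq> U" "\<And>x js. x \<notin> K \<Longrightarrow> iter_partial js g x = 0"
    using test_functionE[OF g] by metis
  show ?thesis
    unfolding set_lebesgue_integral_def
    by (rule Bochner_Integration.integral_cong) (use K in \<open>auto simp: indicator_def subset_iff\<close>)
qed

lemma set_integral_test_0:
  assumes g: "test_function U g"
  shows "(LINT x:U|lborel. f x * complex_of_real (g x)) = (LINT x|lborel. f x * of_real (g x))"
  using set_integral_test[OF assms, of f "[]"] by simp

lemma has_weak_derivI:
  assumes "locally_integrable U f" "locally_integrable U g"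
    and "\<And>\<phi> js. test_function U \<phi> \<Longrightarrow> (\<And>i. count_list js i = k $ i) \<Longrightarrow>
       (LINT x|lborel. f x * of_real (iter_partial js \<phi> x)) =
       (- 1) ^ (\<Sum>i\<in>UNIV. k $ i) * (LINT x|lborel. g x * of_real (\<phi> x))"
  shows "has_weak_deriv U k f g"
  unfolding has_weak_deriv_def
proof (intro conjI allI impI)
  fix \<phi> js assume *: "test_function U \<phi> \<and> (\<forall>i. count_list js i = k $ i)"
  then show "(LINT x:U|lborel. f x * of_real (iter_partial js \<phi> x)) =
       (- 1) ^ (\<Sum>i\<in>UNIV. k $ i) * (LINT x:U|lborel. g x * of_real (\<phi> x))"
    using assms(3)[of \<phi> js] by (simp add: set_integral_test set_integral_test_0)
qed fact+

lemma has_weak_derivD: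
  assumes "has_weak_deriv U k f g" "test_function U \<phi>" "\<And>i. count_list js i = k $ i"
  shows "(LINT x|lborel. f x * of_real (iter_partial js \<phi> x)) =
       (- 1) ^ (\<Sum>i\<in>UNIV. k $ i) * (LINT x|lborel. g x * of_real (\<phi> x))"
proof -
  have "(LINT x:U|lborel. f x * of_real (iter_partial js \<phi> x)) =
       (- 1) ^ (\<Sum>i\<in>UNIV. k $ i) * (LINT x:U|lborel. g x * of_real (\<phi> x))"
    using assms unfolding has_weak_deriv_def by blast
  then show ?thesis unfolding set_integral_test[OF assms(2)] set_integral_test_0[OF assms(2)] .
qed

lemma has_weak_deriv_local:
  assumes "has_weak_deriv U k f g"
  shows "locally_integrable U f" "locally_integrable U g"
  using assms unfolding has_weak_deriv_def by auto

lemma has_weak_deriv_mono: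
  assumes "has_weak_deriv U k f g" "V \<subseteq> U"
  shows "has_weak_deriv V k f g"
  using has_weak_deriv_local[OF assms(1)] assms(2) has_weak_derivD[OF assms(1)]
  by (intro has_weak_derivI) (auto intro: locally_integrable_mono test_function_mono)

lemma locally_integrable_cong:
  assumes "\<And>x. x \<in> U \<Longrightarrow> f x = f' x" "locally_integrable U f"
  shows "locally_integrable U f'"
  unfolding locally_integrable_def
proof (intro allI impI)
  fix K assume K: "compact K \<and> K \<subseteq> U"
  then have "set_integrable lborel K f" using assms unfolding locally_integrable_def by auto
  moreover have "(\<lambda>x. indicat_real K x *\<^sub>R f x) = (\<lambda>x. indicat_real K x *\<^sub>R f' x)"
  proof
    fix x show "indicat_real K x *\<^sub>R f x = indicat_real K x *\<^sub>R f' x"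
      using K assms(1)[of x] by (cases "x \<in> K") auto
  qed
  ultimately show "set_integrable lborel K f'" unfolding set_integrable_def by simp
qed

text \<open>Serves to replace a periodic extension on U by a finite sum of translates, with which it
  agrees only there.\<close>

lemma has_weak_deriv_cong:
  assumes "\<And>x. x \<in> U \<Longrightarrow> f x = f' x" "\<And>x. x \<in> U \<Longrightarrow> g x = g' x" "has_weak_deriv U k f g"
  shows "has_weak_deriv U k f' g'"
proof (rule has_weak_derivI)
  show "locally_integrable U f'"
    by (rule locally_integrable_cong[OF assms(1) has_weak_deriv_local(1)[OF assms(3)]])
  show "locally_integrable U g'"
    by (rule locally_integrable_cong[OF assms(2) has_weak_deriv_local(2)[OF assms(3)]])
  fix \<phi> js assume t: "test_function U \<phi>" and c: "\<And>i. count_list js i = k $ i"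
  obtain K where K: "compact K" "K \<subseteq> U" "\<And>x js. x \<notin> K \<Longrightarrow> iter_partial js \<phi> x = 0"
    using test_functionE[OF t] by metis
  have "(\<lambda>x. f' x * of_real (iter_partial js \<phi> x)) = (\<lambda>x. f x * of_real (iter_partial js \<phi> x))"
  proof
    fix x show "f' x * of_real (iter_partial js \<phi> x) = f x * of_real (iter_partial js \<phi> x)"
      using assms(1)[of x] K(2) K(3)[of x js] by (cases "x \<in> K") auto
  qed
  moreover have "(\<lambda>x. g' x * of_real (\<phi> x)) = (\<lambda>x. g x * of_real (\<phi> x))"
  proof
    fix x show "g' x * of_real (\<phi> x) = g x * of_real (\<phi> x)"
      using assms(2)[of x] K(2) K(3)[of x "[]"] by (cases "x \<in> K") auto
  qed
  ultimately show "(LINT x|lborel. f' x * of_real (iter_partial js \<phi> x)) =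
        (- 1) ^ (\<Sum>i\<in>UNIV. k $ i) * (LINT x|lborel. g' x * of_real (\<phi> x))"
    using has_weak_derivD[OF assms(3) t c] by simp
qed

lemma locally_integrable_sum:
  assumes "\<And>l. l \<in> F \<Longrightarrow> locally_integrable U (f l)"
  shows "locally_integrable U (\<lambda>x. \<Sum>l\<in>F. f l x)"
  using assms unfolding locally_integrable_def set_integrable_def
  by (auto simp: scaleR_sum_right intro!: L_integrable_sum)

lemma has_weak_deriv_sum:
  assumes "\<And>l. l \<in> F \<Longrightarrow> has_weak_deriv U k (f l) (g l)"
  shows "has_weak_deriv U k (\<lambda>x. \<Sum>l\<in>F. f l x) (\<lambda>x. \<Sum>l\<in>F. g l x)"
proof (rule has_weak_derivI)
  show "locally_integrable U (\<lambda>x. \<Sum>l\<in>F. f l x)" "locally_integrable U (\<lambda>x. \<Sum>l\<in>F. g l x)"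
    using assms has_weak_deriv_local by (blast intro: locally_integrable_sum)+
  fix \<phi> js assume t: "test_function U \<phi>" and c: "\<And>i. count_list js i = k $ i"
  have "(LINT x|lborel. (\<Sum>l\<in>F. f l x) * of_real (iter_partial js \<phi> x)) =
      (\<Sum>l\<in>F. LINT x|lborel. f l x * of_real (iter_partial js \<phi> x))"
    unfolding sum_distrib_right
    by (intro L_integral_sum integrable_mult_test[OF _ test_function_iter_partial[OF t]]
        has_weak_deriv_local(1)[OF assms])
  also have "\<dots> = (\<Sum>l\<in>F. (- 1) ^ (\<Sum>i\<in>UNIV. k $ i) * (LINT x|lborel. g l x * of_real (\<phi> x)))"
    by (intro sum.cong refl has_weak_derivD[OF assms t c])
  also have "\<dots> = (- 1) ^ (\<Sum>i\<in>UNIV. k $ i) * (LINT x|lborel. (\<Sum>l\<in>F. g l x) * of_real (\<phi> x))"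
    unfolding sum_distrib_right sum_distrib_left[symmetric]
    by (intro arg_cong2[where f="(*)"] refl L_integral_sum[symmetric]
        integrable_mult_test[OF _ t] has_weak_deriv_local(2)[OF assms])
  finally show "(LINT x|lborel. (\<Sum>l\<in>F. f l x) * of_real (iter_partial js \<phi> x)) =
    (- 1) ^ (\<Sum>i\<in>UNIV. k $ i) * (LINT x|lborel. (\<Sum>l\<in>F. g l x) * of_real (\<phi> x))" .
qed

lemma length_count_list: "(\<And>i::'d::finite. count_list js i = k $ i) \<Longrightarrow> (\<Sum>i\<in>UNIV. k $ i) = length js"
  using sum_count_set[of js UNIV] by simp

lemma ex_count_list: "\<exists>js. \<forall>i::'d::finite. count_list js i = k $ i"
proof -
  obtain xs :: "'d list" where xs: "set xs = UNIV" "distinct xs"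
    using finite_distinct_list[of "UNIV :: 'd set"] by auto
  have "count_list (concat (map (\<lambda>i. replicate (k $ i) i) ys)) i = (\<Sum>j\<leftarrow>ys. if j = i then k $ j else 0)" for ys i
  proof (induction ys)
    case (Cons j ys)
    have "count_list (replicate m j) i = (if j = i then m else 0)" for m
      by (induction m) auto
    then show ?case using Cons by (simp add: count_list_append)
  qed simp
  moreover have "(\<Sum>j\<leftarrow>xs. if j = i then k $ j else 0) = k $ i" for i
    using xs by (simp add: sum_list_distinct_conv_sum_set)
  ultimately show ?thesis by metis
qed

lemma locally_integrable_affine:
  fixes f :: "real ^ 'd \<Rightarrow> complex"
  assumes f: "locally_integrable UNIV f" and [measurable]: "f \<in> borel_fun" and s: "s \<noteq> 0"
  shows "locally_integrable UNIV (\<lambda>x. f (y + s *\<^sub>R x))"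
  unfolding locally_integrable_def
proof (intro allI impI)
  fix K :: "(real ^ 'd) set" assume K: "compact K \<and> K \<subseteq> UNIV"
  let ?K = "(\<lambda>x. y + s *\<^sub>R x) ` K"
  have cK: "compact ?K" using K by (intro compact_continuous_image continuous_intros) auto
  then have i: "integrable lborel (\<lambda>x. indicator ?K x *\<^sub>R f x)"
    using f unfolding locally_integrable_def set_integrable_def by auto
  have [measurable]: "?K \<in> sets borel" "K \<in> sets borel" using cK K by (auto intro: borel_compact)
  have "(\<integral>\<^sup>+x. norm (indicator ?K x *\<^sub>R f x) \<partial>lborel) < \<infinity>"
    using i by (simp add: integrable_iff_bounded)
  moreover have "(\<integral>\<^sup>+x. norm (indicator ?K x *\<^sub>R f x) \<partial>lborel) =
     ennreal (\<bar>s\<bar> ^ DIM(real ^ 'd)) * (\<integral>\<^sup>+x. norm (indicator ?K (y + s *\<^sub>R x) *\<^sub>R f (y + s *\<^sub>R x)) \<partial>lborel)"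
    by (rule nn_integral_lborel_affine) (use s in auto)
  moreover have "indicator ?K (y + s *\<^sub>R x) = (indicator K x :: real)" for x
    using s by (auto simp: indicator_def)
  moreover have "X < \<infinity>" if "ennreal a * X < \<infinity>" "a > 0" for a X
    using that by (cases "X = top") (auto simp: less_top[symmetric] ennreal_mult_eq_top_iff)
  ultimately have "(\<integral>\<^sup>+x. norm (indicator K x *\<^sub>R f (y + s *\<^sub>R x)) \<partial>lborel) < \<infinity>"
    using zero_less_power[of "\<bar>s\<bar>" "DIM(real ^ 'd)"] s by simp
  then show "set_integrable lborel K (\<lambda>x. f (y + s *\<^sub>R x))"
    unfolding set_integrable_def integrable_iff_bounded by auto
qed

lemma has_weak_deriv_affine:
  fixes f g :: "real ^ 'd \<Rightarrow> complex"
  assumes w: "has_weak_deriv UNIV k f g" and s: "s \<noteq> 0"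
    and [measurable]: "f \<in> borel_fun" "g \<in> borel_fun"
  shows "has_weak_deriv UNIV k (\<lambda>x. f (y + s *\<^sub>R x)) (\<lambda>x. of_real (s ^ (\<Sum>i\<in>UNIV. k $ i)) * g (y + s *\<^sub>R x))"
proof (rule has_weak_derivI)
  note loc = has_weak_deriv_local[OF w]
  show "locally_integrable UNIV (\<lambda>x. f (y + s *\<^sub>R x))"
    by (rule locally_integrable_affine) (use loc s in auto)
  have "locally_integrable UNIV (\<lambda>x. g (y + s *\<^sub>R x))"
    by (rule locally_integrable_affine) (use loc s in auto)
  then show "locally_integrable UNIV (\<lambda>x. of_real (s ^ (\<Sum>i\<in>UNIV. k $ i)) * g (y + s *\<^sub>R x))"
    unfolding locally_integrable_def by (auto intro: set_integrable_mult_right)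
  fix \<phi> :: "real ^ 'd \<Rightarrow> real" and js :: "'d list"
  assume t: "test_function UNIV \<phi>" and c: "\<And>i. count_list js i = k $ i"
  let ?n = "\<Sum>i\<in>UNIV. k $ i"
  \<comment> \<open>The test function is carried back by the inverse substitution. Its derivatives
    produce powers of 1/s, and the Jacobian appears on both sides and cancels.\<close>
  define \<psi> where "\<psi> = (\<lambda>x. \<phi> ((1/s) *\<^sub>R x + (- (1/s) *\<^sub>R y)))"
  have t': "test_function UNIV \<psi>" unfolding \<psi>_def by (rule test_function_affine[OF t]) (use s in simp)
  have [measurable]: "iter_partial us \<phi> \<in> borel_fun" "iter_partial us \<psi> \<in> borel_fun" for us
    by (rule smooth_borel[OF smooth_iter_partial[OF test_function_smooth[OF t]]],
        rule smooth_borel[OF smooth_iter_partial[OF test_function_smooth[OF t']]])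
  have [measurable]: "\<phi> \<in> borel_fun" "\<psi> \<in> borel_fun"
    by (rule smooth_borel[OF test_function_smooth[OF t]], rule smooth_borel[OF test_function_smooth[OF t']])
  have eq: "iter_partial us \<psi> (y + s *\<^sub>R x) = (1/s) ^ length us * iter_partial us \<phi> x" for us x
    unfolding \<psi>_def by (subst iter_partial_affine[OF test_function_smooth[OF t]])
      (use s in \<open>simp add: algebra_simps\<close>)
  have len: "?n = length js" by (rule length_count_list[OF c])
  define a where "a = \<bar>s\<bar> ^ DIM(real ^ 'd)"
  have a: "a \<noteq> 0" using s by (simp add: a_def)
  have "a *\<^sub>R (LINT x|lborel. f (y + s *\<^sub>R x) * of_real (iter_partial js \<psi> (y + s *\<^sub>R x))) = (LINT x|lborel. f x * of_real (iter_partial js \<psi> x))"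
    unfolding a_def by (rule integral_lborel_affine[symmetric]) (use s in auto)
  also have "\<dots> = (- 1) ^ ?n * (LINT x|lborel. g x * of_real (\<psi> x))"
    by (rule has_weak_derivD[OF w t' c])
  also have "(LINT x|lborel. g x * of_real (\<psi> x)) = a *\<^sub>R (LINT x|lborel. g (y + s *\<^sub>R x) * of_real (\<psi> (y + s *\<^sub>R x)))"
    unfolding a_def by (rule integral_lborel_affine) (use s in auto)
  finally have "a *\<^sub>R (LINT x|lborel. f (y + s *\<^sub>R x) * of_real (iter_partial js \<psi> (y + s *\<^sub>R x))) =
     a *\<^sub>R ((- 1) ^ ?n * (LINT x|lborel. g (y + s *\<^sub>R x) * of_real (\<psi> (y + s *\<^sub>R x))))"
    by simp
  then have "(LINT x|lborel. f (y + s *\<^sub>R x) * of_real (iter_partial js \<psi> (y + s *\<^sub>R x))) =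
     (- 1) ^ ?n * (LINT x|lborel. g (y + s *\<^sub>R x) * of_real (\<psi> (y + s *\<^sub>R x)))"
    using a by simp
  moreover have "\<psi> (y + s *\<^sub>R x) = \<phi> x" for x using eq[of "[]" x] by simp
  moreover have "(LINT x|lborel. f (y + s *\<^sub>R x) * of_real (iter_partial js \<psi> (y + s *\<^sub>R x))) =
     (LINT x|lborel. of_real ((1/s) ^ ?n) * (f (y + s *\<^sub>R x) * of_real (iter_partial js \<phi> x)))"
    by (simp add: eq len mult_ac)
  moreover have "\<dots> = of_real ((1/s) ^ ?n) * (LINT x|lborel. f (y + s *\<^sub>R x) * of_real (iter_partial js \<phi> x))"
    by (rule integral_mult_right_zero)
  ultimately have "complex_of_real ((1/s) ^ ?n) * (LINT x|lborel. f (y + s *\<^sub>R x) * of_real (iter_partial js \<phi> x)) =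
     (- 1) ^ ?n * (LINT x|lborel. g (y + s *\<^sub>R x) * of_real (\<phi> x))" by simp
  then have "(LINT x|lborel. f (y + s *\<^sub>R x) * of_real (iter_partial js \<phi> x)) =
     complex_of_real (s ^ ?n) * ((- 1) ^ ?n * (LINT x|lborel. g (y + s *\<^sub>R x) * of_real (\<phi> x)))"
    using s by (simp add: field_simps power_divide)
  also have "\<dots> = (- 1) ^ ?n * (LINT x|lborel. (complex_of_real (s ^ ?n) * g (y + s *\<^sub>R x)) * of_real (\<phi> x))"
    unfolding mult.assoc integral_mult_right_zero by (simp add: mult_ac)
  finally show "(LINT x|lborel. f (y + s *\<^sub>R x) * of_real (iter_partial js \<phi> x)) =
    (- 1) ^ ?n * (LINT x|lborel. complex_of_real (s ^ ?n) * g (y + s *\<^sub>R x) * of_real (\<phi> x))" .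
qed

section \<open>Cubes and the partition of unity\<close>

lemma cube_eq_cbox: "cube t c = cbox (\<chi> i. c $ i - t / 2) (\<chi> i. c $ i + t / 2)"
proof -
  have "(\<bar>a - b\<bar> \<le> t / 2) = (b - t / 2 \<le> a \<and> a \<le> b + t / 2)" for a b :: real by arith
  then show ?thesis by (simp add: set_eq_iff cube_def mem_box_cart)
qed

lemma compact_cube: "compact (cube t c)" by (simp add: cube_eq_cbox)

lemma cube_borel[measurable]: "cube t c \<in> sets borel"
  by (simp add: borel_compact compact_cube)

lemma interior_cube: "interior (cube t c) = {x. \<forall>i. \<bar>x $ i - c $ i\<bar> < t / 2}"
proof -
  have "(\<bar>a - b\<bar> < t / 2) = (b - t / 2 < a \<and> a < b + t / 2)" for a b :: real by arith
  then show ?thesis by (simp add: set_eq_iff cube_eq_cbox interior_cbox mem_box_cart)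
qed

lemma finite_int_box: "finite {k :: int ^ 'd. \<forall>i. \<bar>k $ i\<bar> \<le> m}"
proof -
  have "finite ((\<lambda>f. \<chi> i. f i) ` (PiE (UNIV::'d set) (\<lambda>_. {-m..m})))"
    by (intro finite_imageI finite_PiE) auto
  moreover have "{k :: int ^ 'd. \<forall>i. \<bar>k $ i\<bar> \<le> m} \<subseteq> (\<lambda>f. \<chi> i. f i) ` (PiE (UNIV::'d set) (\<lambda>_. {-m..m}))"
  proof
    fix k :: "int ^ 'd" assume "k \<in> {k. \<forall>i. \<bar>k $ i\<bar> \<le> m}"
    then have "(\<lambda>i. k $ i) \<in> PiE UNIV (\<lambda>_. {-m..m})" by (auto simp: abs_le_iff) (smt (verit))+
    then show "k \<in> (\<lambda>f. \<chi> i. f i) ` (PiE (UNIV::'d set) (\<lambda>_. {-m..m}))"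
      by (intro image_eqI[of _ _ "\<lambda>i. k $ i"]) auto
  qed
  ultimately show ?thesis by (rule finite_subset[rotated])
qed

lemma finite_int_bounded:
  assumes "bounded S" shows "finite {k :: int ^ 'd. \<exists>y\<in>S. y \<in> cube t (int_vec k)}"
proof -
  obtain B where B: "\<And>y. y \<in> S \<Longrightarrow> norm y \<le> B" using assms unfolding bounded_iff by auto
  have "{k :: int ^ 'd. \<exists>y\<in>S. y \<in> cube t (int_vec k)} \<subseteq> {k. \<forall>i. \<bar>k $ i\<bar> \<le> \<lceil>B + t / 2\<rceil>}"
  proof clarify
    fix k :: "int ^ 'd" and y i assume y: "y \<in> S" "y \<in> cube t (int_vec k)"
    have "\<bar>y $ i\<bar> \<le> B" using component_le_norm_cart[of y i] B[OF y(1)] by linarith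
    moreover have "\<bar>y $ i - real_of_int (k $ i)\<bar> \<le> t / 2" using y(2) by (simp add: cube_def int_vec_def)
    ultimately have "absc k i \<le> B + t / 2" by linarith
    then show "\<bar>k $ i\<bar> \<le> \<lceil>B + t / 2\<rceil>" by linarith
  qed
  then show ?thesis by (rule finite_subset) (rule finite_int_box)
qed

lemma partition_outside:
  assumes "smooth_partition r p \<theta> \<phi>" "x \<notin> interior (cube \<theta> (int_vec k))"
  shows "iter_partial js (\<phi> k) x = 0"
proof -
  have "test_function (interior (cube \<theta> (int_vec k))) (\<phi> k)"
    using assms(1) unfolding smooth_partition_def by blast
  then show ?thesis using iter_partial_eq_0 assms(2) unfolding test_function_def by blast
qed

lemma partition_outside':
  assumes "smooth_partition r p \<theta> \<phi>" "x \<notin> cube \<theta> (int_vec k)"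
  shows "\<phi> k x = 0"
  using partition_outside[OF assms(1), of x k "[]"] assms(2) interior_subset by auto

lemma partition_sum:
  assumes "smooth_partition r p \<theta> \<phi>" "finite F" "\<And>k. x \<in> cube \<theta> (int_vec k) \<Longrightarrow> k \<in> F"
  shows "(\<Sum>k\<in>F. \<phi> k x) = 1"
proof -
  have "((\<lambda>k. \<phi> k x) has_sum 1) UNIV" using assms(1) unfolding smooth_partition_def by blast
  then have "((\<lambda>k. \<phi> k x) has_sum 1) F"
    by (rule has_sum_cong_neutral[THEN iffD1, rotated -1])
      (use assms(3) partition_outside'[OF assms(1)] in auto)
  moreover have "((\<lambda>k. \<phi> k x) has_sum (\<Sum>k\<in>F. \<phi> k x)) F" by (rule has_sum_finite[OF assms(2)])
  ultimately show ?thesis by (metis has_sum_unique)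
qed

section \<open>Uniqueness of weak derivatives\<close>

lemma dist_cube_le:
  fixes x y :: "real ^ 'd"
  assumes "x \<in> cube t c" "y \<in> cube t c"
  shows "dist x y \<le> t * real CARD('d)"
proof -
  have "norm (x - y) \<le> (\<Sum>i\<in>UNIV. \<bar>(x - y) $ i\<bar>)" by (rule norm_le_l1_cart)
  also have "\<dots> \<le> (\<Sum>i\<in>(UNIV::'d set). t)"
  proof (rule sum_mono)
    fix i :: 'd
    have "\<bar>x $ i - c $ i\<bar> \<le> t / 2" "\<bar>y $ i - c $ i\<bar> \<le> t / 2" using assms by (auto simp: cube_def)
    then show "\<bar>(x - y) $ i\<bar> \<le> t" unfolding vector_minus_component abs_le_iff by linarith
  qed
  finally show ?thesis by (simp add: dist_norm mult.commute)
qed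

text \<open>The indicator of K is a bounded limit of test functions: at scale 1/(N+1), add the
  members of the dilated partition whose cubes meet the dilated set K. The sum is 1 on K, lies in
  [0,1] and vanishes at distance more than a multiple of 1/(N+1) from K, so dominated convergence
  carries the vanishing integrals over to K.\<close>

lemma weak_zero_compact:
  fixes h :: "real ^ 'd \<Rightarrow> complex" and \<phi> :: "int ^ 'd \<Rightarrow> real ^ 'd \<Rightarrow> real"
  assumes part: "smooth_partition r p \<theta> \<phi>" and \<theta>: "\<theta> > 0"
    and U: "open U" and loc: "locally_integrable U h"
    and z: "\<And>\<psi>. test_function U \<psi> \<Longrightarrow> (LINT x|lborel. h x * of_real (\<psi> x)) = 0"
    and K: "compact K" "K \<subseteq> U"
  shows "(LINT x|lborel. indicator K x *\<^sub>R h x) = 0"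
proof (cases "K = {}")
  case False
  obtain e where e: "e > 0" "{x. infdist x K \<le> e} \<subseteq> U"
    using compact_in_open_separated[OF False K(1) U K(2)] by blast
  let ?D = "\<theta> * real CARD('d)"
  let ?K = "{x. infdist x K \<le> e}"
  have cK: "compact ?K" by (rule compact_infdist_le[OF False K(1) e(1)])
  define F where "F N = {k::int^'d. \<exists>y\<in>(\<lambda>y. real (Suc N) *\<^sub>R y) ` K. y \<in> cube \<theta> (int_vec k)}" for N
  define \<psi> where "\<psi> N x = (\<Sum>k\<in>F N. \<phi> k (real (Suc N) *\<^sub>R x + 0))" for N x
  have finF: "finite (F N)" for N
    unfolding F_def by (intro finite_int_bounded bounded_scaling compact_imp_bounded K)
  have pos: "0 \<le> \<phi> k x" for k x using part unfolding smooth_partition_def by blast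
  have one: "\<psi> N x = 1" if "x \<in> K" for N x
    unfolding \<psi>_def by (rule partition_sum[OF part finF]) (use that in \<open>auto simp: F_def\<close>)
  have bound: "\<bar>\<psi> N x\<bar> \<le> 1" for N x
  proof -
    let ?z = "real (Suc N) *\<^sub>R x + 0"
    \<comment> \<open>Adding the cubes that contain the point itself makes the full sum equal to 1,
      which bounds the partial sum.\<close>
    let ?F = "F N \<union> {k::int^'d. \<exists>y\<in>{?z}. y \<in> cube \<theta> (int_vec k)}"
    have fin: "finite ?F" using finF finite_int_bounded[of "{?z}" \<theta>] by (auto simp del: add_0_right)
    have "\<psi> N x \<le> (\<Sum>k\<in>?F. \<phi> k ?z)" unfolding \<psi>_def by (rule sum_mono2[OF fin]) (use pos in auto)
    also have "\<dots> = 1" by (rule partition_sum[OF part fin]) auto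
    finally show ?thesis using sum_nonneg[of "F N" "\<lambda>k. \<phi> k ?z"] pos by (simp add: \<psi>_def)
  qed
  have far: "\<psi> N x = 0" if "?D / real (Suc N) < infdist x K" for N x
    unfolding \<psi>_def
  proof (rule sum.neutral, rule ballI)
    fix k assume "k \<in> F N"
    then obtain y where y: "y \<in> K" "real (Suc N) *\<^sub>R y \<in> cube \<theta> (int_vec k)" unfolding F_def by auto
    show "\<phi> k (real (Suc N) *\<^sub>R x + 0) = 0"
    proof (rule partition_outside'[OF part], rule notI)
      assume "real (Suc N) *\<^sub>R x + 0 \<in> cube \<theta> (int_vec k)"
      then have "dist (real (Suc N) *\<^sub>R x) (real (Suc N) *\<^sub>R y) \<le> ?D"
        using dist_cube_le[OF _ y(2)] by simp
      then have "real (Suc N) * dist x y \<le> ?D" by (simp add: dist_norm scaleR_diff_right[symmetric] del: of_nat_Suc)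
      then have "dist x y \<le> ?D / real (Suc N)" by (simp add: field_simps)
      then show False using that infdist_le[OF y(1), of x] by linarith
    qed
  qed
  have sm: "smooth (\<psi> N)" for N
  proof -
    have "smooth (\<phi> k)" for k using part unfolding smooth_partition_def test_function_def by blast
    then have "smooth (\<lambda>x. 1 * \<phi> k (real (Suc N) *\<^sub>R x + 0))" for k by (rule smooth_affine)
    then have "smooth (\<lambda>x. \<Sum>k\<in>F N. 1 * \<phi> k (real (Suc N) *\<^sub>R x + 0))" by (rule smooth_sum)
    then show ?thesis by (simp add: \<psi>_def[abs_def])
  qed
  have tst: "test_function U (\<psi> N)" if "?D / real (Suc N) < e" for N
    by (rule test_functionI[OF sm cK e(2)]) (use far[of N] that in force)
  \<comment> \<open>From this index on the supports stay within the compact neighbourhood of K in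
    U.\<close>
  obtain N0 where N0: "?D / real (Suc N0) < e"
  proof -
    obtain n where "?D / e < real n" using reals_Archimedean2 by blast
    then have "?D < e * real (Suc n)" using e(1) by (simp add: field_simps)
    then show ?thesis by (intro that[of n]) (simp add: field_simps)
  qed
  have N: "?D / real (Suc (N + N0)) < e" for N
  proof -
    have "?D / real (Suc (N + N0)) \<le> ?D / real (Suc N0)"
      using \<theta> by (intro divide_left_mono) auto
    then show ?thesis using N0 by linarith
  qed
  have iK: "integrable lborel (\<lambda>x. indicator C x *\<^sub>R h x)" if "compact C" "C \<subseteq> U" for C
    using loc that unfolding locally_integrable_def set_integrable_def by auto
  have "(\<lambda>N. LINT x|lborel. h x * of_real (\<psi> (N + N0) x)) \<longlonglongrightarrow> (LINT x|lborel. indicator K x *\<^sub>R h x)"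
  proof (rule integral_dominated_convergence[where w="\<lambda>x. norm (indicator ?K x *\<^sub>R h x)"])
    show "(\<lambda>x. indicator K x *\<^sub>R h x) \<in> borel_measurable lborel"
      using iK[OF K] by (rule borel_measurable_integrable)
    show "(\<lambda>x. h x * of_real (\<psi> (N + N0) x)) \<in> borel_measurable lborel" for N
      by (rule borel_measurable_integrable[OF integrable_mult_test[OF loc tst[OF N]]])
    show "integrable lborel (\<lambda>x. norm (indicator ?K x *\<^sub>R h x))"
      by (intro integrable_norm iK cK e)
    show "AE x in lborel. norm (h x * of_real (\<psi> (N + N0) x)) \<le> norm (indicator ?K x *\<^sub>R h x)" for N
    proof (rule AE_I2)
      fix x
      show "norm (h x * of_real (\<psi> (N + N0) x)) \<le> norm (indicator ?K x *\<^sub>R h x)"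
      proof (cases "x \<in> ?K")
        case True
        then show ?thesis using mult_left_mono[OF bound[of "N + N0" x], of "norm (h x)"] by (simp add: norm_mult)
      next
        case False
        then show ?thesis using far[of "N + N0" x] N[of N] by (auto simp: not_le)
      qed
    qed
    show "AE x in lborel. (\<lambda>N. h x * of_real (\<psi> (N + N0) x)) \<longlonglongrightarrow> indicator K x *\<^sub>R h x"
    proof (rule AE_I2)
      fix x
      show "(\<lambda>N. h x * of_real (\<psi> (N + N0) x)) \<longlonglongrightarrow> indicator K x *\<^sub>R h x"
      proof (cases "x \<in> K")
        case True then show ?thesis by (simp add: one)
      next
        case out: False
        then have pos: "infdist x K > 0"
          using infdist_pos_not_in_closed[OF compact_imp_closed[OF K(1)] False] by blast
        have "(\<lambda>N. ?D / real (Suc (N + N0))) \<longlonglongrightarrow> 0"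
          using tendsto_mult_right_zero[OF LIMSEQ_ignore_initial_segment[OF LIMSEQ_inverse_real_of_nat, of N0], of ?D]
          by (simp add: divide_inverse)
        then have "\<forall>\<^sub>F N in sequentially. ?D / real (Suc (N + N0)) < infdist x K"
          using pos by (rule order_tendstoD)
        then have "\<forall>\<^sub>F N in sequentially. h x * of_real (\<psi> (N + N0) x) = 0"
          by eventually_elim (simp add: far)
        then show ?thesis using out by (simp add: tendsto_eventually)
      qed
    qed
  qed
  moreover have "(LINT x|lborel. h x * of_real (\<psi> (N + N0) x)) = 0" for N
    by (rule z[OF tst[OF N]])
  ultimately show ?thesis by (simp add: LIMSEQ_const_iff)
qed simp

text \<open>Within a compact box the compact sets include all closed subsets, and closed sets are an
  intersection-stable generator of the Borel sets. Hence h integrates to 0 over every Borel part of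
  the box and vanishes there almost everywhere; countably many boxes exhaust U.\<close>

lemma weak_zero_AE:
  fixes h :: "real ^ 'd \<Rightarrow> complex" and \<phi> :: "int ^ 'd \<Rightarrow> real ^ 'd \<Rightarrow> real"
  assumes part: "smooth_partition r p \<theta> \<phi>" and \<theta>: "\<theta> > 0"
    and U: "open U" and loc: "locally_integrable U h"
    and z: "\<And>\<psi>. test_function U \<psi> \<Longrightarrow> (LINT x|lborel. h x * of_real (\<psi> x)) = 0"
  shows "AE x in lborel. x \<in> U \<longrightarrow> h x = 0"
proof -
  obtain D where D: "countable D" "D \<subseteq> Pow U" "\<And>C. C \<in> D \<Longrightarrow> \<exists>a b. C = cbox a b" "\<Union>D = U"
    using open_countable_Union_open_cbox[OF U] by metis
  have "AE x in lborel. x \<in> C \<longrightarrow> h x = 0" if C: "C \<in> D" for C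
  proof -
    have CU: "compact C" "C \<subseteq> U" using D(2) D(3)[OF C] C by auto
    let ?g = "\<lambda>x. indicator C x *\<^sub>R h x"
    have g: "integrable lborel ?g"
      using loc CU unfolding locally_integrable_def set_integrable_def by auto
    have gA: "set_integrable lborel A ?g" if "A \<in> sets borel" for A
      unfolding set_integrable_def by (rule integrable_mult_indicator[OF _ g]) (simp add: that)
    have "(LINT x:A|lborel. ?g x) = 0" if A: "A \<in> sets lborel" for A
    proof -
      have eq: "sigma_sets UNIV (Collect closed) = sets (borel :: (real^'d) measure)"
        by (simp add: borel_eq_closed)
      have "A \<in> sigma_sets UNIV (Collect closed)" using A eq by simp
      from _ _ this show ?thesis
      proof (induct rule: sigma_sets_induct_disjoint)
        show "Int_stable (Collect closed :: (real^'d) set set)" by (auto simp: Int_stable_def)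
        fix A :: "(real^'d) set" assume "A \<in> Collect closed"
        then have "compact (A \<inter> C)" "A \<inter> C \<subseteq> U"
          using CU compact_Int_closed[of C A] by (auto simp: Int_commute)
        from weak_zero_compact[OF part \<theta> U loc z this]
        show "(LINT x:A|lborel. ?g x) = 0"
          by (simp add: set_lebesgue_integral_def indicator_inter_arith)
      next
        fix A :: "(real^'d) set" assume A: "A \<in> sigma_sets UNIV (Collect closed)" and 0: "(LINT x:A|lborel. ?g x) = 0"
        have A': "A \<in> sets borel" using A eq by simp
        have "(LINT x:A \<union> (UNIV - A)|lborel. ?g x) = (LINT x:A|lborel. ?g x) + (LINT x:UNIV - A|lborel. ?g x)"
          by (rule set_integral_Un) (use A' in \<open>auto intro!: gA\<close>)
        moreover have "(LINT x:A \<union> (UNIV - A)|lborel. ?g x) = 0"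
          using weak_zero_compact[OF part \<theta> U loc z CU] by (simp add: set_lebesgue_integral_def)
        ultimately show "(LINT x:UNIV - A|lborel. ?g x) = 0" using 0 by simp
      next
        fix A :: "nat \<Rightarrow> (real^'d) set"
        assume A: "disjoint_family A" "range A \<subseteq> sigma_sets UNIV (Collect closed)"
          and 0: "\<And>i. (LINT x:A i|lborel. ?g x) = 0"
        have A': "A i \<in> sets borel" for i using A(2) eq by auto
        have "(LINT x:(\<Union>i. A i)|lborel. ?g x) = (\<Sum>i. (LINT x:A i|lborel. ?g x))"
          by (rule lebesgue_integral_countable_add)
            (use A' A(1) in \<open>auto intro!: gA simp: disjoint_family_on_def\<close>)
        then show "(LINT x:(\<Union>i. A i)|lborel. ?g x) = 0" using 0 by simp
      qed (auto simp: set_lebesgue_integral_def)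
    qed
    then have "AE x in lborel. ?g x = 0" by (rule sigma_finite_measure.density_zero[OF sigma_finite_lborel g])
    then show ?thesis by eventually_elim auto
  qed
  then have "AE x in lborel. \<forall>C\<in>D. x \<in> C \<longrightarrow> h x = 0"
    by (subst AE_ball_countable[OF D(1)]) auto
  then show ?thesis by eventually_elim (use D(4) in auto)
qed

text \<open>One list of coordinates realizing k suffices: the common sign cancels, and the
  difference of the two candidates tests to 0.\<close>

lemma weak_deriv_unique:
  fixes \<phi> :: "int ^ 'd \<Rightarrow> real ^ 'd \<Rightarrow> real" and U :: "(real ^ 'd) set"
  assumes part: "smooth_partition r p \<theta> \<phi>" and \<theta>: "\<theta> > 0" and U: "open U"
    and w: "has_weak_deriv U k f g" "has_weak_deriv U k f g'"
  shows "AE x in lborel. x \<in> U \<longrightarrow> g x = g' x"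
proof -
  note loc = has_weak_deriv_local(2)[OF w(1)] has_weak_deriv_local(2)[OF w(2)]
  obtain js where js: "\<And>i. count_list js i = k $ i" using ex_count_list[of k] by blast
  have "AE x in lborel. x \<in> U \<longrightarrow> g x - g' x = 0"
  proof (rule weak_zero_AE[OF part \<theta> U])
    show "locally_integrable U (\<lambda>x. g x - g' x)"
      using loc unfolding locally_integrable_def by auto
    fix \<psi> assume t: "test_function U \<psi>"
    have "(- 1) ^ (\<Sum>i\<in>UNIV. k $ i) * (LINT x|lborel. g x * of_real (\<psi> x)) =
       (- 1) ^ (\<Sum>i\<in>UNIV. k $ i) * (LINT x|lborel. g' x * of_real (\<psi> x))"
      using has_weak_derivD[OF w(1) t js] has_weak_derivD[OF w(2) t js] by simp
    then show "(LINT x|lborel. (g x - g' x) * of_real (\<psi> x)) = 0"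
      by (simp add: left_diff_distrib Bochner_Integration.integral_diff integrable_mult_test[OF _ t] loc)
  qed
  then show ?thesis by simp
qed

text \<open>Translation moves a shift from f, which is merely locally integrable, to the kernel h,
  which is bounded with compact support. The conclusions provide the inner t-integral on the kernel,
  the exchanged order of integration, and integrability of the averaged function.\<close>

lemma fubini_shift:
  fixes f :: "'a::euclidean_space \<Rightarrow> complex" and h :: "'a \<Rightarrow> real \<Rightarrow> complex" and e :: 'a
  assumes [measurable]: "f \<in> borel_fun"
    and loc: "\<And>K. compact K \<Longrightarrow> set_integrable lborel K f"
    and hm: "case_prod h \<in> borel_fun"
    and B: "\<And>x t. norm (h x t) \<le> B" and K: "compact K"
    and out: "\<And>x t. \<not> (x \<in> K \<and> t \<in> {0..1}) \<Longrightarrow> h x t = 0"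
  shows "(LINT x|lborel. (LINT t|lborel. f (x + t *\<^sub>R e) * h x t)) =
         (LINT x|lborel. f x * (LINT t|lborel. h (x - t *\<^sub>R e) t))"
    and "(LINT x|lborel. (LINT t|lborel. f (x + t *\<^sub>R e) * h x t)) =
         (LINT t|lborel. (LINT x|lborel. f x * h (x - t *\<^sub>R e) t))"
    and "integrable lborel (\<lambda>x. LINT t|lborel. f (x + t *\<^sub>R e) * h x t)"
proof -
  have B0: "B \<ge> 0" using norm_ge_zero[of "h 0 0"] B[of 0 0] by linarith
  have hm'[measurable]: "case_prod h \<in> borel_measurable (borel \<Otimes>\<^sub>M borel)"
    using hm by (simp add: borel_prod)
  \<comment> \<open>All translates of K along the unit segment in direction e: wherever the shifted
    kernel is nonzero, f is evaluated at a point of this set.\<close>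
  define K' where "K' = (\<lambda>(x, t). x + t *\<^sub>R e) ` (K \<times> {0..1::real})"
  have cK': "compact K'"
    unfolding K'_def case_prod_unfold
    by (intro compact_continuous_image compact_Times K continuous_intros) auto
  then have [measurable]: "K' \<in> sets borel" by (rule borel_compact)
  have i: "integrable lborel (\<lambda>x. indicator K' x *\<^sub>R f x)" using loc[OF cK'] unfolding set_integrable_def .
  have in': "x \<in> K' \<and> t \<in> {0..1}" if "h (x - t *\<^sub>R e) t \<noteq> 0" for x t
  proof -
    have "x - t *\<^sub>R e \<in> K" "t \<in> {0..1}" using out[of "x - t *\<^sub>R e" t] that by auto
    then show ?thesis unfolding K'_def by (auto intro!: image_eqI[of _ _ "(x - t *\<^sub>R e, t)"])
  qed
  have bd: "ennreal (norm (f x * h (x - t *\<^sub>R e) t)) \<le> ennreal B * ennreal (norm (indicator K' x *\<^sub>R f x)) * indicator {0..1} t" for x t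
  proof (cases "h (x - t *\<^sub>R e) t = 0")
    case False
    have "norm (f x * h (x - t *\<^sub>R e) t) \<le> B * norm (f x)"
      using mult_left_mono[OF B[of "x - t *\<^sub>R e" t], of "norm (f x)"] by (simp add: norm_mult mult.commute)
    then show ?thesis using in'[OF False] B0 by (simp add: ennreal_mult'[symmetric] ennreal_leI)
  qed simp
  have fin2: "(\<integral>\<^sup>+x. \<integral>\<^sup>+t. ennreal (norm (f x * h (x - t *\<^sub>R e) t)) \<partial>lborel \<partial>lborel) < \<infinity>"
  proof -
    have "(\<integral>\<^sup>+x. \<integral>\<^sup>+t. ennreal (norm (f x * h (x - t *\<^sub>R e) t)) \<partial>lborel \<partial>lborel)
      \<le> (\<integral>\<^sup>+x. \<integral>\<^sup>+t. ennreal B * ennreal (norm (indicator K' x *\<^sub>R f x)) * indicator {0..1::real} t \<partial>lborel \<partial>lborel)"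
      by (rule nn_integral_mono, rule nn_integral_mono, rule bd)
    also have "\<dots> = ennreal B * (\<integral>\<^sup>+x. ennreal (norm (indicator K' x *\<^sub>R f x)) \<partial>lborel)"
      by (simp add: nn_integral_cmult)
    also have "\<dots> < \<infinity>" using i by (simp add: integrable_iff_bounded ennreal_mult_less_top)
    finally show ?thesis .
  qed
  have i2: "integrable (lborel \<Otimes>\<^sub>M lborel) (\<lambda>(x, t). f x * h (x - t *\<^sub>R e) t)"
    unfolding integrable_iff_bounded
  proof
    show "(\<lambda>(x, t). f x * h (x - t *\<^sub>R e) t) \<in> borel_measurable (lborel \<Otimes>\<^sub>M lborel)" by measurable
    then have "(\<integral>\<^sup>+z. ennreal (norm ((\<lambda>(x, t). f x * h (x - t *\<^sub>R e) t) z)) \<partial>(lborel \<Otimes>\<^sub>M lborel)) =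
       (\<integral>\<^sup>+x. \<integral>\<^sup>+t. ennreal (norm (f x * h (x - t *\<^sub>R e) t)) \<partial>lborel \<partial>lborel)"
      by (subst lborel.nn_integral_fst[symmetric]) auto
    then show "(\<integral>\<^sup>+z. ennreal (norm ((\<lambda>(x, t). f x * h (x - t *\<^sub>R e) t) z)) \<partial>(lborel \<Otimes>\<^sub>M lborel)) < \<infinity>"
      using fin2 by simp
  qed
  have i1: "integrable (lborel \<Otimes>\<^sub>M lborel) (\<lambda>(x, t). f (x + t *\<^sub>R e) * h x t)"
    unfolding integrable_iff_bounded
  proof
    show m: "(\<lambda>(x, t). f (x + t *\<^sub>R e) * h x t) \<in> borel_measurable (lborel \<Otimes>\<^sub>M lborel)" by measurable
    have "(\<integral>\<^sup>+z. ennreal (norm ((\<lambda>(x, t). f (x + t *\<^sub>R e) * h x t) z)) \<partial>(lborel \<Otimes>\<^sub>M lborel)) =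
       (\<integral>\<^sup>+t. \<integral>\<^sup>+x. ennreal (norm (f (x + t *\<^sub>R e) * h x t)) \<partial>lborel \<partial>lborel)"
      using m by (subst lborel_pair.nn_integral_snd[symmetric]) auto
    also have "\<dots> = (\<integral>\<^sup>+t. \<integral>\<^sup>+x. ennreal (norm (f x * h (x - t *\<^sub>R e) t)) \<partial>lborel \<partial>lborel)"
    proof (rule nn_integral_cong)
      fix t :: real
      have "(\<integral>\<^sup>+x. ennreal (norm (f (x + t *\<^sub>R e) * h x t)) \<partial>lborel) =
        (\<integral>\<^sup>+x. ennreal (norm (f (x + t *\<^sub>R e) * h ((x + t *\<^sub>R e) - t *\<^sub>R e) t)) \<partial>lborel)" by simp
      also have "\<dots> = (\<integral>\<^sup>+x. ennreal (norm (f x * h (x - t *\<^sub>R e) t)) \<partial>lborel)"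
        by (rule nn_integral_lborel_translate[where f="\<lambda>x. ennreal (norm (f x * h (x - t *\<^sub>R e) t))"]) measurable
      finally show "(\<integral>\<^sup>+x. ennreal (norm (f (x + t *\<^sub>R e) * h x t)) \<partial>lborel) =
        (\<integral>\<^sup>+x. ennreal (norm (f x * h (x - t *\<^sub>R e) t)) \<partial>lborel)" .
    qed
    also have "\<dots> = (\<integral>\<^sup>+x. \<integral>\<^sup>+t. ennreal (norm (f x * h (x - t *\<^sub>R e) t)) \<partial>lborel \<partial>lborel)"
      by (rule lborel_pair.Fubini') measurable
    finally show "(\<integral>\<^sup>+z. ennreal (norm ((\<lambda>(x, t). f (x + t *\<^sub>R e) * h x t) z)) \<partial>(lborel \<Otimes>\<^sub>M lborel)) < \<infinity>"
      using fin2 by simp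
  qed
  show "integrable lborel (\<lambda>x. LINT t|lborel. f (x + t *\<^sub>R e) * h x t)"
    using lborel_pair.integrable_fst'[OF i1] by simp
  have "(LINT x|lborel. (LINT t|lborel. f (x + t *\<^sub>R e) * h x t)) = (LINT t|lborel. (LINT x|lborel. f (x + t *\<^sub>R e) * h x t))"
    by (rule lborel_pair.Fubini_integral[OF i1, symmetric])
  also have "\<dots> = (LINT t|lborel. (LINT x|lborel. f x * h (x - t *\<^sub>R e) t))"
  proof (rule Bochner_Integration.integral_cong[OF refl])
    fix t :: real
    have "(LINT x|lborel. f (x + t *\<^sub>R e) * h x t) = (LINT x|lborel. f (x + t *\<^sub>R e) * h ((x + t *\<^sub>R e) - t *\<^sub>R e) t)" by simp
    also have "\<dots> = (LINT x|lborel. f x * h (x - t *\<^sub>R e) t)"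
      by (rule integral_lborel_translate[where f="\<lambda>x. f x * h (x - t *\<^sub>R e) t"]) measurable
    finally show "(LINT x|lborel. f (x + t *\<^sub>R e) * h x t) = (LINT x|lborel. f x * h (x - t *\<^sub>R e) t)" .
  qed
  finally show *: "(LINT x|lborel. (LINT t|lborel. f (x + t *\<^sub>R e) * h x t)) =
         (LINT t|lborel. (LINT x|lborel. f x * h (x - t *\<^sub>R e) t))" .
  also have "\<dots> = (LINT x|lborel. (LINT t|lborel. f x * h (x - t *\<^sub>R e) t))"
    by (rule lborel_pair.Fubini_integral[OF i2])
  finally show "(LINT x|lborel. (LINT t|lborel. f (x + t *\<^sub>R e) * h x t)) =
         (LINT x|lborel. f x * (LINT t|lborel. h (x - t *\<^sub>R e) t))" by simp
qed

lemma continuous_set_integrable: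
  fixes f :: "'a::euclidean_space \<Rightarrow> complex"
  assumes "continuous_on UNIV f" "compact K"
  shows "set_integrable lborel K f"
  unfolding set_integrable_def
  by (rule borel_integrable_compact[OF assms(2)]) (rule continuous_on_subset[OF assms(1)], simp)

text \<open>Averaging G' over shifts by t e with t in [0,1] does not change its integral, and along
  each line the average is G(x + e) - G(x). Both terms have the same integral by translation
  invariance.\<close>

lemma integral_line_deriv_0:
  fixes G G' :: "'a::euclidean_space \<Rightarrow> complex" and e :: 'a
  assumes cont: "continuous_on UNIV G" "continuous_on UNIV G'"
    and der: "\<And>x t. ((\<lambda>t. G (x + t *\<^sub>R e)) has_vector_derivative G' (x + t *\<^sub>R e)) (at t)"
    and K: "compact K" and out: "\<And>x. x \<notin> K \<Longrightarrow> G x = 0" "\<And>x. x \<notin> K \<Longrightarrow> G' x = 0"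
  shows "(LINT x|lborel. G' x) = 0"
proof -
  \<comment> \<open>Points from which a unit segment in direction e reaches K; cutting the kernel
    off there changes neither side.\<close>
  define K' where "K' = (\<lambda>(x, t). x - t *\<^sub>R e) ` (K \<times> {0..1::real})"
  have cK': "compact K'"
    unfolding K'_def case_prod_unfold
    by (intro compact_continuous_image compact_Times K continuous_intros) auto
  then have [measurable]: "K' \<in> sets borel" by (rule borel_compact)
  have [measurable]: "G \<in> borel_fun" "G' \<in> borel_fun"
    using cont by (auto intro: borel_measurable_continuous_onI)
  have inK': "x - t *\<^sub>R e \<in> K'" if "x \<in> K" "t \<in> {0..1}" for x t
    unfolding K'_def using that by (auto intro!: image_eqI[of _ _ "(x, t)"])
  let ?h = "\<lambda>x t::real. complex_of_real (indicator K' x * indicator {0..1} t)"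
  have eq: "(LINT x|lborel. (LINT t|lborel. G' (x + t *\<^sub>R e) * ?h x t)) =
         (LINT x|lborel. G' x * (LINT t|lborel. ?h (x - t *\<^sub>R e) t))"
  proof (rule fubini_shift(1)[where B=1 and K=K'])
    show "(\<lambda>(x, t). ?h x t) \<in> borel_fun"
      by (subst borel_prod[symmetric]) measurable
  qed (auto simp: indicator_def cK' continuous_set_integrable[OF cont(2)])
  have R: "G' x * (LINT t|lborel. ?h (x - t *\<^sub>R e) t) = G' x" for x
  proof (cases "x \<in> K")
    case True
    have "(LINT t|lborel. ?h (x - t *\<^sub>R e) t) = (LINT t|lborel. complex_of_real (indicator {0..1::real} t))"
      by (rule Bochner_Integration.integral_cong) (use inK'[OF True] in \<open>auto simp: indicator_def\<close>)
    also have "\<dots> = complex_of_real (LINT t|lborel. indicator {0..1::real} t)"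
      by (rule integral_of_real) (simp add: integrable_real_indicator)
    also have "\<dots> = 1" by simp
    finally show ?thesis by simp
  qed (simp add: out)
  have L: "(LINT t|lborel. G' (x + t *\<^sub>R e) * ?h x t) = G (x + e) - G x" for x
  proof (cases "x \<in> K'")
    case True
    have "(LINT t|lborel. indicator {0..1} t *\<^sub>R G' (x + t *\<^sub>R e)) = G (x + 1 *\<^sub>R e) - G (x + 0 *\<^sub>R e)"
    proof (rule integral_FTC_atLeastAtMost)
      show "continuous_on {0..1} (\<lambda>t. G' (x + t *\<^sub>R e))"
        by (rule continuous_on_compose2[OF cont(2)]) (auto intro!: continuous_intros)
    qed (auto intro: has_vector_derivative_at_within der)
    then show ?thesis using True by (simp add: scaleR_conv_of_real mult.commute)
  next
    case False
    then have "x \<notin> K" "x + e \<notin> K" using inK'[of x 0] inK'[of "x + e" 1] by auto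
    then show ?thesis using False out by simp
  qed
  have iG: "integrable lborel G"
  proof -
    have "(\<lambda>x. indicator K x *\<^sub>R G x) = G" using out by (auto simp: fun_eq_iff indicator_def)
    then show ?thesis using continuous_set_integrable[OF cont(1) K] by (simp add: set_integrable_def)
  qed
  have iGe: "integrable lborel (\<lambda>x. G (x + e))"
  proof (rule integrableI_bounded)
    show "(\<integral>\<^sup>+x. norm (G (x + e)) \<partial>lborel) < \<infinity>"
      using iG nn_integral_lborel_translate[of "\<lambda>x. ennreal (norm (G x))" e]
      by (simp add: integrable_iff_bounded)
  qed simp
  have "(LINT x|lborel. G' x) = (LINT x|lborel. G (x + e) - G x)"
    using eq unfolding R L by simp
  also have "\<dots> = 0" using iG iGe integral_lborel_translate[of G e] by simp
  finally show ?thesis .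
qed

text \<open>Only continuity of h and of its directional derivative enters, so smooth real functions
  and complex trigonometric polynomials are covered alike.\<close>

lemma integral_by_parts_test:
  fixes h h' :: "real ^ 'd \<Rightarrow> complex"
  assumes cont: "continuous_on UNIV h" "continuous_on UNIV h'"
    and der: "\<And>x t. ((\<lambda>t. h (x + t *\<^sub>R axis i 1)) has_vector_derivative h' (x + t *\<^sub>R axis i 1)) (at t)"
    and t: "test_function UNIV \<psi>"
  shows "(LINT x|lborel. h x * of_real (partial_deriv i \<psi> x)) = - (LINT x|lborel. h' x * of_real (\<psi> x))"
proof -
  note sm = test_function_smooth[OF t]
  obtain K where K: "compact K" "K \<subseteq> UNIV" "\<And>x js. x \<notin> K \<Longrightarrow> iter_partial js \<psi> x = 0"
    using test_functionE[OF t] by metis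
  have c: "continuous_on UNIV \<psi>" "continuous_on UNIV (partial_deriv i \<psi>)"
    by (intro smooth_continuous smooth_partial_deriv sm)+
  have "(LINT x|lborel. h x * of_real (partial_deriv i \<psi> x) + h' x * of_real (\<psi> x)) = 0"
  proof (rule integral_line_deriv_0[where G="\<lambda>x. h x * of_real (\<psi> x)" and e="axis i 1" and K=K])
    fix x s
    have "((\<lambda>t. complex_of_real (\<psi> (x + t *\<^sub>R axis i 1))) has_vector_derivative
        of_real (partial_deriv i \<psi> (x + s *\<^sub>R axis i 1))) (at s)"
      using bounded_linear.has_vector_derivative[OF bounded_linear_of_real
          smooth_has_real_derivative[OF sm, of x i s, unfolded has_real_derivative_iff_has_vector_derivative]] .
    from has_vector_derivative_mult[OF der[of x s] this]
    show "((\<lambda>t. h (x + t *\<^sub>R axis i 1) * of_real (\<psi> (x + t *\<^sub>R axis i 1))) has_vector_derivative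
       h (x + s *\<^sub>R axis i 1) * of_real (partial_deriv i \<psi> (x + s *\<^sub>R axis i 1))
        + h' (x + s *\<^sub>R axis i 1) * of_real (\<psi> (x + s *\<^sub>R axis i 1))) (at s)" .
  qed (use K(3)[of _ "[]"] K(3)[of _ "[i]"] K(1) c cont in \<open>auto intro!: continuous_intros\<close>)
  moreover have "integrable lborel (\<lambda>x. h x * of_real (partial_deriv i \<psi> x))"
    "integrable lborel (\<lambda>x. h' x * of_real (\<psi> x))"
    using continuous_set_integrable[OF cont(1)] continuous_set_integrable[OF cont(2)]
    by (auto intro!: integrable_mult_test[of UNIV] t test_function_partial_deriv simp: locally_integrable_def)
  ultimately show ?thesis by (simp add: eq_neg_iff_add_eq_0)
qed

section \<open>Multi-indices and families of weak derivatives\<close>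

definition multi_idx :: "nat \<Rightarrow> (nat ^ 'd) set" where
  "multi_idx r = {k. \<forall>i. k $ i \<le> r}"

text \<open>The coordinates carry no order, so a list realizing the multi-index is chosen;
  derivatives of smooth functions do not depend on the choice.\<close>

definition list_of :: "nat ^ 'd \<Rightarrow> 'd list" where
  "list_of k = (SOME js. \<forall>i. count_list js i = k $ i)"

lemma count_list_of: "count_list (list_of k) i = k $ i"
  unfolding list_of_def using someI_ex[OF ex_count_list[of k]] by blast

lemma finite_multi_idx: "finite (multi_idx r :: (nat ^ 'd) set)"
proof -
  have "finite ((\<lambda>f. \<chi> i. f i) ` (PiE (UNIV::'d set) (\<lambda>_. {..r})))"
    by (intro finite_imageI finite_PiE) auto
  moreover have "multi_idx r \<subseteq> (\<lambda>f. \<chi> i. f i) ` (PiE (UNIV::'d set) (\<lambda>_. {..r}))"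
  proof
    fix k :: "nat ^ 'd" assume "k \<in> multi_idx r"
    then show "k \<in> (\<lambda>f. \<chi> i. f i) ` (PiE (UNIV::'d set) (\<lambda>_. {..r}))"
      by (intro image_eqI[of _ _ "\<lambda>i. k $ i"]) (auto simp: multi_idx_def)
  qed
  ultimately show ?thesis by (rule finite_subset[rotated])
qed

lemma plus_axis_nth: "(k + axis i 1 :: nat ^ 'd) $ j = (if j = i then Suc (k $ j) else k $ j)"
  by (simp add: axis_def)

lemma plus_axis_multi_idx: "k \<in> multi_idx r \<Longrightarrow> k $ i < r \<Longrightarrow> k + axis i 1 \<in> multi_idx r"
  unfolding multi_idx_def mem_Collect_eq plus_axis_nth by auto

text \<open>Weak derivatives linked by single integrations by parts. Averaging and the Leibniz rule
  both compare E k with E (k + e_i), a relation that the defining property of the weak derivatives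
  of E 0 does not display.\<close>

definition weak_family :: "nat \<Rightarrow> (nat ^ 'd \<Rightarrow> real ^ 'd \<Rightarrow> complex) \<Rightarrow> bool" where
  "weak_family r E \<longleftrightarrow>
     (\<forall>k\<in>multi_idx r. locally_integrable UNIV (E k) \<and> E k \<in> borel_fun) \<and>
     (\<forall>k\<in>multi_idx r. \<forall>i \<psi>. k $ i < r \<longrightarrow> test_function UNIV \<psi> \<longrightarrow>
        (LINT x|lborel. E k x * of_real (partial_deriv i \<psi> x)) =
        - (LINT x|lborel. E (k + axis i 1) x * of_real (\<psi> x)))"

lemma weak_familyD:
  assumes "weak_family r E" "k \<in> multi_idx r"
  shows "locally_integrable UNIV (E k)" "E k \<in> borel_fun"
    and "k $ i < r \<Longrightarrow> test_function UNIV \<psi> \<Longrightarrow>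
        (LINT x|lborel. E k x * of_real (partial_deriv i \<psi> x)) =
        - (LINT x|lborel. E (k + axis i 1) x * of_real (\<psi> x))"
  using assms unfolding weak_family_def by blast+

lemma weak_family_iter:
  assumes w: "weak_family r E" and "\<And>j. m $ j + count_list js j \<le> r" and t: "test_function UNIV \<psi>"
  shows "(LINT x|lborel. E m x * of_real (iter_partial js \<psi> x)) =
    (- 1) ^ length js * (LINT x|lborel. E (\<chi> j. m $ j + count_list js j) x * of_real (\<psi> x))"
  using assms(2)
proof (induction js arbitrary: m)
  case Nil
  have "(\<chi> j. m $ j + 0) = m" by (simp add: vec_eq_iff)
  then show ?case by simp
next
  case (Cons i js)
  have le: "m $ j + count_list js j + (if i = j then 1 else 0) \<le> r" for j
    using Cons.prems[of j] by (simp split: if_splits)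
  have m: "m \<in> multi_idx r" unfolding multi_idx_def mem_Collect_eq
  proof
    fix j show "m $ j \<le> r" using le[of j] by linarith
  qed
  have mi: "m $ i < r" using le[of i] by simp
  have le': "(m + axis i 1) $ j + count_list js j \<le> r" for j
    using le[of j] unfolding plus_axis_nth by (simp split: if_splits)
  have eq: "(\<chi> j. (m + axis i 1) $ j + count_list js j) = (\<chi> j. m $ j + count_list (i # js) j)"
    unfolding plus_axis_nth by (simp add: vec_eq_iff)
  have "(LINT x|lborel. E m x * of_real (iter_partial (i # js) \<psi> x)) =
    - (LINT x|lborel. E (m + axis i 1) x * of_real (iter_partial js \<psi> x))"
    unfolding iter_partial_Cons
    by (rule weak_familyD(3)[OF w m mi test_function_iter_partial[OF t]])
  also have "\<dots> = - ((- 1) ^ length js * (LINT x|lborel. E (\<chi> j. m $ j + count_list (i # js) j) x * of_real (\<psi> x)))"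
    unfolding Cons.IH[OF le'] eq ..
  finally show ?case by simp
qed

lemma weak_family_has_weak_deriv:
  assumes w: "weak_family r E" and k: "k \<in> multi_idx r"
  shows "has_weak_deriv UNIV k (E 0) (E k)"
proof (rule has_weak_derivI)
  have 0: "0 \<in> multi_idx r" by (simp add: multi_idx_def)
  show "locally_integrable UNIV (E 0)" "locally_integrable UNIV (E k)"
    using weak_familyD(1)[OF w] 0 k by blast+
  fix \<phi> :: "real ^ 'a \<Rightarrow> real" and js :: "'a list"
  assume t: "test_function UNIV \<phi>" and c: "\<And>i. count_list js i = k $ i"
  have "(\<chi> j. 0 $ j + count_list js j) = k" by (simp add: vec_eq_iff c)
  moreover have "(0::nat^'a) $ j + count_list js j \<le> r" for j using k by (simp add: c multi_idx_def)
  ultimately show "(LINT x|lborel. E 0 x * of_real (iter_partial js \<phi> x)) =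
       (- 1) ^ (\<Sum>i\<in>UNIV. k $ i) * (LINT x|lborel. E k x * of_real (\<phi> x))"
    using weak_family_iter[OF w _ t, of 0 js] length_count_list[of js k] c by simp
qed

text \<open>Testing E k against the derivative of \<psi> in direction i is, up to sign, testing f
  against a derivative of \<psi> of order k + e_i; the two signs differ by one factor -1.\<close>

lemma weak_familyI:
  assumes w: "\<And>k. k \<in> multi_idx r \<Longrightarrow> has_weak_deriv UNIV k f (E k)"
    and m: "\<And>k. k \<in> multi_idx r \<Longrightarrow> E k \<in> borel_fun"
  shows "weak_family r E"
  unfolding weak_family_def
proof (intro conjI ballI allI impI)
  fix k :: "nat ^ 'a" assume k: "k \<in> multi_idx r"
  show "locally_integrable UNIV (E k)" "E k \<in> borel_fun"
    using has_weak_deriv_local[OF w[OF k]] m[OF k] by auto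
  fix i :: 'a and \<psi> :: "real ^ 'a \<Rightarrow> real"
  assume i: "k $ i < r" and t: "test_function UNIV \<psi>"
  let ?k = "k + axis i 1"
  have k': "?k \<in> multi_idx r" by (rule plus_axis_multi_idx[OF k i])
  let ?js = "list_of k"
  have c: "count_list ?js j = k $ j" for j by (rule count_list_of)
  have c': "count_list (?js @ [i]) j = ?k $ j" for j unfolding plus_axis_nth by (simp add: c)
  have "(- 1) ^ (\<Sum>i\<in>UNIV. k $ i) * (LINT x|lborel. E k x * of_real (partial_deriv i \<psi> x))
     = (LINT x|lborel. f x * of_real (iter_partial ?js (partial_deriv i \<psi>) x))"
    by (rule has_weak_derivD[OF w[OF k] test_function_partial_deriv[OF t] c, symmetric])
  also have "\<dots> = (LINT x|lborel. f x * of_real (iter_partial (?js @ [i]) \<psi> x))"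
    by (simp add: iter_partial_append)
  also have "\<dots> = (- 1) ^ (\<Sum>i\<in>UNIV. ?k $ i) * (LINT x|lborel. E ?k x * of_real (\<psi> x))"
    by (rule has_weak_derivD[OF w[OF k'] t c'])
  also have "(\<Sum>j\<in>UNIV. ?k $ j) = Suc (\<Sum>j\<in>UNIV. k $ j)"
    using length_count_list[of "?js @ [i]" ?k, OF c'] length_count_list[of ?js k, OF c] by simp
  finally have "(- 1) ^ (\<Sum>i\<in>UNIV. k $ i) * (LINT x|lborel. E k x * of_real (partial_deriv i \<psi> x))
    = (- 1) ^ (\<Sum>i\<in>UNIV. k $ i) * - (LINT x|lborel. E ?k x * of_real (\<psi> x))"
    by simp
  then show "(LINT x|lborel. E k x * of_real (partial_deriv i \<psi> x)) = - (LINT x|lborel. E ?k x * of_real (\<psi> x))"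
    by (subst (asm) mult_cancel_left) simp
qed

section \<open>Power means\<close>

lemma powr_tangent:
  fixes u m p :: real
  assumes "u \<ge> 0" "m > 0" "p \<ge> 1"
  shows "u \<le> m powr (1 - p) / p * u powr p + m * ((p - 1) / p)"
proof (cases "p = 1")
  case False
  then have p: "p > 1" using assms by simp
  have "u * m powr (p - 1) \<le> u powr p / p + (m powr (p - 1)) powr (p / (p - 1)) / (p / (p - 1))"
    by (rule Youngs_inequality) (use p assms in \<open>auto simp: field_simps\<close>)
  also have "(m powr (p - 1)) powr (p / (p - 1)) = m powr p" using p by (simp add: powr_powr)
  finally have "m powr (1 - p) * (u * m powr (p - 1)) \<le> m powr (1 - p) * (u powr p / p + m powr p / (p / (p - 1)))"
    by (intro mult_left_mono) auto
  moreover have "m powr (1 - p) * m powr (p - 1) = 1" "m powr (1 - p) * m powr p = m"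
    using assms by (simp_all add: powr_add[symmetric])
  ultimately show ?thesis by (simp add: field_simps)
qed (use assms in auto)

text \<open>Jensen's inequality, obtained by integrating the tangent line of the p-th power at m = v
  / T. It is stated for an arbitrary minorant v of the integral, so that nothing has to be known
  integrable beforehand.\<close>

lemma power_mean:
  fixes u :: "'a \<Rightarrow> real" and v p T :: real
  assumes [measurable]: "u \<in> borel_measurable M" and u0: "\<And>x. u x \<ge> 0" and p: "p \<ge> 1" and T: "T > 0"
    and M: "emeasure M (space M) \<le> ennreal T"
    and v: "ennreal v \<le> (\<integral>\<^sup>+x. ennreal (u x) \<partial>M)" "v \<ge> 0"
  shows "ennreal (v powr p) \<le> ennreal (T powr (p - 1)) * (\<integral>\<^sup>+x. ennreal (u x powr p) \<partial>M)"
proof (cases "v = 0 \<or> (\<integral>\<^sup>+x. ennreal (u x powr p) \<partial>M) = \<infinity>")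
  case True
  then show ?thesis using T p by (auto simp: ennreal_mult_eq_top_iff ennreal_mult_top)
next
  case False
  then obtain I where I: "(\<integral>\<^sup>+x. ennreal (u x powr p) \<partial>M) = ennreal I" "I \<ge> 0"
    by (cases "\<integral>\<^sup>+x. ennreal (u x powr p) \<partial>M") auto
  define m where "m = v / T"
  have m: "m > 0" using False v T by (simp add: m_def)
  let ?a = "m powr (1 - p) / p" and ?b = "m * ((p - 1) / p)"
  have a0: "?a \<ge> 0" "?b \<ge> 0" using m p by auto
  have "ennreal v \<le> (\<integral>\<^sup>+x. ennreal (u x) \<partial>M)" by fact
  also have "\<dots> \<le> (\<integral>\<^sup>+x. ennreal ?a * ennreal (u x powr p) + ennreal ?b \<partial>M)"
  proof (rule nn_integral_mono)
    fix x
    have "ennreal (u x) \<le> ennreal (?a * u x powr p + ?b)" using powr_tangent[OF u0 m p] by (rule ennreal_leI)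
    also have "\<dots> = ennreal ?a * ennreal (u x powr p) + ennreal ?b"
      using a0 by (simp add: ennreal_plus ennreal_mult del: times_divide_eq_left)
    finally show "ennreal (u x) \<le> ennreal ?a * ennreal (u x powr p) + ennreal ?b" .
  qed
  also have "\<dots> = ennreal ?a * ennreal I + ennreal ?b * emeasure M (space M)"
    by (simp add: nn_integral_add nn_integral_cmult I)
  also have "\<dots> \<le> ennreal ?a * ennreal I + ennreal ?b * ennreal T"
    by (intro add_left_mono mult_left_mono M) simp
  also have "\<dots> = ennreal (?a * I + ?b * T)"
    using a0 I T by (simp add: ennreal_plus ennreal_mult del: times_divide_eq_left)
  finally have "v \<le> ?a * I + ?b * T"
    using a0 I T by (subst (asm) ennreal_le_iff) (auto simp del: times_divide_eq_left times_divide_eq_right)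
  also have "?b * T = v - v / p" using T p by (simp add: m_def field_simps)
  finally have "v / p \<le> ?a * I" by simp
  then have "v \<le> m powr (1 - p) * I" using p by (simp add: field_simps)
  then have "m powr (p - 1) * v \<le> m powr (p - 1) * (m powr (1 - p) * I)" by (intro mult_left_mono) auto
  also have "\<dots> = I" using m by (simp add: mult.assoc[symmetric] powr_add[symmetric])
  finally have "m powr (p - 1) * v \<le> I" .
  then have "T powr (p - 1) * (m powr (p - 1) * v) \<le> T powr (p - 1) * I" by (intro mult_left_mono) auto
  moreover have "T powr (p - 1) * (m powr (p - 1) * v) = v powr p"
  proof -
    have "T powr (p - 1) * m powr (p - 1) = v powr (p - 1)"
      using T m by (subst powr_mult[symmetric]) (auto simp: m_def)
    then have "T powr (p - 1) * (m powr (p - 1) * v) = v powr (p - 1) * v powr 1"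
      using False v by (simp add: mult.assoc[symmetric])
    also have "\<dots> = v powr p" unfolding powr_add[symmetric] by simp
    finally show ?thesis .
  qed
  ultimately show ?thesis unfolding I by (simp add: ennreal_mult'[symmetric] ennreal_leI)
qed

lemma power_mean_interval:
  fixes u :: "real \<Rightarrow> real" and v p T :: real
  assumes [measurable]: "u \<in> borel_fun" and u0: "\<And>x. u x \<ge> 0" and p: "p \<ge> 1" and T: "T > 0"
    and v: "ennreal v \<le> (\<integral>\<^sup>+t. ennreal (u t) * indicator {0..T} t \<partial>lborel)" "v \<ge> 0"
  shows "ennreal (v powr p) \<le> ennreal (T powr (p - 1)) * (\<integral>\<^sup>+t. ennreal (u t powr p) * indicator {0..T} t \<partial>lborel)"
proof -
  have "ennreal (v powr p) \<le> ennreal (T powr (p - 1)) * (\<integral>\<^sup>+t. ennreal (u t powr p) \<partial>restrict_space lborel {0..T})"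
  proof (rule power_mean[OF _ u0 p T])
    show "u \<in> borel_measurable (restrict_space lborel {0..T})" by (intro measurable_restrict_space1) auto
    show "emeasure (restrict_space lborel {0..T}) (space (restrict_space lborel {0..T})) \<le> ennreal T"
      using T by (simp add: emeasure_restrict_space space_restrict_space)
  qed (use v in \<open>auto simp: nn_integral_restrict_space\<close>)
  then show ?thesis by (simp add: nn_integral_restrict_space)
qed

text \<open>A non-integrable function has Bochner integral 0 by convention, so the bound holds
  without hypotheses.\<close>

lemma norm_integral_le_nn:
  fixes f :: "'a \<Rightarrow> complex"
  shows "ennreal (norm (LINT x|M. f x)) \<le> (\<integral>\<^sup>+x. ennreal (norm (f x)) \<partial>M)"
proof (cases "integrable M f")
  case True then show ?thesis by (rule integral_norm_bound_ennreal)
qed (simp add: not_integrable_integral_eq)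

lemma powr_add_le:
  fixes a b p :: real
  assumes "a \<ge> 0" "b \<ge> 0" "p \<ge> 0"
  shows "(a + b) powr p \<le> 2 powr p * (a powr p + b powr p)"
proof -
  have "(a + b) powr p \<le> (2 * max a b) powr p" using assms by (intro powr_mono2) auto
  also have "\<dots> = 2 powr p * (max a b) powr p" using assms by (simp add: powr_mult)
  also have "(max a b) powr p \<le> a powr p + b powr p" by (auto simp: max_def)
  finally show ?thesis by simp
qed

text \<open>Valued in the extended nonnegative reals, so that p-th powers can be integrated before
  finiteness is known.\<close>

definition pn :: "real \<Rightarrow> complex \<Rightarrow> ennreal" where
  "pn p z = ennreal (norm z powr p)"

lemma pn_measurable[measurable]: "pn p \<in> borel_fun"
  unfolding pn_def[abs_def] by measurable

lemma pn_0[simp]: "pn p 0 = 0" by (simp add: pn_def)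

lemma pn_add: "p \<ge> 0 \<Longrightarrow> pn p (a + b) \<le> ennreal (2 powr p) * (pn p a + pn p b)"
  unfolding pn_def
  by (subst ennreal_plus[symmetric], simp, simp, subst ennreal_mult'[symmetric], simp, rule ennreal_leI,
      rule order_trans[OF powr_mono2 powr_add_le]) (auto simp: norm_triangle_ineq)

lemma pn_mult: "pn p (a * b) = pn p a * pn p b"
  by (simp add: pn_def norm_mult powr_mult ennreal_mult)

text \<open>For smooth G this is the integral over [0,1] of the derivative of -(1 - t) G(x + t e).
  In the weak setting the shifts are moved to the test function, for which the same identity, taken
  backwards along e, holds classically.\<close>

lemma weak_average:
  fixes G G' :: "real ^ 'd \<Rightarrow> complex" and \<phi> :: "int ^ 'd \<Rightarrow> real ^ 'd \<Rightarrow> real"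
  assumes part: "smooth_partition r p' \<theta> \<phi>" and \<theta>: "\<theta> > 0"
    and [measurable]: "G \<in> borel_fun" "G' \<in> borel_fun"
    and loc: "locally_integrable UNIV G" "locally_integrable UNIV G'"
    and ibp: "\<And>\<psi>. test_function UNIV \<psi> \<Longrightarrow>
        (LINT x|lborel. G x * of_real (partial_deriv i \<psi> x)) = - (LINT x|lborel. G' x * of_real (\<psi> x))"
  shows "AE x in lborel. G x = (LINT t|lborel. G (x + t *\<^sub>R axis i 1) * of_real (indicator {0..1} t))
     - (LINT t|lborel. G' (x + t *\<^sub>R axis i 1) * of_real (ramp t))"
proof -
  let ?e = "axis i (1::real)"
  define A where "A = (\<lambda>x. LINT t|lborel. G (x + t *\<^sub>R ?e) * of_real (indicator {0..1} t))"
  define R where "R = (\<lambda>x. LINT t|lborel. G' (x + t *\<^sub>R ?e) * of_real (ramp t))"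
  have loc': "\<And>K. compact K \<Longrightarrow> set_integrable lborel K G" "\<And>K. compact K \<Longrightarrow> set_integrable lborel K G'"
    using loc unfolding locally_integrable_def by auto
  have bd: "\<bar>ramp t\<bar> \<le> (1::real)" for t by (auto simp: indicator_def)
  have locA: "locally_integrable UNIV A"
    unfolding locally_integrable_def
  proof (intro allI impI)
    fix K :: "(real ^ 'd) set" assume "compact K \<and> K \<subseteq> UNIV"
    then have K: "compact K" by simp
    then have [measurable]: "K \<in> sets borel" by (rule borel_compact)
    have "integrable lborel (\<lambda>x. LINT t|lborel. G (x + t *\<^sub>R ?e) * of_real (indicator K x * indicator {0..1} t))"
    proof (rule fubini_shift(3)[where B=1 and K=K])
      show "(\<lambda>(x, t). complex_of_real (indicator K x * indicator {0..1::real} t)) \<in> borel_fun"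
        by (subst borel_prod[symmetric]) measurable
    qed (auto simp: indicator_def K loc')
    moreover have "(LINT t|lborel. G (x + t *\<^sub>R ?e) * of_real (indicator K x * indicator {0..1} t)) = indicator K x *\<^sub>R A x" for x
      unfolding A_def by (simp add: indicator_def)
    ultimately show "set_integrable lborel K A" by (simp add: set_integrable_def)
  qed
  have locR: "locally_integrable UNIV R"
    unfolding locally_integrable_def
  proof (intro allI impI)
    fix K :: "(real ^ 'd) set" assume "compact K \<and> K \<subseteq> UNIV"
    then have K: "compact K" by simp
    then have [measurable]: "K \<in> sets borel" by (rule borel_compact)
    have "integrable lborel (\<lambda>x. LINT t|lborel. G' (x + t *\<^sub>R ?e) * of_real (indicator K x * ramp t))"
    proof (rule fubini_shift(3)[where B=1 and K=K])
      show "(\<lambda>(x, t). complex_of_real (indicator K x * ramp t)) \<in> borel_fun"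
        by (subst borel_prod[symmetric]) measurable
      show "norm (complex_of_real (indicator K x * ramp t)) \<le> 1" for x t
        unfolding norm_of_real using bd[of t] by (cases "x \<in> K") (simp_all add: abs_mult)
    qed (auto simp: indicator_def K loc')
    moreover have "(LINT t|lborel. G' (x + t *\<^sub>R ?e) * of_real (indicator K x * ramp t)) = indicator K x *\<^sub>R R x" for x
      unfolding R_def by (cases "x \<in> K") simp_all
    ultimately show "set_integrable lborel K R" by (simp add: set_integrable_def)
  qed
  have "AE x in lborel. x \<in> UNIV \<longrightarrow> G x - A x + R x = 0"
  proof (rule weak_zero_AE[OF part \<theta> open_UNIV])
    show "locally_integrable UNIV (\<lambda>x. G x - A x + R x)"
      using locA locR loc unfolding locally_integrable_def by auto
    fix \<psi> :: "real ^ 'd \<Rightarrow> real" assume t: "test_function UNIV \<psi>"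
    let ?d = "\<lambda>x t. partial_deriv i \<psi> (x - t *\<^sub>R ?e) * ramp t"
    note sm = test_function_smooth[OF t]
    obtain K where K: "compact K" "K \<subseteq> UNIV" "\<And>x js. x \<notin> K \<Longrightarrow> iter_partial js \<psi> x = 0"
      using test_functionE[OF t] by metis
    obtain B where B: "\<And>x. norm (\<psi> x) \<le> B" using test_function_bounded[OF t] by blast
    obtain B' where B': "\<And>x. norm (partial_deriv i \<psi> x) \<le> B'"
      using test_function_bounded[OF test_function_partial_deriv[OF t]] by blast
    have B0: "B \<ge> 0" "B' \<ge> 0" using B[of 0] B'[of 0] by (meson norm_ge_zero order_trans)+
    have [measurable]: "\<psi> \<in> borel_fun" "partial_deriv i \<psi> \<in> borel_fun"
      by (intro smooth_borel sm smooth_partial_deriv)+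
    have 1: "(LINT x|lborel. A x * of_real (\<psi> x)) = (LINT x|lborel. G x * (LINT t|lborel. of_real (\<psi> (x - t *\<^sub>R ?e) * indicator {0..1} t)))"
    proof -
      have "(LINT x|lborel. A x * of_real (\<psi> x)) = (LINT x|lborel. (LINT t|lborel. G (x + t *\<^sub>R ?e) * of_real (\<psi> x * indicator {0..1} t)))"
        unfolding A_def integral_mult_left_zero[symmetric] by (simp add: mult_ac)
      also have "\<dots> = (LINT x|lborel. G x * (LINT t|lborel. of_real (\<psi> (x - t *\<^sub>R ?e) * indicator {0..1} t)))"
      proof (rule fubini_shift(1)[where B=B and K=K])
        show "(\<lambda>(x, t). complex_of_real (\<psi> x * indicator {0..1::real} t)) \<in> borel_fun"
          by (subst borel_prod[symmetric]) measurable
        show "norm (complex_of_real (\<psi> x * indicator {0..1::real} t)) \<le> B" for x t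
          using B[of x] B0 by (auto simp: indicator_def)
      qed (use K(3)[of _ "[]"] in \<open>auto simp: indicator_def K(1) loc'\<close>)
      finally show ?thesis .
    qed
    have 2: "(LINT x|lborel. R x * of_real (\<psi> x)) = - (LINT x|lborel. G x * (LINT t|lborel. of_real (?d x t)))"
    proof -
      have "(LINT x|lborel. R x * of_real (\<psi> x)) = (LINT x|lborel. (LINT t|lborel. G' (x + t *\<^sub>R ?e) * of_real (\<psi> x * ramp t)))"
        unfolding R_def integral_mult_left_zero[symmetric] by (simp add: mult_ac)
      also have "\<dots> = (LINT t|lborel. (LINT x|lborel. G' x * of_real (\<psi> (x - t *\<^sub>R ?e) * ramp t)))"
      proof (rule fubini_shift(2)[where B=B and K=K])
        show "(\<lambda>(x, t). complex_of_real (\<psi> x * ramp t)) \<in> borel_fun"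
          by (subst borel_prod[symmetric]) measurable
        show "norm (complex_of_real (\<psi> x * ramp t)) \<le> B" for x t
          using mult_mono[OF B[of x] bd[of t]] B0 unfolding norm_of_real by (simp add: abs_mult)
      qed (use K(3)[of _ "[]"] in \<open>auto simp: indicator_def K(1) loc'\<close>)
      \<comment> \<open>For each fixed shift the weak derivative relation is used with a translated
        test function.\<close>
      also have "\<dots> = (LINT t|lborel. - (LINT x|lborel. G x * of_real (?d x t)))"
      proof (rule Bochner_Integration.integral_cong[OF refl])
        fix s :: real
        let ?\<psi> = "\<lambda>x. \<psi> (x + - s *\<^sub>R ?e)"
        have "partial_deriv i ?\<psi> x = partial_deriv i \<psi> (x + - s *\<^sub>R ?e)" for x
          using partial_deriv_affine(1)[OF sm, of i 1 1 "- s *\<^sub>R ?e" x] by simp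
        then have "(LINT x|lborel. G x * of_real (partial_deriv i \<psi> (x + - s *\<^sub>R ?e))) = - (LINT x|lborel. G' x * of_real (?\<psi> x))"
          using ibp[OF test_function_translate[OF t], of "- s *\<^sub>R ?e"] by simp
        then have "(LINT x|lborel. G' x * of_real (\<psi> (x - s *\<^sub>R ?e))) = - (LINT x|lborel. G x * of_real (partial_deriv i \<psi> (x - s *\<^sub>R ?e)))"
          by simp
        then show "(LINT x|lborel. G' x * of_real (\<psi> (x - s *\<^sub>R ?e) * ((1 - s) * indicator {0..1} s))) =
          - (LINT x|lborel. G x * of_real (partial_deriv i \<psi> (x - s *\<^sub>R ?e) * ((1 - s) * indicator {0..1} s)))"
          unfolding of_real_mult[of "\<psi> _"] of_real_mult[of "partial_deriv i \<psi> _"] mult.assoc[symmetric, of "G' _"] mult.assoc[symmetric, of "G _"] integral_mult_left_zero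
          by simp
      qed
      also have "\<dots> = - (LINT t|lborel. (LINT x|lborel. G x * of_real (?d x t)))"
        by simp
      also have "(LINT t|lborel. (LINT x|lborel. G x * of_real (?d x t))) =
         (LINT x|lborel. (LINT t|lborel. G (x + t *\<^sub>R ?e) * of_real (partial_deriv i \<psi> x * ramp t)))"
      proof (rule fubini_shift(2)[symmetric, where B=B' and K=K])
        show "(\<lambda>(x, t). complex_of_real (partial_deriv i \<psi> x * ramp t)) \<in> borel_fun"
          by (subst borel_prod[symmetric]) measurable
        show "norm (complex_of_real (partial_deriv i \<psi> x * ramp t)) \<le> B'" for x t
          using mult_mono[OF B'[of x] bd[of t]] B0 unfolding norm_of_real by (simp add: abs_mult)
      qed (use K(3)[of _ "[i]"] in \<open>auto simp: indicator_def K(1) loc'\<close>)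
      also have "\<dots> = (LINT x|lborel. G x * (LINT t|lborel. of_real (?d x t)))"
      proof (rule fubini_shift(1)[where B=B' and K=K])
        show "(\<lambda>(x, t). complex_of_real (partial_deriv i \<psi> x * ramp t)) \<in> borel_fun"
          by (subst borel_prod[symmetric]) measurable
        show "norm (complex_of_real (partial_deriv i \<psi> x * ramp t)) \<le> B'" for x t
          using mult_mono[OF B'[of x] bd[of t]] B0 unfolding norm_of_real by (simp add: abs_mult)
      qed (use K(3)[of _ "[i]"] in \<open>auto simp: indicator_def K(1) loc'\<close>)
      finally show ?thesis .
    qed
    \<comment> \<open>The classical counterpart: integrate the derivative of -(1 - t) \<psi>(x - t
      e) over [0,1]; the boundary term at t = 1 vanishes.\<close>
    have 3: "(LINT t|lborel. complex_of_real (\<psi> (x - t *\<^sub>R ?e) * indicator {0..1} t)) +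
       (LINT t|lborel. of_real (?d x t)) = of_real (\<psi> x)" for x
    proof -
      have c1: "continuous_on {0..1} (\<lambda>t. \<psi> (x - t *\<^sub>R ?e))" "continuous_on {0..1} (\<lambda>t. partial_deriv i \<psi> (x - t *\<^sub>R ?e))"
        by (rule continuous_on_compose2[OF smooth_continuous[of _ UNIV]], auto intro!: continuous_intros sm smooth_partial_deriv)+
      have i1: "integrable lborel (\<lambda>t. indicator {0..1} t *\<^sub>R \<psi> (x - t *\<^sub>R ?e))"
        "integrable lborel (\<lambda>t. indicator {0..1} t *\<^sub>R (partial_deriv i \<psi> (x - t *\<^sub>R ?e) * (1 - t)))"
        by (rule borel_integrable_compact, simp, intro continuous_intros c1)+
      have "(LINT t|lborel. indicator {0..1} t *\<^sub>R (\<psi> (x - t *\<^sub>R ?e) + partial_deriv i \<psi> (x - t *\<^sub>R ?e) * (1 - t)))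
        = - (1 - 1) * \<psi> (x - 1 *\<^sub>R ?e) - (- (1 - 0) * \<psi> (x - 0 *\<^sub>R ?e))"
      proof (rule integral_FTC_atLeastAtMost[where F="\<lambda>t. - (1 - t) * \<psi> (x - t *\<^sub>R ?e)"])
        fix s :: real
        have "((\<lambda>t. \<psi> (x + (- t) *\<^sub>R ?e)) has_real_derivative partial_deriv i \<psi> (x + (- s) *\<^sub>R ?e) * (- 1)) (at s)"
          by (rule DERIV_chain'[where f="\<lambda>t. - t" and g="\<lambda>t. \<psi> (x + t *\<^sub>R ?e)"])
            (use smooth_has_real_derivative[OF sm, of x i "- s"] in \<open>auto intro!: derivative_eq_intros\<close>)
        then have "((\<lambda>t. - (1 - t) * \<psi> (x + (- t) *\<^sub>R ?e)) has_real_derivative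
            (\<psi> (x - s *\<^sub>R ?e) + partial_deriv i \<psi> (x - s *\<^sub>R ?e) * (1 - s))) (at s)"
          by (auto intro!: derivative_eq_intros simp: algebra_simps)
        then show "((\<lambda>t. - (1 - t) * \<psi> (x - t *\<^sub>R ?e)) has_vector_derivative
            (\<psi> (x - s *\<^sub>R ?e) + partial_deriv i \<psi> (x - s *\<^sub>R ?e) * (1 - s))) (at s within {0..1})"
          by (auto simp: has_real_derivative_iff_has_vector_derivative intro: has_vector_derivative_at_within)
      qed (auto intro!: continuous_intros c1)
      then have "(LINT t|lborel. indicator {0..1} t *\<^sub>R \<psi> (x - t *\<^sub>R ?e)) +
         (LINT t|lborel. indicator {0..1} t *\<^sub>R (partial_deriv i \<psi> (x - t *\<^sub>R ?e) * (1 - t))) = \<psi> x"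
        unfolding scaleR_add_right L_integral_add[OF i1] by simp
      then have "(LINT t|lborel. \<psi> (x - t *\<^sub>R ?e) * indicator {0..1} t) +
         (LINT t|lborel. partial_deriv i \<psi> (x - t *\<^sub>R ?e) * ramp t) = \<psi> x"
        by (simp add: mult_ac)
      moreover have "(LINT t|lborel. complex_of_real (\<psi> (x - t *\<^sub>R ?e) * indicator {0..1} t)) = of_real (LINT t|lborel. \<psi> (x - t *\<^sub>R ?e) * indicator {0..1} t)"
        "(LINT t|lborel. complex_of_real (?d x t)) = of_real (LINT t|lborel. partial_deriv i \<psi> (x - t *\<^sub>R ?e) * ramp t)"
      proof -
        have "integrable lborel (\<lambda>t. \<psi> (x - t *\<^sub>R ?e) * indicator {0..1} t)"
          using i1(1) by (simp add: mult.commute)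
        then show "(LINT t|lborel. complex_of_real (\<psi> (x - t *\<^sub>R ?e) * indicator {0..1} t)) = of_real (LINT t|lborel. \<psi> (x - t *\<^sub>R ?e) * indicator {0..1} t)"
          by (rule integral_of_real)
        have "integrable lborel (\<lambda>t. partial_deriv i \<psi> (x - t *\<^sub>R ?e) * ramp t)"
          using i1(2) by (simp add: mult_ac)
        then show "(LINT t|lborel. complex_of_real (?d x t)) = of_real (LINT t|lborel. partial_deriv i \<psi> (x - t *\<^sub>R ?e) * ramp t)"
          by (rule integral_of_real)
      qed
      ultimately show ?thesis by (simp only: of_real_add[symmetric])
    qed
    note it = integrable_mult_test[OF _ t]
    define a where "a = (\<lambda>x. LINT t|lborel. complex_of_real (\<psi> (x - t *\<^sub>R ?e) * indicator {0..1} t))"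
    define b where "b = (\<lambda>x. LINT t|lborel. complex_of_real (?d x t))"
    have ab: "b x = of_real (\<psi> x) - a x" for x
      unfolding 3[of x, symmetric] a_def b_def by (rule add_diff_cancel_left'[symmetric])
    \<comment> \<open>The integral of G b is split below through b = \<psi> - a, which needs G a
      integrable; a is bounded with compact support.\<close>
    have int_a: "integrable lborel (\<lambda>x. G x * a x)"
    proof -
      define K' where "K' = (\<lambda>(x, t). x + t *\<^sub>R ?e) ` (K \<times> {0..1::real})"
      have cK': "compact K'"
        unfolding K'_def case_prod_unfold
        by (intro compact_continuous_image compact_Times K continuous_intros) auto
      have [measurable]: "a \<in> borel_fun" unfolding a_def by measurable
      have na: "norm (a x) \<le> B" for x
      proof -
        have "ennreal (norm (a x)) \<le> (\<integral>\<^sup>+t. ennreal (norm (complex_of_real (\<psi> (x - t *\<^sub>R ?e) * indicator {0..1} t))) \<partial>lborel)"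
          unfolding a_def by (rule norm_integral_le_nn)
        also have "\<dots> \<le> (\<integral>\<^sup>+t. ennreal B * indicator {0..1::real} t \<partial>lborel)"
          by (rule nn_integral_mono) (use B in \<open>auto simp: indicator_def intro!: ennreal_leI\<close>)
        also have "\<dots> = ennreal B" by (simp add: nn_integral_cmult_indicator)
        finally show ?thesis using B0 by simp
      qed
      have az: "a x = 0" if "x \<notin> K'" for x
      proof -
        have "\<psi> (x - t *\<^sub>R ?e) * indicator {0..1} t = 0" for t
        proof (cases "t \<in> {0..1}")
          case True
          have "x - t *\<^sub>R ?e \<notin> K"
          proof
            assume "x - t *\<^sub>R ?e \<in> K"
            then have "x \<in> K'" unfolding K'_def using True by (auto intro!: image_eqI[of _ _ "(x - t *\<^sub>R ?e, t)"])
            then show False using that by simp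
          qed
          then show ?thesis using K(3)[of _ "[]"] by simp
        qed simp
        then show ?thesis unfolding a_def by (simp only: of_real_0 Bochner_Integration.integral_zero)
      qed
      show ?thesis by (rule locally_integrable_mult[OF loc(1) cK' subset_UNIV _ na az]) measurable
    qed
    have "(LINT x|lborel. (G x - A x + R x) * of_real (\<psi> x)) =
      (LINT x|lborel. G x * of_real (\<psi> x)) - (LINT x|lborel. A x * of_real (\<psi> x)) + (LINT x|lborel. R x * of_real (\<psi> x))"
      using it[OF loc(1)] it[OF locA] it[OF locR] by (simp add: algebra_simps)
    also have "\<dots> = (LINT x|lborel. G x * of_real (\<psi> x)) - (LINT x|lborel. G x * a x) - (LINT x|lborel. G x * b x)"
      unfolding 1 2 a_def b_def by simp
    also have "(LINT x|lborel. G x * b x) = (LINT x|lborel. G x * of_real (\<psi> x)) - (LINT x|lborel. G x * a x)"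
      unfolding ab right_diff_distrib using int_a it[OF loc(1)] by simp
    finally show "(LINT x|lborel. (G x - A x + R x) * of_real (\<psi> x)) = 0" by simp
  qed
  then show ?thesis unfolding A_def R_def by eventually_elim (simp add: algebra_simps)
qed

section \<open>Averages along coordinate directions\<close>

text \<open>The power mean inequality on a unit segment, where the ramp is at most 1.\<close>

lemma pn_average:
  fixes G G' :: "real ^ 'd \<Rightarrow> complex"
  assumes [measurable]: "G \<in> borel_fun" "G' \<in> borel_fun" and p: "p \<ge> 1"
    and eq: "G x = (LINT t|lborel. G (x + t *\<^sub>R e) * of_real (indicator {0..1} t))
     - (LINT t|lborel. G' (x + t *\<^sub>R e) * of_real (ramp t))"
  shows "pn p (G x) \<le> ennreal (2 powr p) *
    (\<integral>\<^sup>+t. (pn p (G (x + t *\<^sub>R e)) + pn p (G' (x + t *\<^sub>R e))) * indicator {0..1} t \<partial>lborel)"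
proof -
  let ?u = "\<lambda>t. norm (G (x + t *\<^sub>R e)) + norm (G' (x + t *\<^sub>R e))"
  have "norm (G x) \<le> norm (LINT t|lborel. G (x + t *\<^sub>R e) * of_real (indicator {0..1} t))
     + norm (LINT t|lborel. G' (x + t *\<^sub>R e) * of_real (ramp t))"
    by (subst eq) (rule norm_triangle_ineq4)
  then have "ennreal (norm (G x)) \<le> ennreal (norm (LINT t|lborel. G (x + t *\<^sub>R e) * of_real (indicator {0..1} t)))
     + ennreal (norm (LINT t|lborel. G' (x + t *\<^sub>R e) * of_real (ramp t)))"
    by (simp add: ennreal_plus[symmetric] ennreal_leI del: ennreal_plus)
  also have "\<dots> \<le> (\<integral>\<^sup>+t. ennreal (norm (G (x + t *\<^sub>R e) * of_real (indicator {0..1} t))) \<partial>lborel)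
     + (\<integral>\<^sup>+t. ennreal (norm (G' (x + t *\<^sub>R e) * of_real (ramp t))) \<partial>lborel)"
    by (intro add_mono norm_integral_le_nn)
  also have "\<dots> = (\<integral>\<^sup>+t. ennreal (norm (G (x + t *\<^sub>R e) * of_real (indicator {0..1} t)))
     + ennreal (norm (G' (x + t *\<^sub>R e) * of_real (ramp t))) \<partial>lborel)"
    by (rule nn_integral_add[symmetric]) auto
  also have "\<dots> \<le> (\<integral>\<^sup>+t. ennreal (?u t) * indicator {0..1} t \<partial>lborel)"
  proof (rule nn_integral_mono)
    fix t :: real
    show "ennreal (norm (G (x + t *\<^sub>R e) * of_real (indicator {0..1} t)))
     + ennreal (norm (G' (x + t *\<^sub>R e) * of_real (ramp t))) \<le> ennreal (?u t) * indicator {0..1} t"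
    proof (cases "t \<in> {0..1}")
      case True
      have "norm (G' (x + t *\<^sub>R e) * of_real (ramp t)) \<le> norm (G' (x + t *\<^sub>R e)) * 1"
        unfolding norm_mult norm_of_real using True by (intro mult_left_mono) auto
      then show ?thesis using True
        by (subst ennreal_plus[symmetric]) (auto intro!: ennreal_leI simp del: ennreal_plus of_real_mult of_real_diff)
    qed simp
  qed
  finally have le: "ennreal (norm (G x)) \<le> (\<integral>\<^sup>+t. ennreal (?u t) * indicator {0..1} t \<partial>lborel)" .
  have "ennreal (norm (G x) powr p) \<le> ennreal (1 powr (p - 1)) * (\<integral>\<^sup>+t. ennreal (?u t powr p) * indicator {0..1} t \<partial>lborel)"
    by (rule power_mean_interval[OF _ _ p _ le]) auto
  also have "\<dots> = (\<integral>\<^sup>+t. ennreal (?u t powr p) * indicator {0..1} t \<partial>lborel)" by simp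
  also have "\<dots> \<le> (\<integral>\<^sup>+t. ennreal (2 powr p) * ((pn p (G (x + t *\<^sub>R e)) + pn p (G' (x + t *\<^sub>R e))) * indicator {0..1} t) \<partial>lborel)"
  proof (rule nn_integral_mono)
    fix t :: real
    have "ennreal (?u t powr p) \<le> ennreal (2 powr p * (norm (G (x + t *\<^sub>R e)) powr p + norm (G' (x + t *\<^sub>R e)) powr p))"
      using p by (intro ennreal_leI powr_add_le) auto
    also have "\<dots> = ennreal (2 powr p) * (pn p (G (x + t *\<^sub>R e)) + pn p (G' (x + t *\<^sub>R e)))"
      by (simp add: pn_def ennreal_mult')
    finally show "ennreal (?u t powr p) * indicator {0..1} t \<le> ennreal (2 powr p) * ((pn p (G (x + t *\<^sub>R e)) + pn p (G' (x + t *\<^sub>R e))) * indicator {0..1} t)"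
      by (auto simp: indicator_def)
  qed
  also have "\<dots> = ennreal (2 powr p) *
    (\<integral>\<^sup>+t. (pn p (G (x + t *\<^sub>R e)) + pn p (G' (x + t *\<^sub>R e))) * indicator {0..1} t \<partial>lborel)"
    by (rule nn_integral_cmult) measurable
  finally show ?thesis by (simp add: pn_def)
qed

text \<open>Unnormalized integrals over segments of length T, backwards along each listed direction:
  the transposes of the forward averages in \<open>pn_average\<close>.\<close>

primrec bavg :: "real \<Rightarrow> 'a::euclidean_space list \<Rightarrow> ('a \<Rightarrow> ennreal) \<Rightarrow> 'a \<Rightarrow> ennreal" where
  "bavg T [] W = W"
| "bavg T (e # es) W = (\<lambda>x. \<integral>\<^sup>+t. bavg T es W (x - t *\<^sub>R e) * indicator {0..T} t \<partial>lborel)"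

lemma bavg_measurable[measurable]:
  assumes [measurable]: "W \<in> borel_fun"
  shows "bavg T es W \<in> borel_fun"
proof (induction es)
  case (Cons e es)
  note [measurable] = Cons
  show ?case unfolding bavg.simps by measurable
qed (simp add: assms)

lemma bavg_append: "bavg T (us @ vs) W = bavg T us (bavg T vs W)"
  by (induction us) auto

lemma bavg_mono:
  assumes "\<And>x. W x \<le> W' x" "T \<le> T'"
  shows "bavg T es W x \<le> bavg T' es W' x"
proof (induction es arbitrary: x)
  case (Cons e es)
  show ?case unfolding bavg.simps
    by (intro nn_integral_mono mult_mono Cons) (use assms(2) in \<open>auto simp: indicator_def\<close>)
qed (simp add: assms)

lemma bavg_cmult:
  assumes [measurable]: "W \<in> borel_fun"
  shows "bavg T es (\<lambda>x. c * W x) x = c * bavg T es W x"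
proof (induction es arbitrary: x)
  case (Cons e es)
  show ?case unfolding bavg.simps Cons mult.assoc by (rule nn_integral_cmult) measurable
qed simp

lemma bavg_le_PiM:
  assumes [measurable]: "W \<in> borel_fun" and "distinct es"
  shows "bavg T es W x \<le> (\<integral>\<^sup>+\<tau>. W (x - (\<Sum>b\<in>set es. \<tau> b *\<^sub>R b)) \<partial>(PiM (set es) (\<lambda>_. lborel)))"
  using assms(2)
proof (induction es arbitrary: x)
  case Nil
  interpret product_sigma_finite "\<lambda>_. lborel :: real measure" by standard
  show ?case by (simp add: PiM_empty nn_integral_count_space_finite)
next
  case (Cons e es)
  interpret product_sigma_finite "\<lambda>_. lborel :: real measure" by standard
  have e: "e \<notin> set es" "finite (set es)" using Cons.prems by auto
  have "bavg T (e # es) W x \<le> (\<integral>\<^sup>+t. bavg T es W (x - t *\<^sub>R e) \<partial>lborel)"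
    unfolding bavg.simps by (rule nn_integral_mono) (auto simp: indicator_def)
  also have "\<dots> \<le> (\<integral>\<^sup>+t. (\<integral>\<^sup>+\<tau>. W (x - t *\<^sub>R e - (\<Sum>b\<in>set es. \<tau> b *\<^sub>R b)) \<partial>(PiM (set es) (\<lambda>_. lborel))) \<partial>lborel)"
    by (rule nn_integral_mono) (rule Cons.IH, use Cons.prems in auto)
  also have "\<dots> = (\<integral>\<^sup>+t. (\<integral>\<^sup>+\<tau>. W (x - (\<Sum>b\<in>insert e (set es). (\<tau>(e := t)) b *\<^sub>R b)) \<partial>(PiM (set es) (\<lambda>_. lborel))) \<partial>lborel)"
  proof (intro nn_integral_cong arg_cong[where f=W])
    fix t :: real and \<tau> :: "'a \<Rightarrow> real"
    have "(\<Sum>b\<in>set es. (\<tau>(e := t)) b *\<^sub>R b) = (\<Sum>b\<in>set es. \<tau> b *\<^sub>R b)"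
      by (rule sum.cong) (use e in auto)
    then show "x - t *\<^sub>R e - (\<Sum>b\<in>set es. \<tau> b *\<^sub>R b) = x - (\<Sum>b\<in>insert e (set es). (\<tau>(e := t)) b *\<^sub>R b)"
      using e by simp
  qed
  also have "\<dots> = (\<integral>\<^sup>+\<tau>. W (x - (\<Sum>b\<in>insert e (set es). \<tau> b *\<^sub>R b)) \<partial>(PiM (insert e (set es)) (\<lambda>_. lborel)))"
    by (rule product_nn_integral_insert_rev[symmetric, OF e(2,1)]) measurable
  finally show ?case by simp
qed

text \<open>Once every basis direction has been averaged, the value at any single point is dominated
  by the integral over the whole space. This is how pointwise bounds become integrals.\<close>

lemma bavg_le_integral:
  fixes W :: "'a::euclidean_space \<Rightarrow> ennreal"
  assumes [measurable]: "W \<in> borel_fun" and es: "distinct es" "set es = Basis"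
  shows "bavg T es W x \<le> (\<integral>\<^sup>+y. W y \<partial>lborel)"
proof -
  have "bavg T es W x \<le> (\<integral>\<^sup>+\<tau>. W (x - (\<Sum>b\<in>Basis. \<tau> b *\<^sub>R b)) \<partial>(PiM Basis (\<lambda>_. lborel)))"
    using bavg_le_PiM[OF assms(1) es(1), of T x] unfolding es(2) .
  also have "\<dots> = (\<integral>\<^sup>+y. W (x - y) \<partial>lborel)"
    by (subst lborel_eq, subst nn_integral_distr) auto
  also have "\<dots> = (\<integral>\<^sup>+y. W y \<partial>lborel)"
    using nn_integral_lborel_affine[OF assms(1), of "-1" x] by simp
  finally show ?thesis .
qed

lemma nn_integral_shift_average:
  fixes V W :: "'a::euclidean_space \<Rightarrow> ennreal"
  assumes [measurable]: "V \<in> borel_fun" "W \<in> borel_fun"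
  shows "(\<integral>\<^sup>+x. (\<integral>\<^sup>+t. V (x + t *\<^sub>R e) * indicator {0..T} t \<partial>lborel) * W x \<partial>lborel) =
     (\<integral>\<^sup>+x. V x * bavg T [e] W x \<partial>lborel)"
proof -
  have "(\<integral>\<^sup>+x. (\<integral>\<^sup>+t. V (x + t *\<^sub>R e) * indicator {0..T} t \<partial>lborel) * W x \<partial>lborel) =
    (\<integral>\<^sup>+x. (\<integral>\<^sup>+t. V (x + t *\<^sub>R e) * indicator {0..T} t * W x \<partial>lborel) \<partial>lborel)"
    by (intro nn_integral_cong nn_integral_multc[symmetric]) measurable
  also have "\<dots> = (\<integral>\<^sup>+t. (\<integral>\<^sup>+x. V (x + t *\<^sub>R e) * indicator {0..T} t * W x \<partial>lborel) \<partial>lborel)"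
    by (rule lborel_pair.Fubini'[symmetric]) measurable
  also have "\<dots> = (\<integral>\<^sup>+t. (\<integral>\<^sup>+x. V x * indicator {0..T} t * W (x - t *\<^sub>R e) \<partial>lborel) \<partial>lborel)"
  proof (rule nn_integral_cong)
    fix t :: real
    show "(\<integral>\<^sup>+x. V (x + t *\<^sub>R e) * indicator {0..T} t * W x \<partial>lborel) = (\<integral>\<^sup>+x. V x * indicator {0..T} t * W (x - t *\<^sub>R e) \<partial>lborel)"
      using nn_integral_lborel_translate[of "\<lambda>x. V x * indicator {0..T} t * W (x - t *\<^sub>R e)" "t *\<^sub>R e"] by simp
  qed
  also have "\<dots> = (\<integral>\<^sup>+x. (\<integral>\<^sup>+t. V x * indicator {0..T} t * W (x - t *\<^sub>R e) \<partial>lborel) \<partial>lborel)"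
    by (rule lborel_pair.Fubini') measurable
  also have "\<dots> = (\<integral>\<^sup>+x. V x * bavg T [e] W x \<partial>lborel)"
    unfolding bavg.simps by (subst nn_integral_cmult[symmetric]) (auto simp: mult_ac)
  finally show ?thesis .
qed

definition fam_pn :: "nat \<Rightarrow> real \<Rightarrow> (nat ^ 'd \<Rightarrow> real ^ 'd \<Rightarrow> complex) \<Rightarrow> real ^ 'd \<Rightarrow> ennreal" where
  "fam_pn r p E x = (\<Sum>m\<in>multi_idx r. pn p (E m x))"

abbreviation (input) local_mass :: "nat \<Rightarrow> real \<Rightarrow> (nat ^ 'd \<Rightarrow> real ^ 'd \<Rightarrow> complex) \<Rightarrow> int ^ 'd \<Rightarrow> ennreal" where
  "local_mass r p E k \<equiv> \<integral>\<^sup>+x. fam_pn r p E x * indicator (cube 4 (int_vec k)) x \<partial>lborel"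

lemma fam_pn_measurable:
  assumes "weak_family r E" shows "fam_pn r p E \<in> borel_fun"
  unfolding fam_pn_def[abs_def] using weak_familyD(2)[OF assms] by measurable

lemma pn_le_fam_pn: "k \<in> multi_idx r \<Longrightarrow> pn p (E k x) \<le> fam_pn r p E x"
  unfolding fam_pn_def using member_le_sum[of k "multi_idx r" "\<lambda>m. pn p (E m x)"] finite_multi_idx by auto

text \<open>Each listed direction costs one application of the averaging identity, which involves E
  k and E (k + e_i). The average is then transposed to W, so that the family ends up unaveraged and
  W averaged.\<close>

lemma weak_family_bavg:
  fixes \<phi> :: "int ^ 'd \<Rightarrow> real ^ 'd \<Rightarrow> real" and E :: "nat ^ 'd \<Rightarrow> real ^ 'd \<Rightarrow> complex"
  assumes part: "smooth_partition r' p' \<theta> \<phi>" and \<theta>: "\<theta> > 0"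
    and w: "weak_family r E" and p: "p \<ge> 1" and "distinct js"
    and "k \<in> multi_idx r" "\<And>i. i \<in> set js \<Longrightarrow> k $ i < r" and "W \<in> borel_fun"
  shows "(\<integral>\<^sup>+x. pn p (E k x) * W x \<partial>lborel) \<le> ennreal ((2 * 2 powr p) ^ length js) *
     (\<integral>\<^sup>+x. fam_pn r p E x * bavg 1 (map (\<lambda>i. axis i 1) (rev js)) W x \<partial>lborel)"
  using assms(5-)
proof (induction js arbitrary: k W)
  case Nil
  show ?case using pn_le_fam_pn[OF Nil.prems(2)] by (auto intro!: nn_integral_mono mult_right_mono)
next
  case (Cons i js)
  note [measurable] = Cons.prems(4) fam_pn_measurable[OF w]
  let ?k = "k + axis i 1"
  let ?B = "bavg 1 [axis i 1] W"
  let ?I = "\<integral>\<^sup>+x. fam_pn r p E x * bavg 1 (map (\<lambda>i. axis i 1) (rev (i # js))) W x \<partial>lborel"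
  let ?c = "(2 * 2 powr p) ^ length js"
  have ki: "k $ i < r" using Cons.prems(3) by simp
  have k': "?k \<in> multi_idx r" by (rule plus_axis_multi_idx[OF Cons.prems(2) ki])
  note m[measurable] = weak_familyD(2)[OF w Cons.prems(2)] weak_familyD(2)[OF w k']
  have B: "bavg 1 (map (\<lambda>i. axis i 1) (rev (i # js))) W = bavg 1 (map (\<lambda>i. axis i 1) (rev js)) ?B"
    by (simp add: bavg_append)
  \<comment> \<open>Raising the order in direction i leaves the remaining directions below r,
    because js has no repetition.\<close>
  have less: "?k $ j < r" if "j \<in> set js" for j
    unfolding plus_axis_nth using that Cons.prems(1,3) by auto
  have AE: "AE x in lborel. pn p (E k x) \<le> ennreal (2 powr p) *
    (\<integral>\<^sup>+t. (pn p (E k (x + t *\<^sub>R axis i 1)) + pn p (E ?k (x + t *\<^sub>R axis i 1))) * indicator {0..1} t \<partial>lborel)"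
  proof -
    have "AE x in lborel. E k x = (LINT t|lborel. E k (x + t *\<^sub>R axis i 1) * of_real (indicator {0..1} t))
      - (LINT t|lborel. E ?k (x + t *\<^sub>R axis i 1) * of_real (ramp t))"
      by (rule weak_average[OF part \<theta> m weak_familyD(1)[OF w Cons.prems(2)] weak_familyD(1)[OF w k']])
        (rule weak_familyD(3)[OF w Cons.prems(2) ki])
    then show ?thesis by eventually_elim (rule pn_average[OF m p])
  qed
  have "(\<integral>\<^sup>+x. pn p (E k x) * W x \<partial>lborel) \<le> (\<integral>\<^sup>+x. ennreal (2 powr p) *
    ((\<integral>\<^sup>+t. (pn p (E k (x + t *\<^sub>R axis i 1)) + pn p (E ?k (x + t *\<^sub>R axis i 1))) * indicator {0..1} t \<partial>lborel) * W x) \<partial>lborel)"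
    unfolding mult.assoc[symmetric]
    by (rule nn_integral_mono_AE, rule AE_mp[OF AE], rule AE_I2, rule impI, erule mult_right_mono, simp)
  also have "\<dots> = ennreal (2 powr p) * (\<integral>\<^sup>+x.
    (\<integral>\<^sup>+t. (pn p (E k (x + t *\<^sub>R axis i 1)) + pn p (E ?k (x + t *\<^sub>R axis i 1))) * indicator {0..1} t \<partial>lborel) * W x \<partial>lborel)"
    by (rule nn_integral_cmult) measurable
  also have "\<dots> = ennreal (2 powr p) * (\<integral>\<^sup>+x. (pn p (E k x) + pn p (E ?k x)) * ?B x \<partial>lborel)"
    by (subst nn_integral_shift_average, measurable)
  also have "\<dots> = ennreal (2 powr p) * ((\<integral>\<^sup>+x. pn p (E k x) * ?B x \<partial>lborel) + (\<integral>\<^sup>+x. pn p (E ?k x) * ?B x \<partial>lborel))"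
    unfolding distrib_right by (intro arg_cong2[where f="(*)"] refl nn_integral_add) measurable
  also have "\<dots> \<le> ennreal (2 powr p) * (ennreal ?c * ?I + ennreal ?c * ?I)"
  proof (rule mult_left_mono[OF add_mono])
    have d: "distinct js" and Bm: "?B \<in> borel_fun"
      using Cons.prems(1) by (simp, intro bavg_measurable Cons.prems(4))
    have lt: "k $ j < r" if "j \<in> set js" for j using Cons.prems(3) that by simp
    show "(\<integral>\<^sup>+x. pn p (E k x) * ?B x \<partial>lborel) \<le> ennreal ?c * ?I"
      unfolding B by (rule Cons.IH[OF d Cons.prems(2) lt Bm])
    show "(\<integral>\<^sup>+x. pn p (E ?k x) * ?B x \<partial>lborel) \<le> ennreal ?c * ?I"
      unfolding B by (rule Cons.IH[OF d k' less Bm])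
  qed simp
  also have "\<dots> = (2 * ennreal (2 powr p)) * ennreal ?c * ?I"
  proof -
    have "a * (c * I + c * I) = (2 * a) * c * I" for a c I :: ennreal
      by (simp add: algebra_simps flip: mult_2)
    then show ?thesis .
  qed
  also have "2 * ennreal (2 powr p) = ennreal (2 * 2 powr p)" by (simp add: ennreal_mult')
  also have "ennreal (2 * 2 powr p) * ennreal ?c = ennreal ((2 * 2 powr p) ^ length (i # js))"
    by (simp add: ennreal_mult)
  finally show ?case .
qed

text \<open>The support of H lies in a cube of side less than 2, so H vanishes two units behind any
  point of that cube; the fundamental theorem on this segment recovers H(z) from its
  derivative.\<close>

lemma smooth_bavg1:
  fixes H :: "real ^ 'd \<Rightarrow> real"
  assumes H: "smooth H" and p: "p \<ge> 1" and t: "t < 4" and out: "\<And>x. x \<notin> cube t c \<Longrightarrow> H x = 0"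
    and tt: "t < 2"
  shows "pn p (of_real (H z)) \<le> ennreal (2 powr p) *
    (\<integral>\<^sup>+s. pn p (of_real (partial_deriv i H (z - s *\<^sub>R axis i 1))) * indicator {0..2} s \<partial>lborel)"
proof -
  let ?e = "axis i (1::real)" and ?D = "partial_deriv i H"
  have [measurable]: "?D \<in> borel_fun" by (intro smooth_borel smooth_partial_deriv H)
  have le: "ennreal \<bar>H z\<bar> \<le> (\<integral>\<^sup>+s. ennreal \<bar>?D (z - s *\<^sub>R ?e)\<bar> * indicator {0..2} s \<partial>lborel)"
  proof (cases "z \<in> cube t c")
    case True
    then have zi: "\<bar>z $ i - c $ i\<bar> \<le> t / 2" by (simp add: cube_def)
    have "z - 2 *\<^sub>R ?e \<notin> cube t c"
    proof
      assume "z - 2 *\<^sub>R ?e \<in> cube t c"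
      then have "\<bar>(z - 2 *\<^sub>R ?e) $ i - c $ i\<bar> \<le> t / 2" unfolding cube_def by blast
      then show False using zi tt by simp
    qed
    then have 0: "H (z - 2 *\<^sub>R ?e) = 0" by (rule out)
    have cD: "continuous_on {0..2} (\<lambda>s. - ?D (z - s *\<^sub>R ?e))"
      by (rule continuous_on_minus, rule continuous_on_compose2[OF smooth_continuous[of _ UNIV]])
        (auto intro!: continuous_intros H smooth_partial_deriv)
    have "(LINT s|lborel. indicator {0..2} s *\<^sub>R (- ?D (z - s *\<^sub>R ?e))) = H (z - 2 *\<^sub>R ?e) - H (z - 0 *\<^sub>R ?e)"
    proof (rule integral_FTC_atLeastAtMost)
      fix s :: real
      have "((\<lambda>s. H (z + (- s) *\<^sub>R ?e)) has_real_derivative ?D (z + (- s) *\<^sub>R ?e) * (- 1)) (at s)"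
        by (rule DERIV_chain'[where f="\<lambda>t. - t" and g="\<lambda>t. H (z + t *\<^sub>R ?e)"])
          (use smooth_has_real_derivative[OF H, of z i "- s"] in \<open>auto intro!: derivative_eq_intros\<close>)
      then show "((\<lambda>s. H (z - s *\<^sub>R ?e)) has_vector_derivative - ?D (z - s *\<^sub>R ?e)) (at s within {0..2})"
        by (auto simp: has_real_derivative_iff_has_vector_derivative intro: has_vector_derivative_at_within)
    qed (use cD in auto)
    then have "\<bar>H z\<bar> = norm (LINT s|lborel. indicator {0..2} s *\<^sub>R (- ?D (z - s *\<^sub>R ?e)))" using 0 by simp
    also have "ennreal \<dots> \<le> (\<integral>\<^sup>+s. ennreal (norm (indicator {0..2} s *\<^sub>R (- ?D (z - s *\<^sub>R ?e)))) \<partial>lborel)"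
      by (rule integral_norm_bound_ennreal) (rule borel_integrable_compact, simp, rule cD)
    also have "\<dots> = (\<integral>\<^sup>+s. ennreal \<bar>?D (z - s *\<^sub>R ?e)\<bar> * indicator {0..2} s \<partial>lborel)"
      by (rule nn_integral_cong) (auto simp: indicator_def)
    finally show ?thesis .
  qed (simp add: out)
  have "ennreal (\<bar>H z\<bar> powr p) \<le> ennreal (2 powr (p - 1)) * (\<integral>\<^sup>+s. ennreal (\<bar>?D (z - s *\<^sub>R ?e)\<bar> powr p) * indicator {0..2} s \<partial>lborel)"
    by (rule power_mean_interval[OF _ _ p _ le]) auto
  also have "\<dots> \<le> ennreal (2 powr p) * (\<integral>\<^sup>+s. ennreal (\<bar>?D (z - s *\<^sub>R ?e)\<bar> powr p) * indicator {0..2} s \<partial>lborel)"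
    by (intro mult_right_mono ennreal_leI) auto
  finally show ?thesis by (simp add: pn_def)
qed

lemma smooth_bavg:
  fixes H :: "real ^ 'd \<Rightarrow> real"
  assumes H: "smooth H" and p: "p \<ge> 1" and out: "\<And>x js. x \<notin> cube t c \<Longrightarrow> iter_partial js H x = 0"
    and tt: "t < 2"
  shows "pn p (of_real (iter_partial vs H z)) \<le> ennreal ((2 powr p) ^ length js) *
    bavg 2 (map (\<lambda>i. axis i 1) js) (\<lambda>x. pn p (of_real (iter_partial (rev js @ vs) H x))) z"
proof (induction js arbitrary: z vs)
  case (Cons i js)
  have [measurable]: "iter_partial us H \<in> borel_fun" for us by (intro smooth_borel smooth_iter_partial H)
  let ?b = "bavg 2 (map (\<lambda>i. axis i 1) js) (\<lambda>x. pn p (of_real (iter_partial (rev (i # js) @ vs) H x)))"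
  have "pn p (of_real (iter_partial vs H z)) \<le> ennreal (2 powr p) *
    (\<integral>\<^sup>+s. pn p (of_real (partial_deriv i (iter_partial vs H) (z - s *\<^sub>R axis i 1))) * indicator {0..2} s \<partial>lborel)"
    by (rule smooth_bavg1[OF smooth_iter_partial[OF H] p _ _ tt]) (use tt out in auto)
  also have "\<dots> \<le> ennreal (2 powr p) *
    (\<integral>\<^sup>+s. ennreal ((2 powr p) ^ length js) * (?b (z - s *\<^sub>R axis i 1) * indicator {0..2} s) \<partial>lborel)"
    using Cons.IH[of "i # vs"] unfolding mult.assoc[symmetric]
    by (intro mult_left_mono nn_integral_mono mult_right_mono) (auto simp: mult.assoc)
  also have "\<dots> = ennreal (2 powr p) * (ennreal ((2 powr p) ^ length js) * (\<integral>\<^sup>+s. ?b (z - s *\<^sub>R axis i 1) * indicator {0..2} s \<partial>lborel))"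
    by (subst nn_integral_cmult) (auto simp del: rev.simps)
  also have "\<dots> = ennreal ((2 powr p) ^ length (i # js)) * bavg 2 (map (\<lambda>i. axis i 1) (i # js)) (\<lambda>x. pn p (of_real (iter_partial (rev (i # js) @ vs) H x))) z"
    by (simp add: ennreal_mult mult.assoc)
  finally show ?case .
qed simp

text \<open>Each distinct direction enlarges the support by at most one unit forwards. A support in
  the cube of side 2 thus stays within the cube of side 4 around the same centre.\<close>

lemma bavg_support:
  fixes W :: "real ^ 'd \<Rightarrow> ennreal"
  assumes W: "\<And>x. W x \<noteq> 0 \<Longrightarrow> x \<in> cube 2 c" and "distinct js" and "bavg 1 (map (\<lambda>i. axis i 1) js) W y \<noteq> 0"
  shows "\<forall>i. - 1 \<le> y $ i - c $ i \<and> y $ i - c $ i \<le> 1 + (if i \<in> set js then 1 else 0)"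
  using assms(2,3)
proof (induction js arbitrary: y)
  case Nil
  then have "y \<in> cube 2 c" using W by simp
  then have "\<bar>y $ i - c $ i\<bar> \<le> 1" for i by (simp add: cube_def)
  then show ?case by (simp add: abs_le_iff) (smt (verit))
next
  case (Cons j js)
  have "\<exists>t\<in>{0..1}. bavg 1 (map (\<lambda>i. axis i 1) js) W (y - t *\<^sub>R axis j 1) \<noteq> 0"
  proof (rule ccontr)
    assume "\<not> ?thesis"
    then have "bavg 1 (map (\<lambda>i. axis i 1) (j # js)) W y = (\<integral>\<^sup>+(t::real). 0 \<partial>lborel)"
      unfolding list.map bavg.simps by (intro nn_integral_cong) (auto simp: indicator_def)
    then show False using Cons.prems(2) by simp
  qed
  then obtain t :: real where t: "0 \<le> t" "t \<le> 1" and nz: "bavg 1 (map (\<lambda>i. axis i 1) js) W (y - t *\<^sub>R axis j 1) \<noteq> 0"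
    by auto
  have j: "j \<notin> set js" "distinct js" using Cons.prems(1) by auto
  have IH: "- 1 \<le> (y - t *\<^sub>R axis j 1) $ i - c $ i \<and> (y - t *\<^sub>R axis j 1) $ i - c $ i \<le> 1 + (if i \<in> set js then 1 else 0)" for i
    using Cons.IH[OF j(2) nz] by blast
  show ?case
  proof
    fix i
    show "- 1 \<le> y $ i - c $ i \<and> y $ i - c $ i \<le> 1 + (if i \<in> set (j # js) then 1 else 0)"
      using IH[of i] t j(1) by (cases "i = j") (auto simp: axis_def split: if_splits)
  qed
qed

lemma cube_mono: "s \<le> t \<Longrightarrow> cube s c \<subseteq> cube t c"
  unfolding cube_def by (fastforce intro: order_trans)

lemma distinct_count_list: "distinct xs \<Longrightarrow> count_list xs x = (if x \<in> set xs then 1 else 0)"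
  by (induction xs) auto

text \<open>The coordinates are divided according to k. Where its entry is below r, the family can
  spare a derivative and is averaged over unit segments (list \<open>xs\<close>). Where it equals r,
  no derivative in that direction falls on H, so H can take one and is integrated over a segment of
  length 2 (list \<open>ys\<close>); r >= 1 keeps its order admissible. Both lists together exhaust
  the coordinates, so the average of the derivative of H is bounded by a full integral, and only
  Sobolev quantities of both factors remain.\<close>

lemma product_term_estimate:
  fixes \<phi> :: "int ^ 'd \<Rightarrow> real ^ 'd \<Rightarrow> real" and H :: "real ^ 'd \<Rightarrow> real"
    and E :: "nat ^ 'd \<Rightarrow> real ^ 'd \<Rightarrow> complex"
  assumes part: "smooth_partition r' p' \<theta> \<phi>" and \<theta>: "\<theta> > 0"
    and w: "weak_family r E" and p: "p \<ge> 1" and r: "r \<ge> 1"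
    and H: "smooth H" and out: "\<And>x js. x \<notin> cube t c \<Longrightarrow> iter_partial js H x = 0" and t: "t < 2"
    and k: "\<And>i. k $ i + count_list vs i \<le> r"
  shows "(\<integral>\<^sup>+x. pn p (E k x * of_real (iter_partial vs H x)) \<partial>lborel) \<le>
    ennreal ((2 * 2 powr p) ^ CARD('d) * (2 powr p) ^ CARD('d)) *
    (\<integral>\<^sup>+x. fam_pn r p E x * indicator (cube 4 c) x \<partial>lborel) *
    (\<Sum>m\<in>multi_idx r. \<integral>\<^sup>+x. pn p (of_real (iter_partial (list_of m) H x)) \<partial>lborel)"
proof -
  let ?ax = "map (\<lambda>i. axis i (1::real)) :: 'd list \<Rightarrow> (real ^ 'd) list"
  let ?C = "(2 * 2 powr p) ^ CARD('d)" and ?C' = "(2 powr p) ^ CARD('d)"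
  have b1: "1 \<le> 2 powr p" using p by (simp add: ge_one_powr_ge_zero)
  obtain xs where xs: "set xs = {i. k $ i < r}" "distinct xs" using finite_distinct_list[of "{i. k $ i < r}"] by auto
  obtain ys where ys: "set ys = {i. \<not> k $ i < r}" "distinct ys" using finite_distinct_list[of "{i. \<not> k $ i < r}"] by auto
  have len: "length xs \<le> CARD('d)" "length ys \<le> CARD('d)"
    using distinct_card[OF xs(2)] distinct_card[OF ys(2)]
      card_mono[of UNIV "set xs"] card_mono[of UNIV "set ys"] by simp_all
  have [measurable]: "iter_partial us H \<in> borel_fun" for us by (intro smooth_borel smooth_iter_partial H)
  note [measurable] = fam_pn_measurable[OF w]
  let ?W = "\<lambda>x. pn p (of_real (iter_partial vs H x))"
  let ?V = "\<lambda>x. pn p (of_real (iter_partial (rev ys @ vs) H x))"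
  define J where "J = (\<integral>\<^sup>+x. ?V x \<partial>lborel)"
  have kr: "k \<in> multi_idx r" unfolding multi_idx_def mem_Collect_eq
  proof
    fix i show "k $ i \<le> r" using k[of i] by linarith
  qed
  have bJ: "bavg 1 (?ax (rev xs)) ?W y \<le> ennreal ?C' * J * indicator (cube 4 c) y" for y
  proof (cases "bavg 1 (?ax (rev xs)) ?W y = 0")
    case False
    have "\<forall>i. - 1 \<le> y $ i - c $ i \<and> y $ i - c $ i \<le> 1 + (if i \<in> set (rev xs) then 1 else 0)"
    proof (rule bavg_support[OF _ _ False])
      fix x assume "?W x \<noteq> 0"
      then have "iter_partial vs H x \<noteq> 0" by auto
      then have "x \<in> cube t c" using out by blast
      then show "x \<in> cube 2 c" using cube_mono[of t 2 c] t by auto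
    qed (use xs in simp)
    then have yi: "- 1 \<le> y $ i - c $ i" "y $ i - c $ i \<le> 2" for i by (auto split: if_splits dest: spec[of _ i])
    have y: "y \<in> cube 4 c" unfolding cube_def mem_Collect_eq
    proof
      fix i show "\<bar>y $ i - c $ i\<bar> \<le> 4 / 2" using yi[of i] by simp
    qed
    \<comment> \<open>Lengthening the unit segments of the first list to 2 merges both averages into
      a single \<open>bavg 2\<close>.\<close>
    have "bavg 1 (?ax (rev xs)) ?W y \<le> bavg 2 (?ax (rev xs)) (\<lambda>x. ennreal ((2 powr p) ^ length ys) * bavg 2 (?ax ys) ?V x) y"
      by (rule bavg_mono) (use smooth_bavg[OF H p out t] in auto)
    also have "\<dots> = ennreal ((2 powr p) ^ length ys) * bavg 2 (?ax (rev xs @ ys)) ?V y"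
      by (subst bavg_cmult) (auto simp: bavg_append)
    also have "\<dots> \<le> ennreal ?C' * J"
      unfolding J_def
    proof (intro mult_mono ennreal_leI power_increasing len b1 bavg_le_integral)
      have "distinct (rev xs @ ys)" using xs ys by auto
      moreover have "inj_on (\<lambda>i::'d. axis i (1::real)) A" for A by (auto simp: inj_on_def axis_eq_axis)
      ultimately show "distinct (?ax (rev xs @ ys))" by (simp only: distinct_map simp_thms)
      have "set (rev xs @ ys) = UNIV" using xs ys by auto
      then show "set (?ax (rev xs @ ys)) = Basis" unfolding set_map by (auto simp: Basis_vec_def)
    qed auto
    finally show ?thesis using y by simp
  qed simp
  have J: "J \<le> (\<Sum>m\<in>multi_idx r. \<integral>\<^sup>+x. pn p (of_real (iter_partial (list_of m) H x)) \<partial>lborel)"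
  proof -
    \<comment> \<open>The order of the derivative that finally falls on H; an entry of
      \<open>ys\<close> occurs only in a direction where \<open>vs\<close> has none.\<close>
    let ?m = "\<chi> i. count_list (rev ys @ vs) i"
    have cy: "count_list ys i = (if k $ i < r then 0 else 1)" for i
    proof -
      have "count_list ys i = (if i \<in> set ys then 1 else 0)"
        using distinct_count_list[OF ys(2)] by simp
      then show ?thesis using ys(1) by auto
    qed
    have mr: "?m \<in> multi_idx r" unfolding multi_idx_def mem_Collect_eq
    proof
      fix i show "?m $ i \<le> r" using k[of i] r by (simp add: count_list_append cy)
    qed
    have "iter_partial (rev ys @ vs) H = iter_partial (list_of ?m) H"
      by (rule iter_partial_perm[OF H]) (simp add: count_list_of)
    then have "J = (\<integral>\<^sup>+x. pn p (of_real (iter_partial (list_of ?m) H x)) \<partial>lborel)" by (simp add: J_def)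
    also have "\<dots> \<le> (\<Sum>m\<in>multi_idx r. \<integral>\<^sup>+x. pn p (of_real (iter_partial (list_of m) H x)) \<partial>lborel)"
      using member_le_sum[OF mr, of "\<lambda>m. \<integral>\<^sup>+x. pn p (of_real (iter_partial (list_of m) H x)) \<partial>lborel"] finite_multi_idx by auto
    finally show ?thesis .
  qed
  have "(\<integral>\<^sup>+x. pn p (E k x * of_real (iter_partial vs H x)) \<partial>lborel) = (\<integral>\<^sup>+x. pn p (E k x) * ?W x \<partial>lborel)"
    by (simp add: pn_mult)
  also have "\<dots> \<le> ennreal ((2 * 2 powr p) ^ length xs) * (\<integral>\<^sup>+x. fam_pn r p E x * bavg 1 (?ax (rev xs)) ?W x \<partial>lborel)"
    by (rule weak_family_bavg[OF part \<theta> w p xs(2) kr]) (use xs in auto)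
  also have "\<dots> \<le> ennreal ?C * (\<integral>\<^sup>+x. (ennreal ?C' * J) * (fam_pn r p E x * indicator (cube 4 c) x) \<partial>lborel)"
  proof (rule mult_mono[OF ennreal_leI[OF power_increasing[OF len(1)]] nn_integral_mono])
    fix x
    show "fam_pn r p E x * bavg 1 (?ax (rev xs)) ?W x \<le> ennreal ?C' * J * (fam_pn r p E x * indicator (cube 4 c) x)"
      using mult_left_mono[OF bJ[of x], of "fam_pn r p E x"] by (simp add: mult_ac)
  qed (use b1 in auto)
  also have "\<dots> = ennreal ?C * ((ennreal ?C' * J) * (\<integral>\<^sup>+x. fam_pn r p E x * indicator (cube 4 c) x \<partial>lborel))"
    by (subst nn_integral_cmult) auto
  also have "\<dots> = ennreal (?C * ?C') * (\<integral>\<^sup>+x. fam_pn r p E x * indicator (cube 4 c) x \<partial>lborel) * J"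
    by (subst ennreal_mult) (auto simp: mult_ac)
  also have "\<dots> \<le> ennreal (?C * ?C') * (\<integral>\<^sup>+x. fam_pn r p E x * indicator (cube 4 c) x \<partial>lborel) *
    (\<Sum>m\<in>multi_idx r. \<integral>\<^sup>+x. pn p (of_real (iter_partial (list_of m) H x)) \<partial>lborel)"
    by (intro mult_left_mono J) auto
  finally show ?thesis .
qed

section \<open>The Leibniz rule for weak derivatives\<close>

primrec leib :: "(nat ^ 'd \<Rightarrow> real ^ 'd \<Rightarrow> complex) \<Rightarrow> 'd list \<Rightarrow> nat ^ 'd \<Rightarrow> (real ^ 'd \<Rightarrow> real) \<Rightarrow> real ^ 'd \<Rightarrow> complex" where
  "leib E [] k \<psi> = (\<lambda>x. E k x * of_real (\<psi> x))"
| "leib E (i # js) k \<psi> = (\<lambda>x. leib E js (k + axis i 1) \<psi> x + leib E js k (partial_deriv i \<psi>) x)"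

lemma locally_integrable_mult_continuous:
  fixes f :: "real ^ 'd \<Rightarrow> complex"
  assumes f: "locally_integrable UNIV f" and h: "continuous_on UNIV h"
  shows "locally_integrable UNIV (\<lambda>x. f x * of_real (h x))"
  unfolding locally_integrable_def
proof (intro allI impI)
  fix K :: "(real ^ 'd) set" assume "compact K \<and> K \<subseteq> UNIV"
  then have K: "compact K" by simp
  then have [measurable]: "K \<in> sets borel" by (rule borel_compact)
  have [measurable]: "h \<in> borel_fun" by (rule borel_measurable_continuous_onI[OF h])
  have "bounded (h ` K)"
    by (intro compact_imp_bounded compact_continuous_image K continuous_on_subset[OF h]) simp
  then obtain B where B: "\<And>x. x \<in> K \<Longrightarrow> norm (h x) \<le> B" unfolding bounded_iff by auto
  have "integrable lborel (\<lambda>x. f x * of_real (indicator K x * h x))"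
  proof (rule locally_integrable_mult[OF f K subset_UNIV, where B="max B 0"])
    show "norm (complex_of_real (indicator K x * h x)) \<le> max B 0" for x
      using B[of x] by (cases "x \<in> K") auto
  qed auto
  moreover have "(\<lambda>x. f x * of_real (indicator K x * h x)) = (\<lambda>x. indicator K x *\<^sub>R (f x * of_real (h x)))"
    by (auto simp: fun_eq_iff indicator_def)
  ultimately show "set_integrable lborel K (\<lambda>x. f x * of_real (h x))"
    unfolding set_integrable_def by simp
qed

lemma idx_step:
  fixes k :: "nat ^ 'd"
  assumes "\<And>j. k $ j + count_list (i # js) j \<le> r"
  shows "\<And>j. (k + axis i 1) $ j + count_list js j \<le> r" "\<And>j. k $ j + count_list js j \<le> r"
    "k \<in> multi_idx r" "k $ i < r"
proof -
  have *: "k $ j + count_list js j + (if i = j then 1 else 0) \<le> r" for j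
    using assms[of j] by (simp split: if_splits)
  show "(k + axis i 1) $ j + count_list js j \<le> r" for j
    using *[of j] unfolding plus_axis_nth by (simp split: if_splits)
  show **: "k $ j + count_list js j \<le> r" for j using *[of j] by linarith
  show "k \<in> multi_idx r" unfolding multi_idx_def mem_Collect_eq
  proof
    fix j show "k $ j \<le> r" using **[of j] by linarith
  qed
  show "k $ i < r" using *[of i] by simp
qed

lemma idx_nil: "(\<And>j. k $ j + count_list js j \<le> r) \<Longrightarrow> k \<in> multi_idx r"
  unfolding multi_idx_def mem_Collect_eq by (metis add_leE)

lemma leib_nice:
  assumes w: "weak_family r E" and "smooth \<psi>" "\<And>j. k $ j + count_list js j \<le> r"
  shows "locally_integrable UNIV (leib E js k \<psi>) \<and> leib E js k \<psi> \<in> borel_fun"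
  using assms(2,3)
proof (induction js arbitrary: k \<psi>)
  case Nil
  have k: "k \<in> multi_idx r" by (rule idx_nil[OF Nil.prems(2)])
  note [measurable] = weak_familyD(2)[OF w k] smooth_borel[OF Nil.prems(1)]
  show ?case
    using locally_integrable_mult_continuous[OF weak_familyD(1)[OF w k] smooth_continuous[OF Nil.prems(1)]]
    by simp
next
  case (Cons i js)
  note s = idx_step[OF Cons.prems(2)]
  note 1 = Cons.IH[OF Cons.prems(1) s(1)] and 2 = Cons.IH[OF smooth_partial_deriv[OF Cons.prems(1), of i] s(2)]
  then have [measurable]: "leib E js (k + axis i 1) \<psi> \<in> borel_fun"
    "leib E js k (partial_deriv i \<psi>) \<in> borel_fun" by auto
  have "leib E (i # js) k \<psi> \<in> borel_fun" unfolding leib.simps by measurable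
  moreover have "locally_integrable UNIV (leib E (i # js) k \<psi>)"
    using 1 2 unfolding locally_integrable_def by auto
  ultimately show ?case by blast
qed

text \<open>In each direction the derivative of \<psi> times the test function yields one term with
  the derivative on the family and one with it on \<psi>. The expansion stays fully unfolded,
  without collecting binomial coefficients, which lets the induction treat one direction at a
  time.\<close>

lemma leib_weak:
  fixes E :: "nat ^ 'd \<Rightarrow> real ^ 'd \<Rightarrow> complex"
  assumes w: "weak_family r E" and "smooth \<psi>" "\<And>j. k $ j + count_list js j \<le> r" and t: "test_function UNIV \<zeta>"
  shows "(LINT x|lborel. E k x * of_real (\<psi> x) * of_real (iter_partial js \<zeta> x)) =
    (- 1) ^ length js * (LINT x|lborel. leib E js k \<psi> x * of_real (\<zeta> x))"
  using assms(2,3)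
proof (induction js arbitrary: k \<psi>)
  case (Cons i js)
  note s = idx_step[OF Cons.prems(2)]
  have k': "k + axis i 1 \<in> multi_idx r" by (rule plus_axis_multi_idx[OF s(3,4)])
  let ?\<eta> = "iter_partial js \<zeta>"
  have t\<eta>: "test_function UNIV ?\<eta>" by (rule test_function_iter_partial[OF t])
  note sp = smooth_partial_deriv[OF Cons.prems(1), of i]
  have tm: "test_function UNIV (\<lambda>x. \<psi> x * ?\<eta> x)" by (rule test_function_mult[OF t\<eta> Cons.prems(1)])
  have tm': "test_function UNIV (\<lambda>x. partial_deriv i \<psi> x * ?\<eta> x)" by (rule test_function_mult[OF t\<eta> sp])
  have d: "partial_deriv i (\<lambda>x. \<psi> x * ?\<eta> x) x = partial_deriv i \<psi> x * ?\<eta> x + \<psi> x * partial_deriv i ?\<eta> x" for x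
    by (rule partial_deriv_mult(1)[OF Cons.prems(1) test_function_smooth[OF t\<eta>]])
  note loc = weak_familyD(1)[OF w s(3)] weak_familyD(1)[OF w k']
  have "(LINT x|lborel. E k x * of_real (\<psi> x) * of_real (iter_partial (i # js) \<zeta> x)) =
    (LINT x|lborel. E k x * of_real (partial_deriv i (\<lambda>x. \<psi> x * ?\<eta> x) x) - E k x * of_real (partial_deriv i \<psi> x * ?\<eta> x))"
    unfolding d by (simp add: algebra_simps)
  also have "\<dots> = (LINT x|lborel. E k x * of_real (partial_deriv i (\<lambda>x. \<psi> x * ?\<eta> x) x)) - (LINT x|lborel. E k x * of_real (partial_deriv i \<psi> x * ?\<eta> x))"
    by (rule Bochner_Integration.integral_diff[OF integrable_mult_test[OF loc(1) test_function_partial_deriv[OF tm]] integrable_mult_test[OF loc(1) tm']])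
  also have "(LINT x|lborel. E k x * of_real (partial_deriv i (\<lambda>x. \<psi> x * ?\<eta> x) x)) = - (LINT x|lborel. E (k + axis i 1) x * of_real (\<psi> x * ?\<eta> x))"
    by (rule weak_familyD(3)[OF w s(3,4) tm])
  also have "(LINT x|lborel. E (k + axis i 1) x * of_real (\<psi> x * ?\<eta> x)) = (- 1) ^ length js * (LINT x|lborel. leib E js (k + axis i 1) \<psi> x * of_real (\<zeta> x))"
    using Cons.IH[OF Cons.prems(1) s(1)] by (simp add: mult.assoc)
  also have "(LINT x|lborel. E k x * of_real (partial_deriv i \<psi> x * ?\<eta> x)) = (- 1) ^ length js * (LINT x|lborel. leib E js k (partial_deriv i \<psi>) x * of_real (\<zeta> x))"
    using Cons.IH[OF sp s(2)] by (simp add: mult.assoc)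
  also have "- ((- 1) ^ length js * (LINT x|lborel. leib E js (k + axis i 1) \<psi> x * of_real (\<zeta> x))) -
      (- 1) ^ length js * (LINT x|lborel. leib E js k (partial_deriv i \<psi>) x * of_real (\<zeta> x)) =
      (- 1) ^ length (i # js) * ((LINT x|lborel. leib E js (k + axis i 1) \<psi> x * of_real (\<zeta> x)) + (LINT x|lborel. leib E js k (partial_deriv i \<psi>) x * of_real (\<zeta> x)))"
    by (simp add: distrib_left)
  also have "(LINT x|lborel. leib E js (k + axis i 1) \<psi> x * of_real (\<zeta> x)) + (LINT x|lborel. leib E js k (partial_deriv i \<psi>) x * of_real (\<zeta> x)) =
     (LINT x|lborel. leib E js (k + axis i 1) \<psi> x * of_real (\<zeta> x) + leib E js k (partial_deriv i \<psi>) x * of_real (\<zeta> x))"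
    using leib_nice[OF w Cons.prems(1) s(1)] leib_nice[OF w sp s(2)]
    by (intro L_integral_add[symmetric] integrable_mult_test[OF _ t]) auto
  also have "\<dots> = (LINT x|lborel. leib E (i # js) k \<psi> x * of_real (\<zeta> x))"
    unfolding leib.simps distrib_right ..
  finally show ?case .
qed simp

text \<open>Shows that the derivatives of a local piece vanish outside the open cube, as
  periodization requires.\<close>

lemma leib_eq_0: "(\<And>us. iter_partial us \<psi> x = 0) \<Longrightarrow> leib E js k \<psi> x = 0"
proof (induction js arbitrary: k \<psi>)
  case Nil then show ?case using Nil[of "[]"] by simp
next
  case (Cons i js)
  have "iter_partial us (partial_deriv i \<psi>) x = 0" for us
    using Cons.prems[of "us @ [i]"] by (simp add: iter_partial_append)
  then show ?case using Cons.IH Cons.prems by simp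
qed

text \<open>Every leaf of the expansion is a member of the family times a derivative of H, bounded
  by X; each direction costs 2 for the number of terms and 2^p for the p-th power of a sum.\<close>

lemma leib_bound:
  fixes E :: "nat ^ 'd \<Rightarrow> real ^ 'd \<Rightarrow> complex"
  assumes w: "weak_family r E" and H: "smooth H" and p: "p \<ge> 0"
    and X: "\<And>k vs. (\<And>j. k $ j + count_list vs j \<le> r) \<Longrightarrow> (\<integral>\<^sup>+x. pn p (E k x * of_real (iter_partial vs H x)) \<partial>lborel) \<le> X"
    and "\<And>j. k $ j + count_list js j + count_list us j \<le> r"
  shows "(\<integral>\<^sup>+x. pn p (leib E js k (iter_partial us H) x) \<partial>lborel) \<le> ennreal ((2 * 2 powr p) ^ length js) * X"
  using assms(5)
proof (induction js arbitrary: k us)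
  case Nil
  then show ?case using X[of k us] by simp
next
  case (Cons i js)
  have *: "k $ j + count_list (i # js) j \<le> r" for j using Cons.prems[of j] by linarith
  note s = idx_step[OF *]
  note sm = smooth_iter_partial[OF H]
  have [measurable]: "leib E js (k + axis i 1) (iter_partial us H) \<in> borel_fun"
    "leib E js k (iter_partial (i # us) H) \<in> borel_fun"
    using leib_nice[OF w sm s(1)] leib_nice[OF w sm s(2)] by blast+
  let ?c = "(2 * 2 powr p) ^ length js"
  have i1: "(k + axis i 1) $ j + count_list js j + count_list us j \<le> r" for j
    using Cons.prems[of j] unfolding plus_axis_nth by (simp split: if_splits)
  have i2: "k $ j + count_list js j + count_list (i # us) j \<le> r" for j
    using Cons.prems[of j] by (simp split: if_splits)
  have "(\<integral>\<^sup>+x. pn p (leib E (i # js) k (iter_partial us H) x) \<partial>lborel) \<le>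
    (\<integral>\<^sup>+x. ennreal (2 powr p) * (pn p (leib E js (k + axis i 1) (iter_partial us H) x) + pn p (leib E js k (iter_partial (i # us) H) x)) \<partial>lborel)"
    unfolding leib.simps iter_partial_Cons by (intro nn_integral_mono pn_add p)
  also have "\<dots> = ennreal (2 powr p) * ((\<integral>\<^sup>+x. pn p (leib E js (k + axis i 1) (iter_partial us H) x) \<partial>lborel) + (\<integral>\<^sup>+x. pn p (leib E js k (iter_partial (i # us) H) x) \<partial>lborel))"
    by (subst nn_integral_cmult, measurable, subst nn_integral_add, measurable)
  also have "\<dots> \<le> ennreal (2 powr p) * (ennreal ?c * X + ennreal ?c * X)"
    by (rule mult_left_mono[OF add_mono[OF Cons.IH[OF i1] Cons.IH[OF i2]]]) simp
  also have "\<dots> = (2 * ennreal (2 powr p)) * ennreal ?c * X"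
    by (simp add: algebra_simps flip: mult_2)
  also have "2 * ennreal (2 powr p) = ennreal (2 * 2 powr p)" by (simp add: ennreal_mult')
  also have "ennreal (2 * 2 powr p) * ennreal ?c = ennreal ((2 * 2 powr p) ^ length (i # js))"
    by (simp add: ennreal_mult)
  finally show ?case .
qed

lemma product_weak:
  fixes E :: "nat ^ 'd \<Rightarrow> real ^ 'd \<Rightarrow> complex"
  assumes w: "weak_family r E" and H: "smooth H" and k: "k \<in> multi_idx r"
  shows "has_weak_deriv UNIV k (\<lambda>x. E 0 x * of_real (H x)) (leib E (list_of k) 0 H)"
proof (rule has_weak_derivI)
  have 0: "0 \<in> multi_idx r" by (simp add: multi_idx_def)
  have le: "(0 :: nat ^ 'd) $ j + count_list (list_of k) j \<le> r" for j
    using k by (simp add: count_list_of multi_idx_def)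
  show "locally_integrable UNIV (\<lambda>x. E 0 x * of_real (H x))"
    by (intro locally_integrable_mult_continuous weak_familyD(1)[OF w 0] smooth_continuous H)
  show "locally_integrable UNIV (leib E (list_of k) 0 H)" using leib_nice[OF w H le] by blast
  fix \<zeta> :: "real ^ 'd \<Rightarrow> real" and js :: "'d list"
  assume t: "test_function UNIV \<zeta>" and c: "\<And>i. count_list js i = k $ i"
  have eq: "iter_partial js \<zeta> = iter_partial (list_of k) \<zeta>"
    by (rule iter_partial_perm[OF test_function_smooth[OF t]]) (simp add: c count_list_of)
  show "(LINT x|lborel. E 0 x * of_real (H x) * of_real (iter_partial js \<zeta> x)) =
    (- 1) ^ (\<Sum>i\<in>UNIV. k $ i) * (LINT x|lborel. leib E (list_of k) 0 H x * of_real (\<zeta> x))"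
    unfolding eq length_count_list[of "list_of k" k, OF count_list_of]
    by (rule leib_weak[OF w H le t])
qed

lemma length_list_of: "k \<in> multi_idx r \<Longrightarrow> length (list_of k :: 'd list) \<le> r * CARD('d::finite)"
  using sum_mono[of "UNIV :: 'd set" "\<lambda>i. k $ i" "\<lambda>_. r"]
  unfolding length_count_list[of "list_of k" k, OF count_list_of, symmetric] by (simp add: multi_idx_def mult.commute)

text \<open>Classical derivatives are admissible weak ones; through this the Sobolev norms of the
  partition of unity become integrals of explicit derivatives.\<close>

lemma smooth_weak_family:
  fixes H :: "real ^ 'd \<Rightarrow> real"
  assumes H: "smooth H"
  shows "weak_family r (\<lambda>m x. complex_of_real (iter_partial (list_of m) H x))"
  unfolding weak_family_def
proof (intro conjI ballI allI impI)
  note sm = smooth_iter_partial[OF H]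
  fix k :: "nat ^ 'd" assume k: "k \<in> multi_idx r"
  have c: "continuous_on UNIV (\<lambda>x. complex_of_real (iter_partial us H x))" for us
    by (intro continuous_on_of_real smooth_continuous sm)
  show "locally_integrable UNIV (\<lambda>x. complex_of_real (iter_partial (list_of k) H x))"
    unfolding locally_integrable_def using continuous_set_integrable[OF c] by blast
  show "(\<lambda>x. complex_of_real (iter_partial (list_of k) H x)) \<in> borel_fun"
    by (rule borel_measurable_continuous_onI[OF c])
  fix i :: 'd and \<psi> :: "real ^ 'd \<Rightarrow> real" assume t: "test_function UNIV \<psi>"
  have eq: "iter_partial (list_of (k + axis i 1)) H = partial_deriv i (iter_partial (list_of k) H)"
    unfolding iter_partial_Cons[symmetric]
    by (rule iter_partial_perm[OF H]) (unfold count_list_of plus_axis_nth, simp add: count_list_of)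
  show "(LINT x|lborel. complex_of_real (iter_partial (list_of k) H x) * of_real (partial_deriv i \<psi> x)) =
     - (LINT x|lborel. complex_of_real (iter_partial (list_of (k + axis i 1)) H x) * of_real (\<psi> x))"
    unfolding eq
  proof (rule integral_by_parts_test[OF c _ _ t])
    show "continuous_on UNIV (\<lambda>x. complex_of_real (partial_deriv i (iter_partial (list_of k) H) x))"
      using c[of "i # list_of k"] by simp
    show "((\<lambda>t. complex_of_real (iter_partial (list_of k) H (x + t *\<^sub>R axis i 1))) has_vector_derivative
       complex_of_real (partial_deriv i (iter_partial (list_of k) H) (x + s *\<^sub>R axis i 1))) (at s)" for x s
      using bounded_linear.has_vector_derivative[OF bounded_linear_of_real
          smooth_has_real_derivative[OF sm, of "list_of k" x i s, unfolded has_real_derivative_iff_has_vector_derivative]] .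
  qed
qed

section \<open>Lebesgue spaces and Sobolev norms modulo null sets\<close>

lemma Lp_iff: "f \<in> Lp p M \<longleftrightarrow> f \<in> borel_measurable M \<and> (\<integral>\<^sup>+x. pn p (f x) \<partial>M) < \<infinity>"
  unfolding Lp_def pn_def by (auto simp: integrable_iff_bounded)

lemma Lp_norm_nonneg: "Lp_norm p M f \<ge> 0" by (simp add: Lp_norm_def)

lemma Lp_norm_powr:
  assumes "f \<in> Lp p M" "p > 0"
  shows "ennreal (Lp_norm p M f powr p) = (\<integral>\<^sup>+x. pn p (f x) \<partial>M)"
proof -
  have i: "integrable M (\<lambda>x. norm (f x) powr p)" using assms unfolding Lp_def by blast
  have "Lp_norm p M f powr p = (LINT x|M. norm (f x) powr p)"
    unfolding Lp_norm_def using assms(2) by (simp add: powr_powr)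
  then show ?thesis using nn_integral_eq_integral[OF i] by (simp add: pn_def)
qed

lemma Lp_cong:
  assumes "\<And>x. x \<in> space M \<Longrightarrow> f x = g x" shows "f \<in> Lp p M \<longleftrightarrow> g \<in> Lp p M"
  unfolding Lp_iff using measurable_cong[of M f g] nn_integral_cong[of M "\<lambda>x. pn p (f x)" "\<lambda>x. pn p (g x)"] assms
  by auto

lemma Lp_add:
  assumes "f \<in> Lp p M" "g \<in> Lp p M" "p \<ge> 0"
  shows "(\<lambda>x. f x + g x) \<in> Lp p M"
proof -
  have [measurable]: "f \<in> borel_measurable M" "g \<in> borel_measurable M" using assms by (auto simp: Lp_iff)
  have "(\<integral>\<^sup>+x. pn p (f x + g x) \<partial>M) \<le> (\<integral>\<^sup>+x. ennreal (2 powr p) * (pn p (f x) + pn p (g x)) \<partial>M)"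
    by (intro nn_integral_mono pn_add assms)
  also have "\<dots> = ennreal (2 powr p) * ((\<integral>\<^sup>+x. pn p (f x) \<partial>M) + (\<integral>\<^sup>+x. pn p (g x) \<partial>M))"
    by (subst nn_integral_cmult, measurable, subst nn_integral_add, measurable)
  also have "\<dots> < \<infinity>" using assms by (auto simp: Lp_iff ennreal_mult_less_top)
  finally show ?thesis by (simp add: Lp_iff)
qed

lemma Lp_cmult:
  assumes "f \<in> Lp p M" shows "(\<lambda>x. c * f x) \<in> Lp p M"
proof -
  have [measurable]: "f \<in> borel_measurable M" using assms by (auto simp: Lp_iff)
  have "(\<integral>\<^sup>+x. pn p (c * f x) \<partial>M) = pn p c * (\<integral>\<^sup>+x. pn p (f x) \<partial>M)"
    unfolding pn_mult by (rule nn_integral_cmult) measurable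
  also have "\<dots> < \<infinity>" using assms by (auto simp: Lp_iff ennreal_mult_less_top pn_def)
  finally show ?thesis by (simp add: Lp_iff)
qed

lemma Lp_zero: "(\<lambda>_. 0) \<in> Lp p M" by (simp add: Lp_iff)

lemma Lp_sum:
  assumes "\<And>l. l \<in> F \<Longrightarrow> f l \<in> Lp p M" "p \<ge> 0"
  shows "(\<lambda>x. \<Sum>l\<in>F. f l x) \<in> Lp p M"
  using assms(1) by (induction F rule: infinite_finite_induct) (auto simp: Lp_zero intro!: Lp_add assms(2))

lemma space_leb_on: "space (leb_on S) = S"
  by (simp add: leb_on_def space_restrict_space)

lemma nn_integral_leb_on: "S \<in> sets borel \<Longrightarrow> (\<integral>\<^sup>+x. f x \<partial>leb_on S) = (\<integral>\<^sup>+x. f x * indicator S x \<partial>lborel)"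
  by (simp add: leb_on_def nn_integral_restrict_space)

lemma measurable_leb_on: "f \<in> borel_fun \<Longrightarrow> f \<in> borel_measurable (leb_on S)"
  unfolding leb_on_def by (rule measurable_restrict_space1) simp

lemma Lp_leb_on_iff:
  assumes "f \<in> borel_fun" "S \<in> sets borel"
  shows "f \<in> Lp p (leb_on S) \<longleftrightarrow> (\<integral>\<^sup>+x. pn p (f x) * indicator S x \<partial>lborel) < \<infinity>"
  using assms by (simp add: Lp_iff measurable_leb_on nn_integral_leb_on)

lemma AE_leb_on: "S \<in> sets borel \<Longrightarrow> (AE x in leb_on S. P x) \<longleftrightarrow> (AE x in lborel. x \<in> S \<longrightarrow> P x)"
  unfolding leb_on_def by (rule AE_restrict_space_iff) simp

lemma emeasure_unit_cube: "emeasure (unit_cube :: (real ^ 'd) measure) (space (unit_cube :: (real ^ 'd) measure)) = 1"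
proof -
  have "emeasure lborel (cube 1 (0 :: real ^ 'd)) = (\<Prod>b\<in>Basis. (((\<chi> i. 1 / 2) - (\<chi> i. - 1 / 2)) :: real ^ 'd) \<bullet> b)"
    unfolding cube_eq_cbox by (subst emeasure_lborel_cbox) (auto simp: Basis_vec_def inner_axis)
  also have "\<dots> = 1" by (auto simp: Basis_vec_def inner_axis intro!: prod.neutral)
  finally show ?thesis
    unfolding leb_on_def by (subst emeasure_restrict_space) (simp_all add: space_restrict_space cube_borel)
qed

lemma AE_cube_interior: "AE x in lborel. x \<in> cube t c \<longrightarrow> x \<in> interior (cube t c)"
proof -
  let ?a = "\<chi> i. c $ i - t / 2" and ?b = "\<chi> i. c $ i + t / 2"
  have "cbox ?a ?b - box ?a ?b \<in> null_sets lborel"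
    using negligible_frontier_interval[of ?a ?b]
    by (simp add: negligible_iff_null_sets null_sets_completion_iff)
  then have "AE x in lborel. x \<notin> cbox ?a ?b - box ?a ?b" by (rule AE_not_in)
  then show ?thesis unfolding cube_eq_cbox interior_cbox by eventually_elim auto
qed

text \<open>\<open>weak_deriv\<close> is a choice, and uniqueness identifies it with other
  candidates only almost everywhere in the interior. The assumption \<open>AE\<close> says that the
  interior carries the whole measure, which holds for closed cubes and for the weighted
  space.\<close>

lemma sobolev_norm_eq:
  fixes \<phi> :: "int ^ 'd \<Rightarrow> real ^ 'd \<Rightarrow> real" and M :: "(real ^ 'd) measure"
  assumes part: "smooth_partition r' p' \<theta> \<phi>" and \<theta>: "\<theta> > 0" and p: "p > 0"
    and AE: "\<And>P. (AE x in lborel. x \<in> interior (space M) \<longrightarrow> P x) \<Longrightarrow> (AE x in M. P x)"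
    and g: "\<And>k. k \<in> multi_idx r \<Longrightarrow> g k \<in> Lp p M"
    and wg: "\<And>k. k \<in> multi_idx r \<Longrightarrow> has_weak_deriv (interior (space M)) k f (g k)"
  shows "ennreal (sobolev_norm r p M f powr p) = (\<Sum>k\<in>multi_idx r. \<integral>\<^sup>+x. pn p (g k x) \<partial>M)"
proof -
  have tm: "ennreal (Lp_norm p M (weak_deriv p M k f) powr p) = (\<integral>\<^sup>+x. pn p (g k x) \<partial>M)"
    if k: "k \<in> multi_idx r" for k
  proof -
    have "weak_deriv p M k f \<in> Lp p M \<and> has_weak_deriv (interior (space M)) k f (weak_deriv p M k f)"
      unfolding weak_deriv_def by (rule someI[of _ "g k"]) (use g[OF k] wg[OF k] in blast)
    then have h: "weak_deriv p M k f \<in> Lp p M" "has_weak_deriv (interior (space M)) k f (weak_deriv p M k f)" by auto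
    have "AE x in M. weak_deriv p M k f x = g k x"
      by (rule AE, rule weak_deriv_unique[OF part \<theta> open_interior h(2) wg[OF k]])
    then have "(\<integral>\<^sup>+x. pn p (weak_deriv p M k f x) \<partial>M) = (\<integral>\<^sup>+x. pn p (g k x) \<partial>M)"
      by (intro nn_integral_cong_AE) auto
    then show ?thesis using Lp_norm_powr[OF h(1) p] by simp
  qed
  have "sobolev_norm r p M f powr p = (\<Sum>k\<in>multi_idx r. Lp_norm p M (weak_deriv p M k f) powr p)"
    unfolding sobolev_norm_def multi_idx_def using p by (simp add: powr_powr sum_nonneg)
  then have "ennreal (sobolev_norm r p M f powr p) = (\<Sum>k\<in>multi_idx r. ennreal (Lp_norm p M (weak_deriv p M k f) powr p))"
    by (simp add: sum_ennreal)
  also have "\<dots> = (\<Sum>k\<in>multi_idx r. \<integral>\<^sup>+x. pn p (g k x) \<partial>M)" by (rule sum.cong) (auto simp: tm)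
  finally show ?thesis .
qed

lemma sobolev_norm_nonneg: "sobolev_norm r p M f \<ge> 0" by (simp add: sobolev_norm_def)

lemma AE_cube_leb_on:
  assumes "AE x in lborel. x \<in> interior (space (leb_on (cube t c))) \<longrightarrow> P x"
  shows "AE x in leb_on (cube t c). P x"
  unfolding AE_leb_on[OF cube_borel]
  using assms[unfolded space_leb_on] AE_cube_interior[of t c] by eventually_elim auto

section \<open>Periodization\<close>

definition rd :: "real ^ 'd \<Rightarrow> real ^ 'd" where
  "rd x = (\<chi> i. x $ i - of_int \<lfloor>x $ i + 1 / 2\<rfloor>)"

lemma periodic_rd:
  fixes u :: "real ^ 'd \<Rightarrow> complex"
  shows "periodic 1 (\<lambda>x. u (rd x))"
proof -
  have "rd (x + axis i 1) = rd x" for x :: "real ^ 'd" and i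
  proof -
    have "(x + axis i 1) $ j - of_int \<lfloor>(x + axis i 1) $ j + 1 / 2\<rfloor> = x $ j - of_int \<lfloor>x $ j + 1 / 2\<rfloor>" for j
    proof (cases "j = i")
      case True
      have "\<lfloor>x $ i + 1 + 1 / 2\<rfloor> = \<lfloor>x $ i + 1 / 2\<rfloor> + 1" by linarith
      then show ?thesis using True by simp
    qed (simp add: axis_def)
    then show ?thesis by (simp only: rd_def)
  qed
  then show ?thesis by (simp add: periodic_def)
qed

lemma rd_interior: "x \<in> interior (cube 1 0) \<Longrightarrow> rd x = x"
proof -
  assume x: "x \<in> interior (cube 1 0)"
  have "\<lfloor>x $ i + 1 / 2\<rfloor> = 0" for i
  proof -
    have "\<bar>x $ i\<bar> < 1 / 2" using x unfolding interior_cube by simp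
    then show ?thesis by (simp add: floor_eq_iff) linarith
  qed
  then show "rd x = x" by (simp add: rd_def vec_eq_iff)
qed

text \<open>The face at 1/2 is folded onto the face at -1/2, so a boundary point never lands in the
  interior. A function vanishing off the interior is thus unchanged by folding on the closed
  cube.\<close>

lemma rd_boundary:
  assumes x: "x \<in> cube 1 0" "x \<notin> interior (cube 1 0)" shows "rd x \<notin> interior (cube 1 0)"
proof -
  have le: "\<bar>x $ i\<bar> \<le> 1 / 2" for i using x(1) unfolding cube_def by simp
  obtain i where "\<not> \<bar>x $ i\<bar> < 1 / 2" using x(2) unfolding interior_cube by auto
  then have i: "x $ i = 1 / 2 \<or> x $ i = - 1 / 2" using le[of i] by linarith
  then have "rd x $ i = - 1 / 2"
  proof
    assume a: "x $ i = 1 / 2" show ?thesis by (simp add: rd_def a)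
  next
    assume a: "x $ i = - 1 / 2" show ?thesis by (simp add: rd_def a)
  qed
  then have "\<not> \<bar>rd x $ i - 0 $ i\<bar> < 1 / 2" by simp
  then show ?thesis unfolding interior_cube by blast
qed

text \<open>At most one translate of u is nonzero at x, the one by the integer vector obtained by
  rounding x. On a bounded set the periodization is therefore a finite sum of translates.\<close>

lemma rd_sum:
  fixes u :: "real ^ 'd \<Rightarrow> complex"
  assumes u: "\<And>x. x \<notin> interior (cube 1 0) \<Longrightarrow> u x = 0"
    and F: "finite F" "\<And>l. x \<in> cube 1 (int_vec l) \<Longrightarrow> l \<in> F"
  shows "u (rd x) = (\<Sum>l\<in>F. u (x - int_vec l))"
proof -
  let ?l = "\<chi> i. \<lfloor>x $ i + 1 / 2\<rfloor> :: int ^ 'd"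
  have rd: "rd x = x - int_vec ?l" by (simp add: rd_def int_vec_def vec_eq_iff)
  have "x \<in> cube 1 (int_vec ?l)" unfolding cube_def int_vec_def mem_Collect_eq
  proof
    fix i
    have "\<bar>y - real_of_int \<lfloor>y + 1 / 2\<rfloor>\<bar> \<le> 1 / 2" for y :: real by linarith
    from this[of "x $ i"] show "\<bar>x $ i - (\<chi> i. real_of_int (?l $ i)) $ i\<bar> \<le> 1 / 2" by simp
  qed
  then have lF: "?l \<in> F" by (rule F(2))
  have "u (x - int_vec l) = 0" if "l \<noteq> ?l" for l
  proof (rule u, rule notI)
    assume "x - int_vec l \<in> interior (cube 1 0)"
    then have "\<bar>x $ i - real_of_int (l $ i)\<bar> < 1 / 2" for i unfolding interior_cube by (simp add: int_vec_def)
    then have "l $ i = \<lfloor>x $ i + 1 / 2\<rfloor>" for i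
      by (smt (verit) floor_eq_iff field_sum_of_halves)
    then have "l = ?l" by (simp add: vec_eq_iff)
    then show False using that by simp
  qed
  then have "(\<Sum>l\<in>F. u (x - int_vec l)) = (\<Sum>l\<in>F. if l = ?l then u (x - int_vec ?l) else 0)"
    by (intro sum.cong) auto
  also have "\<dots> = u (rd x)" using lF F(1) by (simp add: rd)
  finally show ?thesis by simp
qed

lemma has_weak_deriv_translate:
  fixes f g :: "real ^ 'd \<Rightarrow> complex"
  assumes "has_weak_deriv UNIV k f g" "f \<in> borel_fun" "g \<in> borel_fun"
  shows "has_weak_deriv UNIV k (\<lambda>x. f (x - y)) (\<lambda>x. g (x - y))"
  using has_weak_deriv_affine[OF assms(1) _ assms(2,3), of 1 "- y"] by simp

text \<open>A function that vanishes together with its derivatives off the open cube extends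
  periodically without losing regularity: on a bounded set the extension is a finite sum of
  translates, with which weak derivatives commute.\<close>

lemma sobolev_per_periodize:
  fixes u :: "real ^ 'd \<Rightarrow> complex" and g :: "nat ^ 'd \<Rightarrow> real ^ 'd \<Rightarrow> complex"
    and \<phi> :: "int ^ 'd \<Rightarrow> real ^ 'd \<Rightarrow> real"
  assumes part: "smooth_partition r' p' \<theta> \<phi>" and \<theta>: "\<theta> > 0" and p: "p > 0"
    and u[measurable]: "u \<in> borel_fun" and u0: "\<And>x. x \<notin> interior (cube 1 0) \<Longrightarrow> u x = 0"
    and g[measurable]: "\<And>k. k \<in> multi_idx r \<Longrightarrow> g k \<in> borel_fun"
    and g0: "\<And>k x. x \<notin> interior (cube 1 0) \<Longrightarrow> g k x = 0"
    and w: "\<And>k. k \<in> multi_idx r \<Longrightarrow> has_weak_deriv UNIV k u (g k)"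
    and fin: "(\<integral>\<^sup>+x. pn p (u x) \<partial>lborel) < \<infinity>" "\<And>k. k \<in> multi_idx r \<Longrightarrow> (\<integral>\<^sup>+x. pn p (g k x) \<partial>lborel) < \<infinity>"
  shows "u \<in> sobolev_per 1 r p"
    and "ennreal (sobolev_norm r p unit_cube u powr p) = (\<Sum>k\<in>multi_idx r. \<integral>\<^sup>+x. pn p (g k x) \<partial>lborel)"
proof -
  have lp: "h \<in> Lp p (leb_on S)" if "h \<in> borel_fun" "(\<integral>\<^sup>+x. pn p (h x) \<partial>lborel) < \<infinity>" "S \<in> sets borel" for h S
  proof -
    have "(\<integral>\<^sup>+x. pn p (h x) * indicator S x \<partial>lborel) \<le> (\<integral>\<^sup>+x. pn p (h x) \<partial>lborel)"
      by (rule nn_integral_mono) (auto simp: indicator_def)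
    then show ?thesis using that by (simp add: Lp_leb_on_iff)
  qed
  have gl: "g k \<in> Lp p unit_cube" if "k \<in> multi_idx r" for k
    using g[OF that] fin(2)[OF that] by (intro lp) auto
  have "u \<in> sobolev r p unit_cube"
    unfolding sobolev_def mem_Collect_eq
  proof (intro conjI allI impI)
    show "u \<in> Lp p unit_cube" using fin(1) by (intro lp) auto
    fix k :: "nat ^ 'd" assume "\<forall>i. k $ i \<le> r"
    then have k: "k \<in> multi_idx r" by (simp add: multi_idx_def)
    show "\<exists>g\<in>Lp p unit_cube. has_weak_deriv (interior (space unit_cube)) k u g"
      by (rule bexI[OF _ gl[OF k]]) (rule has_weak_deriv_mono[OF w[OF k]], simp)
  qed
  moreover have "AE x in unit_cube. u (rd x) = u x"
  proof (rule AE_I2)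
    fix x assume "x \<in> space (leb_on (cube 1 0 :: (real^'d) set))"
    then have x: "x \<in> cube 1 0" by (simp add: space_leb_on)
    show "u (rd x) = u x"
      using rd_interior[of x] rd_boundary[OF x] u0 by (cases "x \<in> interior (cube 1 0)") auto
  qed
  moreover have "(\<lambda>x. u (rd x)) \<in> sobolev r p (leb_on U)" if U: "open U" "bounded U" for U
  proof -
    define F where "F = {l::int^'d. \<exists>y\<in>U. y \<in> cube 1 (int_vec l)}"
    have F: "finite F" unfolding F_def by (rule finite_int_bounded[OF U(2)])
    have inF: "l \<in> F" if "x \<in> U" "x \<in> cube 1 (int_vec l)" for x l using that unfolding F_def by blast
    have Ub: "U \<in> sets borel" using U by auto
    have eq: "h (rd x) = (\<Sum>l\<in>F. h (x - int_vec l))"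
      if "x \<in> U" "\<And>x. x \<notin> interior (cube 1 0) \<Longrightarrow> h x = 0" for h :: "real ^ 'd \<Rightarrow> complex" and x
      by (rule rd_sum[OF that(2) F inF[OF that(1)]])
    have lpU: "(\<lambda>x. h (rd x)) \<in> Lp p (leb_on U)"
      if h: "\<And>x. x \<notin> interior (cube 1 0) \<Longrightarrow> h x = 0" and [measurable]: "h \<in> borel_fun"
       and f: "(\<integral>\<^sup>+x. pn p (h x) \<partial>lborel) < \<infinity>" for h
    proof -
      have e: "h (rd x) = (\<Sum>l\<in>F. h (x - int_vec l))" if "x \<in> U" for x by (rule eq[OF that h])
      have "(\<lambda>x. \<Sum>l\<in>F. h (x - int_vec l)) \<in> Lp p (leb_on U)"
      proof (rule Lp_sum)
        fix l
        have "(\<integral>\<^sup>+x. pn p (h (x - int_vec l)) \<partial>lborel) = (\<integral>\<^sup>+x. pn p (h x) \<partial>lborel)"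
          using nn_integral_lborel_translate[of "\<lambda>x. pn p (h x)" "- int_vec l"] by simp
        then show "(\<lambda>x. h (x - int_vec l)) \<in> Lp p (leb_on U)" using f by (intro lp Ub) auto
      qed (use p in simp)
      then show ?thesis
        by (subst Lp_cong[where g="\<lambda>x. \<Sum>l\<in>F. h (x - int_vec l)"]) (simp_all only: space_leb_on e)
    qed
    show ?thesis
      unfolding sobolev_def mem_Collect_eq
    proof (intro conjI allI impI)
      show "(\<lambda>x. u (rd x)) \<in> Lp p (leb_on U)" by (rule lpU[OF u0 u fin(1)])
      fix k :: "nat ^ 'd" assume "\<forall>i. k $ i \<le> r"
      then have k: "k \<in> multi_idx r" by (simp add: multi_idx_def)
      have "has_weak_deriv U k (\<lambda>x. \<Sum>l\<in>F. u (x - int_vec l)) (\<lambda>x. \<Sum>l\<in>F. g k (x - int_vec l))"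
        by (intro has_weak_deriv_sum has_weak_deriv_mono[OF has_weak_deriv_translate[OF w[OF k] u g[OF k]]]) simp
      then have "has_weak_deriv U k (\<lambda>x. u (rd x)) (\<lambda>x. g k (rd x))"
        by (rule has_weak_deriv_cong[rotated 2]) (erule eq[OF _ u0, symmetric], assumption, erule eq[OF _ g0, symmetric])
      then show "\<exists>g\<in>Lp p (leb_on U). has_weak_deriv (interior (space (leb_on U))) k (\<lambda>x. u (rd x)) g"
        using lpU[OF g0 g[OF k] fin(2)[OF k]] U(1) by (auto simp: space_leb_on interior_open)
    qed
  qed
  ultimately show "u \<in> sobolev_per 1 r p"
    unfolding sobolev_per_def using periodic_rd[of u] by blast
  have "ennreal (sobolev_norm r p unit_cube u powr p) = (\<Sum>k\<in>multi_idx r. \<integral>\<^sup>+x. pn p (g k x) \<partial>unit_cube)"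
    by (rule sobolev_norm_eq[OF part \<theta> p AE_cube_leb_on gl]) (use has_weak_deriv_mono[OF w] in auto)
  also have "\<dots> = (\<Sum>k\<in>multi_idx r. \<integral>\<^sup>+x. pn p (g k x) \<partial>lborel)"
  proof (rule sum.cong[OF refl])
    fix k
    have "pn p (g k x) * indicator (cube 1 0) x = pn p (g k x)" for x
    proof (cases "x \<in> cube 1 0")
      case False
      then have "x \<notin> interior (cube 1 0)" using interior_subset by blast
      then show ?thesis by (simp add: g0)
    qed simp
    then show "(\<integral>\<^sup>+x. pn p (g k x) \<partial>unit_cube) = (\<integral>\<^sup>+x. pn p (g k x) \<partial>lborel)"
      by (simp add: nn_integral_leb_on)
  qed
  finally show "ennreal (sobolev_norm r p unit_cube u powr p) = (\<Sum>k\<in>multi_idx r. \<integral>\<^sup>+x. pn p (g k x) \<partial>lborel)" .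
qed

section \<open>Sobolev bounds for the local pieces\<close>

lemma list_of_0: "list_of 0 = []"
proof -
  have "count_list (list_of 0) i = 0" for i :: 'a by (simp add: count_list_of)
  then show ?thesis by (cases "list_of (0 :: nat ^ 'a)") (force split: if_splits)+
qed

text \<open>The hypothesis bounds a norm made of chosen weak derivatives; for the smooth
  \<open>\<phi> k\<close> these agree almost everywhere with the classical ones, whose integrals
  inherit the bound.\<close>

lemma partition_derivs_bound:
  fixes \<phi> :: "int ^ 'd \<Rightarrow> real ^ 'd \<Rightarrow> real"
  assumes part: "smooth_partition r p \<theta> \<phi>" and \<theta>: "\<theta> > 0" and p: "p > 0"
  obtains C where "C \<ge> 0"
    "\<And>k. (\<Sum>m\<in>multi_idx r. \<integral>\<^sup>+x. pn p (of_real (iter_partial (list_of m) (\<phi> k) x)) \<partial>lborel) \<le> ennreal C"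
proof -
  obtain C0 where C0: "\<And>k. sobolev_norm r p (leb_on (cube \<theta> (int_vec k))) (\<lambda>x. of_real (\<phi> k x)) \<le> C0"
    using part unfolding smooth_partition_def by blast
  show ?thesis
  proof
    show "0 \<le> C0 powr p" by simp
    fix k :: "int ^ 'd"
    let ?M = "leb_on (cube \<theta> (int_vec k))"
    let ?g = "\<lambda>m x. complex_of_real (iter_partial (list_of m) (\<phi> k) x)"
    have t: "test_function (interior (cube \<theta> (int_vec k))) (\<phi> k)"
      using part unfolding smooth_partition_def by blast
    note sm = test_function_smooth[OF t]
    have gm[measurable]: "?g m \<in> borel_fun" for m
      using smooth_borel[OF smooth_iter_partial[OF sm]] by measurable
    have out: "?g m x = 0" if "x \<notin> cube \<theta> (int_vec k)" for m x
      using partition_outside[OF part, of x k] that subsetD[OF interior_subset, of x "cube \<theta> (int_vec k)"] by auto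
    have g: "?g m \<in> Lp p ?M" for m
    proof -
      obtain B where B: "\<And>x. norm (iter_partial (list_of m) (\<phi> k) x) \<le> B"
        using test_function_bounded[OF test_function_iter_partial[OF t]] by blast
      have "(\<integral>\<^sup>+x. pn p (?g m x) * indicator (cube \<theta> (int_vec k)) x \<partial>lborel) \<le>
        (\<integral>\<^sup>+x. ennreal (B powr p) * indicator (cube \<theta> (int_vec k)) x \<partial>lborel)"
        using B p by (intro nn_integral_mono mult_right_mono) (auto simp: pn_def intro!: ennreal_leI powr_mono2)
      also have "\<dots> < \<infinity>"
        using emeasure_compact_finite[OF compact_cube, of \<theta> "int_vec k :: real ^ 'd"]
        by (simp add: nn_integral_cmult_indicator ennreal_mult_less_top)
      finally show ?thesis by (simp add: Lp_leb_on_iff)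
    qed
    have w: "has_weak_deriv (interior (space ?M)) m (\<lambda>x. of_real (\<phi> k x)) (?g m)" if "m \<in> multi_idx r" for m
      using has_weak_deriv_mono[OF weak_family_has_weak_deriv[OF smooth_weak_family[OF sm] that]]
      by (simp add: list_of_0)
    have "ennreal (sobolev_norm r p ?M (\<lambda>x. of_real (\<phi> k x)) powr p) = (\<Sum>m\<in>multi_idx r. \<integral>\<^sup>+x. pn p (?g m x) \<partial>?M)"
      by (rule sobolev_norm_eq[OF part \<theta> p AE_cube_leb_on g w])
    also have "\<dots> = (\<Sum>m\<in>multi_idx r. \<integral>\<^sup>+x. pn p (?g m x) \<partial>lborel)"
    proof (rule sum.cong[OF refl])
      fix m :: "nat ^ 'd"
      have "pn p (?g m x) * indicator (cube \<theta> (int_vec k)) x = pn p (?g m x)" for x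
        using out[of x m] by (cases "x \<in> cube \<theta> (int_vec k)") auto
      then show "(\<integral>\<^sup>+x. pn p (?g m x) \<partial>?M) = (\<integral>\<^sup>+x. pn p (?g m x) \<partial>lborel)"
        by (simp add: nn_integral_leb_on)
    qed
    finally have "(\<Sum>m\<in>multi_idx r. \<integral>\<^sup>+x. pn p (?g m x) \<partial>lborel) =
      ennreal (sobolev_norm r p ?M (\<lambda>x. of_real (\<phi> k x)) powr p)" ..
    also have "\<dots> \<le> ennreal (C0 powr p)"
      using C0[of k] p by (intro ennreal_leI powr_mono2) (auto simp: sobolev_norm_nonneg)
    finally show "(\<Sum>m\<in>multi_idx r. \<integral>\<^sup>+x. pn p (?g m x) \<partial>lborel) \<le> ennreal (C0 powr p)" .
  qed
qed

text \<open>The constants accumulate: \<open>K1\<close> for one product term, \<open>K2\<close> for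
  the Leibniz expansion, \<open>K3\<close> for the dilation by \<theta>, \<open>K4\<close> for the
  number of multi-indices. The L_p bound of the piece itself is recorded as well, for cubes on which
  the operator is 0.\<close>

lemma local_sobolev:
  fixes \<phi> :: "int ^ 'd \<Rightarrow> real ^ 'd \<Rightarrow> real"
  assumes part: "smooth_partition r p \<theta> \<phi>" and \<theta>: "1 < \<theta>" "\<theta> < 2" and p: "p \<ge> 1" and r: "r \<ge> 1"
  obtains C where "C \<ge> 0"
    "\<And>(E :: nat ^ 'd \<Rightarrow> real ^ 'd \<Rightarrow> complex) k B. weak_family r E \<Longrightarrow> B \<ge> 0 \<Longrightarrow>
      local_mass r p E k \<le> ennreal B \<Longrightarrow>
      (\<lambda>y. localized \<phi> k (E 0) (\<theta> *\<^sub>R y)) \<in> sobolev_per 1 r p \<and>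
      sobolev_norm r p unit_cube (\<lambda>y. localized \<phi> k (E 0) (\<theta> *\<^sub>R y)) \<le> C * B powr (1 / p) \<and>
      (\<integral>\<^sup>+y. pn p (localized \<phi> k (E 0) (\<theta> *\<^sub>R y)) \<partial>lborel) \<le> ennreal ((C * B powr (1 / p)) powr p)"
proof -
  have \<theta>0: "\<theta> > 0" and p0: "p > 0" "p \<ge> 0" using \<theta> p by auto
  obtain C0 where C0: "C0 \<ge> 0"
    "\<And>k. (\<Sum>m\<in>multi_idx r. \<integral>\<^sup>+x. pn p (of_real (iter_partial (list_of m) (\<phi> k) x)) \<partial>lborel) \<le> ennreal C0"
    using partition_derivs_bound[OF part \<theta>0 p0(1)] by blast
  let ?d = "CARD('d)"
  define K1 where "K1 = (2 * 2 powr p) ^ ?d * (2 powr p) ^ ?d * C0"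
  define K2 where "K2 = (2 * 2 powr p) ^ (r * ?d)"
  define K3 where "K3 = (\<theta> ^ (r * ?d)) powr p * K2 * K1"
  define K4 where "K4 = real (card (multi_idx r :: (nat ^ 'd) set)) * K3"
  have K0: "K1 \<ge> 0" "K2 \<ge> 0" "K3 \<ge> 0" "K4 \<ge> 0" using C0(1) unfolding K1_def K2_def K3_def K4_def by auto
  define C where "C = K4 powr (1 / p)"
  show ?thesis
  proof
    show "C \<ge> 0" by (simp add: C_def)
    fix E :: "nat ^ 'd \<Rightarrow> real ^ 'd \<Rightarrow> complex" and k :: "int ^ 'd" and B :: real
    assume w: "weak_family r E" and B: "B \<ge> 0"
      and le: "local_mass r p E k \<le> ennreal B"
    let ?c = "int_vec k :: real ^ 'd"
    have t: "test_function (interior (cube \<theta> ?c)) (\<phi> k)"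
      using part unfolding smooth_partition_def by blast
    note sm = test_function_smooth[OF t]
    have out: "iter_partial js (\<phi> k) x = 0" if "x \<notin> cube \<theta> ?c" for js x
      using partition_outside[OF part, of x k js] that subsetD[OF interior_subset, of x "cube \<theta> ?c"] by auto
    have X: "(\<integral>\<^sup>+x. pn p (E m x * of_real (iter_partial vs (\<phi> k) x)) \<partial>lborel) \<le> ennreal (K1 * B)"
      if "\<And>i. m $ i + count_list vs i \<le> r" for m vs
    proof -
      have "(\<integral>\<^sup>+x. pn p (E m x * of_real (iter_partial vs (\<phi> k) x)) \<partial>lborel) \<le>
        ennreal ((2 * 2 powr p) ^ ?d * (2 powr p) ^ ?d) *
        (\<integral>\<^sup>+x. fam_pn r p E x * indicator (cube 4 ?c) x \<partial>lborel) *
        (\<Sum>m\<in>multi_idx r. \<integral>\<^sup>+x. pn p (of_real (iter_partial (list_of m) (\<phi> k) x)) \<partial>lborel)"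
        by (rule product_term_estimate[OF part \<theta>0 w p r sm out \<theta>(2) that])
      also have "\<dots> \<le> ennreal ((2 * 2 powr p) ^ ?d * (2 powr p) ^ ?d) * ennreal B * ennreal C0"
        by (intro mult_mono le C0(2)) auto
      also have "\<dots> = ennreal (K1 * B)"
        using C0(1) B unfolding K1_def by (simp add: ennreal_mult[symmetric] mult_ac)
      finally show ?thesis .
    qed
    define v where "v m = leib E (list_of m) 0 (\<phi> k)" for m
    have idx: "(0 :: nat ^ 'd) $ j + count_list (list_of m) j \<le> r" if "m \<in> multi_idx r" for m j
      using that by (simp add: count_list_of multi_idx_def)
    have vm[measurable]: "v m \<in> borel_fun" if "m \<in> multi_idx r" for m
      using leib_nice[OF w sm idx[OF that]] unfolding v_def by blast
    have vb: "(\<integral>\<^sup>+x. pn p (v m x) \<partial>lborel) \<le> ennreal (K2 * (K1 * B))" if m: "m \<in> multi_idx r" for m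
    proof -
      have "(\<integral>\<^sup>+x. pn p (leib E (list_of m) 0 (iter_partial [] (\<phi> k)) x) \<partial>lborel) \<le> ennreal ((2 * 2 powr p) ^ length (list_of m)) * ennreal (K1 * B)"
        by (rule leib_bound[OF w sm p0(2) X]) (use idx[OF m] in auto)
      also have "\<dots> \<le> ennreal K2 * ennreal (K1 * B)"
        unfolding K2_def using length_list_of[OF m] p0
        by (intro mult_right_mono ennreal_leI power_increasing) (auto intro: order_trans[OF _ mult_left_mono[OF ge_one_powr_ge_zero]])
      also have "\<dots> = ennreal (K2 * (K1 * B))" using K0 by (simp add: ennreal_mult')
      finally show ?thesis by (simp add: v_def)
    qed
    define u where "u = (\<lambda>y. localized \<phi> k (E 0) (\<theta> *\<^sub>R y))"
    have E0: "E 0 \<in> borel_fun" by (rule weak_familyD(2)[OF w]) (simp add: multi_idx_def)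
    note [measurable] = E0 smooth_borel[OF sm]
    have u: "u y = E 0 (?c + \<theta> *\<^sub>R y) * of_real (\<phi> k (?c + \<theta> *\<^sub>R y))" for y
      by (simp add: u_def localized_def add.commute)
    define g where "g m y = complex_of_real (\<theta> ^ (\<Sum>i\<in>UNIV. m $ i)) * v m (?c + \<theta> *\<^sub>R y)" for m y
    have in_cube: "?c + \<theta> *\<^sub>R y \<in> interior (cube \<theta> ?c) \<longleftrightarrow> y \<in> interior (cube 1 0)" for y
    proof -
      have "\<bar>\<theta> * z\<bar> * 2 < \<theta> \<longleftrightarrow> \<bar>z\<bar> * 2 < 1" for z
        using \<theta>0 by (simp add: abs_mult)
      then show ?thesis unfolding interior_cube by simp
    qed
    have umeas: "u \<in> borel_fun" unfolding u[abs_def] by measurable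
    have gmeas: "g m \<in> borel_fun" if "m \<in> multi_idx r" for m
      unfolding g_def[abs_def] using vm[OF that] by measurable
    have u0: "u y = 0" if "y \<notin> interior (cube 1 0)" for y
      using partition_outside[OF part, of "?c + \<theta> *\<^sub>R y" k "[]"] that in_cube[of y] by (simp add: u)
    have g0: "g m y = 0" if "y \<notin> interior (cube 1 0)" for m y
    proof -
      have "iter_partial us (\<phi> k) (?c + \<theta> *\<^sub>R y) = 0" for us
        using partition_outside[OF part] that in_cube[of y] by blast
      then have "v m (?c + \<theta> *\<^sub>R y) = 0" unfolding v_def by (rule leib_eq_0)
      then show ?thesis by (simp add: g_def)
    qed
    have wd: "has_weak_deriv UNIV m u (g m)" if m: "m \<in> multi_idx r" for m
      unfolding u[abs_def] g_def[abs_def]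
      using has_weak_deriv_affine[OF product_weak[OF w sm m], of \<theta> ?c] \<theta>0 vm[OF m] by (simp add: v_def)
    have gb: "(\<integral>\<^sup>+y. pn p (g m y) \<partial>lborel) \<le> ennreal (K3 * B)" if m: "m \<in> multi_idx r" for m
    proof -
      have [measurable]: "v m \<in> borel_fun" by (rule vm[OF m])
      \<comment> \<open>The Jacobian of the dilation is at least 1 and may be dropped.\<close>
      have 1: "(\<integral>\<^sup>+y. pn p (v m (?c + \<theta> *\<^sub>R y)) \<partial>lborel) \<le> (\<integral>\<^sup>+x. pn p (v m x) \<partial>lborel)"
      proof -
        have "1 * (\<integral>\<^sup>+y. pn p (v m (?c + \<theta> *\<^sub>R y)) \<partial>lborel) \<le> ennreal (\<bar>\<theta>\<bar> ^ DIM(real ^ 'd)) * (\<integral>\<^sup>+y. pn p (v m (?c + \<theta> *\<^sub>R y)) \<partial>lborel)"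
          using \<theta> by (intro mult_right_mono) (auto simp: one_le_power)
        also have "\<dots> = (\<integral>\<^sup>+x. pn p (v m x) \<partial>lborel)"
          by (rule nn_integral_lborel_affine[symmetric]) (use \<theta>0 in auto)
        finally show ?thesis by simp
      qed
      have "(\<Sum>i\<in>UNIV. m $ i) \<le> r * ?d"
        using length_list_of[OF m] unfolding length_count_list[of "list_of m" m, OF count_list_of] .
      then have "pn p (complex_of_real (\<theta> ^ (\<Sum>i\<in>UNIV. m $ i))) \<le> ennreal ((\<theta> ^ (r * ?d)) powr p)"
        unfolding pn_def using \<theta> p0 by (intro ennreal_leI powr_mono2) (auto simp: norm_power intro!: power_increasing)
      then have "(\<integral>\<^sup>+y. pn p (g m y) \<partial>lborel) \<le> ennreal ((\<theta> ^ (r * ?d)) powr p) * ennreal (K2 * (K1 * B))"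
        unfolding g_def pn_mult
        by (subst nn_integral_cmult, measurable) (rule mult_mono[OF _ order_trans[OF 1 vb[OF m]]], auto)
      also have "\<dots> = ennreal (K3 * B)" using K0 B unfolding K3_def by (simp add: ennreal_mult'[symmetric] mult_ac)
      finally show ?thesis .
    qed
    have z: "0 \<in> multi_idx r" by (simp add: multi_idx_def)
    have ug: "u = g 0" by (rule ext) (simp add: u g_def v_def list_of_0)
    have gfin: "(\<integral>\<^sup>+y. pn p (g m y) \<partial>lborel) < \<infinity>" if "m \<in> multi_idx r" for m
      using le_less_trans[OF gb[OF that]] by simp
    have ufin: "(\<integral>\<^sup>+y. pn p (u y) \<partial>lborel) < \<infinity>" unfolding ug by (rule gfin[OF z])
    note per = sobolev_per_periodize[OF part \<theta>0 p0(1) umeas u0 gmeas g0 wd ufin gfin]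
    have "(\<Sum>m\<in>multi_idx r. \<integral>\<^sup>+x. pn p (g m x) \<partial>lborel) \<le> (\<Sum>m\<in>(multi_idx r :: (nat^'d) set). ennreal (K3 * B))"
      by (rule sum_mono) (rule gb)
    also have "\<dots> = ennreal (K4 * B)" unfolding K4_def using K0 B by (simp add: ennreal_mult[symmetric] ennreal_of_nat_eq_real_of_nat mult_ac)
    finally have s: "(\<Sum>m\<in>multi_idx r. \<integral>\<^sup>+x. pn p (g m x) \<partial>lborel) \<le> ennreal (K4 * B)" .
    have "(K4 * B) powr (1 / p) = C * B powr (1 / p)" unfolding C_def using K0 B by (simp add: powr_mult)
    moreover have KB: "((K4 * B) powr (1 / p)) powr p = K4 * B" using K0 B p0 by (simp add: powr_powr)
    ultimately have CB: "(C * B powr (1 / p)) powr p = K4 * B" by simp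
    have "sobolev_norm r p unit_cube u powr p \<le> K4 * B"
    proof -
      have "ennreal (sobolev_norm r p unit_cube u powr p) = (\<Sum>k\<in>multi_idx r. \<integral>\<^sup>+x. pn p (g k x) \<partial>lborel)"
        by (rule per(2))
      then have "ennreal (sobolev_norm r p unit_cube u powr p) \<le> ennreal (K4 * B)" using s by simp
      then show ?thesis using K0 B by (subst (asm) ennreal_le_iff) auto
    qed
    then have "(sobolev_norm r p unit_cube u powr p) powr (1 / p) \<le> (K4 * B) powr (1 / p)"
      using p0 by (intro powr_mono2) auto
    then have "sobolev_norm r p unit_cube u \<le> C * B powr (1 / p)"
      using p0 sobolev_norm_nonneg[of r p "unit_cube" u] \<open>(K4 * B) powr (1 / p) = C * B powr (1 / p)\<close>
      by (simp add: powr_powr)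
    moreover have "(\<integral>\<^sup>+y. pn p (u y) \<partial>lborel) \<le> ennreal ((C * B powr (1 / p)) powr p)"
      unfolding CB ug using member_le_sum[OF z, of "\<lambda>m. \<integral>\<^sup>+y. pn p (g m y) \<partial>lborel"] finite_multi_idx s
      by (auto intro: order_trans)
    moreover have "u \<in> sobolev_per 1 r p" by (rule per(1))
    ultimately show "(\<lambda>y. localized \<phi> k (E 0) (\<theta> *\<^sub>R y)) \<in> sobolev_per 1 r p \<and>
      sobolev_norm r p unit_cube (\<lambda>y. localized \<phi> k (E 0) (\<theta> *\<^sub>R y)) \<le> C * B powr (1 / p) \<and>
      (\<integral>\<^sup>+y. pn p (localized \<phi> k (E 0) (\<theta> *\<^sub>R y)) \<partial>lborel) \<le> ennreal ((C * B powr (1 / p)) powr p)"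
      unfolding u_def by blast
  qed
qed

section \<open>Finite rank modulo null sets\<close>

interpretation fun_space: vector_space "\<lambda>(c::complex) (f :: 'i \<Rightarrow> complex) i. c * f i"
  by standard (auto simp: fun_eq_iff algebra_simps)

lemma sum_fun_apply: "(\<Sum>i\<in>I. f i) x = (\<Sum>i\<in>I. f i x :: complex)"
  by (induction I rule: infinite_finite_induct) auto

text \<open>\<open>dim_at_most\<close> wants its generators inside L, whereas the given e i need not
  belong to L. A maximal independent set among the coefficient vectors has at most card I members,
  and elements of L with these coefficients generate L.\<close>

lemma dim_at_most_span:
  fixes e :: "'i \<Rightarrow> 'a \<Rightarrow> complex"
  assumes I: "finite I" "card I \<le> n"
    and sp: "\<And>g. g \<in> L \<Longrightarrow> \<exists>c. AE x in M. g x = (\<Sum>i\<in>I. c i * e i x)"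
  shows "dim_at_most M n L"
proof -
  \<comment> \<open>Coefficients outside I are arbitrary; setting them to 0 puts the vectors into
    the span of the unit vectors over I.\<close>
  have "\<forall>g\<in>L. \<exists>c. (\<forall>i. i \<notin> I \<longrightarrow> c i = 0) \<and> (AE x in M. g x = (\<Sum>i\<in>I. c i * e i x))"
  proof
    fix g assume "g \<in> L"
    then obtain c where c: "AE x in M. g x = (\<Sum>i\<in>I. c i * e i x)" using sp by blast
    have "(\<Sum>i\<in>I. c i * e i x) = (\<Sum>i\<in>I. (if i \<in> I then c i else 0) * e i x)" for x
      by (rule sum.cong) auto
    then show "\<exists>c. (\<forall>i. i \<notin> I \<longrightarrow> c i = 0) \<and> (AE x in M. g x = (\<Sum>i\<in>I. c i * e i x))"
      using c by (intro exI[of _ "\<lambda>i. if i \<in> I then c i else 0"]) auto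
  qed
  then obtain c where c0: "\<And>g i. g \<in> L \<Longrightarrow> i \<notin> I \<Longrightarrow> c g i = 0"
    and c: "\<And>g. g \<in> L \<Longrightarrow> AE x in M. g x = (\<Sum>i\<in>I. c g i * e i x)" by metis
  obtain V where V: "V \<subseteq> c ` L" "fun_space.independent V" "c ` L \<subseteq> fun_space.span V"
    using fun_space.maximal_independent_subset[of "c ` L"] by metis
  let ?U = "(\<lambda>i j. if j = i then 1 else 0 :: complex) ` I"
  have "V \<subseteq> fun_space.span ?U"
  proof
    fix b assume "b \<in> V"
    then obtain g where g: "g \<in> L" "b = c g" using V(1) by blast
    have "b = (\<Sum>i\<in>I. (\<lambda>j. c g i * (if j = i then 1 else 0)))"
    proof
      fix j
      have "(\<Sum>i\<in>I. (\<lambda>j. c g i * (if j = i then 1 else 0))) j = (\<Sum>i\<in>I. if i = j then c g j else 0)"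
        by (subst sum_fun_apply) (auto intro!: sum.cong)
      then show "b j = (\<Sum>i\<in>I. (\<lambda>j. c g i * (if j = i then 1 else 0))) j"
        using c0[OF g(1), of j] I(1) by (simp add: g(2))
    qed
    then show "b \<in> fun_space.span ?U"
    proof -
      assume b: "b = (\<Sum>i\<in>I. (\<lambda>j. c g i * (if j = i then 1 else 0)))"
      show ?thesis
        unfolding b by (intro fun_space.span_sum fun_space.span_scale fun_space.span_base imageI)
    qed
  qed
  then have fV: "finite V" "card V \<le> card ?U"
    using fun_space.independent_span_bound[OF _ V(2), of ?U] I(1) by auto
  have "card ?U \<le> n" using card_image_le[OF I(1), of "\<lambda>i j. if j = i then 1 else 0 :: complex"] I(2) by linarith
  then have cV: "card V \<le> n" using fV by linarith
  have "\<forall>b\<in>V. \<exists>g. g \<in> L \<and> c g = b" using V(1) by blast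
  then obtain s where "\<forall>b\<in>V. s b \<in> L \<and> c (s b) = b" by (rule bchoice[THEN exE])
  then have s: "\<And>b. b \<in> V \<Longrightarrow> s b \<in> L" "\<And>b. b \<in> V \<Longrightarrow> c (s b) = b" by auto
  have inj: "inj_on s V" by (rule inj_on_inverseI[where g=c]) (rule s(2))
  show ?thesis unfolding dim_at_most_def
  proof (intro exI[of _ "s ` V"] conjI ballI)
    show "s ` V \<subseteq> L" using s by auto
    show "finite (s ` V)" using fV by simp
    show "card (s ` V) \<le> n" using cV card_image[OF inj] by simp
    fix g assume g: "g \<in> L"
    then have "c g \<in> fun_space.span V" using V(3) by blast
    then obtain a where a: "c g = (\<Sum>b\<in>V. (\<lambda>i. a b * b i))"
      using fun_space.span_finite[OF fV(1)] by auto
    have "AE x in M. \<forall>b\<in>V. s b x = (\<Sum>i\<in>I. b i * e i x)"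
      using c[OF s(1)] s(2) by (intro AE_finite_allI[OF fV(1)]) metis
    with c[OF g] have "AE x in M. g x = (\<Sum>b\<in>V. a b * s b x)"
    proof eventually_elim
      case (elim x)
      have "g x = (\<Sum>i\<in>I. (\<Sum>b\<in>V. a b * b i) * e i x)"
        using elim(1) unfolding a by (simp add: sum_fun_apply)
      also have "\<dots> = (\<Sum>b\<in>V. a b * (\<Sum>i\<in>I. b i * e i x))"
        unfolding sum_distrib_right sum_distrib_left by (subst sum.swap) (simp add: mult.assoc)
      also have "\<dots> = (\<Sum>b\<in>V. a b * s b x)" by (rule sum.cong) (use elim(2) in auto)
      finally show ?case .
    qed
    moreover have "(\<Sum>b\<in>V. a b * s b x) = (\<Sum>h\<in>s ` V. a (the_inv_into V s h) * h x)" for x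
      by (subst sum.reindex[OF inj]) (auto intro!: sum.cong simp: the_inv_into_f_f[OF inj])
    ultimately show "\<exists>c. AE x in M. g x = (\<Sum>h\<in>s ` V. c h * h x)"
      by (intro exI[of _ "\<lambda>h. a (the_inv_into V s h)"]) simp
  qed
qed

section \<open>The rank budget and the weights\<close>

definition int_box :: "nat \<Rightarrow> (int ^ 'd) set" where
  "int_box N = {k. \<forall>i. \<bar>k $ i\<bar> \<le> int N}"

lemma finite_int_box': "finite (int_box N)" unfolding int_box_def by (rule finite_int_box)

text \<open>Reduces lattice sums of product form to a single coordinate.\<close>

lemma int_box_sum_prod:
  fixes g :: "int \<Rightarrow> real"
  shows "(\<Sum>k\<in>(int_box N :: (int ^ 'd) set). \<Prod>i\<in>UNIV. g (k $ i)) = (\<Sum>j\<in>{- int N..int N}. g j) ^ CARD('d)"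
proof -
  have "(\<Sum>j\<in>{- int N..int N}. g j) ^ CARD('d) = (\<Prod>i\<in>(UNIV :: 'd set). \<Sum>j\<in>{- int N..int N}. g j)" by simp
  also have "\<dots> = (\<Sum>f\<in>PiE (UNIV :: 'd set) (\<lambda>_. {- int N..int N}). \<Prod>i\<in>UNIV. g (f i))"
    by (rule prod_sum_PiE) auto
  also have "\<dots> = (\<Sum>k\<in>(int_box N :: (int ^ 'd) set). \<Prod>i\<in>UNIV. g (k $ i))"
  proof (rule sum.reindex_bij_witness[where i="\<lambda>k i. k $ i" and j="\<lambda>f. \<chi> i. f i"])
    fix f assume "f \<in> PiE (UNIV :: 'd set) (\<lambda>_. {- int N..int N})"
    then have "f i \<in> {- int N..int N}" for i by auto
    then have "\<bar>f i\<bar> \<le> int N" for i by (simp add: abs_le_iff) (smt (verit))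
    then show "(\<chi> i. f i) \<in> int_box N" by (simp add: int_box_def)
  next
    fix k :: "int ^ 'd" assume "k \<in> int_box N"
    then have "\<bar>k $ i\<bar> \<le> int N" for i by (simp add: int_box_def)
    then have "k $ i \<in> {- int N..int N}" for i by (simp add: abs_le_iff) (smt (verit))
    then show "(\<lambda>i. k $ i) \<in> PiE UNIV (\<lambda>_. {- int N..int N})" by auto
  qed auto
  finally show ?thesis by simp
qed

lemma finite_subset_int_box:
  assumes "finite (F :: (int ^ 'd) set)" obtains N where "F \<subseteq> int_box N"
proof -
  let ?N = "\<Sum>k\<in>F. \<Sum>i\<in>UNIV. nat \<bar>k $ i\<bar>"
  have "F \<subseteq> int_box ?N"
  proof
    fix k assume k: "k \<in> F"
    have "\<bar>k $ i\<bar> \<le> int ?N" for i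
    proof -
      have "nat \<bar>k $ i\<bar> \<le> (\<Sum>i\<in>UNIV. nat \<bar>k $ i\<bar>)" by (rule member_le_sum) auto
      also have "\<dots> \<le> ?N" using assms k by (intro member_le_sum) auto
      finally have "int (nat \<bar>k $ i\<bar>) \<le> int ?N" by (simp only: of_nat_le_iff)
      then show ?thesis by simp
    qed
    then show "k \<in> int_box ?N" by (simp add: int_box_def)
  qed
  then show ?thesis by (rule that)
qed

lemma sum_exp_nat_le:
  assumes c: "(c :: real) > 0"
  shows "(\<Sum>s\<le>N. exp (- c * real s)) \<le> 1 + 1 / c"
proof -
  have e: "exp (- c) < 1" using c by simp
  have "exp (- c * real s) = exp (- c) ^ s" for s by (simp add: exp_of_nat_mult[symmetric] mult.commute)
  then have "(\<Sum>s\<le>N. exp (- c * real s)) = (\<Sum>s<Suc N. exp (- c) ^ s)" by (simp add: lessThan_Suc_atMost)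
  also have "\<dots> \<le> (\<Sum>s. exp (- c) ^ s)" using e by (intro sum_le_suminf summable_geometric) auto
  also have "\<dots> = 1 / (1 - exp (- c))" using e by (intro suminf_geometric) auto
  also have "\<dots> \<le> 1 + 1 / c"
  proof -
    have "1 + c \<le> exp c" by simp
    then have "exp (- c) \<le> 1 / (1 + c)" using c by (simp add: exp_minus field_simps)
    then have "c / (1 + c) \<le> 1 - exp (- c)" using c by (simp add: field_simps)
    then have "1 / (1 - exp (- c)) \<le> 1 / (c / (1 + c))" using c by (intro divide_left_mono) auto
    then show ?thesis using c by (simp add: field_simps)
  qed
  finally show ?thesis .
qed

lemma sum_exp_int_le:
  assumes c: "(c :: real) > 0"
  shows "(\<Sum>j\<in>{- int N..int N}. exp (- c * real_of_int \<bar>j\<bar>)) \<le> 2 * (1 + 1 / c)"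
proof -
  let ?f = "\<lambda>j::int. exp (- c * real_of_int \<bar>j\<bar>)"
  have "{- int N..int N} \<subseteq> int ` {..N} \<union> (\<lambda>n. - int n) ` {..N}"
  proof
    fix j assume j: "j \<in> {- int N..int N}"
    show "j \<in> int ` {..N} \<union> (\<lambda>n. - int n) ` {..N}"
    proof (cases "j \<ge> 0")
      case True
      then have "j = int (nat j)" "nat j \<in> {..N}" using j by auto
      then show ?thesis by blast
    next
      case False
      then have "j = - int (nat (- j))" "nat (- j) \<in> {..N}" using j by auto
      then show ?thesis by blast
    qed
  qed
  then have "(\<Sum>j\<in>{- int N..int N}. ?f j) \<le> (\<Sum>j\<in>int ` {..N} \<union> (\<lambda>n. - int n) ` {..N}. ?f j)"
    by (intro sum_mono2) auto
  also have "\<dots> \<le> (\<Sum>j\<in>int ` {..N}. ?f j) + (\<Sum>j\<in>(\<lambda>n. - int n) ` {..N}. ?f j)"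
    by (subst sum_Un) (auto intro!: sum_nonneg)
  also have "\<dots> = 2 * (\<Sum>s\<le>N. exp (- c * real s))"
    by (subst (1 2) sum.reindex) (auto simp: inj_on_def)
  also have "\<dots> \<le> 2 * (1 + 1 / c)" using sum_exp_nat_le[OF c, of N] by simp
  finally show ?thesis .
qed

lemma int_vec_nth: "int_vec k $ i = of_int (k $ i)" by (simp add: int_vec_def)

text \<open>The operator indices depend on the Euclidean norm of k, the weight on its coordinates;
  this lemma and the next translate between the two.\<close>

lemma norm_int_vec_powr_ge:
  fixes k :: "int ^ 'd"
  assumes "lam > 0"
  shows "(\<Sum>i\<in>UNIV. absc k i powr lam) \<le> real CARD('d) * norm (int_vec k) powr lam"
proof -
  have "absc k i powr lam \<le> norm (int_vec k) powr lam" for i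
    using component_le_norm_cart[of "int_vec k" i] assms by (intro powr_mono2) (auto simp: int_vec_nth)
  then show ?thesis using sum_mono[of "UNIV :: 'd set" "\<lambda>i. absc k i powr lam" "\<lambda>_. norm (int_vec k) powr lam"] by simp
qed

lemma norm_int_vec_powr_le:
  fixes k :: "int ^ 'd"
  assumes "lam > 0"
  shows "norm (int_vec k) powr lam \<le> real CARD('d) powr lam * (\<Sum>i\<in>UNIV. absc k i powr lam)"
proof -
  obtain j where j: "\<And>i. \<bar>k $ i\<bar> \<le> \<bar>k $ j\<bar>"
  proof -
    have "finite (range (\<lambda>i. \<bar>k $ i\<bar>))" by simp
    from Max_in[OF this] have "Max (range (\<lambda>i. \<bar>k $ i\<bar>)) \<in> range (\<lambda>i. \<bar>k $ i\<bar>)" by blast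
    then obtain j where "Max (range (\<lambda>i. \<bar>k $ i\<bar>)) = \<bar>k $ j\<bar>" by (rule rangeE)
    then show ?thesis by (intro that[of j]) (metis Max_ge finite rangeI finite_imageI)
  qed
  have "norm (int_vec k) \<le> (\<Sum>i\<in>UNIV. \<bar>int_vec k $ i\<bar>)" by (rule norm_le_l1_cart)
  also have "\<dots> \<le> (\<Sum>i\<in>(UNIV :: 'd set). real_of_int \<bar>k $ j\<bar>)"
  proof (rule sum_mono)
    fix i have "absc k i \<le> real_of_int \<bar>k $ j\<bar>" using j[of i] by (simp only: of_int_le_iff)
    then show "\<bar>int_vec k $ i\<bar> \<le> real_of_int \<bar>k $ j\<bar>" by (simp add: int_vec_nth)
  qed
  also have "\<dots> = real CARD('d) * real_of_int \<bar>k $ j\<bar>" by simp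
  finally have "norm (int_vec k) powr lam \<le> (real CARD('d) * real_of_int \<bar>k $ j\<bar>) powr lam"
    using assms by (intro powr_mono2) auto
  also have "\<dots> = real CARD('d) powr lam * real_of_int \<bar>k $ j\<bar> powr lam" by (simp add: powr_mult)
  also have "\<dots> \<le> real CARD('d) powr lam * (\<Sum>i\<in>UNIV. absc k i powr lam)"
    by (intro mult_left_mono member_le_sum[of j UNIV "\<lambda>i. absc k i powr lam"]) auto
  finally show ?thesis .
qed

text \<open>A linear minorant, which turns decay of the form exp(-y^lam) into geometric
  decay.\<close>

lemma powr_ge_sub_one: "(y::real) \<ge> 0 \<Longrightarrow> lam \<ge> 1 \<Longrightarrow> y - 1 \<le> y powr lam"
  by (cases "y \<ge> 1") (use powr_mono[of 1 lam y] in \<open>auto intro: order_trans[of _ 0]\<close>)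

lemma power_le_exp:
  assumes "(y::real) \<ge> 0" "d > 0" shows "(y / real d) ^ d \<le> exp y"
proof -
  have "(y / real d) ^ d \<le> exp (y / real d) ^ d"
    using assms exp_ge_add_one_self[of "y / real d"] by (intro power_mono) (auto simp: field_simps)
  also have "\<dots> = exp y" using assms by (simp add: exp_of_nat_mult[symmetric])
  finally show ?thesis .
qed

text \<open>With c = a \<delta> / r and the length X = c^(-1/lam), the exponent becomes (s/X)^lam.
  Owing to its factor s^d the series in \<open>rho\<close> is at least of order X^(d+1), whereas the
  lattice sum over all k is at most of order X^d. The series wins once X is large, that is, once
  \<delta> is small.\<close>

lemma rank_budget:
  fixes lam a :: real and r :: nat
  assumes lam: "lam > 1" and a: "a > 0" and r: "r \<ge> 1"
  shows "\<exists>\<delta>1>0. \<forall>\<delta>. 0 < \<delta> \<and> \<delta> < \<delta>1 \<longrightarrow> rho CARD('d) lam a r \<delta> > 0 \<and>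
    (\<forall>F :: (int ^ 'd) set. finite F \<longrightarrow>
       (\<Sum>k\<in>F. rho CARD('d) lam a r \<delta> * exp (- (a * \<delta> / real r) * norm (int_vec k) powr lam)) \<le> 1)"
proof -
  let ?d = "CARD('d)"
  define \<kappa> where "\<kappa> = 2 * (2 * pi) powr ((real ?d - 1) / 2) / real (double_fact ?d)"
  have "double_fact n > 0" for n by (induction n rule: double_fact.induct) auto
  then have \<kappa>: "\<kappa> > 0" by (simp add: \<kappa>_def)
  \<comment> \<open>Chosen so that \<kappa> times Z terms of size (X/2)^d / e equals e (4 X d)^d,
    the bound for the lattice sum.\<close>
  define Z where "Z = exp 2 * (8 * real ?d) ^ ?d / \<kappa>"
  have Z: "Z > 0" using \<kappa> by (simp add: Z_def)
  \<comment> \<open>X >= X0 makes X/2 - 1 at least Z, and X/2 - 1 is a lower bound for the number of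
    s with X/2 <= s <= X.\<close>
  define X0 where "X0 = 2 * (1 + Z)"
  have X0: "X0 > 2" using Z by (simp add: X0_def)
  show ?thesis
  proof (intro exI[of _ "real r * X0 powr (- lam) / a"] conjI allI impI)
    show "real r * X0 powr (- lam) / a > 0" using r a X0 by simp
    fix \<delta> assume \<delta>: "0 < \<delta> \<and> \<delta> < real r * X0 powr (- lam) / a"
    define c where "c = a * \<delta> / real r"
    have c: "c > 0" "c \<le> X0 powr (- lam)" using \<delta> a r by (auto simp: c_def field_simps)
    define X where "X = c powr (- (1 / lam))"
    have X: "X > 0" using c by (simp add: X_def)
    have "(X0 powr (- lam)) powr (- (1 / lam)) \<le> X" unfolding X_def
      using c lam by (intro powr_mono2') auto
    then have XX0: "X \<ge> X0" using lam X0 by (simp add: powr_powr)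
    have cX: "c * s powr lam = (s / X) powr lam" if "s \<ge> 0" for s
    proof -
      have "(s / X) powr lam = s powr lam / X powr lam" using that X by (simp add: powr_divide)
      also have "X powr lam = c powr (- 1)" unfolding X_def using lam by (simp add: powr_powr)
      also have "\<dots> = 1 / c" using c by (simp add: powr_minus_divide)
      finally show ?thesis by simp
    qed
    have ge: "s / X - 1 \<le> c * s powr lam" if "s \<ge> 0" for s
      unfolding cX[OF that] using that X lam by (intro powr_ge_sub_one) auto
    define T where "T s = real s ^ ?d * exp (- c * real s powr lam)" for s
    have T0: "T s \<ge> 0" for s by (simp add: T_def)
    \<comment> \<open>Half of the exponential decay absorbs s^d. Summability is what allows a
      partial sum to bound the series in \<open>rho\<close> from below.\<close>
    have "summable T"
    proof (rule summable_comparison_test')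
      show "summable (\<lambda>s. (2 * X * real ?d) ^ ?d * exp 1 * exp (- (1 / (2 * X))) ^ s)"
        using X by (intro summable_mult summable_geometric) simp
      fix s :: nat
      have "(real s / (2 * X) / real ?d) ^ ?d \<le> exp (real s / (2 * X))" using X by (intro power_le_exp) auto
      then have p: "real s ^ ?d \<le> (2 * X * real ?d) ^ ?d * exp (real s / (2 * X))"
        using X by (simp add: power_divide field_simps power_mult_distrib)
      have "exp (- c * real s powr lam) \<le> exp (1 - real s / X)" using ge[of "real s"] by simp
      then have "T s \<le> ((2 * X * real ?d) ^ ?d * exp (real s / (2 * X))) * exp (1 - real s / X)"
        unfolding T_def using p X by (intro mult_mono) auto
      also have "\<dots> = (2 * X * real ?d) ^ ?d * exp (1 - real s / (2 * X))"
        using X by (simp add: mult.assoc exp_add[symmetric] field_simps)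
      also have "exp (1 - real s / (2 * X)) = exp 1 * exp (- (1 / (2 * X))) ^ s"
        by (simp add: exp_of_nat_mult[symmetric] exp_add[symmetric])
      finally show "norm (T s) \<le> (2 * X * real ?d) ^ ?d * exp 1 * exp (- (1 / (2 * X))) ^ s"
        using T0[of s] by (simp add: mult.assoc)
    qed
    let ?S = "{nat \<lceil>X / 2\<rceil>..nat \<lfloor>X\<rfloor>}"
    have cS: "real (card ?S) \<ge> X / 2 - 1"
      using X XX0 X0 by (simp add: of_nat_diff) linarith
    have TS: "T s \<ge> (X / 2) ^ ?d * exp (- 1)" if "s \<in> ?S" for s
    proof -
      have s: "X / 2 \<le> real s" "real s \<le> X" using that X by (auto simp: nat_le_iff le_nat_iff ceiling_le_iff le_floor_iff)
      have "c * real s powr lam \<le> 1" unfolding cX[OF of_nat_0_le_iff]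
        using s X lam powr_mono2[of lam "real s / X" 1] by simp
      then show ?thesis unfolding T_def using s X by (intro mult_mono power_mono) auto
    qed
    have "(X / 2 - 1) * ((X / 2) ^ ?d * exp (- 1)) \<le> real (card ?S) * ((X / 2) ^ ?d * exp (- 1))"
      using cS X by (intro mult_right_mono) auto
    also have "\<dots> \<le> (\<Sum>s\<in>?S. T s)" using sum_mono[of ?S "\<lambda>_. (X / 2) ^ ?d * exp (- 1)" T] TS by simp
    also have "\<dots> \<le> (\<Sum>s. T s)" using \<open>summable T\<close> T0 by (intro sum_le_suminf) auto
    finally have sT: "(X / 2 - 1) * ((X / 2) ^ ?d * exp (- 1)) \<le> (\<Sum>s. T s)" .
    have X2: "X / 2 - 1 \<ge> Z" using XX0 by (simp add: X0_def)
    have lower: "exp 1 * (4 * X * real ?d) ^ ?d \<le> \<kappa> * (\<Sum>s. T s)"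
    proof -
      have "exp 1 * (4 * X * real ?d) ^ ?d = \<kappa> * (Z * ((X / 2) ^ ?d * exp (- 1)))"
      proof -
        have "(8 * real ?d) * (X / 2) = 4 * X * real ?d" by simp
        then have 1: "(8 * real ?d) ^ ?d * (X / 2) ^ ?d = (4 * X * real ?d) ^ ?d"
          unfolding power_mult_distrib[of "8 * real ?d" "X / 2", symmetric] by (rule arg_cong)
        have 2: "exp 2 * exp (- 1) = exp (1::real)" unfolding exp_add[symmetric] by simp
        have "\<kappa> * (e2 * B / \<kappa> * (A * e1)) = (e2 * e1) * (B * A)" for A B e1 e2 using \<kappa> by simp
        from this[of "exp 2" "(8 * real ?d) ^ ?d" "(X / 2) ^ ?d" "exp (- 1)"] show ?thesis
          unfolding Z_def 1 2 by (rule sym)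
      qed
      also have "\<dots> \<le> \<kappa> * ((X / 2 - 1) * ((X / 2) ^ ?d * exp (- 1)))"
        using X2 \<kappa> X by (intro mult_left_mono mult_right_mono) auto
      also have "\<dots> \<le> \<kappa> * (\<Sum>s. T s)" using sT \<kappa> by (intro mult_left_mono) auto
      finally show ?thesis .
    qed
    have rho: "rho ?d lam a r \<delta> = inverse (\<kappa> * (\<Sum>s. T s))"
      unfolding rho_def T_def \<kappa>_def c_def ..
    have pos: "exp 1 * (4 * X * real ?d) ^ ?d > 0" using X by simp
    then have Tpos: "\<kappa> * (\<Sum>s. T s) > 0" using lower by linarith
    then show rpos: "rho ?d lam a r \<delta> > 0" unfolding rho by (rule positive_imp_inverse_positive)
    fix F :: "(int ^ 'd) set" assume F: "finite F"
    obtain N where N: "F \<subseteq> int_box N" using finite_subset_int_box[OF F] by blast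
    let ?c = "1 / (X * real ?d)"
    have c': "?c > 0" using X by simp
    \<comment> \<open>|k|^lam is at least the mean of the |k_i|^lam; the linear minorant in each
      coordinate then yields a product of geometric factors.\<close>
    have tb: "exp (- c * norm (int_vec k) powr lam) \<le> exp 1 * (\<Prod>i\<in>UNIV. exp (- ?c * absc k i))" for k :: "int ^ 'd"
    proof -
      have "(\<Sum>i\<in>UNIV. absc k i / X - 1) \<le> (\<Sum>i\<in>UNIV. c * absc k i powr lam)"
        by (intro sum_mono ge) simp
      also have "\<dots> \<le> c * (real ?d * norm (int_vec k) powr lam)"
        unfolding sum_distrib_left[symmetric] using c norm_int_vec_powr_ge[of lam k] lam by (intro mult_left_mono) auto
      finally have "(\<Sum>i\<in>UNIV. absc k i) / X - real ?d \<le> c * (real ?d * norm (int_vec k) powr lam)"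
        by (simp add: sum_subtractf sum_divide_distrib)
      then have "((\<Sum>i\<in>UNIV. absc k i) / X - real ?d) / real ?d \<le> (c * (real ?d * norm (int_vec k) powr lam)) / real ?d"
        by (intro divide_right_mono) auto
      then have "- c * norm (int_vec k) powr lam \<le> 1 + (\<Sum>i\<in>UNIV. - ?c * absc k i)"
        unfolding sum_distrib_left[symmetric] by (simp add: diff_divide_distrib mult.commute)
      then have "exp (- c * norm (int_vec k) powr lam) \<le> exp (1 + (\<Sum>i\<in>UNIV. - ?c * absc k i))" by simp
      also have "\<dots> = exp 1 * (\<Prod>i\<in>UNIV. exp (- ?c * absc k i))"
        by (simp only: exp_add exp_sum[OF finite])
      finally show ?thesis .
    qed
    have "(\<Sum>k\<in>F. exp (- c * norm (int_vec k) powr lam)) \<le> (\<Sum>k\<in>(int_box N :: (int ^ 'd) set). exp (- c * norm (int_vec k) powr lam))"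
      by (rule sum_mono2[OF finite_int_box' N]) simp
    also have "\<dots> \<le> (\<Sum>k\<in>(int_box N :: (int ^ 'd) set). exp 1 * (\<Prod>i\<in>UNIV. exp (- ?c * absc k i)))"
      by (rule sum_mono) (rule tb)
    also have "\<dots> = exp 1 * (\<Sum>j\<in>{- int N..int N}. exp (- ?c * real_of_int \<bar>j\<bar>)) ^ ?d"
      unfolding sum_distrib_left[symmetric] int_box_sum_prod[of "\<lambda>j. exp (- ?c * real_of_int \<bar>j\<bar>)"] ..
    also have "\<dots> \<le> exp 1 * (2 * (1 + 1 / ?c)) ^ ?d"
      by (intro mult_left_mono power_mono sum_exp_int_le[OF c'] sum_nonneg) auto
    \<comment> \<open>Here 1 / c' = X d is at least 1 and absorbs the additive 1.\<close>
    also have "\<dots> \<le> exp 1 * (4 * X * real ?d) ^ ?d"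
    proof -
      have d1: "1 \<le> real ?d" by (metis One_nat_def Suc_leI of_nat_1 of_nat_mono zero_less_card_finite)
      have "1 * 1 \<le> X * real ?d" using XX0 X0 d1 by (intro mult_mono) auto
      then show ?thesis using X by (intro mult_left_mono power_mono) auto
    qed
    also have "\<dots> \<le> \<kappa> * (\<Sum>s. T s)" by (rule lower)
    finally have fin: "(\<Sum>k\<in>F. exp (- c * norm (int_vec k) powr lam)) \<le> \<kappa> * (\<Sum>s. T s)" .
    have "(\<Sum>k\<in>F. rho ?d lam a r \<delta> * exp (- (a * \<delta> / real r) * norm (int_vec k) powr lam)) =
      rho ?d lam a r \<delta> * (\<Sum>k\<in>F. exp (- c * norm (int_vec k) powr lam))"
      by (simp add: sum_distrib_left c_def)
    also have "\<dots> \<le> rho ?d lam a r \<delta> * (\<kappa> * (\<Sum>s. T s))" using fin rpos by (intro mult_left_mono) auto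
    also have "\<dots> = 1" unfolding rho using Tpos by (intro left_inverse) linarith
    finally show "(\<Sum>k\<in>F. rho ?d lam a r \<delta> * exp (- (a * \<delta> / real r) * norm (int_vec k) powr lam)) \<le> 1" .
  qed
qed

text \<open>Exponent of one coordinate factor in the sum over cubes: the weight at its largest, the
  weight at its smallest to the power -s with s = q/p, and D t^lam for the loss of the operator on
  that cube. Powers of e^b are kept apart.\<close>

definition weight_exponent :: "real \<Rightarrow> real \<Rightarrow> real \<Rightarrow> real \<Rightarrow> real \<Rightarrow> real" where
  "weight_exponent lam a s D t = - a * max 0 (t - 1) powr lam + s * a * (t + 2) powr lam + D * t powr lam"

text \<open>The shifts by -1 and +2 change t^lam only by a factor tending to 1, so the leading
  coefficient is close to -a (1 - s) + D, which is at most -a (1 - s) / 2. Here s < 1, that is q <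
  p, is essential.\<close>

lemma weight_exponent_bound:
  assumes lam: "lam > 1" and a: "a > 0" and s: "0 \<le> s" "s < 1" and D: "0 \<le> D" "D \<le> a * (1 - s) / 2"
  shows "\<exists>K c. c > 0 \<and> (\<forall>t\<ge>0. weight_exponent lam a s D t \<le> K - c * t)"
proof -
  \<comment> \<open>The two shifts cost at most 2 a \<eta> = a (1 - s) / 4, half of the available a
    (1 - s) / 2.\<close>
  define \<eta> where "\<eta> = (1 - s) / 8"
  have \<eta>: "\<eta> > 0" "\<eta> < 1" using s by (auto simp: \<eta>_def)
  have "((\<lambda>t. (1 - inverse t) powr lam) \<longlongrightarrow> (1 - 0) powr lam) at_top"
    by (intro tendsto_intros tendsto_inverse_0_at_top filterlim_ident) auto
  then have l1: "\<forall>\<^sub>F t in at_top. 1 - \<eta> < (1 - inverse t) powr lam" using \<eta> by (intro order_tendstoD(1)) auto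
  have "((\<lambda>t. (1 + 2 * inverse t) powr lam) \<longlongrightarrow> (1 + 2 * 0) powr lam) at_top"
    by (intro tendsto_intros tendsto_inverse_0_at_top filterlim_ident) auto
  then have l2: "\<forall>\<^sub>F t in at_top. (1 + 2 * inverse t) powr lam < 1 + \<eta>" using \<eta> by (intro order_tendstoD(2)) auto
  obtain T where T: "T \<ge> 1" "\<And>t. t \<ge> T \<Longrightarrow> 1 - \<eta> < (1 - inverse t) powr lam \<and> (1 + 2 * inverse t) powr lam < 1 + \<eta>"
  proof -
    have "\<forall>\<^sub>F t in at_top. (1 - \<eta> < (1 - inverse t) powr lam \<and> (1 + 2 * inverse t) powr lam < 1 + \<eta>)"
      using l1 l2 by (rule eventually_conj)
    then obtain T0 where "\<forall>t\<ge>T0. 1 - \<eta> < (1 - inverse t) powr lam \<and> (1 + 2 * inverse t) powr lam < 1 + \<eta>"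
      unfolding eventually_at_top_linorder by blast
    then show ?thesis by (intro that[of "max 1 T0"]) auto
  qed
  define c where "c = a * (1 - s) / 4"
  have c: "c > 0" using a s by (simp add: c_def)
  define K0 where "K0 = a * (T + 2) powr lam + D * T powr lam"
  have K0: "K0 \<ge> 0" using a D unfolding K0_def by (intro add_nonneg_nonneg mult_nonneg_nonneg) auto
  have "weight_exponent lam a s D t \<le> (K0 + c * T + c) - c * t" if t: "t \<ge> 0" for t
  proof (cases "t \<ge> T")
    case True
    then have t1: "t \<ge> 1" using T by simp
    have t': "t * (1 - inverse t) = t - 1" "t * (1 + 2 * inverse t) = t + 2"
      using t1 by (simp_all add: algebra_simps)
    have e1: "max 0 (t - 1) powr lam = t powr lam * (1 - inverse t) powr lam"
      using t1 by (subst powr_mult[symmetric]) (auto simp: t' inverse_le_1_iff)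
    have e2: "(t + 2) powr lam = t powr lam * (1 + 2 * inverse t) powr lam"
      using t1 by (subst powr_mult[symmetric]) (auto simp: t')
    have "weight_exponent lam a s D t = t powr lam * (- a * (1 - inverse t) powr lam + s * a * (1 + 2 * inverse t) powr lam + D)"
      unfolding weight_exponent_def e1 e2 by (simp add: algebra_simps)
    also have "\<dots> \<le> t powr lam * (- a * (1 - \<eta>) + s * a * (1 + \<eta>) + a * (1 - s) / 2)"
    proof (rule mult_left_mono[OF add_mono[OF add_mono]])
      show "- a * (1 - inverse t) powr lam \<le> - a * (1 - \<eta>)" using T(2)[OF True] a by simp
      show "s * a * (1 + 2 * inverse t) powr lam \<le> s * a * (1 + \<eta>)" using T(2)[OF True] a s by (intro mult_left_mono) auto
    qed (use D in auto)
    also have "- a * (1 - \<eta>) + s * a * (1 + \<eta>) + a * (1 - s) / 2 = - (a * (1 - s) / 2) + a * \<eta> * (1 + s)"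
      by (simp add: algebra_simps add_divide_distrib diff_divide_distrib)
    also have "\<dots> \<le> - (a * (1 - s) / 2) + a * \<eta> * 2" using a \<eta> s by simp
    also have "\<dots> = - c" unfolding c_def \<eta>_def by (simp add: field_simps)
    finally have "weight_exponent lam a s D t \<le> t powr lam * (- c)" by (simp add: mult_left_mono)
    also have "\<dots> \<le> (t - 1) * (- c)" using powr_ge_sub_one[of t lam] t lam c by (intro mult_right_mono_neg) auto
    also have "\<dots> \<le> (K0 + c * T + c) - c * t"
    proof -
      have "c * T \<ge> 0" using c T by simp
      then show ?thesis using K0 by (simp add: algebra_simps)
    qed
    finally show ?thesis .
  next
    case False
    have "- a * max 0 (t - 1) powr lam \<le> 0" using a by simp
    moreover have "s * a * (t + 2) powr lam \<le> 1 * a * (T + 2) powr lam"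
      using s a t False lam by (intro mult_mono powr_mono2) auto
    moreover have "D * t powr lam \<le> D * T powr lam" using D t False lam by (intro mult_left_mono powr_mono2) auto
    ultimately have "weight_exponent lam a s D t \<le> K0" unfolding weight_exponent_def K0_def by simp
    moreover have "c * t \<le> c * T" using c False by (intro mult_left_mono) auto
    ultimately show ?thesis using c by linarith
  qed
  then show ?thesis using c by blast
qed

lemma weight_sum_bound:
  assumes lam: "lam > 1" and a: "a > 0" and s: "0 \<le> s" "s < 1" and D: "0 \<le> D" "D \<le> a * (1 - s) / 2"
  shows "\<exists>S\<ge>0. \<forall>N. (\<Sum>k\<in>(int_box N :: (int ^ 'd) set). \<Prod>i\<in>UNIV. exp (weight_exponent lam a s D (absc k i))) \<le> S"
proof -
  obtain K c where c: "c > 0" and K: "\<And>t. t \<ge> 0 \<Longrightarrow> weight_exponent lam a s D t \<le> K - c * t"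
    using weight_exponent_bound[OF assms] by blast
  let ?S = "(exp K * (2 * (1 + 1 / c))) ^ CARD('d)"
  have "(\<Sum>k\<in>(int_box N :: (int ^ 'd) set). \<Prod>i\<in>UNIV. exp (weight_exponent lam a s D (absc k i))) \<le> ?S" for N
    unfolding int_box_sum_prod[of "\<lambda>j. exp (weight_exponent lam a s D (real_of_int \<bar>j\<bar>))"]
  proof (intro power_mono sum_nonneg)
    have "(\<Sum>j\<in>{- int N..int N}. exp (weight_exponent lam a s D (real_of_int \<bar>j\<bar>))) \<le>
      (\<Sum>j\<in>{- int N..int N}. exp K * exp (- c * real_of_int \<bar>j\<bar>))"
      using K by (intro sum_mono) (auto simp: exp_add[symmetric])
    also have "\<dots> \<le> exp K * (2 * (1 + 1 / c))"
      unfolding sum_distrib_left[symmetric] by (intro mult_left_mono sum_exp_int_le c) auto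
    finally show "(\<Sum>j\<in>{- int N..int N}. exp (weight_exponent lam a s D (real_of_int \<bar>j\<bar>))) \<le> exp K * (2 * (1 + 1 / c))" .
  qed auto
  moreover have "?S \<ge> 0" using c by simp
  ultimately show ?thesis by blast
qed

section \<open>The weight on lattice cubes\<close>

definition weight_density :: "real \<Rightarrow> real \<Rightarrow> real \<Rightarrow> real ^ 'd \<Rightarrow> real" where
  "weight_density lam a b x = (\<Prod>i\<in>UNIV. weight lam a b (x $ i))"

lemma weight_density_pos: "weight_density lam a b x > 0"
  by (auto simp: weight_density_def weight_def intro!: prod_pos)

lemma weight_density_measurable[measurable]: "weight_density lam a b \<in> borel_fun"
  unfolding weight_density_def[abs_def] weight_def by measurable

lemma sets_weight_measure[measurable_cong]: "sets (weight_measure lam a b) = sets borel"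
  by (simp add: weight_measure_def)

lemma space_weight_measure: "space (weight_measure lam a b) = UNIV"
  by (simp add: weight_measure_def)

lemma weight_measure_eq: "weight_measure lam a b = density lborel (\<lambda>x. ennreal (weight_density lam a b x))"
  by (simp add: weight_measure_def weight_density_def)

lemma nn_integral_weight:
  "h \<in> borel_fun \<Longrightarrow>
    (\<integral>\<^sup>+x. h x \<partial>weight_measure lam a b) = (\<integral>\<^sup>+x. ennreal (weight_density lam a b x) * h x \<partial>lborel)"
  unfolding weight_measure_eq by (rule nn_integral_density) auto

lemma AE_weight: "(AE x in weight_measure lam a b. P x) \<longleftrightarrow> (AE x in lborel. P x)"
  unfolding weight_measure_eq by (subst AE_density) (auto simp: weight_density_pos)

lemma measurable_weight: "f \<in> borel_measurable (weight_measure lam a b) \<longleftrightarrow> f \<in> borel_fun"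
  by (rule iffI; subst measurable_cong_sets[OF _ refl]) (auto simp: sets_weight_measure)

text \<open>A lower bound of the weight on the cube of side 4, to which the averages of f extend;
  \<open>weight_high\<close> is an upper bound on the cube of side 2, which contains the pieces of
  the operator.\<close>

definition weight_low :: "real \<Rightarrow> real \<Rightarrow> real \<Rightarrow> int ^ 'd \<Rightarrow> real" where
  "weight_low lam a b k = (\<Prod>i\<in>UNIV. exp (- a * (absc k i + 2) powr lam + b))"

definition weight_high :: "real \<Rightarrow> real \<Rightarrow> real \<Rightarrow> int ^ 'd \<Rightarrow> real" where
  "weight_high lam a b k = (\<Prod>i\<in>UNIV. exp (- a * max 0 (absc k i - 1) powr lam + b))"

lemma weight_low_pos: "weight_low lam a b k > 0" by (simp add: weight_low_def prod_pos)
lemma weight_high_pos: "weight_high lam a b k > 0" by (simp add: weight_high_def prod_pos)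

lemma weight_low_le:
  assumes "a > 0" "lam > 0" "x \<in> cube 4 (int_vec k)"
  shows "weight_low lam a b k \<le> weight_density lam a b x"
  unfolding weight_low_def weight_density_def weight_def
proof (intro prod_mono conjI)
  fix i
  have "\<bar>x $ i - real_of_int (k $ i)\<bar> \<le> 2" using assms(3) by (simp add: cube_def int_vec_nth)
  then have "\<bar>x $ i\<bar> \<le> absc k i + 2" by simp
  then have "\<bar>x $ i\<bar> powr lam \<le> (absc k i + 2) powr lam" using assms by (intro powr_mono2) auto
  then show "exp (- a * (absc k i + 2) powr lam + b) \<le> exp (- a * \<bar>x $ i\<bar> powr lam + b)"
    using assms by simp
qed simp

lemma weight_high_ge:
  assumes "a > 0" "lam > 0" "x \<in> cube 2 (int_vec k)"
  shows "weight_density lam a b x \<le> weight_high lam a b k"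
  unfolding weight_high_def weight_density_def weight_def
proof (intro prod_mono conjI)
  fix i
  have "\<bar>x $ i - real_of_int (k $ i)\<bar> \<le> 1" using assms(3) by (simp add: cube_def int_vec_nth)
  then have "max 0 (absc k i - 1) \<le> \<bar>x $ i\<bar>" by simp
  then have "max 0 (absc k i - 1) powr lam \<le> \<bar>x $ i\<bar> powr lam" using assms by (intro powr_mono2) auto
  then show "exp (- a * \<bar>x $ i\<bar> powr lam + b) \<le> exp (- a * max 0 (absc k i - 1) powr lam + b)"
    using assms by simp
qed simp

lemma pn_sum_le:
  assumes F: "finite F" "card F \<le> m" and q: "q \<ge> 0"
  shows "pn q (\<Sum>k\<in>F. g k) \<le> ennreal (real m powr q) * (\<Sum>k\<in>F. pn q (g k))"
proof (cases "F = {}")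
  case False
  obtain j where j: "j \<in> F" "\<And>k. k \<in> F \<Longrightarrow> norm (g k) \<le> norm (g j)"
  proof -
    have "Max ((\<lambda>k. norm (g k)) ` F) \<in> (\<lambda>k. norm (g k)) ` F" using F False by (intro Max_in) auto
    then obtain j where "j \<in> F" "Max ((\<lambda>k. norm (g k)) ` F) = norm (g j)" by auto
    then show ?thesis using F(1) by (intro that[of j]) (auto intro: Max_ge simp flip: \<open>Max _ = _\<close>)
  qed
  have "norm (\<Sum>k\<in>F. g k) \<le> (\<Sum>k\<in>F. norm (g k))" by (rule norm_sum)
  also have "\<dots> \<le> real (card F) * norm (g j)" using sum_mono[of F "\<lambda>k. norm (g k)" "\<lambda>_. norm (g j)"] j(2) by simp
  also have "\<dots> \<le> real m * norm (g j)" using F(2) by (intro mult_right_mono) auto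
  finally have "norm (\<Sum>k\<in>F. g k) powr q \<le> (real m * norm (g j)) powr q" using q by (intro powr_mono2) auto
  then have "pn q (\<Sum>k\<in>F. g k) \<le> ennreal (real m powr q) * pn q (g j)"
    unfolding pn_def by (simp add: powr_mult ennreal_mult[symmetric] ennreal_leI)
  also have "\<dots> \<le> ennreal (real m powr q) * (\<Sum>k\<in>F. pn q (g k))"
    using j(1) F(1) by (intro mult_left_mono member_le_sum) auto
  finally show ?thesis .
qed simp

lemma finite_cubes_at: "finite {k :: int ^ 'd. x \<in> cube t (int_vec k)}"
  using finite_int_bounded[of "{x}" t] by simp

text \<open>A side below 2 forces each coordinate of k to differ from the floor of that of x by at
  most 1.\<close>

lemma card_cubes_at:
  assumes "t < 2" shows "card {k :: int ^ 'd. x \<in> cube t (int_vec k)} \<le> 3 ^ CARD('d)"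
proof -
  let ?P = "PiE (UNIV :: 'd set) (\<lambda>_. {- 1..1::int})"
  have "card {k :: int ^ 'd. x \<in> cube t (int_vec k)} \<le> card ?P"
  proof (rule card_inj_on_le[where f="\<lambda>k i. k $ i - \<lfloor>x $ i\<rfloor>"])
    show "inj_on (\<lambda>k i. k $ i - \<lfloor>x $ i\<rfloor>) {k :: int ^ 'd. x \<in> cube t (int_vec k)}"
      by (auto simp: inj_on_def fun_eq_iff vec_eq_iff)
    show "(\<lambda>k i. k $ i - \<lfloor>x $ i\<rfloor>) ` {k :: int ^ 'd. x \<in> cube t (int_vec k)} \<subseteq> ?P"
    proof clarify
      fix k :: "int ^ 'd" assume "x \<in> cube t (int_vec k)"
      then have "\<bar>x $ i - real_of_int (k $ i)\<bar> \<le> t / 2" for i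
        unfolding cube_def int_vec_nth by blast
      then have "\<bar>x $ i - real_of_int (k $ i)\<bar> < 1" for i
        by (rule le_less_trans) (use assms in simp)
      then have "k $ i - \<lfloor>x $ i\<rfloor> \<in> {- 1..1}" for i
      proof -
        have "real_of_int (k $ i) < x $ i + 1" "x $ i - 1 < real_of_int (k $ i)"
          using \<open>\<And>i. \<bar>x $ i - real_of_int (k $ i)\<bar> < 1\<close>[of i] by (auto simp: abs_less_iff)
        then have "k $ i \<le> \<lfloor>x $ i\<rfloor> + 1" "\<lfloor>x $ i\<rfloor> - 1 \<le> k $ i" by linarith+
        then show ?thesis by simp
      qed
      then show "(\<lambda>i. k $ i - \<lfloor>x $ i\<rfloor>) \<in> ?P" by auto
    qed
  qed (auto intro: finite_PiE)
  also have "card ?P = 3 ^ CARD('d)" by (subst card_PiE) auto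
  finally show ?thesis .
qed

section \<open>Local pieces and the weighted space\<close>

definition lift :: "real \<Rightarrow> int ^ 'd \<Rightarrow> (real ^ 'd \<Rightarrow> complex) \<Rightarrow> real ^ 'd \<Rightarrow> complex" where
  "lift \<theta> k h x = indicator (cube \<theta> (int_vec k)) x * h ((1 / \<theta>) *\<^sub>R (x - int_vec k))"

lemma in_cube_scale:
  assumes "\<theta> > 0" shows "(1 / \<theta>) *\<^sub>R (x - c) \<in> cube 1 0 \<longleftrightarrow> x \<in> cube \<theta> c"
  using assms unfolding cube_def by (simp add: abs_mult field_simps abs_divide)

lemma lift_eq:
  assumes "\<theta> > 0"
  shows "lift \<theta> k h x = (\<lambda>y. indicator (cube 1 0) y * h y) ((1 / \<theta>) *\<^sub>R (x - int_vec k))"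
  unfolding lift_def using in_cube_scale[OF assms, of x "int_vec k"] by (auto simp: indicator_def)

lemma cube_restrict_measurable:
  assumes "h \<in> borel_measurable unit_cube"
  shows "(\<lambda>y. indicator (cube 1 0) y * h y :: complex) \<in> borel_fun"
proof -
  have "(\<lambda>y. indicator (cube 1 0) y *\<^sub>R h y) \<in> borel_measurable lborel"
    using assms unfolding leb_on_def by (subst (asm) borel_measurable_restrict_space_iff) auto
  moreover have "(\<lambda>y. indicator (cube 1 0) y *\<^sub>R h y) = (\<lambda>y. indicator (cube 1 0) y * h y)"
    by (auto simp: fun_eq_iff indicator_def)
  ultimately show ?thesis by simp
qed

lemma lift_measurable:
  assumes "\<theta> > 0" "h \<in> borel_measurable unit_cube"
  shows "lift \<theta> k h \<in> borel_fun"
proof -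
  note [measurable] = cube_restrict_measurable[OF assms(2)]
  have [measurable]: "(\<lambda>x. (1 / \<theta>) *\<^sub>R (x - int_vec k)) \<in> borel_fun" by simp
  show ?thesis unfolding lift_eq[OF assms(1), abs_def] by measurable
qed

lemma lift_AE:
  assumes "\<theta> > 0" "AE y in unit_cube. P y"
  shows "AE x in lborel. x \<in> cube \<theta> (int_vec k) \<longrightarrow> P ((1 / \<theta>) *\<^sub>R (x - int_vec k))"
proof -
  have "AE y in lborel. y \<in> cube 1 0 \<longrightarrow> P y" using assms(2) by (simp add: AE_leb_on)
  from AE_lborel_affine[OF _ this, of "1 / \<theta>" "- (1 / \<theta>) *\<^sub>R int_vec k"] assms(1)
  have "AE x in lborel. (1 / \<theta>) *\<^sub>R (x - int_vec k) \<in> cube 1 0 \<longrightarrow> P ((1 / \<theta>) *\<^sub>R (x - int_vec k))"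
    by (simp add: scaleR_diff_right)
  then show ?thesis using in_cube_scale[OF assms(1), of _ "int_vec k"] by simp
qed

lemma lift_integral:
  fixes k :: "int ^ 'd"
  assumes \<theta>: "1 < \<theta>" "\<theta> < 2" and a: "a > 0" "lam > 0" and h: "h \<in> borel_measurable unit_cube"
  shows "(\<integral>\<^sup>+x. pn q (lift \<theta> k h x) \<partial>weight_measure lam a b) \<le>
    ennreal (weight_high lam a b k * \<theta> ^ CARD('d)) * (\<integral>\<^sup>+y. pn q (h y) \<partial>unit_cube)"
proof -
  have \<theta>0: "\<theta> > 0" using \<theta> by simp
  let ?h = "\<lambda>y. indicator (cube 1 0) y * h y"
  note hm[measurable] = cube_restrict_measurable[OF h] lift_measurable[OF \<theta>0 h]
  have "(\<integral>\<^sup>+x. pn q (lift \<theta> k h x) \<partial>weight_measure lam a b) =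
    (\<integral>\<^sup>+x. ennreal (weight_density lam a b x) * pn q (lift \<theta> k h x) \<partial>lborel)"
    by (rule nn_integral_weight) measurable
  also have "\<dots> \<le> (\<integral>\<^sup>+x. ennreal (weight_high lam a b k) * pn q (lift \<theta> k h x) \<partial>lborel)"
  proof (rule nn_integral_mono)
    fix x
    show "ennreal (weight_density lam a b x) * pn q (lift \<theta> k h x) \<le> ennreal (weight_high lam a b k) * pn q (lift \<theta> k h x)"
    proof (cases "x \<in> cube \<theta> (int_vec k)")
      case True
      then have "x \<in> cube 2 (int_vec k)" using cube_mono[of \<theta> 2] \<theta> by auto
      then show ?thesis using weight_high_ge[OF a] by (intro mult_right_mono ennreal_leI) auto
    qed (simp add: lift_def)
  qed
  also have "\<dots> = ennreal (weight_high lam a b k) * (\<integral>\<^sup>+x. pn q (lift \<theta> k h x) \<partial>lborel)"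
    by (rule nn_integral_cmult) measurable
  also have "(\<integral>\<^sup>+x. pn q (lift \<theta> k h x) \<partial>lborel) =
     ennreal (\<bar>\<theta>\<bar> ^ DIM(real ^ 'd)) * (\<integral>\<^sup>+y. pn q (lift \<theta> k h (int_vec k + \<theta> *\<^sub>R y)) \<partial>lborel)"
    by (rule nn_integral_lborel_affine) (measurable, use \<theta>0 in simp)
  also have "(\<integral>\<^sup>+y. pn q (lift \<theta> k h (int_vec k + \<theta> *\<^sub>R y)) \<partial>lborel) = (\<integral>\<^sup>+y. pn q (h y) * indicator (cube 1 0) y \<partial>lborel)"
    unfolding lift_eq[OF \<theta>0] by (rule nn_integral_cong) (use \<theta>0 in \<open>auto simp: indicator_def\<close>)
  also have "\<dots> = (\<integral>\<^sup>+y. pn q (h y) \<partial>unit_cube)" by (simp add: nn_integral_leb_on)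
  finally show ?thesis using \<theta>0 weight_high_pos[of lam a b k] by (simp add: ennreal_mult mult.assoc)
qed

lemma local_integral_le:
  fixes k :: "int ^ 'd" and h :: "real ^ 'd \<Rightarrow> ennreal"
  assumes a: "a > 0" "lam > 0" and [measurable]: "h \<in> borel_fun"
  shows "(\<integral>\<^sup>+x. h x * indicator (cube 4 (int_vec k)) x \<partial>lborel) \<le>
    ennreal (1 / weight_low lam a b k) * (\<integral>\<^sup>+x. h x \<partial>weight_measure lam a b)"
proof -
  let ?w = "weight_low lam a b k"
  have w: "?w > 0" by (rule weight_low_pos)
  have "(\<integral>\<^sup>+x. h x * indicator (cube 4 (int_vec k)) x \<partial>lborel) \<le>
    (\<integral>\<^sup>+x. ennreal (1 / ?w) * (ennreal (weight_density lam a b x) * h x) \<partial>lborel)"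
  proof (rule nn_integral_mono)
    fix x
    show "h x * indicator (cube 4 (int_vec k)) x \<le> ennreal (1 / ?w) * (ennreal (weight_density lam a b x) * h x)"
    proof (cases "x \<in> cube 4 (int_vec k)")
      case True
      have "1 \<le> 1 / ?w * weight_density lam a b x" using weight_low_le[OF a True, of b] w by (simp add: field_simps)
      then have "1 \<le> ennreal (1 / ?w) * ennreal (weight_density lam a b x)"
        using w by (simp add: ennreal_mult'[symmetric])
      from mult_right_mono[OF this, of "h x"] show ?thesis using True by (simp add: mult.assoc)
    qed simp
  qed
  also have "\<dots> = ennreal (1 / ?w) * (\<integral>\<^sup>+x. ennreal (weight_density lam a b x) * h x \<partial>lborel)"
    by (rule nn_integral_cmult) measurable
  finally show ?thesis by (simp add: nn_integral_weight)
qed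

text \<open>The operator acts on the whole weighted L_q space, so the pieces are needed in periodic
  L_q without any Sobolev regularity. Folding changes nothing on the open cube, and the boundary is
  a null set.\<close>

lemma localized_Lp_per:
  fixes f :: "real ^ 'd \<Rightarrow> complex" and \<phi> :: "int ^ 'd \<Rightarrow> real ^ 'd \<Rightarrow> real"
  assumes part: "smooth_partition r p \<theta> \<phi>" and \<theta>: "1 < \<theta>" "\<theta> < 2" and a: "a > 0" "lam > 0" and q: "q > 0"
    and f: "f \<in> Lp q (weight_measure lam a b)"
  shows "(\<lambda>y. localized \<phi> k f (\<theta> *\<^sub>R y)) \<in> Lp_per 1 q"
proof -
  let ?u = "\<lambda>y. localized \<phi> k f (\<theta> *\<^sub>R y)" and ?c = "int_vec k :: real ^ 'd"
  have \<theta>0: "\<theta> > 0" using \<theta> by simp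
  have [measurable]: "f \<in> borel_fun" using f by (simp add: Lp_iff measurable_weight)
  have "smooth (\<phi> k)" using part unfolding smooth_partition_def test_function_def by blast
  then have [measurable]: "\<phi> k \<in> borel_fun" by (rule smooth_borel)
  have um: "?u \<in> borel_fun" unfolding localized_def by measurable
  have "(\<integral>\<^sup>+y. pn q (?u y) * indicator (cube 1 0) y \<partial>lborel) \<le>
    (\<integral>\<^sup>+y. pn q (f (?c + \<theta> *\<^sub>R y)) * indicator (cube 4 ?c) (?c + \<theta> *\<^sub>R y) \<partial>lborel)"
  proof (rule nn_integral_mono)
    fix y :: "real ^ 'd"
    have p01: "0 \<le> \<phi> k x" "\<phi> k x \<le> 1" for x using part unfolding smooth_partition_def by auto
    have "pn q (?u y) \<le> pn q (f (?c + \<theta> *\<^sub>R y))"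
      unfolding pn_def localized_def norm_mult
      using p01[of "\<theta> *\<^sub>R y + ?c"] q by (intro ennreal_leI powr_mono2) (auto simp: add.commute intro: mult_left_le)
    moreover have "?c + \<theta> *\<^sub>R y \<in> cube 4 ?c" if "y \<in> cube 1 0"
    proof -
      have "?c + \<theta> *\<^sub>R y \<in> cube \<theta> ?c" using that in_cube_scale[OF \<theta>0, of "?c + \<theta> *\<^sub>R y" ?c] \<theta>0 by simp
      then show ?thesis using cube_mono[of \<theta> 4 ?c] \<theta> by auto
    qed
    ultimately show "pn q (?u y) * indicator (cube 1 0) y \<le> pn q (f (?c + \<theta> *\<^sub>R y)) * indicator (cube 4 ?c) (?c + \<theta> *\<^sub>R y)"
      by (auto simp: indicator_def)
  qed
  also have "\<dots> \<le> ennreal (\<bar>\<theta>\<bar> ^ DIM(real ^ 'd)) * (\<integral>\<^sup>+y. pn q (f (?c + \<theta> *\<^sub>R y)) * indicator (cube 4 ?c) (?c + \<theta> *\<^sub>R y) \<partial>lborel)"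
    using mult_right_mono[of 1 "ennreal (\<bar>\<theta>\<bar> ^ DIM(real ^ 'd))"] \<theta> by (simp add: one_le_power)
  also have "\<dots> = (\<integral>\<^sup>+x. pn q (f x) * indicator (cube 4 ?c) x \<partial>lborel)"
    by (rule nn_integral_lborel_affine[symmetric]) (measurable, use \<theta>0 in simp)
  also have "\<dots> \<le> ennreal (1 / weight_low lam a b k) * (\<integral>\<^sup>+x. pn q (f x) \<partial>weight_measure lam a b)"
    by (rule local_integral_le[OF a]) measurable
  also have "\<dots> < \<infinity>" using f by (simp add: Lp_iff ennreal_mult_less_top)
  finally have "?u \<in> Lp q unit_cube" using um by (simp add: Lp_leb_on_iff)
  moreover have "AE y in unit_cube. ?u (rd y) = ?u y"
    by (rule AE_cube_leb_on) (auto simp: space_leb_on rd_interior)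
  ultimately show ?thesis unfolding Lp_per_def using periodic_rd[of ?u] by blast
qed

section \<open>The assembled operator\<close>

locale hc_setting =
  fixes lam a b p q \<theta> :: real and r :: nat
    and A :: "nat \<Rightarrow> (real ^ 'd \<Rightarrow> complex) \<Rightarrow> real ^ 'd \<Rightarrow> complex"
    and \<phi> :: "int ^ 'd \<Rightarrow> real ^ 'd \<Rightarrow> real"
  assumes lam: "lam > 1" and a: "a > 0" and r: "r \<ge> 1" and q: "1 \<le> q" and qp: "q < p"
    and \<theta>: "1 < \<theta>" "\<theta> < 2" and part: "smooth_partition r p \<theta> \<phi>"
    and A_linear: "\<And>m. m \<ge> 1 \<Longrightarrow> linear_operator unit_cube (Lp_per 1 q) (A m)"
    and A_rank: "\<And>m. m \<ge> 1 \<Longrightarrow> rank_le unit_cube (Lp_per 1 q) m (A m)"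
    and A_error: "\<exists>C. \<forall>m\<ge>1. \<forall>f \<in> sobolev_per 1 r p.
           Lp_norm q unit_cube (\<lambda>x. f x - A m f x)
             \<le> C * rate CARD('d) r (real m) * sobolev_norm r p unit_cube f"
begin

abbreviation \<mu> :: "(real ^ 'd) measure" where "\<mu> \<equiv> weight_measure lam a b"

definition loc :: "int ^ 'd \<Rightarrow> (real ^ 'd \<Rightarrow> complex) \<Rightarrow> real ^ 'd \<Rightarrow> complex" where
  "loc k f = (\<lambda>y. localized \<phi> k f (\<theta> *\<^sub>R y))"

lemma \<theta>0: "\<theta> > 0" using \<theta> by simp
lemma lam0: "lam > 0" using lam by simp
lemma q0: "q > 0" "q \<ge> 0" using q by auto
lemma p0: "p > 0" "p \<ge> 1" using q qp by auto

lemma loc_Lp_per: "f \<in> Lp q \<mu> \<Longrightarrow> loc k f \<in> Lp_per 1 q"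
  unfolding loc_def by (rule localized_Lp_per[OF part \<theta> a lam0 q0(1)])

lemma op_linear: "linear_operator unit_cube (Lp_per 1 q) (op_at_real A m)"
proof (cases "m < 1")
  case True
  have "(\<lambda>_. 0) \<in> (Lp_per 1 q :: (real ^ 'd \<Rightarrow> complex) set)"
    unfolding Lp_per_def by (auto simp: Lp_zero periodic_def intro!: exI[of _ "\<lambda>_. 0"])
  then show ?thesis using True unfolding linear_operator_def by (simp add: op_at_real_def)
next
  case False
  then have "nat \<lfloor>m\<rfloor> \<ge> 1" by linarith
  from A_linear[OF this] False show ?thesis unfolding linear_operator_def op_at_real_def by simp
qed

lemma op_rank:
  "\<exists>B. finite B \<and> card B \<le> nat \<lfloor>m\<rfloor> \<and>
    (\<forall>g\<in>Lp_per 1 q. \<exists>c. AE x in unit_cube. op_at_real A m g x = (\<Sum>h\<in>B. c h * h x))"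
proof (cases "m < 1")
  case True
  then show ?thesis by (intro exI[of _ "{}"]) (auto simp: op_at_real_def)
next
  case False
  then have m: "nat \<lfloor>m\<rfloor> \<ge> 1" by linarith
  obtain B where B: "B \<subseteq> A (nat \<lfloor>m\<rfloor>) ` Lp_per 1 q" "finite B" "card B \<le> nat \<lfloor>m\<rfloor>"
    "\<forall>g \<in> A (nat \<lfloor>m\<rfloor>) ` Lp_per 1 q. \<exists>c. AE x in unit_cube. g x = (\<Sum>h\<in>B. c h * h x)"
    using A_rank[OF m] unfolding rank_le_def dim_at_most_def by blast
  have "op_at_real A m g = A (nat \<lfloor>m\<rfloor>) g" for g using False by (simp add: op_at_real_def fun_eq_iff)
  then show ?thesis using B by (intro exI[of _ B]) simp
qed

lemma Lp_per_measurable: "h \<in> Lp_per 1 q \<Longrightarrow> h \<in> borel_measurable unit_cube"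
  by (simp add: Lp_per_def Lp_iff)

lemma lift_Lp:
  assumes "h \<in> Lp q unit_cube" shows "lift \<theta> k h \<in> Lp q \<mu>"
proof -
  have h: "h \<in> borel_measurable unit_cube" "(\<integral>\<^sup>+y. pn q (h y) \<partial>unit_cube) < \<infinity>"
    using assms by (auto simp: Lp_iff)
  have "(\<integral>\<^sup>+x. pn q (lift \<theta> k h x) \<partial>\<mu>) < \<infinity>"
    using h(2) by (intro le_less_trans[OF lift_integral[OF \<theta> a lam0 h(1)]]) (simp add: ennreal_mult_less_top)
  then show ?thesis using lift_measurable[OF \<theta>0 h(1)] by (simp add: Lp_iff measurable_weight)
qed

definition active :: "real \<Rightarrow> real \<Rightarrow> (int ^ 'd) set" where
  "active \<delta> n = {k. norm (int_vec k) < xi lam r \<delta> n}"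

lemma finite_active: "finite (active \<delta> n)"
proof -
  have "active \<delta> n \<subseteq> {k :: int ^ 'd. \<exists>y\<in>cball 0 (xi lam r \<delta> n). y \<in> cube 0 (int_vec k)}"
    unfolding active_def by (auto simp: cube_def intro!: bexI[of _ "int_vec _"])
  then show ?thesis by (rule finite_subset) (rule finite_int_bounded[OF bounded_cball])
qed

abbreviation lr :: "real \<Rightarrow> real \<Rightarrow> int ^ 'd \<Rightarrow> real" where "lr \<equiv> local_rank lam a r"

abbreviation asm_op :: "real \<Rightarrow> real \<Rightarrow> (real ^ 'd \<Rightarrow> complex) \<Rightarrow> real ^ 'd \<Rightarrow> complex" where
  "asm_op \<equiv> assembled_op A \<phi> \<theta> lam a r"

lemma assembled_eq:
  "asm_op \<delta> n f = (\<lambda>x. \<Sum>k\<in>active \<delta> n. lift \<theta> k (op_at_real A (lr \<delta> n k) (loc k f)) x)"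
  by (rule ext) (simp add: assembled_op_def active_def lift_def dilated_op_def loc_def)

lemma op_Lp_per: "g \<in> Lp_per 1 q \<Longrightarrow> op_at_real A m g \<in> Lp_per 1 q"
  using op_linear[of m] unfolding linear_operator_def by blast

lemma Lp_per_Lp: "g \<in> Lp_per 1 q \<Longrightarrow> g \<in> Lp q unit_cube"
  by (simp add: Lp_per_def)

lemma lift_AE_cong:
  assumes "AE y in unit_cube. g y = h y"
  shows "AE x in \<mu>. lift \<theta> k g x = lift \<theta> k h x"
  unfolding AE_weight using lift_AE[OF \<theta>0 assms, of k]
  by eventually_elim (auto simp: lift_def indicator_def)

lemma lift_add: "lift \<theta> k (\<lambda>y. g y + h y) x = lift \<theta> k g x + lift \<theta> k h x"
  by (simp add: lift_def distrib_left)

lemma lift_cmult: "lift \<theta> k (\<lambda>y. c * g y) x = c * lift \<theta> k g x"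
  by (simp add: lift_def mult_ac)

text \<open>Each local operator is linear and well defined only modulo null sets; since finitely
  many cubes are active, the exceptional sets can be united.\<close>

lemma assembled_linear: "linear_operator \<mu> (Lp q \<mu>) (asm_op \<delta> n)"
  unfolding linear_operator_def
proof (intro conjI ballI allI impI)
  let ?O = "\<lambda>k. op_at_real A (lr \<delta> n k)"
  note op = op_linear[unfolded linear_operator_def]
  fix f assume f: "f \<in> Lp q \<mu>"
  show "asm_op \<delta> n f \<in> Lp q \<mu>"
    unfolding assembled_eq by (intro Lp_sum lift_Lp Lp_per_Lp op_Lp_per loc_Lp_per f q0)
  show "AE x in \<mu>. asm_op \<delta> n (\<lambda>y. c * f y) x = c * asm_op \<delta> n f x" for c
  proof -
    have "loc k (\<lambda>y. c * f y) = (\<lambda>y. c * loc k f y)" for k by (simp add: loc_def localized_def mult.assoc)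
    then have "AE x in \<mu>. lift \<theta> k (?O k (loc k (\<lambda>y. c * f y))) x = c * lift \<theta> k (?O k (loc k f)) x" for k
      unfolding lift_cmult[symmetric] using op loc_Lp_per[OF f] by (simp only:) (rule lift_AE_cong, blast)
    then have "AE x in \<mu>. \<forall>k\<in>active \<delta> n. lift \<theta> k (?O k (loc k (\<lambda>y. c * f y))) x = c * lift \<theta> k (?O k (loc k f)) x"
      by (intro AE_finite_allI finite_active)
    then show ?thesis unfolding assembled_eq by eventually_elim (simp add: sum_distrib_left)
  qed
  fix g assume g: "g \<in> Lp q \<mu>"
  show "AE x in \<mu>. asm_op \<delta> n (\<lambda>y. f y + g y) x = asm_op \<delta> n f x + asm_op \<delta> n g x"
  proof -
    have "loc k (\<lambda>y. f y + g y) = (\<lambda>y. loc k f y + loc k g y)" for k by (simp add: loc_def localized_def distrib_right)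
    then have "AE x in \<mu>. lift \<theta> k (?O k (loc k (\<lambda>y. f y + g y))) x = lift \<theta> k (?O k (loc k f)) x + lift \<theta> k (?O k (loc k g)) x" for k
      unfolding lift_add[symmetric] using op loc_Lp_per[OF f] loc_Lp_per[OF g] by (simp only:) (rule lift_AE_cong, blast)
    then have "AE x in \<mu>. \<forall>k\<in>active \<delta> n. lift \<theta> k (?O k (loc k (\<lambda>y. f y + g y))) x = lift \<theta> k (?O k (loc k f)) x + lift \<theta> k (?O k (loc k g)) x"
      by (intro AE_finite_allI finite_active)
    then show ?thesis unfolding assembled_eq by eventually_elim (simp add: sum.distrib)
  qed
  assume eq: "AE x in \<mu>. f x = g x"
  show "AE x in \<mu>. asm_op \<delta> n f x = asm_op \<delta> n g x"
  proof -
    have "AE y in unit_cube. loc k f y = loc k g y" for k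
    proof -
      have "AE y in lborel. f (int_vec k + \<theta> *\<^sub>R y) = g (int_vec k + \<theta> *\<^sub>R y)"
        using eq unfolding AE_weight by (rule AE_lborel_affine[rotated]) (use \<theta>0 in simp)
      then have "AE y in lborel. y \<in> cube 1 0 \<longrightarrow> loc k f y = loc k g y"
        by eventually_elim (simp add: loc_def localized_def add.commute)
      then show ?thesis by (simp add: AE_leb_on)
    qed
    then have "AE x in \<mu>. lift \<theta> k (?O k (loc k f)) x = lift \<theta> k (?O k (loc k g)) x" for k
      using op loc_Lp_per[OF f] loc_Lp_per[OF g] by (intro lift_AE_cong) blast
    then have "AE x in \<mu>. \<forall>k\<in>active \<delta> n. lift \<theta> k (?O k (loc k f)) x = lift \<theta> k (?O k (loc k g)) x"
      by (intro AE_finite_allI finite_active)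
    then show ?thesis unfolding assembled_eq by eventually_elim simp
  qed
qed

text \<open>Generators are indexed by pairs of a cube and a local generator, so their number is the
  sum of the local ranks even if some coincide after lifting.\<close>

lemma assembled_rank:
  assumes n: "n \<ge> 1" and pos: "\<And>k. lr \<delta> n k \<ge> 0"
    and budget: "(\<Sum>k\<in>active \<delta> n. lr \<delta> n k) \<le> n"
  shows "rank_le \<mu> (Lp q \<mu>) (nat \<lfloor>n\<rfloor>) (asm_op \<delta> n)"
proof -
  let ?K = "active \<delta> n"
  have "\<forall>k. \<exists>B. finite B \<and> card B \<le> nat \<lfloor>lr \<delta> n k\<rfloor> \<and>
    (\<forall>g\<in>Lp_per 1 q. \<exists>c. AE x in unit_cube. op_at_real A (lr \<delta> n k) g x = (\<Sum>h\<in>B. c h * h x))"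
    by (rule allI, rule op_rank)
  then have "\<exists>B. \<forall>k. finite (B k) \<and> card (B k) \<le> nat \<lfloor>lr \<delta> n k\<rfloor> \<and>
    (\<forall>g\<in>Lp_per 1 q. \<exists>c. AE x in unit_cube. op_at_real A (lr \<delta> n k) g x = (\<Sum>h\<in>B k. c h * h x))"
    by (rule choice)
  then obtain B where "\<forall>k. finite (B k) \<and> card (B k) \<le> nat \<lfloor>lr \<delta> n k\<rfloor> \<and>
    (\<forall>g\<in>Lp_per 1 q. \<exists>c. AE x in unit_cube. op_at_real A (lr \<delta> n k) g x = (\<Sum>h\<in>B k. c h * h x))"
    by (rule exE)
  then have B: "\<And>k. finite (B k)" "\<And>k. card (B k) \<le> nat \<lfloor>lr \<delta> n k\<rfloor>"
    "\<And>k g. g \<in> Lp_per 1 q \<Longrightarrow> \<exists>c. AE x in unit_cube. op_at_real A (lr \<delta> n k) g x = (\<Sum>h\<in>B k. c h * h x)"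
    by auto
  have fin: "finite (Sigma ?K B)" using finite_active B(1) by auto
  have "real (card (Sigma ?K B)) = (\<Sum>k\<in>?K. real (card (B k)))" using finite_active B(1) by simp
  also have "\<dots> \<le> (\<Sum>k\<in>?K. lr \<delta> n k)"
  proof (rule sum_mono)
    fix k
    have "real (card (B k)) \<le> real (nat \<lfloor>lr \<delta> n k\<rfloor>)" using B(2) by simp
    also have "\<dots> \<le> lr \<delta> n k" using pos[of k] by simp
    finally show "real (card (B k)) \<le> lr \<delta> n k" .
  qed
  also have "\<dots> \<le> n" by (rule budget)
  finally have card: "card (Sigma ?K B) \<le> nat \<lfloor>n\<rfloor>" using n by (simp add: le_nat_iff le_floor_iff)
  show ?thesis unfolding rank_le_def
  proof (rule dim_at_most_span[OF fin card, where e="\<lambda>(k, h). lift \<theta> k h"])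
    fix g assume "g \<in> asm_op \<delta> n ` Lp q \<mu>"
    then obtain f where f: "f \<in> Lp q \<mu>" "g = asm_op \<delta> n f" by blast
    have "\<forall>k. \<exists>c. AE x in unit_cube. op_at_real A (lr \<delta> n k) (loc k f) x = (\<Sum>h\<in>B k. c h * h x)"
      by (rule allI, rule B(3)[OF loc_Lp_per[OF f(1)]])
    then have "\<exists>c. \<forall>k. AE x in unit_cube. op_at_real A (lr \<delta> n k) (loc k f) x = (\<Sum>h\<in>B k. c k h * h x)"
      by (rule choice)
    then obtain c where c: "\<And>k. AE x in unit_cube. op_at_real A (lr \<delta> n k) (loc k f) x = (\<Sum>h\<in>B k. c k h * h x)"
      by blast
    have "AE x in \<mu>. \<forall>k\<in>?K. lift \<theta> k (op_at_real A (lr \<delta> n k) (loc k f)) x = lift \<theta> k (\<lambda>y. \<Sum>h\<in>B k. c k h * h y) x"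
      by (intro AE_finite_allI finite_active lift_AE_cong c)
    then have "AE x in \<mu>. g x = (\<Sum>kh\<in>Sigma ?K B. c (fst kh) (snd kh) * (case kh of (k, h) \<Rightarrow> lift \<theta> k h) x)"
    proof eventually_elim
      case (elim x)
      have "g x = (\<Sum>k\<in>?K. lift \<theta> k (\<lambda>y. \<Sum>h\<in>B k. c k h * h y) x)" using elim by (simp add: f(2) assembled_eq)
      also have "\<dots> = (\<Sum>k\<in>?K. \<Sum>h\<in>B k. c k h * lift \<theta> k h x)"
        by (simp add: lift_def sum_distrib_left mult_ac)
      also have "\<dots> = (\<Sum>(k, h)\<in>Sigma ?K B. c k h * lift \<theta> k h x)"
        by (rule sum.Sigma) (use finite_active B(1) in auto)
      finally show ?case by (simp add: case_prod_unfold)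
    qed
    then show "\<exists>c. AE x in \<mu>. g x = (\<Sum>kh\<in>Sigma ?K B. c kh * (case kh of (k, h) \<Rightarrow> lift \<theta> k h) x)"
      by (rule exI[of _ "\<lambda>kh. c (fst kh) (snd kh)"])
  qed
qed

end

text \<open>Space is exhausted by growing cubes, so all sums over lattice cubes stay finite and a
  bound uniform in N suffices. The margin \<open>Suc N\<close> admits cubes centred just
  outside.\<close>

lemma nn_integral_cover:
  fixes h :: "real ^ 'd \<Rightarrow> ennreal" and g :: "int ^ 'd \<Rightarrow> real ^ 'd \<Rightarrow> ennreal"
  assumes M: "sets M = sets borel" and [measurable]: "h \<in> borel_fun" "\<And>k. g k \<in> borel_fun"
    and le: "\<And>N x. (\<And>i. \<bar>x $ i\<bar> \<le> real N) \<Longrightarrow> h x \<le> (\<Sum>k\<in>int_box (Suc N). g k x)"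
    and X: "\<And>N. (\<Sum>k\<in>int_box N. \<integral>\<^sup>+x. g k x \<partial>M) \<le> X"
  shows "(\<integral>\<^sup>+x. h x \<partial>M) \<le> X"
proof -
  note [measurable_cong] = M
  define Q where "Q N = cube (2 * real N) (0 :: real ^ 'd)" for N :: nat
  have Q: "x \<in> Q N \<longleftrightarrow> (\<forall>i. \<bar>x $ i\<bar> \<le> real N)" for x N by (simp add: Q_def cube_def)
  have [measurable]: "Q N \<in> sets borel" for N unfolding Q_def by (rule cube_borel)
  have "h x = (SUP N. h x * indicator (Q N) x)" for x
  proof (rule antisym)
    obtain N where "norm x \<le> real N" using real_arch_simple by blast
    then have "x \<in> Q N" unfolding Q using component_le_norm_cart[of x] order_trans by blast
    then have "h x \<le> h x * indicator (Q N) x" by simp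
    then show "h x \<le> (SUP N. h x * indicator (Q N) x)" by (rule SUP_upper2[OF UNIV_I])
    show "(SUP N. h x * indicator (Q N) x) \<le> h x" by (rule SUP_least) (simp add: indicator_def)
  qed
  then have "(\<integral>\<^sup>+x. h x \<partial>M) = (\<integral>\<^sup>+x. (SUP N. h x * indicator (Q N) x) \<partial>M)" by simp
  also have "\<dots> = (SUP N. \<integral>\<^sup>+x. h x * indicator (Q N) x \<partial>M)"
  proof (rule nn_integral_monotone_convergence_SUP)
    show "incseq (\<lambda>N x. h x * indicator (Q N) x)"
    proof (rule incseq_SucI, rule le_funI)
      fix N x
      have "x \<in> Q N \<Longrightarrow> x \<in> Q (Suc N)" unfolding Q by (auto intro: order_trans)
      then show "h x * indicator (Q N) x \<le> h x * indicator (Q (Suc N)) x" by (auto simp: indicator_def)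
    qed
  qed measurable
  also have "\<dots> \<le> X"
  proof (rule SUP_least)
    fix N
    have "(\<integral>\<^sup>+x. h x * indicator (Q N) x \<partial>M) \<le> (\<integral>\<^sup>+x. (\<Sum>k\<in>int_box (Suc N). g k x) \<partial>M)"
      using le[of _ N] by (intro nn_integral_mono) (auto simp: indicator_def Q)
    also have "\<dots> = (\<Sum>k\<in>int_box (Suc N). \<integral>\<^sup>+x. g k x \<partial>M)" by (rule nn_integral_sum) measurable
    also have "\<dots> \<le> X" by (rule X)
    finally show "(\<integral>\<^sup>+x. h x * indicator (Q N) x \<partial>M) \<le> X" .
  qed
  finally show ?thesis .
qed

lemma cube_at_int_box:
  fixes x :: "real ^ 'd"
  assumes "t < 2" "\<And>i. \<bar>x $ i\<bar> \<le> real N" "x \<in> cube t (int_vec k)"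
  shows "k \<in> int_box (Suc N)"
  unfolding int_box_def mem_Collect_eq
proof
  fix i
  have "\<bar>x $ i - real_of_int (k $ i)\<bar> \<le> t / 2" using assms(3) unfolding cube_def int_vec_nth by blast
  then have "\<bar>real_of_int (k $ i)\<bar> < real N + 1" using assms(1) assms(2)[of i] by linarith
  then show "\<bar>k $ i\<bar> \<le> int (Suc N)" by linarith
qed

lemma weight_high_eq:
  "weight_high lam a b k = exp b ^ CARD('d) * (\<Prod>i\<in>UNIV. exp (weight_exponent lam a 0 0 (absc k i)))"
  for k :: "int ^ 'd"
proof -
  have "exp (- a * m + b) = exp b * exp (- a * m)" for m by (simp add: exp_add[symmetric] add.commute)
  then show ?thesis by (simp only: weight_high_def prod.distrib) (simp add: weight_exponent_def)
qed

text \<open>The special case s = D = 0 of the weight sum.\<close>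

lemma emeasure_weight_finite:
  assumes lam: "lam > 1" and a: "a > 0"
  shows "emeasure (weight_measure lam a b :: (real ^ 'd) measure) UNIV < \<infinity>"
proof -
  let ?M = "weight_measure lam a b :: (real ^ 'd) measure"
  obtain S where S: "S \<ge> 0" "\<And>N. (\<Sum>k\<in>(int_box N :: (int ^ 'd) set). \<Prod>i\<in>UNIV. exp (weight_exponent lam a 0 0 (absc k i))) \<le> S"
    using weight_sum_bound[OF lam a, of 0 0] a by auto
  define c where "c = measure lborel (cube 1 (0 :: real ^ 'd))"
  have c: "emeasure lborel (cube 1 (y :: real ^ 'd)) \<le> ennreal (2 ^ CARD('d))" for y
  proof -
    have "emeasure lborel (cube 1 y) = (\<Prod>b\<in>Basis. (((\<chi> i. y $ i + 1 / 2) - (\<chi> i. y $ i - 1 / 2)) :: real ^ 'd) \<bullet> b)"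
      unfolding cube_eq_cbox by (rule emeasure_lborel_cbox) (auto simp: Basis_vec_def inner_axis)
    also have "\<dots> = ennreal (\<Prod>b\<in>(Basis :: (real ^ 'd) set). 1)"
      by (intro arg_cong[where f=ennreal] prod.cong) (auto simp: Basis_vec_def inner_axis)
    finally show ?thesis by (simp add: ennreal_leI)
  qed
  have "(\<integral>\<^sup>+x. 1 \<partial>?M) \<le> ennreal (2 ^ CARD('d) * exp b ^ CARD('d) * S)"
  proof (rule nn_integral_cover[where g="\<lambda>k. indicator (cube 1 (int_vec k))"])
    fix N :: nat and x :: "real ^ 'd" assume x: "\<And>i. \<bar>x $ i\<bar> \<le> real N"
    let ?k = "\<chi> i. \<lfloor>x $ i + 1 / 2\<rfloor> :: int ^ 'd"
    have k: "x \<in> cube 1 (int_vec ?k)" unfolding cube_def mem_Collect_eq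
    proof
      fix i
      have "\<bar>y - real_of_int \<lfloor>y + 1 / 2\<rfloor>\<bar> \<le> 1 / 2" for y :: real by linarith
      from this[of "x $ i"] show "\<bar>x $ i - int_vec ?k $ i\<bar> \<le> 1 / 2" by (simp add: int_vec_nth)
    qed
    have kb: "?k \<in> int_box (Suc N)" by (rule cube_at_int_box[OF _ x k]) simp
    have "(1 :: ennreal) = indicator (cube 1 (int_vec ?k)) x" using k by simp
    also have "\<dots> \<le> (\<Sum>k\<in>int_box (Suc N). indicator (cube 1 (int_vec k)) x)"
      using member_le_sum[OF kb, of "\<lambda>k. indicator (cube 1 (int_vec k)) x :: ennreal"] finite_int_box' by auto
    finally show "(1 :: ennreal) \<le> (\<Sum>k\<in>int_box (Suc N). indicator (cube 1 (int_vec k)) x)" .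
  next
    fix N
    have "(\<integral>\<^sup>+x. indicator (cube 1 (int_vec k)) x \<partial>?M) \<le> ennreal (2 ^ CARD('d) * weight_high lam a b k)" for k :: "int ^ 'd"
    proof -
      have "(\<integral>\<^sup>+x. indicator (cube 1 (int_vec k)) x \<partial>?M) = (\<integral>\<^sup>+x. ennreal (weight_density lam a b x) * indicator (cube 1 (int_vec k)) x \<partial>lborel)"
        by (rule nn_integral_weight) measurable
      also have "\<dots> \<le> (\<integral>\<^sup>+x. ennreal (weight_high lam a b k) * indicator (cube 1 (int_vec k)) x \<partial>lborel)"
        using weight_high_ge[OF a, of lam _ k b] lam cube_mono[of 1 2 "int_vec k :: real ^ 'd"]
        by (intro nn_integral_mono) (auto simp: indicator_def intro!: ennreal_leI)
      also have "\<dots> = ennreal (weight_high lam a b k) * emeasure lborel (cube 1 (int_vec k :: real ^ 'd))"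
        by (simp add: nn_integral_cmult)
      also have "\<dots> \<le> ennreal (weight_high lam a b k) * ennreal (2 ^ CARD('d))" by (intro mult_left_mono c) simp
      finally show ?thesis using weight_high_pos[of lam a b k] by (simp add: ennreal_mult[symmetric] mult.commute)
    qed
    then have "(\<Sum>k\<in>int_box N. \<integral>\<^sup>+x. indicator (cube 1 (int_vec k)) x \<partial>?M) \<le> (\<Sum>k\<in>(int_box N :: (int ^ 'd) set). ennreal (2 ^ CARD('d) * weight_high lam a b k))"
      by (rule sum_mono)
    also have "\<dots> = ennreal (\<Sum>k\<in>(int_box N :: (int ^ 'd) set). 2 ^ CARD('d) * weight_high lam a b k)"
      by (rule sum_ennreal) (auto intro!: mult_nonneg_nonneg less_imp_le[OF weight_high_pos])
    also have "\<dots> \<le> ennreal (2 ^ CARD('d) * exp b ^ CARD('d) * S)"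
      unfolding weight_high_eq mult.assoc sum_distrib_left[symmetric]
      by (intro ennreal_leI mult_left_mono S) auto
    finally show "(\<Sum>k\<in>int_box N. \<integral>\<^sup>+x. indicator (cube 1 (int_vec k)) x \<partial>?M) \<le> ennreal (2 ^ CARD('d) * exp b ^ CARD('d) * S)" .
  qed (auto simp: sets_weight_measure)
  then have "emeasure ?M (space ?M) < \<infinity>" by (simp add: le_less_trans)
  then show ?thesis by (simp add: space_weight_measure)
qed

text \<open>The total mass is finite, and |f|^q <= 1 + |f|^p.\<close>

lemma Lp_mono_weight:
  assumes lam: "lam > 1" and a: "a > 0" and qp: "0 < q" "q \<le> p"
    and f: "f \<in> Lp p (weight_measure lam a b :: (real ^ 'd) measure)"
  shows "f \<in> Lp q (weight_measure lam a b)"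
proof -
  let ?M = "weight_measure lam a b :: (real ^ 'd) measure"
  have [measurable]: "f \<in> borel_measurable ?M" using f by (simp add: Lp_iff)
  have "(\<integral>\<^sup>+x. pn q (f x) \<partial>?M) \<le> (\<integral>\<^sup>+x. 1 + pn p (f x) \<partial>?M)"
  proof (rule nn_integral_mono)
    fix x
    have "norm (f x) powr q \<le> 1 + norm (f x) powr p"
    proof (cases "norm (f x) \<le> 1")
      case True
      then have "norm (f x) powr q \<le> 1" using powr_mono2[of q "norm (f x)" 1] qp by simp
      then show ?thesis by (simp add: add_increasing2)
    next
      case False
      then have "norm (f x) powr q \<le> norm (f x) powr p" using qp by (intro powr_mono) auto
      then show ?thesis by simp
    qed
    then have "ennreal (norm (f x) powr q) \<le> ennreal (1 + norm (f x) powr p)" by (rule ennreal_leI)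
    then show "pn q (f x) \<le> 1 + pn p (f x)" by (simp add: pn_def)
  qed
  also have "\<dots> = emeasure ?M UNIV + (\<integral>\<^sup>+x. pn p (f x) \<partial>?M)"
    by (subst nn_integral_add) (auto simp: space_weight_measure)
  also have "\<dots> < \<infinity>" using f emeasure_weight_finite[OF lam a, of b, where 'd='d] by (simp add: Lp_iff)
  finally show ?thesis using f by (simp add: Lp_iff)
qed

lemma rate_pos: "n \<ge> 1 \<Longrightarrow> rate d r n > 0"
  by (simp add: rate_def)

section \<open>Error of the assembled operator\<close>

context hc_setting
begin

text \<open>The chosen weak derivative of order 0 agrees with f only almost everywhere, while the
  pieces are formed from f itself; order 0 is therefore represented by f.\<close>

lemma ball_family:
  assumes "f \<in> sobolev_ball r p \<mu>"
  obtains E where "weak_family r E" "E 0 = f" "(\<integral>\<^sup>+x. fam_pn r p E x \<partial>\<mu>) \<le> 1"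
proof -
  define E where "E k = (if k = 0 then f else weak_deriv p \<mu> k f)" for k
  have f: "f \<in> sobolev r p \<mu>" "sobolev_norm r p \<mu> f \<le> 1" using assms unfolding sobolev_ball_def by auto
  have int: "interior (space \<mu>) = UNIV" by (simp add: space_weight_measure)
  have fp: "f \<in> Lp p \<mu>" using f(1) unfolding sobolev_def by blast
  have ex: "\<exists>g\<in>Lp p \<mu>. has_weak_deriv UNIV k f g" if "k \<in> multi_idx r" for k
    using f(1) that unfolding sobolev_def multi_idx_def int by blast
  have wd: "weak_deriv p \<mu> k f \<in> Lp p \<mu> \<and> has_weak_deriv UNIV k f (weak_deriv p \<mu> k f)" if "k \<in> multi_idx r" for k
    unfolding weak_deriv_def int
    by (rule someI_ex[where P="\<lambda>g. g \<in> Lp p \<mu> \<and> has_weak_deriv UNIV k f g"]) (use ex[OF that] in blast)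
  have z: "has_weak_deriv UNIV 0 f f"
  proof -
    have loc: "locally_integrable UNIV f" using ex[of 0] has_weak_deriv_local(1) by (auto simp: multi_idx_def)
    have "js = []" if "\<And>i. count_list js i = (0 :: nat ^ 'd) $ i" for js
      using that by (cases js) (force split: if_splits)+
    note js = this
    show ?thesis
    proof (rule has_weak_derivI[OF loc loc])
      fix \<psi> :: "real ^ 'd \<Rightarrow> real" and us :: "'d list"
      assume "\<And>i. count_list us i = (0 :: nat ^ 'd) $ i"
      then have "us = []" by (rule js)
      then show "(LINT x|lborel. f x * of_real (iter_partial us \<psi> x)) =
        (- 1) ^ (\<Sum>i\<in>UNIV. (0 :: nat ^ 'd) $ i) * (LINT x|lborel. f x * of_real (\<psi> x))" by simp
    qed
  qed
  have E: "E k \<in> Lp p \<mu>" "has_weak_deriv UNIV k f (E k)" if "k \<in> multi_idx r" for k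
    using wd[OF that] z fp by (auto simp: E_def)
  have Em: "E k \<in> borel_fun" if "k \<in> multi_idx r" for k
    using E(1)[OF that] by (simp add: Lp_iff measurable_weight)
  have w: "weak_family r E" by (rule weak_familyI[OF E(2) Em])
  have "(\<integral>\<^sup>+x. fam_pn r p E x \<partial>\<mu>) = (\<Sum>k\<in>multi_idx r. \<integral>\<^sup>+x. pn p (E k x) \<partial>\<mu>)"
    unfolding fam_pn_def by (rule nn_integral_sum) (use Em in \<open>auto simp: measurable_weight\<close>)
  also have "\<dots> = ennreal (sobolev_norm r p \<mu> f powr p)"
  proof (rule sobolev_norm_eq[OF part \<theta>0 p0(1), symmetric])
    show "AE x in \<mu>. P x" if "AE x in lborel. x \<in> interior (space \<mu>) \<longrightarrow> P x" for P
      using that unfolding AE_weight int by simp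
  qed (use E int in auto)
  also have "\<dots> \<le> ennreal (1 powr p)" using f(2) p0 by (intro ennreal_leI powr_mono2) (auto simp: sobolev_norm_nonneg)
  finally show ?thesis using w by (intro that[of E]) (auto simp: E_def)
qed

lemma ball_Lp: "f \<in> sobolev_ball r p \<mu> \<Longrightarrow> f \<in> Lp q \<mu>"
  by (rule Lp_mono_weight[OF lam a q0(1) less_imp_le[OF qp]]) (simp add: sobolev_ball_def sobolev_def)

text \<open>For an index below 1 the operator is 0 and the error is the piece itself, whose L_q norm
  is at most its L_p norm on a cube of measure 1; the value 1 of the capped rate covers this
  case.\<close>

lemma local_error:
  obtains C where "C \<ge> 0"
    "\<And>E k m B. weak_family r E \<Longrightarrow> E 0 \<in> Lp q \<mu> \<Longrightarrow> B \<ge> 0 \<Longrightarrow>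
      local_mass r p E k \<le> ennreal B \<Longrightarrow>
      (\<integral>\<^sup>+y. pn q (loc k (E 0) y - op_at_real A m (loc k (E 0)) y) \<partial>unit_cube) \<le>
        ennreal ((C * capped_rate CARD('d) r m * B powr (1 / p)) powr q)"
proof -
  obtain C1 where C1a: "C1 \<ge> 0" and C1b: "\<And>(E :: nat ^ 'd \<Rightarrow> real ^ 'd \<Rightarrow> complex) k B. weak_family r E \<Longrightarrow> B \<ge> 0 \<Longrightarrow>
      local_mass r p E k \<le> ennreal B \<Longrightarrow>
      (\<lambda>y. localized \<phi> k (E 0) (\<theta> *\<^sub>R y)) \<in> sobolev_per 1 r p \<and>
      sobolev_norm r p unit_cube (\<lambda>y. localized \<phi> k (E 0) (\<theta> *\<^sub>R y)) \<le> C1 * B powr (1 / p) \<and>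
      (\<integral>\<^sup>+y. pn p (localized \<phi> k (E 0) (\<theta> *\<^sub>R y)) \<partial>lborel) \<le> ennreal ((C1 * B powr (1 / p)) powr p)"
    by (rule local_sobolev[OF part \<theta> p0(2) r], rule that; assumption)
  have C1: "C1 \<ge> 0" "\<And>E k B. weak_family r E \<Longrightarrow> B \<ge> 0 \<Longrightarrow>
      local_mass r p E k \<le> ennreal B \<Longrightarrow>
      loc k (E 0) \<in> sobolev_per 1 r p \<and>
      sobolev_norm r p unit_cube (loc k (E 0)) \<le> C1 * B powr (1 / p) \<and>
      (\<integral>\<^sup>+y. pn p (loc k (E 0) y) \<partial>lborel) \<le> ennreal ((C1 * B powr (1 / p)) powr p)"
    unfolding loc_def by (rule C1a, rule C1b)
  obtain C2 where C2: "\<And>m f. m \<ge> 1 \<Longrightarrow> f \<in> sobolev_per 1 r p \<Longrightarrow>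
     Lp_norm q unit_cube (\<lambda>x. f x - A m f x) \<le> C2 * rate CARD('d) r (real m) * sobolev_norm r p unit_cube f"
    using A_error by blast
  \<comment> \<open>The maximum with 1 serves the case of the zero operator; the sign of
    \<open>C2\<close> is unknown, hence the absolute value.\<close>
  define C where "C = max 1 \<bar>C2\<bar> * C1"
  show ?thesis
  proof
    show "C \<ge> 0" using C1(1) by (simp add: C_def)
    fix E k m B
    assume w: "weak_family r E" and E0: "E 0 \<in> Lp q \<mu>" and B: "B \<ge> 0"
      and le: "local_mass r p E k \<le> ennreal B"
    let ?u = "loc k (E 0)" and ?Q = "unit_cube :: (real ^ 'd) measure"
    let ?s = "C1 * B powr (1 / p)"
    note u = C1(2)[OF w B le]
    have s0: "?s \<ge> 0" using C1(1) by simp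
    have up: "?u \<in> Lp_per 1 q" by (rule loc_Lp_per[OF E0])
    show "(\<integral>\<^sup>+y. pn q (?u y - op_at_real A m ?u y) \<partial>?Q) \<le>
        ennreal ((C * capped_rate CARD('d) r m * B powr (1 / p)) powr q)"
    proof (cases "m < 1")
      case True
      have fin: "(\<integral>\<^sup>+y. pn q (?u y) \<partial>?Q) < \<infinity>" using up by (simp add: Lp_per_def Lp_iff)
      define v where "v = enn2real (\<integral>\<^sup>+y. pn q (?u y) \<partial>?Q)"
      have v: "(\<integral>\<^sup>+y. pn q (?u y) \<partial>?Q) = ennreal v" "v \<ge> 0" using fin by (auto simp: v_def less_top)
      have [measurable]: "?u \<in> borel_measurable ?Q" by (rule Lp_per_measurable[OF up])
      have "ennreal (v powr (p / q)) \<le> ennreal (1 powr (p / q - 1)) * (\<integral>\<^sup>+y. ennreal ((norm (?u y) powr q) powr (p / q)) \<partial>?Q)"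
      proof (rule power_mean)
        show "emeasure ?Q (space ?Q) \<le> ennreal 1" by (simp add: emeasure_unit_cube)
        show "ennreal v \<le> (\<integral>\<^sup>+y. ennreal (norm (?u y) powr q) \<partial>?Q)" using v by (simp add: pn_def)
      qed (use qp q0 v in auto)
      also have "\<dots> = (\<integral>\<^sup>+y. pn p (?u y) \<partial>?Q)" using q0 by (simp add: powr_powr pn_def)
      also have "\<dots> \<le> (\<integral>\<^sup>+y. pn p (?u y) \<partial>lborel)"
        by (simp add: nn_integral_leb_on) (rule nn_integral_mono, simp add: indicator_def)
      also have "\<dots> \<le> ennreal (?s powr p)" using u by blast
      finally have "v powr (p / q) \<le> ?s powr p" by simp
      then have "(v powr (p / q)) powr (q / p) \<le> (?s powr p) powr (q / p)" using p0 q0 by (intro powr_mono2) auto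
      then have "v \<le> ?s powr q" using p0 q0 v by (simp add: powr_powr)
      also have "\<dots> \<le> (C * 1 * B powr (1 / p)) powr q"
        using s0 q0 C1(1) unfolding C_def by (intro powr_mono2) (auto intro!: mult_right_mono simp: mult_le_cancel_right1 le_max_iff_disj)
      finally show ?thesis using True v by (simp add: op_at_real_def ennreal_leI)
    next
      case False
      then have m: "nat \<lfloor>m\<rfloor> \<ge> 1" by linarith
      let ?R = "rate CARD('d) r (real (nat \<lfloor>m\<rfloor>))"
      have R: "?R > 0" using m by (intro rate_pos) simp
      have op: "op_at_real A m ?u = A (nat \<lfloor>m\<rfloor>) ?u" using False by (simp add: op_at_real_def fun_eq_iff)
      have "Lp_norm q ?Q (\<lambda>x. ?u x - A (nat \<lfloor>m\<rfloor>) ?u x) \<le> C2 * ?R * sobolev_norm r p ?Q ?u"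
        using u by (intro C2[OF m]) blast
      also have "\<dots> \<le> max 1 \<bar>C2\<bar> * ?R * ?s"
        using u R by (intro mult_mono) (auto simp: sobolev_norm_nonneg)
      also have "\<dots> = C * ?R * B powr (1 / p)" by (simp add: C_def mult_ac)
      finally have n: "Lp_norm q ?Q (\<lambda>x. ?u x - A (nat \<lfloor>m\<rfloor>) ?u x) \<le> C * ?R * B powr (1 / p)" .
      have "A (nat \<lfloor>m\<rfloor>) ?u \<in> Lp q ?Q" using op_Lp_per[OF up, of m] unfolding op by (rule Lp_per_Lp)
      then have "(\<lambda>x. ?u x - A (nat \<lfloor>m\<rfloor>) ?u x) \<in> Lp q ?Q"
        using Lp_add[OF Lp_per_Lp[OF up] Lp_cmult[of _ q ?Q "- 1"] q0(2)] by simp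
      from Lp_norm_powr[OF this q0(1)]
      have "(\<integral>\<^sup>+y. pn q (?u y - A (nat \<lfloor>m\<rfloor>) ?u y) \<partial>?Q) = ennreal (Lp_norm q ?Q (\<lambda>x. ?u x - A (nat \<lfloor>m\<rfloor>) ?u x) powr q)" ..
      also have "\<dots> \<le> ennreal ((C * ?R * B powr (1 / p)) powr q)"
        using n q0 by (intro ennreal_leI powr_mono2) (auto simp: Lp_norm_nonneg)
      finally show ?thesis using False by (simp add: op)
    qed
  qed
qed

text \<open>Index 0 yields the zero operator beyond the truncation radius, so that all cubes are
  treated by one formula.\<close>

definition op_index :: "real \<Rightarrow> real \<Rightarrow> int ^ 'd \<Rightarrow> real" where
  "op_index \<delta> n k = (if k \<in> active \<delta> n then lr \<delta> n k else 0)"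

text \<open>The partition of unity reassembles f from its pieces, and only the finitely many cubes
  containing x contribute.\<close>

lemma error_decomposition:
  "f x - asm_op \<delta> n f x =
    (\<Sum>k | x \<in> cube \<theta> (int_vec k). lift \<theta> k (\<lambda>y. loc k f y - op_at_real A (op_index \<delta> n k) (loc k f) y) x)"
proof -
  let ?F = "{k. x \<in> cube \<theta> (int_vec k)}"
  have F: "finite ?F" by (rule finite_cubes_at)
  have "lift \<theta> k (loc k f) x = f x * of_real (\<phi> k x)" if "k \<in> ?F" for k
    using that \<theta>0 by (simp add: lift_def loc_def localized_def)
  then have "(\<Sum>k\<in>?F. lift \<theta> k (loc k f) x) = f x * of_real (\<Sum>k\<in>?F. \<phi> k x)"
    by (simp add: sum_distrib_left)
  also have "(\<Sum>k\<in>?F. \<phi> k x) = 1" by (rule partition_sum[OF part F]) simp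
  finally have 1: "(\<Sum>k\<in>?F. lift \<theta> k (loc k f) x) = f x" by simp
  have "asm_op \<delta> n f x = (\<Sum>k\<in>active \<delta> n. lift \<theta> k (op_at_real A (lr \<delta> n k) (loc k f)) x)"
    by (simp add: assembled_eq)
  also have "\<dots> = (\<Sum>k\<in>?F. lift \<theta> k (op_at_real A (op_index \<delta> n k) (loc k f)) x)"
    by (rule sum.mono_neutral_cong[OF F finite_active]) (auto simp: lift_def op_index_def op_at_real_def)
  finally have 2: "asm_op \<delta> n f x = (\<Sum>k\<in>?F. lift \<theta> k (op_at_real A (op_index \<delta> n k) (loc k f)) x)" .
  show ?thesis unfolding 2 by (subst 1[symmetric]) (simp add: lift_def right_diff_distrib sum_subtractf)
qed

text \<open>The index on the cube at k is n \<open>rho\<close> exp(-(a \<delta> / r) |k|^lam), whose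
  power -r costs exp(a \<delta> |k|^lam). Beyond the truncation radius nothing is gained from the
  operator, but there \<delta> |k|^lam >= lam r log n, so n^r <= exp(\<delta> |k|^lam). The exponent
  (a + 1) \<delta> covers both.\<close>

lemma local_rate:
  assumes \<delta>: "\<delta> > 0" and rho: "rho CARD('d) lam a r \<delta> > 0" and le: "\<And>n k. n \<ge> 1 \<Longrightarrow> lr \<delta> n k \<le> n"
  obtains K where "K \<ge> 0" "\<And>n k. n \<ge> 1 \<Longrightarrow>
    capped_rate CARD('d) r (op_index \<delta> n k) \<le>
      K * exp ((a + 1) * \<delta> * norm (int_vec k) powr lam) * rate CARD('d) r n"
proof -
  let ?rho = "rho CARD('d) lam a r \<delta>" and ?e = "(CARD('d) - 1) * r"
  define K where "K = max 1 (2 powr real r * ?rho powr (- real r))"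
  have K: "K \<ge> 1" "K \<ge> 2 powr real r * ?rho powr (- real r)" by (auto simp: K_def)
  show ?thesis
  proof
    show "K \<ge> 0" using K by simp
    fix n :: real and k :: "int ^ 'd" assume n: "n \<ge> 1"
    let ?N = "norm (int_vec k :: real ^ 'd) powr lam"
    let ?L = "max 1 (ln n) ^ ?e"
    have L: "?L \<ge> 1" by (intro one_le_power) simp
    have dN: "\<delta> * ?N \<ge> 0" using \<delta> by simp
    have expo: "exp (a * \<delta> * ?N) \<le> exp ((a + 1) * \<delta> * ?N)" using dN by (simp add: algebra_simps)
    have core: "2 powr real r * lr \<delta> n k powr (- real r) * ?L \<le> K * exp ((a + 1) * \<delta> * ?N) * rate CARD('d) r n"
    proof -
      have "lr \<delta> n k powr (- real r) = ?rho powr (- real r) * n powr (- real r) * exp (- (a * \<delta> / real r) * ?N) powr (- real r)"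
        unfolding local_rank_def using rho n by (simp add: powr_mult)
      also have "exp (- (a * \<delta> / real r) * ?N) powr (- real r) = exp (a * \<delta> * ?N)"
        using r by (simp add: powr_def)
      finally have "2 powr real r * lr \<delta> n k powr (- real r) * ?L = (2 powr real r * ?rho powr (- real r)) * exp (a * \<delta> * ?N) * (n powr (- real r) * ?L)"
        by (simp add: mult_ac)
      also have "\<dots> \<le> K * exp ((a + 1) * \<delta> * ?N) * (n powr (- real r) * ?L)"
        using K expo by (intro mult_right_mono mult_mono) auto
      finally show ?thesis by (simp add: rate_def)
    qed
    have lpos: "lr \<delta> n k > 0" unfolding local_rank_def using rho n by simp
    consider (out) "k \<notin> active \<delta> n" | (small) "k \<in> active \<delta> n" "lr \<delta> n k < 1" | (big) "k \<in> active \<delta> n" "lr \<delta> n k \<ge> 1" by fastforce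
    then show "capped_rate CARD('d) r (op_index \<delta> n k) \<le>
      K * exp ((a + 1) * \<delta> * ?N) * rate CARD('d) r n"
    proof cases
      case out
      then have "xi lam r \<delta> n \<le> norm (int_vec k :: real ^ 'd)" by (simp add: active_def)
      then have "xi lam r \<delta> n powr lam \<le> ?N" using lam0 by (intro powr_mono2) (auto simp: xi_def)
      moreover have "xi lam r \<delta> n powr lam = lam * real r * ln n / \<delta>"
        unfolding xi_def using lam n \<delta> by (simp add: powr_powr)
      ultimately have "lam * real r * ln n \<le> \<delta> * ?N" using \<delta> by (simp add: field_simps)
      moreover have "1 * (real r * ln n) \<le> lam * (real r * ln n)" using lam n by (intro mult_right_mono) auto
      moreover have "1 * (\<delta> * ?N) \<le> (a + 1) * (\<delta> * ?N)" using a dN by (intro mult_right_mono) auto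
      ultimately have "real r * ln n \<le> (a + 1) * \<delta> * ?N" by (simp add: mult.assoc)
      then have "exp (real r * ln n) \<le> exp ((a + 1) * \<delta> * ?N)" by simp
      then have "n powr real r \<le> exp ((a + 1) * \<delta> * ?N)" using n by (simp add: powr_def)
      then have "n powr real r * n powr (- real r) \<le> exp ((a + 1) * \<delta> * ?N) * n powr (- real r)" by (intro mult_right_mono) auto
      then have 1: "1 \<le> exp ((a + 1) * \<delta> * ?N) * n powr (- real r)" using n by (simp add: powr_add[symmetric])
      have "1 * 1 * 1 \<le> K * (exp ((a + 1) * \<delta> * ?N) * n powr (- real r)) * ?L"
        using K 1 L by (intro mult_mono) auto
      then show ?thesis using out by (simp add: op_index_def rate_def mult_ac)
    next
      \<comment> \<open>An index below 1 has a power -r of at least 1, so the trivial bound already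
        has the required form.\<close>
      case small
      have "1 \<le> lr \<delta> n k powr (- real r)" using small(2) lpos r
        by (subst powr_minus_divide) (simp add: powr_le1)
      moreover have "1 \<le> 2 powr real r" by (simp add: ge_one_powr_ge_zero)
      ultimately have "1 * 1 * 1 \<le> 2 powr real r * lr \<delta> n k powr (- real r) * ?L" using L by (intro mult_mono) auto
      then show ?thesis using core small by (simp add: op_index_def)
    next
      \<comment> \<open>Rounding down at most halves an index that is at least 1; this is the factor
        2^r.\<close>
      case big
      let ?m = "real (nat \<lfloor>lr \<delta> n k\<rfloor>)"
      have m: "?m \<ge> 1" "lr \<delta> n k / 2 \<le> ?m" "?m \<le> lr \<delta> n k"
      proof -
        have "?m = real_of_int \<lfloor>lr \<delta> n k\<rfloor>" using big(2) by simp
        note e = this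
        show "?m \<ge> 1" unfolding e using big(2) by simp
          have "1 \<le> real_of_int \<lfloor>lr \<delta> n k\<rfloor>" using big(2) by (simp only: one_le_floor of_int_1_le_iff)
          then show "lr \<delta> n k / 2 \<le> ?m" unfolding e using real_of_int_floor_add_one_gt[of "lr \<delta> n k"] by linarith
          show "?m \<le> lr \<delta> n k" unfolding e by linarith
      qed
      have "?m powr (- real r) \<le> (lr \<delta> n k / 2) powr (- real r)" using m lpos by (intro powr_mono2') auto
      also have "\<dots> = 2 powr real r * lr \<delta> n k powr (- real r)"
        using lpos by (simp add: powr_divide powr_minus_divide field_simps)
      finally have 1: "?m powr (- real r) \<le> 2 powr real r * lr \<delta> n k powr (- real r)" .
      have "ln ?m \<le> ln n" using m(1) order_trans[OF m(3) le[OF n, of k]] by (intro ln_mono) linarith+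
      then have 2: "max 1 (ln ?m) ^ ?e \<le> ?L" by (intro power_mono) auto
      have "rate CARD('d) r ?m \<le> 2 powr real r * lr \<delta> n k powr (- real r) * ?L"
        unfolding rate_def using 1 2 by (intro mult_mono) auto
      then show ?thesis using core big by (simp add: op_index_def)
    qed
  qed
qed

text \<open>On each cube the error is bounded by a constant times the rate, exp((a + 1) \<delta>
  |k|^lam), and the lower weight to the power -1/p, which comes from comparing the local mass of the
  derivatives with the weighted one. After q-th powers and multiplication by the upper weight the
  sum over k converges because q/p < 1; overlapping cubes cost a constant.\<close>

lemma upper_bound:
  "\<exists>\<delta>2>0. \<forall>\<delta>. 0 < \<delta> \<and> \<delta> < \<delta>2 \<and> rho CARD('d) lam a r \<delta> > 0 \<and> (\<forall>n k. n \<ge> 1 \<longrightarrow> lr \<delta> n k \<le> n) \<longrightarrow>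
    (\<exists>C\<ge>0. \<forall>n\<ge>1. \<forall>f\<in>sobolev_ball r p \<mu>. Lp_norm q \<mu> (\<lambda>x. f x - asm_op \<delta> n f x) \<le> C * rate CARD('d) r n)"
proof -
  let ?d = "CARD('d)" and ?s = "q / p"
  \<comment> \<open>D0 \<delta> is the coefficient left after |k|^lam is bounded by d^lam times the
    sum of the coordinate powers; the threshold for \<delta> keeps it below a (1 - q/p) / 2.\<close>
  define D0 where "D0 = q * (a + 1) * real ?d powr lam"
  have D0: "D0 > 0" using q0 a by (simp add: D0_def)
  have s: "0 \<le> ?s" "?s < 1" using q0 qp p0 by auto
  obtain C0 where C0: "C0 \<ge> 0" "\<And>E k m B. weak_family r E \<Longrightarrow> E 0 \<in> Lp q \<mu> \<Longrightarrow> B \<ge> 0 \<Longrightarrow>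
      local_mass r p E k \<le> ennreal B \<Longrightarrow>
      (\<integral>\<^sup>+y. pn q (loc k (E 0) y - op_at_real A m (loc k (E 0)) y) \<partial>unit_cube) \<le>
        ennreal ((C0 * capped_rate CARD('d) r m * B powr (1 / p)) powr q)"
    by (rule local_error, rule that; assumption)
  show ?thesis
  proof (rule exI[of _ "a * (1 - ?s) / (2 * D0)"], intro conjI allI impI)
    show "a * (1 - ?s) / (2 * D0) > 0" using a s D0 by simp
    fix \<delta> assume "0 < \<delta> \<and> \<delta> < a * (1 - ?s) / (2 * D0) \<and> rho ?d lam a r \<delta> > 0 \<and> (\<forall>n k. n \<ge> 1 \<longrightarrow> lr \<delta> n k \<le> n)"
    then have \<delta>: "0 < \<delta>" "\<delta> < a * (1 - ?s) / (2 * D0)" and rho: "rho ?d lam a r \<delta> > 0" and le: "\<And>n k. n \<ge> 1 \<Longrightarrow> lr \<delta> n k \<le> n"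
      by auto
    obtain K where K: "K \<ge> 0" "\<And>n k. n \<ge> 1 \<Longrightarrow>
      capped_rate CARD('d) r (op_index \<delta> n k) \<le>
        K * exp ((a + 1) * \<delta> * norm (int_vec k) powr lam) * rate CARD('d) r n"
      by (rule local_rate[OF \<delta>(1) rho le], assumption, rule that; assumption)
    define D where "D = D0 * \<delta>"
    have D: "0 \<le> D" "D \<le> a * (1 - ?s) / 2"
      using D0 \<delta> by (auto simp: D_def field_simps)
    obtain S where S: "S \<ge> 0" "\<And>N. (\<Sum>k\<in>(int_box N :: (int ^ 'd) set). \<Prod>i\<in>UNIV. exp (weight_exponent lam a ?s D (absc k i))) \<le> S"
      using weight_sum_bound[OF lam a s D] by blast
    let ?Y = "\<lambda>k :: int ^ 'd. \<Prod>i\<in>UNIV. exp (weight_exponent lam a ?s D (absc k i))" and ?X = "\<lambda>k :: int ^ 'd. \<Prod>i\<in>UNIV. exp (D * absc k i powr lam)" and ?c = "real (3 ^ ?d) powr q"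
    \<comment> \<open>The Jacobian of the lift, and the powers of e^b left over from the upper
      weight times the lower weight to the power -q/p.\<close>
    define G where "G = \<theta> ^ ?d * exp (b * (1 - ?s)) ^ ?d"
    have G: "G > 0" using \<theta>0 by (simp add: G_def)
    define Z where "Z = ?c * (G * S)"
    have Z: "Z \<ge> 0" using G S by (simp add: Z_def)
    show "\<exists>C\<ge>0. \<forall>n\<ge>1. \<forall>f\<in>sobolev_ball r p \<mu>. Lp_norm q \<mu> (\<lambda>x. f x - asm_op \<delta> n f x) \<le> C * rate ?d r n"
    proof (intro exI[of _ "C0 * K * Z powr (1 / q)"] conjI allI impI ballI)
      show "0 \<le> C0 * K * Z powr (1 / q)" using C0 K by simp
      fix n :: real and f assume n: "n \<ge> 1" and f: "f \<in> sobolev_ball r p \<mu>"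
      have fq: "f \<in> Lp q \<mu>" by (rule ball_Lp[OF f])
      obtain E where E: "weak_family r E" "E 0 = f" "(\<integral>\<^sup>+x. fam_pn r p E x \<partial>\<mu>) \<le> 1" using ball_family[OF f] by blast
      define g where "g k = (\<lambda>y. loc k f y - op_at_real A (op_index \<delta> n k) (loc k f) y)" for k
      have gm: "g k \<in> borel_measurable unit_cube" for k
        unfolding g_def using Lp_per_measurable[OF loc_Lp_per[OF fq]] Lp_per_measurable[OF op_Lp_per[OF loc_Lp_per[OF fq]]]
        by (intro borel_measurable_diff)
      let ?R = "C0 * K * rate ?d r n"
      have R: "?R \<ge> 0" using C0 K rate_pos[OF n, of ?d r] by simp
      have piece: "(\<integral>\<^sup>+x. pn q (lift \<theta> k (g k) x) \<partial>\<mu>) \<le>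
        ennreal (?R powr q * G * ?Y k)" for k
      proof -
        let ?B = "1 / weight_low lam a b k"
        let ?N = "norm (int_vec k :: real ^ 'd) powr lam"
        have B: "?B > 0" using weight_low_pos[of lam a b k] by simp
        have "local_mass r p E k \<le> ennreal ?B * (\<integral>\<^sup>+x. fam_pn r p E x \<partial>\<mu>)"
          by (rule local_integral_le[OF a lam0 fam_pn_measurable[OF E(1)]])
        also have "\<dots> \<le> ennreal ?B * 1" by (intro mult_left_mono E(3)) simp
        finally have fam: "local_mass r p E k \<le> ennreal ?B" by simp
        have "(\<integral>\<^sup>+y. pn q (g k y) \<partial>unit_cube) \<le>
          ennreal ((C0 * capped_rate ?d r (op_index \<delta> n k) * ?B powr (1 / p)) powr q)"
          unfolding g_def E(2)[symmetric] by (rule C0(2)[OF E(1) _ less_imp_le[OF B] fam]) (use fq E(2) in simp)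
        also have "\<dots> \<le> ennreal ((C0 * (K * exp ((a + 1) * \<delta> * ?N) * rate ?d r n) * ?B powr (1 / p)) powr q)"
        proof (rule ennreal_leI, rule powr_mono2)
          have "0 \<le> capped_rate ?d r (op_index \<delta> n k)"
            by (simp add: rate_def)
          then show "0 \<le> C0 * capped_rate ?d r (op_index \<delta> n k) * ?B powr (1 / p)"
            using C0(1) by simp
          show "C0 * capped_rate ?d r (op_index \<delta> n k) * ?B powr (1 / p)
            \<le> C0 * (K * exp ((a + 1) * \<delta> * ?N) * rate ?d r n) * ?B powr (1 / p)"
            by (intro mult_right_mono mult_left_mono K(2)[OF n] C0(1)) simp
        qed (use q0 in simp)
        also have "(C0 * (K * exp ((a + 1) * \<delta> * ?N) * rate ?d r n) * ?B powr (1 / p)) powr q =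
          ?R powr q * exp (q * (a + 1) * \<delta> * ?N) * ?B powr ?s"
        proof -
          have "C0 * (K * exp ((a + 1) * \<delta> * ?N) * rate ?d r n) * ?B powr (1 / p) = ?R * exp ((a + 1) * \<delta> * ?N) * ?B powr (1 / p)"
            by (simp add: mult_ac)
          moreover have "(?R * exp ((a + 1) * \<delta> * ?N) * ?B powr (1 / p)) powr q = ?R powr q * exp ((a + 1) * \<delta> * ?N) powr q * (?B powr (1 / p)) powr q"
            using R by (simp add: powr_mult)
          moreover have "exp ((a + 1) * \<delta> * ?N) powr q = exp (q * (a + 1) * \<delta> * ?N)" by (simp add: powr_def mult_ac)
          moreover have "(?B powr (1 / p)) powr q = ?B powr ?s" by (simp add: powr_powr)
          ultimately show ?thesis by (simp only:)
        qed
        finally have loc_le: "(\<integral>\<^sup>+y. pn q (g k y) \<partial>unit_cube) \<le> ennreal (?R powr q * exp (q * (a + 1) * \<delta> * ?N) * ?B powr ?s)" .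
        have "exp (q * (a + 1) * \<delta> * ?N) \<le> exp (D * (\<Sum>i\<in>UNIV. absc k i powr lam))"
        proof -
          have "q * (a + 1) * \<delta> * ?N \<le> q * (a + 1) * \<delta> * (real ?d powr lam * (\<Sum>i\<in>UNIV. absc k i powr lam))"
            using q0 a \<delta> by (intro mult_left_mono norm_int_vec_powr_le lam0) auto
          then show ?thesis by (simp add: D_def D0_def mult_ac)
        qed
        also have "\<dots> = ?X k" by (simp add: sum_distrib_left exp_sum)
        finally have e1: "exp (q * (a + 1) * \<delta> * ?N) \<le> ?X k" .
        have e2: "?B powr ?s = (\<Prod>i\<in>UNIV. exp (?s * (a * (absc k i + 2) powr lam - b)))"
        proof -
          have "?B = (\<Prod>i\<in>UNIV. exp (a * (absc k i + 2) powr lam - b))"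
            unfolding weight_low_def divide_inverse mult_1_left prod_inversef[symmetric]
            by (intro prod.cong refl) (simp add: exp_minus[symmetric])
          then have "?B = exp (\<Sum>i\<in>UNIV. a * (absc k i + 2) powr lam - b)" by (simp add: exp_sum)
          then have "?B powr ?s = exp (?s * (\<Sum>i\<in>UNIV. a * (absc k i + 2) powr lam - b))" by (simp add: powr_def)
          then show ?thesis unfolding sum_distrib_left by (simp add: exp_sum)
        qed
        have "(\<integral>\<^sup>+x. pn q (lift \<theta> k (g k) x) \<partial>\<mu>) \<le> ennreal (weight_high lam a b k * \<theta> ^ ?d) * (\<integral>\<^sup>+y. pn q (g k y) \<partial>unit_cube)"
          by (rule lift_integral[OF \<theta> a lam0 gm])
        also have "\<dots> \<le> ennreal (weight_high lam a b k * \<theta> ^ ?d) * ennreal (?R powr q * ?X k * ?B powr ?s)"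
          by (intro mult_left_mono order_trans[OF loc_le] ennreal_leI mult_right_mono e1) auto
        also have "\<dots> = ennreal (weight_high lam a b k * \<theta> ^ ?d * (?R powr q * ?X k * ?B powr ?s))"
          using \<theta>0 weight_high_pos[of lam a b k] by (intro ennreal_mult[symmetric]) (auto intro!: mult_nonneg_nonneg prod_nonneg)
        also have "weight_high lam a b k * \<theta> ^ ?d * (?R powr q * ?X k * ?B powr ?s) =
          ?R powr q * \<theta> ^ ?d * (weight_high lam a b k * ?X k * ?B powr ?s)"
          by (simp add: mult_ac)
        \<comment> \<open>All factors are products over coordinates and merge into the exponents
          summed by \<open>weight_sum_bound\<close>.\<close>
        also have "weight_high lam a b k * ?X k * ?B powr ?s =
          (\<Prod>i\<in>UNIV. exp (b * (1 - ?s)) * exp (weight_exponent lam a ?s D (absc k i)))"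
          unfolding e2 weight_high_def prod.distrib[symmetric] exp_add[symmetric] weight_exponent_def
          by (intro prod.cong refl arg_cong[where f=exp]) (simp add: algebra_simps)
        also have "\<dots> = exp (b * (1 - ?s)) ^ ?d * ?Y k"
          unfolding prod.distrib by simp
        finally show ?thesis by (simp add: G_def mult_ac)
      qed
      have liftm[measurable]: "lift \<theta> k (g k) \<in> borel_fun" for k by (rule lift_measurable[OF \<theta>0 gm])
      have am: "asm_op \<delta> n f \<in> Lp q \<mu>" using assembled_linear[of \<delta> n] fq unfolding linear_operator_def by blast
      have diff: "(\<lambda>x. f x - asm_op \<delta> n f x) \<in> Lp q \<mu>" using Lp_add[OF fq Lp_cmult[OF am, of "- 1"] q0(2)] by simp
      have "(\<integral>\<^sup>+x. pn q (f x - asm_op \<delta> n f x) \<partial>\<mu>) \<le> ennreal (Z * ?R powr q)"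
      proof (rule nn_integral_cover[where g="\<lambda>k x. ennreal (?c) * pn q (lift \<theta> k (g k) x)"])
        show "(\<lambda>x. pn q (f x - asm_op \<delta> n f x)) \<in> borel_fun"
          using diff by (intro measurable_compose[OF _ pn_measurable]) (simp add: Lp_iff measurable_weight)
        fix N :: nat and x :: "real ^ 'd" assume x: "\<And>i. \<bar>x $ i\<bar> \<le> real N"
        let ?F = "{k. x \<in> cube \<theta> (int_vec k)}"
        have "pn q (f x - asm_op \<delta> n f x) = pn q (\<Sum>k\<in>?F. lift \<theta> k (g k) x)"
          unfolding error_decomposition g_def ..
        also have "\<dots> \<le> ennreal (?c) * (\<Sum>k\<in>?F. pn q (lift \<theta> k (g k) x))"
          by (rule pn_sum_le[OF finite_cubes_at card_cubes_at[OF \<theta>(2)] q0(2)])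
        also have "\<dots> \<le> ennreal (?c) * (\<Sum>k\<in>int_box (Suc N). pn q (lift \<theta> k (g k) x))"
          using cube_at_int_box[OF \<theta>(2) x] by (intro mult_left_mono sum_mono2 finite_int_box') auto
        finally show "pn q (f x - asm_op \<delta> n f x) \<le> (\<Sum>k\<in>int_box (Suc N). ennreal (?c) * pn q (lift \<theta> k (g k) x))"
          by (simp add: sum_distrib_left)
      next
        fix N
        have "(\<integral>\<^sup>+x. ennreal (?c) * pn q (lift \<theta> k (g k) x) \<partial>\<mu>) \<le>
          ennreal (?c * (?R powr q * G * ?Y k))" for k
        proof -
          have "(\<integral>\<^sup>+x. ennreal (?c) * pn q (lift \<theta> k (g k) x) \<partial>\<mu>) = ennreal (?c) * (\<integral>\<^sup>+x. pn q (lift \<theta> k (g k) x) \<partial>\<mu>)"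
            by (rule nn_integral_cmult) (simp add: measurable_weight)
          also have "\<dots> \<le> ennreal (?c) * ennreal (?R powr q * G * ?Y k)"
            by (intro mult_left_mono piece) simp
          finally show ?thesis by (simp add: ennreal_mult'[symmetric])
        qed
        note term_le = this
        have "(\<Sum>k\<in>(int_box N :: (int ^ 'd) set). \<integral>\<^sup>+x. ennreal (?c) * pn q (lift \<theta> k (g k) x) \<partial>\<mu>) \<le>
          (\<Sum>k\<in>(int_box N :: (int ^ 'd) set). ennreal (?c * (?R powr q * G * ?Y k)))"
          by (rule sum_mono) (rule term_le)
        also have "\<dots> = ennreal (\<Sum>k\<in>(int_box N :: (int ^ 'd) set). ?c * (?R powr q * G * ?Y k))"
          using G by (intro sum_ennreal) (auto intro!: mult_nonneg_nonneg prod_nonneg)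
        also have "\<dots> \<le> ennreal (?c * (?R powr q * G * S))"
          unfolding sum_distrib_left[symmetric] using G by (intro ennreal_leI mult_left_mono S) auto
        also have "?c * (?R powr q * G * S) = Z * ?R powr q" by (simp add: Z_def mult_ac)
        finally show "(\<Sum>k\<in>(int_box N :: (int ^ 'd) set). \<integral>\<^sup>+x. ennreal (?c) * pn q (lift \<theta> k (g k) x) \<partial>\<mu>) \<le> ennreal (Z * ?R powr q)" .
      qed (auto simp: sets_weight_measure)
      then have "Lp_norm q \<mu> (\<lambda>x. f x - asm_op \<delta> n f x) powr q \<le> Z * ?R powr q"
        using Z unfolding Lp_norm_powr[OF diff q0(1), symmetric] by simp
      then have "(Lp_norm q \<mu> (\<lambda>x. f x - asm_op \<delta> n f x) powr q) powr (1 / q) \<le> (Z * ?R powr q) powr (1 / q)"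
        using q0 by (intro powr_mono2) auto
      also have "\<dots> = Z powr (1 / q) * ?R"
      proof -
        have "(Z * X powr q) powr (1 / q) = Z powr (1 / q) * X" if "X \<ge> 0" for X :: real
          using that Z q0 by (simp add: powr_mult powr_powr)
        then show ?thesis using R by blast
      qed
      finally show "Lp_norm q \<mu> (\<lambda>x. f x - asm_op \<delta> n f x) \<le> C0 * K * Z powr (1 / q) * rate ?d r n"
        using q0 Lp_norm_nonneg[of q \<mu>] by (simp add: powr_powr mult_ac)
    qed
  qed
qed

end

section \<open>Random signs\<close>

definition signs :: "'k set \<Rightarrow> ('k \<Rightarrow> real) set" where
  "signs I = PiE I (\<lambda>_. {- 1, 1})"

lemma finite_signs: "finite I \<Longrightarrow> finite (signs I)"
  unfolding signs_def by (intro finite_PiE) auto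

lemma card_signs: "finite I \<Longrightarrow> card (signs I) = 2 ^ card I"
  unfolding signs_def by (subst card_PiE) (auto simp: numeral_2_eq_2)

lemma signs_cases: "s \<in> signs I \<Longrightarrow> k \<in> I \<Longrightarrow> s k = - 1 \<or> s k = 1"
  unfolding signs_def by (auto dest: PiE_mem)

text \<open>Independence of the signs: sums of coordinatewise products factor.\<close>

lemma sum_signs_prod:
  fixes f :: "'k \<Rightarrow> real \<Rightarrow> real"
  assumes "finite I" shows "(\<Sum>s\<in>signs I. \<Prod>k\<in>I. f k (s k)) = (\<Prod>k\<in>I. f k (- 1) + f k 1)"
  unfolding signs_def using prod_sum_PiE[of I "\<lambda>_. {- 1, 1}" f] assms by simp

lemma exp_le_quadratic:
  assumes "\<bar>x\<bar> \<le> (1::real)" shows "exp x \<le> 1 + x + x\<^sup>2"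
proof (cases "x \<ge> 0")
  case True then show ?thesis using exp_bound[of x] assms by simp
next
  case False
  define y where "y = - x"
  have y: "0 < y" "y \<le> 1" using False assms by (auto simp: y_def)
  have "1 + y \<le> exp y" by simp
  then have "exp (- y) \<le> 1 / (1 + y)" using y by (simp add: exp_minus field_simps)
  also have "\<dots> \<le> 1 - y + y\<^sup>2"
  proof -
    have "(1 - y + y\<^sup>2) * (1 + y) = 1 + y ^ 3" by (simp add: algebra_simps power2_eq_square power3_eq_cube)
    then have "1 \<le> (1 - y + y\<^sup>2) * (1 + y)" using y by simp
    then show ?thesis using y by (simp add: divide_le_eq)
  qed
  finally show ?thesis by (simp add: y_def)
qed

text \<open>Exponential moments control all power moments, with a constant that depends on p
  only.\<close>

lemma powr_le_exp:
  assumes p: "p > 0" obtains C where "C \<ge> 0" "\<And>t::real. \<bar>t\<bar> powr p \<le> C * (exp t + exp (- t))"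
proof -
  define n where "n = nat \<lceil>p\<rceil>"
  have n: "n > 0" "p \<le> real n" using p by (auto simp: n_def)

  have *: "\<bar>t\<bar> powr p \<le> (1 + real n ^ n) * exp \<bar>t\<bar>" for t :: real
  proof (cases "\<bar>t\<bar> \<le> 1")
    case True
    have "\<bar>t\<bar> powr p \<le> 1 * 1" using True p powr_mono2[of p "\<bar>t\<bar>" 1] by simp
    also have "\<dots> \<le> (1 + real n ^ n) * exp \<bar>t\<bar>" by (intro mult_mono) auto
    finally show ?thesis .
  next
    case False
    then have "\<bar>t\<bar> powr p \<le> \<bar>t\<bar> powr real n" using n by (intro powr_mono) auto
    also have "\<dots> = \<bar>t\<bar> ^ n" using False by (simp add: powr_realpow)
    also have "\<dots> = real n ^ n * (\<bar>t\<bar> / real n) ^ n" using n by (simp add: power_divide)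
    also have "\<dots> \<le> real n ^ n * exp \<bar>t\<bar>" using n by (intro mult_left_mono power_le_exp) auto
    also have "\<dots> \<le> (1 + real n ^ n) * exp \<bar>t\<bar>" by (intro mult_right_mono) auto
    finally show ?thesis .
  qed
  have "exp \<bar>t\<bar> \<le> exp t + exp (- t)" for t :: real by (cases "t \<ge> 0") (auto simp: add_increasing add_increasing2)
  then have "(1 + real n ^ n) * exp \<bar>t\<bar> \<le> (1 + real n ^ n) * (exp t + exp (- t))" for t :: real
    by (intro mult_left_mono) auto
  then show ?thesis using * by (intro that[of "1 + real n ^ n"]) (auto intro: order_trans)
qed

text \<open>The coefficients are at most 1 in modulus, so the quadratic bound for exp applies. The
  linear terms cancel between the two signs, and the squares add up in the exponent.\<close>

lemma sum_signs_exp_le: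
  fixes \<alpha> :: "'k \<Rightarrow> real"
  assumes I: "finite I" and 1: "(\<Sum>k\<in>I. (\<alpha> k)\<^sup>2) \<le> 1"
  shows "(\<Sum>s\<in>signs I. exp (\<Sum>k\<in>I. s k * \<alpha> k)) \<le> 2 ^ card I * exp 1"
proof -
  have le1: "\<bar>\<alpha> k\<bar> \<le> 1" if "k \<in> I" for k
  proof -
    have "(\<alpha> k)\<^sup>2 \<le> (\<Sum>k\<in>I. (\<alpha> k)\<^sup>2)" using I that by (intro member_le_sum) auto
    then show ?thesis using 1 by (simp add: abs_square_le_1[symmetric])
  qed
  have "(\<Sum>s\<in>signs I. exp (\<Sum>k\<in>I. s k * \<alpha> k)) = (\<Sum>s\<in>signs I. \<Prod>k\<in>I. exp (s k * \<alpha> k))"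
    using I by (simp add: exp_sum)
  also have "\<dots> = (\<Prod>k\<in>I. exp (- 1 * \<alpha> k) + exp (1 * \<alpha> k))"
    by (rule sum_signs_prod[OF I, of "\<lambda>k e. exp (e * \<alpha> k)"])
  also have "\<dots> \<le> (\<Prod>k\<in>I. 2 * exp ((\<alpha> k)\<^sup>2))"
  proof (intro prod_mono conjI)
    fix k assume k: "k \<in> I"
    have "exp (- 1 * \<alpha> k) + exp (1 * \<alpha> k) \<le> 2 * (1 + (\<alpha> k)\<^sup>2)"
      using exp_le_quadratic[of "\<alpha> k"] exp_le_quadratic[of "- \<alpha> k"] le1[OF k] by simp
    also have "\<dots> \<le> 2 * exp ((\<alpha> k)\<^sup>2)" by (intro mult_left_mono exp_ge_add_one_self) simp
    finally show "exp (- 1 * \<alpha> k) + exp (1 * \<alpha> k) \<le> 2 * exp ((\<alpha> k)\<^sup>2)" .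
  qed simp
  also have "\<dots> = 2 ^ card I * exp (\<Sum>k\<in>I. (\<alpha> k)\<^sup>2)" using I by (simp add: prod.distrib exp_sum)
  also have "\<dots> \<le> 2 ^ card I * exp 1" using 1 by simp
  finally show ?thesis .
qed

text \<open>Division by \<sigma> normalizes the coefficients; the exponential moments of the sum and
  of its negative then bound the p-th power. This is the upper Khintchine inequality.\<close>

lemma khintchine_real:
  assumes p: "p > 0"
  obtains C where "C \<ge> 0" "\<And>(I :: 'k set) \<alpha> \<sigma>. finite I \<Longrightarrow> \<sigma> > 0 \<Longrightarrow> (\<Sum>k\<in>I. (\<alpha> k)\<^sup>2) \<le> \<sigma>\<^sup>2 \<Longrightarrow>
    (\<Sum>s\<in>signs I. \<bar>\<Sum>k\<in>I. s k * \<alpha> k\<bar> powr p) \<le> 2 ^ card I * C * \<sigma> powr p"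
proof -
  obtain C where C: "C \<ge> 0" "\<And>t::real. \<bar>t\<bar> powr p \<le> C * (exp t + exp (- t))" by (rule powr_le_exp[OF p], rule that; assumption)
  show ?thesis
  proof (rule that[of "C * (2 * exp 1)"])
    show "C * (2 * exp 1) \<ge> 0" using C by simp
    fix I :: "'k set" and \<alpha> \<sigma> assume I: "finite I" and \<sigma>: "(\<sigma>::real) > 0" and le: "(\<Sum>k\<in>I. (\<alpha> k)\<^sup>2) \<le> \<sigma>\<^sup>2"
    have 1: "(\<Sum>k\<in>I. (\<alpha> k / \<sigma>)\<^sup>2) \<le> 1" using le \<sigma> by (simp add: power_divide sum_divide_distrib[symmetric])
    then have 2: "(\<Sum>k\<in>I. (- (\<alpha> k / \<sigma>))\<^sup>2) \<le> 1" by simp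
    have "(\<Sum>s\<in>signs I. \<bar>\<Sum>k\<in>I. s k * \<alpha> k\<bar> powr p) \<le>
      (\<Sum>s\<in>signs I. \<sigma> powr p * (C * (exp (\<Sum>k\<in>I. s k * (\<alpha> k / \<sigma>)) + exp (\<Sum>k\<in>I. s k * - (\<alpha> k / \<sigma>)))))"
    proof (rule sum_mono)
      fix s
      let ?t = "\<Sum>k\<in>I. s k * (\<alpha> k / \<sigma>)"
      have e: "(\<Sum>k\<in>I. s k * \<alpha> k) = \<sigma> * ?t" using \<sigma> by (simp add: sum_distrib_left)
      have n: "(\<Sum>k\<in>I. s k * - (\<alpha> k / \<sigma>)) = - ?t" by (simp add: sum_negf)
      have "\<bar>\<Sum>k\<in>I. s k * \<alpha> k\<bar> powr p = \<sigma> powr p * \<bar>?t\<bar> powr p" unfolding e using \<sigma> by (simp add: abs_mult powr_mult)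
      also have "\<dots> \<le> \<sigma> powr p * (C * (exp ?t + exp (- ?t)))" by (intro mult_left_mono C) simp
      finally show "\<bar>\<Sum>k\<in>I. s k * \<alpha> k\<bar> powr p \<le> \<sigma> powr p * (C * (exp ?t + exp (\<Sum>k\<in>I. s k * - (\<alpha> k / \<sigma>))))" unfolding n .
    qed
    also have "\<dots> = \<sigma> powr p * (C * ((\<Sum>s\<in>signs I. exp (\<Sum>k\<in>I. s k * (\<alpha> k / \<sigma>))) + (\<Sum>s\<in>signs I. exp (\<Sum>k\<in>I. s k * - (\<alpha> k / \<sigma>)))))"
      by (simp only: sum_distrib_left[symmetric] sum.distrib)
    also have "\<dots> \<le> \<sigma> powr p * (C * (2 ^ card I * exp 1 + 2 ^ card I * exp 1))"
      by (intro mult_left_mono add_mono sum_signs_exp_le I 1 2 C) simp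
    also have "\<dots> = 2 ^ card I * (C * (2 * exp 1)) * \<sigma> powr p" by (simp add: algebra_simps)
    finally show "(\<Sum>s\<in>signs I. \<bar>\<Sum>k\<in>I. s k * \<alpha> k\<bar> powr p) \<le> 2 ^ card I * (C * (2 * exp 1)) * \<sigma> powr p" .
  qed
qed

text \<open>Real and imaginary parts are treated separately. C >= 1 makes the thresholds for
  Markov's inequality positive.\<close>

lemma khintchine:
  assumes p: "p > 0"
  obtains C where "C \<ge> 1" "\<And>(I :: 'k set) (c :: 'k \<Rightarrow> complex) \<sigma>. finite I \<Longrightarrow> \<sigma> > 0 \<Longrightarrow> (\<Sum>k\<in>I. (norm (c k))\<^sup>2) \<le> \<sigma>\<^sup>2 \<Longrightarrow>
    (\<Sum>s\<in>signs I. norm (\<Sum>k\<in>I. of_real (s k) * c k) powr p) \<le> 2 ^ card I * C * \<sigma> powr p"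
proof -
  obtain C where C: "C \<ge> 0" "\<And>(I :: 'k set) \<alpha> \<sigma>. finite I \<Longrightarrow> \<sigma> > 0 \<Longrightarrow> (\<Sum>k\<in>I. (\<alpha> k)\<^sup>2) \<le> \<sigma>\<^sup>2 \<Longrightarrow>
    (\<Sum>s\<in>signs I. \<bar>\<Sum>k\<in>I. s k * \<alpha> k\<bar> powr p) \<le> 2 ^ card I * C * \<sigma> powr p"
    by (rule khintchine_real[OF p], rule that; assumption)
  define D where "D = max 1 (2 powr p * (C + C))"
  show ?thesis
  proof (rule that[of D])
    show "D \<ge> 1" by (simp add: D_def)
    fix I :: "'k set" and c :: "'k \<Rightarrow> complex" and \<sigma> :: real
    assume I: "finite I" and \<sigma>: "\<sigma> > 0" and le: "(\<Sum>k\<in>I. (norm (c k))\<^sup>2) \<le> \<sigma>\<^sup>2"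
    have R: "(\<Sum>k\<in>I. (Re (c k))\<^sup>2) \<le> \<sigma>\<^sup>2"
      by (rule order_trans[OF sum_mono le]) (simp add: cmod_power2)
    have M: "(\<Sum>k\<in>I. (Im (c k))\<^sup>2) \<le> \<sigma>\<^sup>2"
      by (rule order_trans[OF sum_mono le]) (simp add: cmod_power2)
    have "(\<Sum>s\<in>signs I. norm (\<Sum>k\<in>I. of_real (s k) * c k) powr p) \<le>
      (\<Sum>s\<in>signs I. 2 powr p * (\<bar>\<Sum>k\<in>I. s k * Re (c k)\<bar> powr p + \<bar>\<Sum>k\<in>I. s k * Im (c k)\<bar> powr p))"
    proof (rule sum_mono)
      fix s
      let ?z = "\<Sum>k\<in>I. of_real (s k) * c k"
      have "norm ?z powr p \<le> (\<bar>Re ?z\<bar> + \<bar>Im ?z\<bar>) powr p" using p by (intro powr_mono2 cmod_le) auto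
      also have "\<dots> \<le> 2 powr p * (\<bar>Re ?z\<bar> powr p + \<bar>Im ?z\<bar> powr p)" using p by (intro powr_add_le) auto
      finally show "norm ?z powr p \<le> 2 powr p * (\<bar>\<Sum>k\<in>I. s k * Re (c k)\<bar> powr p + \<bar>\<Sum>k\<in>I. s k * Im (c k)\<bar> powr p)"
        by simp
    qed
    also have "\<dots> = 2 powr p * ((\<Sum>s\<in>signs I. \<bar>\<Sum>k\<in>I. s k * Re (c k)\<bar> powr p) + (\<Sum>s\<in>signs I. \<bar>\<Sum>k\<in>I. s k * Im (c k)\<bar> powr p))"
      by (simp only: sum_distrib_left[symmetric] sum.distrib)
    also have "\<dots> \<le> 2 powr p * (2 ^ card I * C * \<sigma> powr p + 2 ^ card I * C * \<sigma> powr p)"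
      by (intro mult_left_mono add_mono C I \<sigma> R M) simp
    also have "\<dots> = 2 ^ card I * (2 powr p * (C + C)) * \<sigma> powr p" by (simp add: algebra_simps)
    also have "\<dots> \<le> 2 ^ card I * D * \<sigma> powr p" by (intro mult_right_mono mult_left_mono) (auto simp: D_def)
    finally show "(\<Sum>s\<in>signs I. norm (\<Sum>k\<in>I. of_real (s k) * c k) powr p) \<le> 2 ^ card I * D * \<sigma> powr p" .
  qed
qed

definition hamming :: "'k set \<Rightarrow> ('k \<Rightarrow> real) \<Rightarrow> ('k \<Rightarrow> real) \<Rightarrow> nat" where
  "hamming I s t = card {k \<in> I. s k \<noteq> t k}"

text \<open>Weight each sign vector by (1/4)^distance, with N = card I. The total weight is (5/4)^N,
  and on the ball each weight is at least (1/4)^(N/8). Eighth powers keep the exponents integral,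
  and (5/4)^8 times 4 is at most (3/2)^8.\<close>

lemma card_hamming_ball:
  assumes I: "finite I" and t: "t \<in> signs I"
  shows "real (card {s \<in> signs I. 8 * hamming I s t < card I}) \<le> (3 / 2) ^ card I"
proof -
  let ?f = "\<lambda>k e. if e = t k then 1 else 1 / 4 :: real"
  have q: "(1 / 4 :: real) ^ n * 4 ^ n = 1" for n :: nat by (simp add: power_mult_distrib[symmetric])
  have p: "(\<Prod>k\<in>I. ?f k (s k)) = (1 / 4) ^ hamming I s t" for s
  proof -
    have "(\<Prod>k\<in>I. ?f k (s k)) = (\<Prod>k\<in>{k \<in> I. s k \<noteq> t k}. 1 / 4)"
      using I by (intro prod.mono_neutral_cong_right) auto
    then show ?thesis by (simp add: hamming_def)
  qed
  have tot: "(\<Sum>s\<in>signs I. (1 / 4 :: real) ^ hamming I s t) = (5 / 4) ^ card I"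
  proof -
    have "(\<Sum>s\<in>signs I. (1 / 4 :: real) ^ hamming I s t) = (\<Prod>k\<in>I. ?f k (- 1) + ?f k 1)"
      unfolding p[symmetric] by (rule sum_signs_prod[OF I])
    also have "\<dots> = (\<Prod>k\<in>I. 5 / 4)"
    proof (rule prod.cong[OF refl])
      fix k assume "k \<in> I"
      then show "?f k (- 1) + ?f k 1 = 5 / 4" using signs_cases[OF t] by fastforce
    qed
    finally show ?thesis by simp
  qed
  let ?B = "{s \<in> signs I. 8 * hamming I s t < card I}"
  have fB: "finite ?B" using finite_signs[OF I] by auto
  have "real (card ?B) ^ 8 \<le> ((3 / 2) ^ card I) ^ 8"
  proof -
    define N where "N = card I"
    \<comment> \<open>The largest h with 8 h < N if N > 0; for N = 0 the ball is empty.\<close>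
    define h where "h = (N - 1) div 8"
    have hB: "hamming I s t \<le> h" if "s \<in> ?B" for s using that unfolding h_def N_def by auto
    have "real (card ?B) * (1 / 4) ^ h = (\<Sum>s\<in>?B. (1 / 4) ^ h)" by simp
    also have "\<dots> \<le> (\<Sum>s\<in>?B. (1 / 4) ^ hamming I s t)" by (intro sum_mono power_decreasing hB) auto
    also have "\<dots> \<le> (\<Sum>s\<in>signs I. (1 / 4) ^ hamming I s t)" using finite_signs[OF I] by (intro sum_mono2) auto
    also have "\<dots> = (5 / 4) ^ N" unfolding tot N_def ..
    finally have "real (card ?B) * (1 / 4) ^ h \<le> (5 / 4) ^ N" .
    then have "real (card ?B) * ((1 / 4) ^ h * 4 ^ h) \<le> (5 / 4) ^ N * 4 ^ h"
      unfolding mult.assoc[symmetric] by (rule mult_right_mono) simp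
    then have "real (card ?B) \<le> (5 / 4) ^ N * 4 ^ h" unfolding q by simp
    then have "real (card ?B) ^ 8 \<le> ((5 / 4) ^ N * 4 ^ h) ^ 8" by (intro power_mono) auto
    also have "\<dots> = ((5 / 4) ^ 8) ^ N * 4 ^ (8 * h)"
      by (simp add: power_mult_distrib power_mult[symmetric] mult.commute)
    also have "\<dots> \<le> ((5 / 4) ^ 8) ^ N * 4 ^ N"
    proof -
      have "8 * h \<le> N" unfolding h_def by (metis diff_le_self le_trans mult.commute div_times_less_eq_dividend)
      then show ?thesis by (intro mult_left_mono power_increasing) auto
    qed
    also have "\<dots> = ((5 / 4) ^ 8 * 4) ^ N" by (simp add: power_mult_distrib)
    also have "\<dots> \<le> ((3 / 2) ^ 8) ^ N" by (intro power_mono) (auto simp: power_divide divide_simps)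
    also have "\<dots> = ((3 / 2) ^ card I) ^ 8" unfolding N_def by (simp add: power_mult[symmetric] mult.commute)
    finally show ?thesis .
  qed
  then show ?thesis by (rule power_le_imp_le_base[of _ 7, simplified]) simp
qed

text \<open>The balls around the points of a maximal separated subset cover G, and each contains at
  most (3/2)^(card I) sign vectors.\<close>

lemma separated_signs:
  assumes I: "finite I" and G: "G \<subseteq> signs I"
  obtains P where "P \<subseteq> G" "\<And>s t. s \<in> P \<Longrightarrow> t \<in> P \<Longrightarrow> s \<noteq> t \<Longrightarrow> card I \<le> 8 * hamming I s t"
    "real (card G) \<le> real (card P) * (3 / 2) ^ card I"
proof -
  let ?ok = "\<lambda>P. P \<subseteq> G \<and> (\<forall>s\<in>P. \<forall>t\<in>P. s \<noteq> t \<longrightarrow> card I \<le> 8 * hamming I s t)"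
  have fG: "finite G" using finite_subset[OF G finite_signs[OF I]] .
  have "finite {P. ?ok P}" by (rule finite_subset[of _ "Pow G"]) (use fG in auto)
  moreover have "{} \<in> {P. ?ok P}" by simp
  ultimately have "\<exists>m\<in>{P. ?ok P}. {} \<subseteq> m \<and> (\<forall>b\<in>{P. ?ok P}. m \<subseteq> b \<longrightarrow> m = b)" by (rule finite_has_maximal2)
  then obtain P where P0: "P \<in> {P. ?ok P}" and max: "\<forall>P'\<in>{P. ?ok P}. P \<subseteq> P' \<longrightarrow> P = P'"
    by (elim bexE conjE) (rule that)
  from P0 have P: "?ok P" by (rule CollectD)
  have Pmax: "P' = P" if "?ok P'" "P \<subseteq> P'" for P' using bspec[OF max CollectI, OF that(1)] that(2) by (rule mp[THEN sym])
  let ?U = "\<Union>t\<in>P. {s \<in> signs I. 8 * hamming I s t < card I}"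
  have fP: "finite P" using P fG by (auto intro: finite_subset)
  have sym: "hamming I s t = hamming I t s" for s t unfolding hamming_def by (rule arg_cong[where f=card]) auto
  have "G \<subseteq> ?U \<union> P"
  proof
    fix s assume s: "s \<in> G"
    show "s \<in> ?U \<union> P"
    proof (rule ccontr)
      assume neg: "s \<notin> ?U \<union> P"
      then have far: "card I \<le> 8 * hamming I s t" if "t \<in> P" for t
        using s G that by (auto simp: not_less)
      then have "?ok (insert s P)" "P \<subseteq> insert s P" using P(1) s sym by auto
      then have "insert s P = P" by (rule Pmax)
      then show False using neg by blast
    qed
  qed
  show ?thesis
  \<comment> \<open>For empty I the balls, defined by a strict inequality, are empty and cover
    nothing.\<close>
  proof (cases "card I = 0")
    case True
    then have "card G \<le> 1" using card_mono[OF finite_signs[OF I] G] card_signs[OF I] by simp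
    then show ?thesis using that[of G] True by (auto simp: card_le_Suc0_iff_eq[OF fG])
  next
    case False
    have "P \<subseteq> ?U"
    proof
      fix t assume t: "t \<in> P"
      moreover have "hamming I t t = 0" by (simp add: hamming_def)
      ultimately have "t \<in> {s \<in> signs I. 8 * hamming I s t < card I}" using False P(1) G by auto
      then show "t \<in> ?U" using t by blast
    qed
    then have "G \<subseteq> ?U"
      using \<open>G \<subseteq> _ \<union> P\<close> by blast
    then have "card G \<le> card ?U"
      using fP finite_signs[OF I] by (intro card_mono) auto
    also have "\<dots> \<le> (\<Sum>t\<in>P. card {s \<in> signs I. 8 * hamming I s t < card I})" by (rule card_UN_le[OF fP])
    finally have "real (card G) \<le> (\<Sum>t\<in>P. real (card {s \<in> signs I. 8 * hamming I s t < card I}))"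
      by (simp only: of_nat_sum[symmetric] of_nat_le_iff)
    also have "\<dots> \<le> (\<Sum>t\<in>P. (3 / 2) ^ card I)" using P(1) G by (intro sum_mono card_hamming_ball I) auto
    finally show ?thesis using P(1) by (intro that[of P]) auto
  qed
qed

text \<open>Markov's inequality. The level 4 V excludes at most a quarter of S, so two such
  conditions together keep at least half.\<close>

lemma markov_count:
  fixes g :: "'k \<Rightarrow> ennreal"
  assumes S: "finite S" and V: "V > 0" and le: "(\<Sum>s\<in>S. g s) \<le> ennreal (real (card S) * V)"
  shows "4 * card {s \<in> S. g s > ennreal (4 * V)} \<le> card S"
proof -
  let ?B = "{s \<in> S. g s > ennreal (4 * V)}"
  have "ennreal (real (card ?B) * (4 * V)) = (\<Sum>s\<in>?B. ennreal (4 * V))"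
    using V by (simp add: ennreal_of_nat_eq_real_of_nat ennreal_mult[symmetric])
  also have "\<dots> \<le> (\<Sum>s\<in>?B. g s)" by (intro sum_mono) auto
  also have "\<dots> \<le> (\<Sum>s\<in>S. g s)" using S by (intro sum_mono2) auto
  also have "\<dots> \<le> ennreal (real (card S) * V)" by (rule le)
  finally have "real (card ?B) * (4 * V) \<le> real (card S) * V" using V by (simp add: ennreal_le_iff)
  then have "real (4 * card ?B) \<le> real (card S)" using V by (simp add: mult_ac)
  then show ?thesis by (simp only: of_nat_le_iff)
qed

text \<open>Each complex coordinate has real dimension 2, hence the exponent; the restriction to B
  keeps the substituted point extensional.\<close>

lemma nn_integral_PiM_affine:
  fixes a :: "'h \<Rightarrow> complex" and s :: real
  assumes "finite B" and s: "s > 0" and "F \<in> borel_measurable (PiM B (\<lambda>_. lborel :: complex measure))"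
  shows "(\<integral>\<^sup>+x. F x \<partial>PiM B (\<lambda>_. lborel)) =
    ennreal (s ^ (2 * card B)) * (\<integral>\<^sup>+x. F (\<lambda>h\<in>B. a h + s *\<^sub>R x h) \<partial>PiM B (\<lambda>_. lborel))"
  using assms(1,3)
proof (induction B arbitrary: F)
  case empty
  show ?case by (simp add: PiM_empty nn_integral_count_space_finite restrict_def)
next
  case (insert i B)
  interpret product_sigma_finite "\<lambda>_. lborel :: complex measure" by standard
  note [measurable] = insert.prems
  have [measurable]: "(\<lambda>x. \<lambda>h\<in>B. a h + s *\<^sub>R x h) \<in> PiM B (\<lambda>_. lborel) \<rightarrow>\<^sub>M PiM B (\<lambda>_. lborel :: complex measure)" for B
    by measurable
  have eq: "(\<lambda>h\<in>insert i B. a h + s *\<^sub>R (x(i := y)) h) = (\<lambda>h\<in>B. a h + s *\<^sub>R x h)(i := a i + s *\<^sub>R y)" for x y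
    using insert.hyps(2) by (auto simp: fun_eq_iff restrict_def)
  have m1: "(\<lambda>x. F (\<lambda>h\<in>insert i B. a h + s *\<^sub>R x h)) \<in> borel_measurable (PiM (insert i B) (\<lambda>_. lborel))"
    by measurable
  have m2: "(\<lambda>x. F (x(i := y))) \<in> borel_measurable (PiM B (\<lambda>_. lborel))" for y
    using insert.hyps(2) by measurable
  have m3: "(\<lambda>y. \<integral>\<^sup>+x. F (x(i := y)) \<partial>PiM B (\<lambda>_. lborel)) \<in> borel_fun"
  proof -
    interpret B: sigma_finite_measure "PiM B (\<lambda>_. lborel :: complex measure)"
      by (rule sigma_finite[OF insert.hyps(1)])
    have "(\<lambda>y. \<integral>\<^sup>+x. F (x(i := y)) \<partial>PiM B (\<lambda>_. lborel)) \<in> borel_measurable lborel"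
      by measurable
    then show ?thesis by simp
  qed
  have "(\<integral>\<^sup>+x. F x \<partial>PiM (insert i B) (\<lambda>_. lborel)) = (\<integral>\<^sup>+y. (\<integral>\<^sup>+x. F (x(i := y)) \<partial>PiM B (\<lambda>_. lborel)) \<partial>lborel)"
    by (rule product_nn_integral_insert_rev[OF insert.hyps insert.prems])
  also have "\<dots> = ennreal (\<bar>s\<bar> ^ DIM(complex)) * (\<integral>\<^sup>+y. (\<integral>\<^sup>+x. F (x(i := a i + s *\<^sub>R y)) \<partial>PiM B (\<lambda>_. lborel)) \<partial>lborel)"
    by (rule nn_integral_lborel_affine[OF m3]) (use s in simp)
  also have "(\<lambda>y. \<integral>\<^sup>+x. F (x(i := a i + s *\<^sub>R y)) \<partial>PiM B (\<lambda>_. lborel)) =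
    (\<lambda>y. ennreal (s ^ (2 * card B)) * (\<integral>\<^sup>+x. F ((\<lambda>h\<in>B. a h + s *\<^sub>R x h)(i := a i + s *\<^sub>R y)) \<partial>PiM B (\<lambda>_. lborel)))"
    by (rule ext, rule insert.IH[OF m2])
  also have "(\<integral>\<^sup>+y. ennreal (s ^ (2 * card B)) * (\<integral>\<^sup>+x. F ((\<lambda>h\<in>B. a h + s *\<^sub>R x h)(i := a i + s *\<^sub>R y)) \<partial>PiM B (\<lambda>_. lborel)) \<partial>lborel) =
    ennreal (s ^ (2 * card B)) * (\<integral>\<^sup>+y. (\<integral>\<^sup>+x. F (\<lambda>h\<in>insert i B. a h + s *\<^sub>R (x(i := y)) h) \<partial>PiM B (\<lambda>_. lborel)) \<partial>lborel)"
    unfolding eq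
  proof (rule nn_integral_cmult)
    interpret B: sigma_finite_measure "PiM B (\<lambda>_. lborel :: complex measure)"
      by (rule sigma_finite[OF insert.hyps(1)])
    show "(\<lambda>y. \<integral>\<^sup>+x. F ((\<lambda>h\<in>B. a h + s *\<^sub>R x h)(i := a i + s *\<^sub>R y)) \<partial>PiM B (\<lambda>_. lborel)) \<in> borel_measurable lborel"
      unfolding eq[symmetric] using m1 by measurable
  qed
  also have "(\<integral>\<^sup>+y. (\<integral>\<^sup>+x. F (\<lambda>h\<in>insert i B. a h + s *\<^sub>R (x(i := y)) h) \<partial>PiM B (\<lambda>_. lborel)) \<partial>lborel) =
    (\<integral>\<^sup>+x. F (\<lambda>h\<in>insert i B. a h + s *\<^sub>R x h) \<partial>PiM (insert i B) (\<lambda>_. lborel))"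
    by (rule product_nn_integral_insert_rev[OF insert.hyps m1, symmetric])
  also have "ennreal (\<bar>s\<bar> ^ DIM(complex)) * (ennreal (s ^ (2 * card B)) * z) = ennreal (s ^ (2 * card (insert i B))) * z" for z
    using s insert.hyps by (simp add: mult.assoc[symmetric] ennreal_mult[symmetric] power_add[symmetric])
  finally show ?case .
qed

section \<open>Packing and hyperbolic crosses\<close>

text \<open>Volume comparison: disjoint balls of radius r around the points lie in one ball of
  radius R + r. Since nu may vanish on a subspace, its balls can have infinite volume; all of them
  are cut by boxes, and the box size T is so large that the big box, shrunk by the factor w, fits
  into the small one.\<close>

lemma seminorm_packing:
  fixes nu :: "('h \<Rightarrow> complex) \<Rightarrow> real" and cf :: "'i \<Rightarrow> 'h \<Rightarrow> complex"
  assumes B: "finite B" and P: "finite P"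
    and meas: "nu \<in> borel_measurable (PiM B (\<lambda>_. lborel))"
    and loc: "\<And>c d. (\<And>h. h \<in> B \<Longrightarrow> c h = d h) \<Longrightarrow> nu c = nu d"
    and tri: "\<And>c d. nu (\<lambda>h. c h + d h) \<le> nu c + nu d"
    and hom: "\<And>c s. nu (\<lambda>h. s *\<^sub>R c h) = \<bar>s\<bar> * nu c"
    and bd: "\<And>c T. (\<And>h. h \<in> B \<Longrightarrow> norm (c h) \<le> T) \<Longrightarrow> nu c \<le> K * T" and K: "K \<ge> 0"
    and R: "\<And>i. i \<in> P \<Longrightarrow> nu (cf i) \<le> R" and R0: "R > 0" and r: "r > 0"
    and sep: "\<And>i j. i \<in> P \<Longrightarrow> j \<in> P \<Longrightarrow> i \<noteq> j \<Longrightarrow> 2 * r \<le> nu (\<lambda>h. cf i h - cf j h)"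
  shows "real (card P) \<le> ((R + r) / r) ^ (2 * card B)"
proof -
  let ?M = "PiM B (\<lambda>_. lborel :: complex measure)"
  interpret product_sigma_finite "\<lambda>_ :: 'h. lborel :: complex measure"
    by (rule product_sigma_finite.intro) (rule sigma_finite_lborel)
  define S where "S a T e = {x \<in> space ?M. (\<forall>h\<in>B. norm (x h - a h) \<le> T) \<and> nu (\<lambda>h. x h - a h) < e}" for a T e
  have shift: "(\<lambda>x. nu (\<lambda>h. x h - a h)) \<in> borel_measurable ?M" for a
  proof -
    have "(\<lambda>x. \<lambda>h\<in>B. x h - a h) \<in> measurable ?M ?M"
      by (rule measurable_restrict) (auto intro: borel_measurable_diff measurable_component_singleton)
    from measurable_compose[OF this meas] have "(\<lambda>x. nu (\<lambda>h\<in>B. x h - a h)) \<in> borel_measurable ?M" .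
    moreover have "nu (\<lambda>h\<in>B. x h - a h) = nu (\<lambda>h. x h - a h)" for x by (rule loc) simp
    ultimately show ?thesis by simp
  qed
  have S_sets: "S a T e \<in> sets ?M" for a T e
    unfolding S_def
  proof (rule sets.sets_Collect_conj)
    show "{x \<in> space ?M. nu (\<lambda>h. x h - a h) < e} \<in> sets ?M" using shift by (rule borel_measurable_less) simp
    show "{x \<in> space ?M. \<forall>h\<in>B. norm (x h - a h) \<le> T} \<in> sets ?M"
    proof (rule sets.sets_Collect_finite_All[OF _ B])
      fix h assume "h \<in> B"
      then have "(\<lambda>x. x h) \<in> measurable ?M lborel" by (rule measurable_component_singleton)
      then have "(\<lambda>x. x h) \<in> borel_measurable ?M" by simp
      then show "{x \<in> space ?M. norm (x h - a h) \<le> T} \<in> sets ?M" by (intro borel_measurable_le) auto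
    qed
  qed
  have affine: "emeasure ?M (S a T e) = ennreal (s ^ (2 * card B)) * emeasure ?M (S (\<lambda>_. 0) (T / s) (e / s))" if s: "s > 0" for a T e s
  proof -
    have "emeasure ?M (S a T e) = (\<integral>\<^sup>+x. indicator (S a T e) x \<partial>?M)" using S_sets by simp
    also have "\<dots> = ennreal (s ^ (2 * card B)) * (\<integral>\<^sup>+x. indicator (S a T e) (\<lambda>h\<in>B. a h + s *\<^sub>R x h) \<partial>?M)"
      by (rule nn_integral_PiM_affine[OF B s]) (use S_sets in simp)
    also have "(\<integral>\<^sup>+x. indicator (S a T e) (\<lambda>h\<in>B. a h + s *\<^sub>R x h) \<partial>?M) = (\<integral>\<^sup>+x. indicator (S (\<lambda>_. 0) (T / s) (e / s)) x \<partial>?M)"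
    proof (rule nn_integral_cong)
      fix x assume x: "x \<in> space ?M"
      have "nu (\<lambda>h. (\<lambda>h\<in>B. a h + s *\<^sub>R x h) h - a h) = nu (\<lambda>h. s *\<^sub>R (x h - 0))" by (rule loc) simp
      also have "\<dots> = s * nu (\<lambda>h. x h - 0)" using hom[of s "\<lambda>h. x h - 0"] s by simp
      finally have 1: "nu (\<lambda>h. (\<lambda>h\<in>B. a h + s *\<^sub>R x h) h - a h) = s * nu (\<lambda>h. x h - 0)" .
      have 2: "norm ((\<lambda>h\<in>B. a h + s *\<^sub>R x h) h - a h) = s * norm (x h - 0)" if "h \<in> B" for h
        using that s by simp
      have 3: "(\<lambda>h\<in>B. a h + s *\<^sub>R x h) \<in> space ?M" by (auto simp: space_PiM)
      have "(\<lambda>h\<in>B. a h + s *\<^sub>R x h) \<in> S a T e \<longleftrightarrow> x \<in> S (\<lambda>_. 0) (T / s) (e / s)"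
        unfolding S_def mem_Collect_eq 1 using 2 3 x s
        by (auto simp: pos_le_divide_eq pos_less_divide_eq mult.commute)
      then show "(indicator (S a T e) (\<lambda>h\<in>B. a h + s *\<^sub>R x h) :: ennreal) = indicator (S (\<lambda>_. 0) (T / s) (e / s)) x"
        by (simp add: indicator_def)
    qed
    also have "\<dots> = emeasure ?M (S (\<lambda>_. 0) (T / s) (e / s))" using S_sets by simp
    finally show ?thesis .
  qed
  have fin: "emeasure ?M (S (\<lambda>_. 0) T r) < \<infinity>" for T
  proof -
    have "emeasure ?M (S (\<lambda>_. 0) T r) \<le> emeasure ?M (PiE B (\<lambda>_. cball 0 T))"
      by (rule emeasure_mono) (auto simp: S_def space_PiM PiE_iff extensional_def intro!: sets_PiM_I_finite B)
    also have "\<dots> = (\<Prod>h\<in>B. emeasure lborel (cball (0::complex) T))" by (rule emeasure_PiM[OF B]) simp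
    also have "emeasure lborel (cball (0::complex) T) = ennreal (measure lborel (cball (0::complex) T))"
      by (rule emeasure_eq_ennreal_measure) (use emeasure_lborel_cball_finite[of "0::complex" T] in auto)
    also have "(\<Prod>h\<in>B. ennreal (measure lborel (cball (0::complex) T))) < \<infinity>" by (simp add: ennreal_power)
    finally show ?thesis .
  qed
  \<comment> \<open>By \<open>bd\<close> the seminorm is small on a small polydisc, which has
    positive volume.\<close>
  have pos: "emeasure ?M (S (\<lambda>_. 0) T r) > 0" if T: "T > 0" for T
  proof -
    define t where "t = min T (r / (2 * (K + 1)))"
    have t: "t > 0" "t \<le> T" "K * t < r"
    proof -
      show "t > 0" "t \<le> T" using T r K by (auto simp: t_def)
      have "K * t \<le> K * (r / (2 * (K + 1)))" using K by (intro mult_left_mono) (auto simp: t_def)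
      also have "\<dots> < r" using K r by (simp add: field_simps) (smt (verit) mult_nonneg_nonneg)
      finally show "K * t < r" .
    qed
    have "0 < measure lborel (ball (0::complex) t)" by (rule content_ball_pos[OF t(1)])
    then have "0 < emeasure lborel (ball (0::complex) t)" by (simp add: measure_def enn2real_positive_iff)
    then have "0 < (\<Prod>h\<in>B. emeasure lborel (ball (0::complex) t))" by (auto simp: zero_less_iff_neq_zero prod_zero_iff B)
    also have "\<dots> = emeasure ?M (PiE B (\<lambda>_. ball 0 t))" by (rule emeasure_PiM[OF B, symmetric]) simp
    also have "\<dots> \<le> emeasure ?M (S (\<lambda>_. 0) T r)"
    proof (rule emeasure_mono[OF subsetI S_sets])
      fix x assume x: "x \<in> PiE B (\<lambda>_. ball (0::complex) t)"
      then have xh: "norm (x h) < t" if "h \<in> B" for h using that by (auto dest: PiE_mem)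
      have "nu (\<lambda>h. x h - 0) \<le> K * t" by (rule bd) (use xh in \<open>auto intro: less_imp_le\<close>)
      then show "x \<in> S (\<lambda>_. 0) T r" unfolding S_def using x xh t by (fastforce simp: space_PiM PiE_iff)
    qed
    finally show ?thesis .
  qed
  define m where "m = (\<Sum>i\<in>P. \<Sum>h\<in>B. norm (cf i h))"
  have m: "norm (cf i h) \<le> m" if "i \<in> P" "h \<in> B" for i h
  proof -
    have "norm (cf i h) \<le> (\<Sum>h\<in>B. norm (cf i h))" using B that by (intro member_le_sum) auto
    also have "\<dots> \<le> m" unfolding m_def using P that by (intro member_le_sum[of i P "\<lambda>i. \<Sum>h\<in>B. norm (cf i h)"]) (auto intro: sum_nonneg)
    finally show ?thesis .
  qed
  have m0: "m \<ge> 0" by (simp add: m_def sum_nonneg)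
  define w where "w = (R + r) / r"
  have w: "w > 1" using R0 r by (simp add: w_def)
  \<comment> \<open>Gives T + m <= w T; the summand 1 ensures positivity even for m = 0.\<close>
  define T where "T = 1 + m / (w - 1)"
  have T: "T > 0" "(T + m) / w \<le> T"
  proof -
    show "T > 0" using m0 w by (simp add: T_def add_pos_nonneg)
    have "(w - 1) * T = (w - 1) + m" using w by (simp add: T_def field_simps)
    then have "m \<le> (w - 1) * T" using w by simp
    then show "(T + m) / w \<le> T" using w by (simp add: pos_divide_le_eq algebra_simps)
  qed
  let ?V = "emeasure ?M (S (\<lambda>_. 0) T r)"
  have disj: "disjoint_family_on (\<lambda>i. S (cf i) T r) P"
    unfolding disjoint_family_on_def
  proof (intro ballI impI, rule ccontr)
    fix i j assume ij: "i \<in> P" "j \<in> P" "i \<noteq> j" and "S (cf i) T r \<inter> S (cf j) T r \<noteq> {}"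
    then obtain x where x: "nu (\<lambda>h. x h - cf i h) < r" "nu (\<lambda>h. x h - cf j h) < r" unfolding S_def by blast
    have "nu (\<lambda>h. cf i h - cf j h) = nu (\<lambda>h. (- 1) *\<^sub>R (x h - cf i h) + (x h - cf j h))" by (rule loc) simp
    also have "\<dots> \<le> nu (\<lambda>h. (- 1) *\<^sub>R (x h - cf i h)) + nu (\<lambda>h. x h - cf j h)" by (rule tri)
    also have "nu (\<lambda>h. (- 1) *\<^sub>R (x h - cf i h)) = nu (\<lambda>h. x h - cf i h)" by (subst hom) simp
    finally show False using x sep[OF ij] by simp
  qed
  have sub: "S (cf i) T r \<subseteq> S (\<lambda>_. 0) (T + m) (R + r)" if i: "i \<in> P" for i
  proof
    fix x assume x: "x \<in> S (cf i) T r"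
    have "norm (x h - 0) \<le> T + m" if h: "h \<in> B" for h
    proof -
      have "norm (x h - cf i h) \<le> T" using x h by (simp add: S_def)
      then show ?thesis using m[OF i h] norm_triangle_ineq[of "x h - cf i h" "cf i h"] by simp
    qed
    moreover have "nu (\<lambda>h. x h - 0) < R + r"
    proof -
      have "nu (\<lambda>h. x h - 0) = nu (\<lambda>h. (x h - cf i h) + cf i h)" by (rule loc) simp
      also have "\<dots> \<le> nu (\<lambda>h. x h - cf i h) + nu (cf i)" by (rule tri)
      finally show ?thesis using x R[OF i] by (simp add: S_def)
    qed
    ultimately show "x \<in> S (\<lambda>_. 0) (T + m) (R + r)" using x by (simp add: S_def)
  qed
  have "of_nat (card P) * ?V = (\<Sum>i\<in>P. emeasure ?M (S (cf i) T r))"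
  proof -
    have "emeasure ?M (S (cf i) T r) = ?V" for i using affine[of 1 "cf i" T r] by simp
    then show ?thesis by (simp only: sum_constant)
  qed
  also have "\<dots> = emeasure ?M (\<Union>i\<in>P. S (cf i) T r)" by (rule sum_emeasure[OF _ disj P]) (use S_sets in auto)
  also have "\<dots> \<le> emeasure ?M (S (\<lambda>_. 0) (T + m) (R + r))" by (rule emeasure_mono[OF UN_least S_sets]) (rule sub)
  also have "\<dots> = ennreal (w ^ (2 * card B)) * emeasure ?M (S (\<lambda>_. 0) ((T + m) / w) ((R + r) / w))"
    by (rule affine) (use w in simp)
  also have "(R + r) / w = r" using R0 r by (simp add: w_def)
  also have "ennreal (w ^ (2 * card B)) * emeasure ?M (S (\<lambda>_. 0) ((T + m) / w) r) \<le> ennreal (w ^ (2 * card B)) * ?V"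
    by (rule mult_left_mono[OF emeasure_mono[OF _ S_sets]]) (use T(2) in \<open>force simp: S_def\<close>)+
  finally have le: "of_nat (card P) * ?V \<le> ennreal (w ^ (2 * card B)) * ?V" .
  define v where "v = enn2real ?V"
  have v: "?V = ennreal v" "v > 0"
    using pos[OF T(1)] fin[of T] by (auto simp: v_def enn2real_positive_iff less_top)
  have "ennreal (real (card P) * v) \<le> ennreal (w ^ (2 * card B) * v)"
    using le w v(2) unfolding v(1) by (simp add: ennreal_of_nat_eq_real_of_nat ennreal_mult)
  then have "real (card P) * v \<le> w ^ (2 * card B) * v" using w v(2) by (subst (asm) ennreal_le_iff) auto
  then show ?thesis using v(2) by (simp add: w_def[symmetric])
qed

section \<open>Counting the points of a hyperbolic cross\<close>

definition hyp_points :: "'j set \<Rightarrow> real \<Rightarrow> ('j \<Rightarrow> nat) set" where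
  "hyp_points J M = {k \<in> PiE J (\<lambda>_. {1..}). real (\<Prod>j\<in>J. k j) \<le> M}"

lemma hyp_points_le:
  assumes "finite J" "k \<in> hyp_points J M" "j \<in> J" shows "1 \<le> k j" "real (k j) \<le> M"
proof -
  have k: "\<And>j. j \<in> J \<Longrightarrow> 1 \<le> k j" and M: "real (\<Prod>j\<in>J. k j) \<le> M"
    using assms(2) by (auto simp: hyp_points_def dest: PiE_mem)
  show "1 \<le> k j" by (rule k[OF assms(3)])
  have "0 < (\<Prod>j\<in>J - {j}. k j)" by (rule prod_pos) (use k in force)
  then have "k j * 1 \<le> k j * (\<Prod>j\<in>J - {j}. k j)" by (intro mult_left_mono) auto
  also have "\<dots> = (\<Prod>j\<in>J. k j)" using assms by (simp add: prod.remove)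
  finally show "real (k j) \<le> M" using M by linarith
qed

lemma finite_hyp_points: assumes "finite J" shows "finite (hyp_points J M)"
proof (rule finite_subset[of _ "PiE J (\<lambda>_. {.. nat \<lfloor>M\<rfloor>})"])
  show "hyp_points J M \<subseteq> PiE J (\<lambda>_. {.. nat \<lfloor>M\<rfloor>})"
  proof
    fix k assume k: "k \<in> hyp_points J M"
    then show "k \<in> PiE J (\<lambda>_. {.. nat \<lfloor>M\<rfloor>})"
      using hyp_points_le(2)[OF assms k] by (auto simp: hyp_points_def PiE_iff le_nat_floor)
  qed
qed (use assms in \<open>auto intro: finite_PiE\<close>)

text \<open>If the new coordinate is m, the others range over the cross of size M/m. For m <= sqrt M
  the logarithm of M/m is still at least half that of M, so the counts add up to the previous bound
  times a harmonic sum, which supplies one more logarithm.\<close>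

lemma hyperbolic_count:
  assumes "finite J" "J \<noteq> {}"
  shows "\<exists>c>0. \<forall>M\<ge>1. c * M * max 1 (ln M) ^ (card J - 1) \<le> real (card (hyp_points J M))"
  using assms
proof (induction J rule: finite_ne_induct)
  case (singleton j)
  have "1 / 2 * M \<le> real (card (hyp_points {j} M))" if M: "M \<ge> 1" for M
  proof -
    have "card ((\<lambda>n. \<lambda>_\<in>{j}. n) ` {1..nat \<lfloor>M\<rfloor>}) = card {1..nat \<lfloor>M\<rfloor>}"
      by (rule card_image) (auto simp: inj_on_def fun_eq_iff restrict_def split: if_splits)
    moreover have "(\<lambda>n. \<lambda>_\<in>{j}. n) ` {1..nat \<lfloor>M\<rfloor>} \<subseteq> hyp_points {j} M"
    proof clarify
      fix n assume n: "n \<in> {1..nat \<lfloor>M\<rfloor>}"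
      then have "real n \<le> M" using M by (simp add: le_nat_iff le_floor_iff)
      then show "(\<lambda>_\<in>{j}. n) \<in> hyp_points {j} M" using n by (simp add: hyp_points_def PiE_iff)
    qed
    ultimately have "nat \<lfloor>M\<rfloor> \<le> card (hyp_points {j} M)"
      using card_mono[OF finite_hyp_points[of "{j}" M], of "(\<lambda>n. \<lambda>_\<in>{j}. n) ` {1..nat \<lfloor>M\<rfloor>}"] by simp
    moreover have "1 / 2 * M \<le> real (nat \<lfloor>M\<rfloor>)"
    proof -
      have "1 \<le> real_of_int \<lfloor>M\<rfloor>" using M by (simp only: one_le_floor of_int_1_le_iff)
      moreover have "real (nat \<lfloor>M\<rfloor>) = real_of_int \<lfloor>M\<rfloor>" using M by simp
      ultimately show ?thesis using real_of_int_floor_add_one_gt[of M] by linarith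
    qed
    ultimately show ?thesis by linarith
  qed
  then show ?case by (intro exI[of _ "1 / 2"]) auto
next
  case (insert j J)
  let ?e = "card J - 1"
  from insert obtain c where c: "c > 0" "\<And>M. M \<ge> 1 \<Longrightarrow> c * M * max 1 (ln M) ^ ?e \<le> real (card (hyp_points J M))" by blast
  have e: "card (insert j J) - 1 = Suc ?e" using insert by (simp add: card_gt_0_iff)
  show ?case
  proof (intro exI[of _ "c / 2 ^ Suc ?e"] conjI allI impI)
    show "c / 2 ^ Suc ?e > 0" using c by simp
    fix M :: real assume M: "M \<ge> 1"
    define K where "K = nat \<lfloor>sqrt M\<rfloor>"
    let ?L = "max 1 (ln M)"
    have sq: "sqrt M \<ge> 1" using M by simp
    have K: "real K \<le> sqrt M" "sqrt M \<le> real K + 1" "K \<ge> 1"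
      using sq real_of_int_floor_add_one_gt[of "sqrt M"] by (auto simp: K_def le_nat_iff le_floor_iff less_imp_le)
    have lnsq: "ln (sqrt M) = ln M / 2" using M by (simp add: ln_sqrt)
    have harm: "?L / 2 \<le> (\<Sum>m=1..K. 1 / real m)"
    proof -
      have "ln (sqrt M) \<le> ln (real K + 1)" using K sq by (subst ln_le_cancel_iff) auto
      also have "\<dots> \<le> (\<Sum>m=1..K. 1 / real m)" using ln_le_harm[of K] by (simp add: harm_def inverse_eq_divide)
      finally have 1: "ln M / 2 \<le> (\<Sum>m=1..K. 1 / real m)" unfolding lnsq .
      have "1 / real 1 \<le> (\<Sum>m=1..K. 1 / real m)" using K by (intro member_le_sum[of 1 "{1..K}" "\<lambda>m. 1 / real m"]) auto
      then show ?thesis using 1 by (simp add: max_def)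
    qed
    have term_le: "c / 2 ^ ?e * M * ?L ^ ?e * (1 / real m) \<le> real (card (hyp_points J (M / real m)))" if k: "m \<in> {1..K}" for m
    proof -
      have k1: "real m \<ge> 1" "real m \<le> sqrt M" using k K by auto
      have "sqrt M * real m \<le> sqrt M * sqrt M" using k1 sq by (intro mult_left_mono) auto
      then have ge: "sqrt M \<le> M / real m" using k1 M by (simp add: pos_le_divide_eq)
      have "ln (sqrt M) \<le> ln (M / real m)" using ge sq by (intro ln_mono) linarith+
      then have "?L / 2 \<le> max 1 (ln (M / real m))" unfolding lnsq by (simp add: max_def)
      then have "(?L / 2) ^ ?e \<le> max 1 (ln (M / real m)) ^ ?e" by (intro power_mono) auto
      then have "c * (M / real m) * (?L / 2) ^ ?e \<le> c * (M / real m) * max 1 (ln (M / real m)) ^ ?e"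
        using c M by (intro mult_left_mono) auto
      also have "\<dots> \<le> real (card (hyp_points J (M / real m)))" by (rule c(2)) (use ge sq in linarith)
      finally show ?thesis by (simp add: power_divide mult_ac)
    qed
    have "c / 2 ^ Suc ?e * M * ?L ^ Suc ?e = c / 2 ^ ?e * M * ?L ^ ?e * (?L / 2)" by (simp add: mult_ac)
    also have "\<dots> \<le> c / 2 ^ ?e * M * ?L ^ ?e * (\<Sum>m=1..K. 1 / real m)" using c M by (intro mult_left_mono harm) auto
    also have "\<dots> \<le> (\<Sum>m=1..K. real (card (hyp_points J (M / real m))))"
      unfolding sum_distrib_left by (rule sum_mono) (rule term_le)
    also have "\<dots> = real (card (Sigma {1..K} (\<lambda>m. hyp_points J (M / real m))))"
      using finite_hyp_points[OF insert(1)] by (subst card_SigmaI) auto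
    also have "\<dots> = real (card ((\<lambda>(m, k). k(j := m)) ` Sigma {1..K} (\<lambda>m. hyp_points J (M / real m))))"
    proof (rule arg_cong[where f=real], rule card_image[symmetric], rule inj_onI, clarify)
      fix x k y l assume "k \<in> hyp_points J (M / real x)" "l \<in> hyp_points J (M / real y)" and eq: "k(j := x) = l(j := y)"
      \<comment> \<open>Extensional functions share the default value at j, so the update there
        loses no information.\<close>
      then have "k j = undefined" "l j = undefined" using insert(3) by (auto simp: hyp_points_def PiE_iff extensional_def)
      then have "k i = l i" for i using fun_cong[OF eq, of i] by (cases "i = j") auto
      then have "k = l" by (rule ext)
      moreover have "x = y" using eq by (metis fun_upd_same)
      ultimately show "x = y \<and> k = l" by simp
    qed
    also have "\<dots> \<le> real (card (hyp_points (insert j J) M))"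
    proof (rule of_nat_mono, rule card_mono)
      show "finite (hyp_points (insert j J) M)" by (rule finite_hyp_points) (use insert in simp)
      show "(\<lambda>(m, k). k(j := m)) ` Sigma {1..K} (\<lambda>m. hyp_points J (M / real m)) \<subseteq> hyp_points (insert j J) M"
      proof clarify
        fix m k assume m: "m \<in> {1..K}" and k: "k \<in> hyp_points J (M / real m)"
        have "(\<Prod>i\<in>insert j J. (k(j := m)) i) = m * (\<Prod>i\<in>J. k i)"
        proof -
          have "(\<Prod>i\<in>J. (k(j := m)) i) = (\<Prod>i\<in>J. k i)" by (rule prod.cong) (use insert(3) in auto)
          then show ?thesis using insert(1,3) by (subst prod.insert) auto
        qed
        then have "real (\<Prod>i\<in>insert j J. (k(j := m)) i) = real m * real (\<Prod>i\<in>J. k i)" by simp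
        also have "\<dots> \<le> M" using k m by (simp add: hyp_points_def pos_le_divide_eq mult.commute)
        finally show "k(j := m) \<in> hyp_points (insert j J) M"
          using k m by (auto simp: hyp_points_def PiE_iff extensional_def)
      qed
    qed
    finally show "c / 2 ^ Suc ?e * M * ?L ^ (card (insert j J) - 1) \<le> real (card (hyp_points (insert j J) M))" unfolding e .
  qed
qed

section \<open>Trigonometric polynomials on the unit cube\<close>

lemma cube_integral_prod:
  fixes f :: "'d::finite \<Rightarrow> real \<Rightarrow> complex"
  assumes f: "\<And>i. continuous_on UNIV (f i)"
  shows "(LINT x|(unit_cube :: (real ^ 'd) measure). (\<Prod>i\<in>UNIV. f i (x $ i))) =
    (\<Prod>i\<in>UNIV. (LINT t|lborel. indicator {- 1 / 2..1 / 2} t *\<^sub>R f i t))"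
proof -
  interpret product_sigma_finite "\<lambda>_ :: real ^ 'd. lborel :: real measure"
    by (rule product_sigma_finite.intro) (rule sigma_finite_lborel)
  define g where "g i t = indicator {- 1 / 2..1 / 2} t *\<^sub>R f i t" for i t
  define ax where "ax i = (axis i 1 :: real ^ 'd)" for i
  have inj: "inj ax" by (auto simp: inj_def ax_def axis_eq_axis)
  have Bas: "Basis = range ax" by (auto simp: Basis_vec_def ax_def)
  have gi: "integrable lborel (g i)" for i
    unfolding g_def[abs_def] by (rule borel_integrable_compact) (auto intro: continuous_on_subset[OF f])
  then have gm[measurable]: "g i \<in> borel_fun" for i using borel_measurable_integrable by fastforce
  have reind: "(\<Prod>b\<in>Basis. G b) = (\<Prod>i\<in>UNIV. G (ax i))" for G :: "real ^ 'd \<Rightarrow> complex"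
    unfolding Bas by (subst prod.reindex[OF inj]) simp
  have comp: "(\<Sum>b\<in>Basis. y b *\<^sub>R b) $ i = y (ax i)" for y :: "real ^ 'd \<Rightarrow> real" and i
    unfolding cart_eq_inner_axis ax_def by (rule inner_sum_left_Basis) (simp add: axis_in_Basis_iff)
  have cube: "indicator (cube 1 0) x *\<^sub>R (\<Prod>i\<in>UNIV. f i (x $ i)) = (\<Prod>i\<in>UNIV. g i (x $ i))" for x :: "real ^ 'd"
  proof (cases "x \<in> cube 1 0")
    case True
    then have "- 1 / 2 \<le> x $ i \<and> x $ i \<le> 1 / 2" for i by (auto simp: cube_def abs_le_iff dest!: spec[of _ i])
    then show ?thesis using True by (simp add: g_def)
  next
    case False
    then obtain i where "\<not> \<bar>x $ i\<bar> \<le> 1 / 2" by (auto simp: cube_def)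
    then have "g i (x $ i) = 0" by (auto simp: g_def indicator_def abs_le_iff)
    then have "(\<Prod>i\<in>UNIV. g i (x $ i)) = 0" by (intro prod_zero) auto
    then show ?thesis using False by simp
  qed
  have "(LINT x|(unit_cube :: (real ^ 'd) measure). (\<Prod>i\<in>UNIV. f i (x $ i))) = (LINT x|lborel. (\<Prod>i\<in>UNIV. g i (x $ i)))"
    unfolding leb_on_def by (subst integral_restrict_space) (simp_all add: cube cube_borel)
  also have "\<dots> = (LINT y|PiM Basis (\<lambda>_. lborel). (\<Prod>i\<in>UNIV. g i ((\<Sum>b\<in>Basis. y b *\<^sub>R b) $ i)))"
    by (subst lborel_eq, subst integral_distr) auto
  also have "\<dots> = (LINT y|PiM Basis (\<lambda>_. lborel). (\<Prod>b\<in>Basis. g (inv ax b) (y b)))"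
    unfolding reind comp by (simp add: inv_f_f[OF inj])
  also have "\<dots> = (\<Prod>b\<in>Basis. (LINT t|lborel. g (inv ax b) t))"
    by (rule product_integral_prod) (auto intro: gi)
  also have "\<dots> = (\<Prod>i\<in>UNIV. (LINT t|lborel. g i t))" unfolding reind by (simp add: inv_f_f[OF inj])
  finally show ?thesis by (simp add: g_def)
qed

lemma integral_cis_int:
  "(LINT t|lborel. indicator {- 1 / 2..1 / 2} t *\<^sub>R cis (2 * pi * real_of_int m * t)) = (if m = 0 then 1 else 0)"
proof (cases "m = 0")
  case False
  let ?z = "2 * pi * real_of_int m"
  have "(LINT t|lborel. indicator {- 1 / 2..1 / 2} t *\<^sub>R cis (?z * t)) =
    cis (?z * (1 / 2)) / (\<i> * ?z) - cis (?z * (- 1 / 2)) / (\<i> * ?z)"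
  proof (rule integral_FTC_atLeastAtMost)
    show "((\<lambda>t. cis (?z * t) / (\<i> * ?z)) has_vector_derivative cis (?z * t)) (at t within {- 1 / 2..1 / 2})" for t
      unfolding cis_conv_exp using False
      by (auto intro!: derivative_eq_intros has_vector_derivative_real_field simp: field_simps)
    show "continuous_on {- 1 / 2..1 / 2} (\<lambda>t. cis (?z * t))" by (intro continuous_intros)
  qed simp
  \<comment> \<open>Both endpoints give the same value, since the sine vanishes at integer multiples
    of pi.\<close>
  also have "cis (?z * (1 / 2)) = cis (?z * (- 1 / 2))"
    using sin_npi_int[of m] by (simp add: complex_eq_iff mult.commute)
  finally show ?thesis using False by simp
qed simp

definition trig :: "('d::finite \<Rightarrow> nat) \<Rightarrow> real ^ 'd \<Rightarrow> complex" where
  "trig k x = (\<Prod>i\<in>UNIV. cis (2 * pi * real (k i) * x $ i))"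

lemma norm_trig: "norm (trig k x) = 1" by (simp add: trig_def prod_norm[symmetric])

lemma continuous_trig: "continuous_on UNIV (trig k)"
  unfolding trig_def[abs_def] by (intro continuous_intros)

lemma trig_borel[measurable]: "trig k \<in> borel_fun"
  by (rule borel_measurable_continuous_onI[OF continuous_trig])

lemma trig_orthogonal:
  "(LINT x|(unit_cube :: (real ^ 'd) measure). trig k x * cnj (trig l x)) = (if k = l then 1 else 0)"
proof -
  have "trig k x * cnj (trig l x) = (\<Prod>i\<in>UNIV. cis (2 * pi * real_of_int (int (k i) - int (l i)) * x $ i))" for x :: "real ^ 'd"
    unfolding trig_def cnj_prod prod.distrib[symmetric]
    by (intro prod.cong refl) (simp add: cis_cnj cis_mult algebra_simps)
  then have "(LINT x|(unit_cube :: (real ^ 'd) measure). trig k x * cnj (trig l x)) =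
    (\<Prod>i\<in>UNIV. (LINT t|lborel. indicator {- 1 / 2..1 / 2} t *\<^sub>R cis (2 * pi * real_of_int (int (k i) - int (l i)) * t)))"
    by (simp only:) (rule cube_integral_prod, intro continuous_intros)
  also have "\<dots> = (\<Prod>i\<in>UNIV. if k i = l i then 1 else 0)" unfolding integral_cis_int by simp
  also have "\<dots> = (if k = l then 1 else 0)" by (auto simp: fun_eq_iff)
  finally show ?thesis .
qed

definition trig_poly :: "('d::finite \<Rightarrow> nat) set \<Rightarrow> (('d \<Rightarrow> nat) \<Rightarrow> real) \<Rightarrow> real ^ 'd \<Rightarrow> complex" where
  "trig_poly J c x = (\<Sum>k\<in>J. of_real (c k) * trig k x)"

lemma continuous_trig_poly: "continuous_on UNIV (trig_poly J c)"
  unfolding trig_poly_def[abs_def] by (intro continuous_intros continuous_trig)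

lemma trig_poly_borel[measurable]: "trig_poly J c \<in> borel_fun"
  by (rule borel_measurable_continuous_onI[OF continuous_trig_poly])

lemma trig_poly_parseval:
  assumes J: "finite J"
  shows "(\<integral>\<^sup>+x. ennreal ((norm (trig_poly J c x))\<^sup>2) \<partial>(unit_cube :: (real ^ 'd) measure)) = ennreal (\<Sum>k\<in>J. (c k)\<^sup>2)"
proof -
  let ?Q = "(unit_cube :: (real ^ 'd) measure)"
  have int: "integrable ?Q h" if "continuous_on UNIV h" for h :: "real ^ 'd \<Rightarrow> complex"
    using continuous_set_integrable[OF that compact_cube, of 1 0]
    unfolding leb_on_def set_integrable_def by (subst integrable_restrict_space) (simp_all add: cube_borel)
  have eq: "complex_of_real ((norm (trig_poly J c x))\<^sup>2) = (\<Sum>k\<in>J. \<Sum>l\<in>J. of_real (c k) * of_real (c l) * (trig k x * cnj (trig l x)))" for x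
  proof -
    have "complex_of_real ((norm (trig_poly J c x))\<^sup>2) = trig_poly J c x * cnj (trig_poly J c x)"
      by (rule complex_norm_square)
    also have "\<dots> = (\<Sum>k\<in>J. \<Sum>l\<in>J. of_real (c k) * of_real (c l) * (trig k x * cnj (trig l x)))"
      unfolding trig_poly_def cnj_sum sum_product by (intro sum.cong refl) (simp add: mult_ac)
    finally show ?thesis .
  qed
  have i1: "integrable ?Q (\<lambda>x. (norm (trig_poly J c x))\<^sup>2)"
  proof -
    have "integrable ?Q (\<lambda>x. complex_of_real ((norm (trig_poly J c x))\<^sup>2))"
      by (rule int) (intro continuous_intros continuous_trig_poly)
    then show ?thesis by (simp only: complex_of_real_integrable_eq)
  qed
  have "complex_of_real (LINT x|?Q. (norm (trig_poly J c x))\<^sup>2) = (LINT x|?Q. complex_of_real ((norm (trig_poly J c x))\<^sup>2))"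
    by (rule integral_complex_of_real[symmetric])
  also have "\<dots> = (\<Sum>k\<in>J. \<Sum>l\<in>J. of_real (c k) * of_real (c l) * (LINT x|?Q. trig k x * cnj (trig l x)))"
  proof -
    have 1: "integrable ?Q (\<lambda>x. of_real (c k) * of_real (c l) * (trig k x * cnj (trig l x)))" for k l
      by (rule int) (intro continuous_intros continuous_trig)
    show ?thesis unfolding eq using 1 by (simp add: L_integral_sum)
  qed
  also have "\<dots> = complex_of_real (\<Sum>k\<in>J. (c k)\<^sup>2)"
    unfolding trig_orthogonal using J by (simp add: power2_eq_square if_distrib sum.delta cong: if_cong)
  finally have "(LINT x|?Q. (norm (trig_poly J c x))\<^sup>2) = (\<Sum>k\<in>J. (c k)\<^sup>2)" by (simp only: of_real_eq_iff)
  then show ?thesis by (subst nn_integral_eq_integral[OF i1]) auto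
qed

text \<open>Makes the directional derivative that of an exponential in one real variable.\<close>

lemma trig_shift:
  "trig k (x + t *\<^sub>R axis i 1) = trig k x * exp (of_real t * (2 * of_real pi * \<i> * of_nat (k i)))"
proof -
  have "trig k (x + t *\<^sub>R axis i 1) =
    (\<Prod>j\<in>UNIV. cis (2 * pi * real (k j) * x $ j) * (if j = i then cis (2 * pi * real (k i) * t) else 1))"
    unfolding trig_def by (intro prod.cong refl) (simp add: axis_def cis_mult algebra_simps)
  also have "\<dots> = trig k x * cis (2 * pi * real (k i) * t)"
    unfolding prod.distrib trig_def by (simp add: prod.delta)
  finally show ?thesis by (simp add: cis_conv_exp mult_ac)
qed

definition trig_coeff :: "('d::finite \<Rightarrow> nat) \<Rightarrow> nat ^ 'd \<Rightarrow> complex" where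
  "trig_coeff k m = (\<Prod>j\<in>UNIV. (2 * of_real pi * \<i> * of_nat (k j)) ^ (m $ j))"

definition trig_deriv :: "('d::finite \<Rightarrow> nat) set \<Rightarrow> (('d \<Rightarrow> nat) \<Rightarrow> real) \<Rightarrow> nat ^ 'd \<Rightarrow> real ^ 'd \<Rightarrow> complex" where
  "trig_deriv J c m x = (\<Sum>k\<in>J. of_real (c k) * (trig_coeff k m * trig k x))"

lemma trig_deriv_0: "trig_deriv J c 0 = trig_poly J c"
  by (simp add: fun_eq_iff trig_deriv_def trig_poly_def trig_coeff_def)

lemma continuous_trig_deriv: "continuous_on UNIV (trig_deriv J c m)"
  unfolding trig_deriv_def[abs_def] by (intro continuous_intros continuous_trig)

lemma trig_deriv_borel[measurable]: "trig_deriv J c m \<in> borel_fun"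
  by (rule borel_measurable_continuous_onI[OF continuous_trig_deriv])

lemma trig_coeff_Suc: "trig_coeff k (m + axis i 1) = (2 * of_real pi * \<i> * of_nat (k i)) * trig_coeff k m"
proof -
  let ?z = "\<lambda>j. 2 * of_real pi * \<i> * of_nat (k j) :: complex"
  have "trig_coeff k (m + axis i 1) = (\<Prod>j\<in>UNIV. ?z j ^ (m $ j) * (if j = i then ?z i else 1))"
    unfolding trig_coeff_def plus_axis_nth by (intro prod.cong refl) (simp add: mult.commute)
  then show ?thesis unfolding prod.distrib by (simp add: prod.delta trig_coeff_def mult.commute)
qed

lemma trig_deriv_weak_family: "weak_family r (trig_deriv J c)"
  unfolding weak_family_def
proof (intro conjI ballI allI impI)
  fix m :: "nat ^ 'a"
  show "locally_integrable UNIV (trig_deriv J c m)"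
    unfolding locally_integrable_def using continuous_set_integrable[OF continuous_trig_deriv] by blast
  show "trig_deriv J c m \<in> borel_fun" by measurable
  fix i :: 'a and \<psi> :: "real ^ 'a \<Rightarrow> real" assume \<psi>: "test_function UNIV \<psi>"
  show "(LINT x|lborel. trig_deriv J c m x * of_real (partial_deriv i \<psi> x)) =
        - (LINT x|lborel. trig_deriv J c (m + axis i 1) x * of_real (\<psi> x))"
  proof (rule integral_by_parts_test[OF continuous_trig_deriv continuous_trig_deriv _ \<psi>])
    fix x :: "real ^ 'a" and t
    have 1: "((\<lambda>t. trig k (x + t *\<^sub>R axis i 1)) has_vector_derivative
        trig k (x + t *\<^sub>R axis i 1) * (2 * of_real pi * \<i> * of_nat (k i))) (at t)" for k
      unfolding trig_shift
      by (rule has_vector_derivative_real_field) (auto intro!: derivative_eq_intros)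
    show "((\<lambda>t. trig_deriv J c m (x + t *\<^sub>R axis i 1)) has_vector_derivative
        trig_deriv J c (m + axis i 1) (x + t *\<^sub>R axis i 1)) (at t)"
      unfolding trig_deriv_def
    proof (rule has_vector_derivative_sum)
      fix k
      show "((\<lambda>t. of_real (c k) * (trig_coeff k m * trig k (x + t *\<^sub>R axis i 1))) has_vector_derivative
        of_real (c k) * (trig_coeff k (m + axis i 1) * trig k (x + t *\<^sub>R axis i 1))) (at t)"
        using has_vector_derivative_mult_right[OF has_vector_derivative_mult_right[OF 1[of k], of "trig_coeff k m"], of "of_real (c k)"]
        unfolding trig_coeff_Suc by (simp only: mult_ac)
    qed
  qed
qed

text \<open>All frequencies are at least 1, so every factor 2 pi k_j is at least 1 and may be raised
  to the full power r; the product of the k_j is at most M. This is why the points of the cross have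
  positive entries only.\<close>

lemma norm_trig_coeff_le:
  fixes m :: "nat ^ 'd"
  assumes k: "k \<in> hyp_points UNIV M" and m: "m \<in> multi_idx r"
  shows "norm (trig_coeff k m) \<le> ((2 * pi) ^ CARD('d) * M) ^ r"
proof -
  have k1: "1 \<le> real (k j)" for j using hyp_points_le(1)[OF _ k, of j] by simp
  have pi1: "2 * pi * real (k j) \<ge> 1" for j
    using mult_mono[of 1 "2 * pi" 1 "real (k j)"] k1[of j] pi_gt3 by simp
  have "norm (trig_coeff k m) = (\<Prod>j\<in>UNIV. (2 * pi * real (k j)) ^ (m $ j))"
    unfolding trig_coeff_def by (simp add: prod_norm[symmetric] norm_power norm_mult)
  also have "\<dots> \<le> (\<Prod>j\<in>UNIV. (2 * pi * real (k j)) ^ r)"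
    using m pi1 by (intro prod_mono conjI power_increasing) (auto simp: multi_idx_def)
  also have "\<dots> = ((2 * pi) ^ CARD('d) * real (\<Prod>j\<in>UNIV. k j)) ^ r"
    by (simp add: prod_power_distrib[symmetric] prod.distrib)
  also have "\<dots> \<le> ((2 * pi) ^ CARD('d) * M) ^ r"
    using k by (intro power_mono mult_left_mono) (auto simp: hyp_points_def intro!: prod_nonneg mult_nonneg_nonneg)
  finally show ?thesis .
qed

lemma integrable_unit_cube:
  fixes g :: "real ^ 'd \<Rightarrow> real"
  assumes "continuous_on UNIV g" shows "integrable unit_cube g"
proof -
  have "integrable lborel (\<lambda>x. indicator (cube 1 0) x *\<^sub>R g x)"
    by (rule borel_integrable_compact[OF compact_cube]) (rule continuous_on_subset[OF assms], simp)
  then show ?thesis unfolding leb_on_def by (subst integrable_restrict_space) (simp_all add: cube_borel)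
qed

lemma trig_poly_parseval_real:
  assumes "finite J"
  shows "(LINT x|unit_cube. (norm (trig_poly J c x))\<^sup>2) = (\<Sum>k\<in>J. (c k)\<^sup>2)"
proof -
  have i: "integrable unit_cube (\<lambda>x. (norm (trig_poly J c x))\<^sup>2)"
    by (intro integrable_unit_cube continuous_intros continuous_trig_poly)
  then have "ennreal (LINT x|unit_cube. (norm (trig_poly J c x))\<^sup>2) = ennreal (\<Sum>k\<in>J. (c k)\<^sup>2)"
    unfolding trig_poly_parseval[OF assms, symmetric] by (intro nn_integral_eq_integral[symmetric]) auto
  then show ?thesis by (subst (asm) ennreal_inj) (auto intro!: sum_nonneg)
qed

lemma sum_sq_signs:
  assumes "finite I" "s \<in> signs I" shows "(\<Sum>k\<in>I. (s k)\<^sup>2) = real (card I)"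
proof -
  have "(\<Sum>k\<in>I. (s k)\<^sup>2) = (\<Sum>k\<in>I. 1)" by (rule sum.cong) (use signs_cases[OF assms(2)] in fastforce)+
  then show ?thesis by simp
qed

text \<open>Cauchy-Schwarz on a space of measure 1, in the form h <= w/2 + h^2 / (2 w) with w^2 = N,
  together with Parseval's identity.\<close>

lemma trig_poly_L1_le:
  assumes J: "finite J" "J \<noteq> {}" and s: "s \<in> signs J"
  shows "(LINT x|unit_cube. norm (trig_poly J s x)) \<le> sqrt (real (card J))"
proof -
  let ?w = "sqrt (real (card J))" and ?h = "\<lambda>x. norm (trig_poly J s x)"
  have w: "?w > 0" "?w * ?w = real (card J)" using J by (auto simp: card_gt_0_iff)
  have i: "integrable unit_cube ?h" "integrable unit_cube (\<lambda>x. (?h x)\<^sup>2)" "integrable unit_cube (\<lambda>_. ?w)"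
    by (intro integrable_unit_cube continuous_intros continuous_trig_poly)+
  have m1: "measure unit_cube (space unit_cube) = 1" by (simp add: measure_def emeasure_unit_cube)
  have "(LINT x|unit_cube. ?h x) \<le> (LINT x|unit_cube. ?w / 2 + (?h x)\<^sup>2 / (2 * ?w))"
  proof (rule integral_mono)
    show "integrable unit_cube (\<lambda>x. ?w / 2 + (?h x)\<^sup>2 / (2 * ?w))"
      by (intro integrable_unit_cube continuous_intros continuous_trig_poly) (use w in simp)
    fix x
    have "0 \<le> (?w - ?h x)\<^sup>2" by simp
    then have "?h x * (2 * ?w) \<le> ?w * ?w + (?h x)\<^sup>2" by (simp add: power2_eq_square algebra_simps)
    then have "?h x \<le> (?w * ?w + (?h x)\<^sup>2) / (2 * ?w)" using w(1) by (subst pos_le_divide_eq) auto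
    moreover have "(w * w + y) / (2 * w) = w / 2 + y / (2 * w)" if "w > 0" for w y :: real
      using that by (simp add: field_simps)
    ultimately show "?h x \<le> ?w / 2 + (?h x)\<^sup>2 / (2 * ?w)" using w(1) by (simp only:)
  qed (rule i)
  also have "\<dots> = ?w / 2 + (LINT x|unit_cube. (?h x)\<^sup>2) / (2 * ?w)"
    using i(2,3) m1 by (subst L_integral_add) auto
  also have "(LINT x|unit_cube. (?h x)\<^sup>2) = ?w * ?w"
    unfolding trig_poly_parseval_real[OF J(1)] sum_sq_signs[OF J(1) s] w(2) ..
  also have "?w / 2 + ?w * ?w / (2 * ?w) = ?w"
  proof -
    have "w / 2 + w * w / (2 * w) = w" if "w > 0" for w :: real using that by simp
    then show ?thesis using w(1) by blast
  qed
  finally show ?thesis .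
qed

text \<open>An \<open>L\<^sub>1\<close> lower bound from \<open>L\<^sub>2\<close> and \<open>L\<^sub>4\<close>, by integrating
  \<open>h\<^sup>2 \<le> \<tau> \<bar>h\<bar> + h\<^sup>4 / \<tau>\<^sup>2\<close> with \<open>\<tau>\<^sup>2 = 64 C N\<close>.\<close>

lemma trig_poly_L1_separated:
  assumes J: "finite J" "J \<noteq> {}" and s: "s \<in> signs J" and t: "t \<in> signs J" and C: "C > 0"
    and s4: "(LINT x|unit_cube. (norm (trig_poly J s x)) ^ 4) \<le> C * (real (card J))\<^sup>2"
    and t4: "(LINT x|unit_cube. (norm (trig_poly J t x)) ^ 4) \<le> C * (real (card J))\<^sup>2"
    and far: "card J \<le> 8 * hamming J s t"
  shows "sqrt (real (card J)) / (32 * sqrt C) \<le> (LINT x|unit_cube. norm (trig_poly J s x - trig_poly J t x))"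
proof -
  define N where "N = real (card J)"
  have N: "N > 0" using J by (simp add: N_def card_gt_0_iff)
  define \<tau> where "\<tau> = 8 * sqrt C * sqrt N"
  have \<tau>: "\<tau> > 0" "\<tau>\<^sup>2 = 64 * C * N" using C N by (auto simp: \<tau>_def power_mult_distrib)
  let ?u = "\<lambda>x. norm (trig_poly J s x)" and ?v = "\<lambda>x. norm (trig_poly J t x)"
  let ?h = "\<lambda>x. norm (trig_poly J s x - trig_poly J t x)"
  let ?I = "LINT x|unit_cube. ?h x"
  have i: "integrable unit_cube ?h" "integrable unit_cube (\<lambda>x. (?h x)\<^sup>2)" "integrable unit_cube (\<lambda>x. (?h x) ^ 4)"
    "integrable unit_cube (\<lambda>x. (?u x) ^ 4)" "integrable unit_cube (\<lambda>x. (?v x) ^ 4)"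
    by (intro integrable_unit_cube continuous_intros continuous_trig_poly)+
  have diff: "trig_poly J s x - trig_poly J t x = trig_poly J (\<lambda>k. s k - t k) x" for x
    by (simp add: trig_poly_def sum_subtractf algebra_simps)
  have L2: "N / 2 \<le> (LINT x|unit_cube. (?h x)\<^sup>2)"
  proof -
    \<comment> \<open>Signs that disagree differ by 2 in modulus, so each disagreement contributes
      4.\<close>
    have "(\<Sum>k\<in>J. (s k - t k)\<^sup>2) = (\<Sum>k\<in>{k \<in> J. s k \<noteq> t k}. 4)"
    proof (rule sum.mono_neutral_cong_right[OF J(1)])
      fix k assume "k \<in> {k \<in> J. s k \<noteq> t k}"
      then have "k \<in> J" "s k \<noteq> t k" by auto
      then show "(s k - t k)\<^sup>2 = 4" using signs_cases[OF s, of k] signs_cases[OF t, of k] by auto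
    qed auto
    then have "(\<Sum>k\<in>J. (s k - t k)\<^sup>2) = 4 * real (hamming J s t)" by (simp add: hamming_def)
    moreover have "N \<le> 8 * real (hamming J s t)" using far unfolding N_def by linarith
    ultimately show ?thesis unfolding diff trig_poly_parseval_real[OF J(1)] by linarith
  qed
  have L4: "(LINT x|unit_cube. (?h x) ^ 4) \<le> 16 * C * N\<^sup>2"
  proof -
    have "(LINT x|unit_cube. (?h x) ^ 4) \<le> (LINT x|unit_cube. 8 * (?u x) ^ 4 + 8 * (?v x) ^ 4)"
    proof (rule integral_mono[OF i(3)])
      show "integrable unit_cube (\<lambda>x. 8 * (?u x) ^ 4 + 8 * (?v x) ^ 4)"
        by (intro integrable_unit_cube continuous_intros continuous_trig_poly)
      fix x
      have "(?h x) ^ 4 \<le> (?u x + ?v x) ^ 4" by (intro power_mono norm_triangle_ineq4) simp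
      also have "\<dots> \<le> 8 * (?u x) ^ 4 + 8 * (?v x) ^ 4"
      proof -
        have sq: "(a + b)\<^sup>2 \<le> 2 * (a\<^sup>2 + b\<^sup>2)" for a b :: real
          using zero_le_power2[of "a - b"] by (simp add: power2_eq_square algebra_simps)
        have "(?u x + ?v x) ^ 4 = ((?u x + ?v x)\<^sup>2)\<^sup>2" by (simp add: power_mult[symmetric])
        also have "\<dots> \<le> (2 * ((?u x)\<^sup>2 + (?v x)\<^sup>2))\<^sup>2" by (intro power_mono sq) simp
        also have "\<dots> = 4 * ((?u x)\<^sup>2 + (?v x)\<^sup>2)\<^sup>2" unfolding power_mult_distrib by simp
        also have "\<dots> \<le> 4 * (2 * (((?u x)\<^sup>2)\<^sup>2 + ((?v x)\<^sup>2)\<^sup>2))" by (intro mult_left_mono sq) simp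
        finally show ?thesis by (simp add: power_mult[symmetric])
      qed
      finally show "(?h x) ^ 4 \<le> 8 * (?u x) ^ 4 + 8 * (?v x) ^ 4" .
    qed
    also have "\<dots> = 8 * (LINT x|unit_cube. (?u x) ^ 4) + 8 * (LINT x|unit_cube. (?v x) ^ 4)"
      using i(4,5) by simp
    also have "\<dots> \<le> 8 * (C * N\<^sup>2) + 8 * (C * N\<^sup>2)" using s4 t4 unfolding N_def by linarith
    finally show ?thesis by simp
  qed
  have "(LINT x|unit_cube. (?h x)\<^sup>2) \<le> (LINT x|unit_cube. \<tau> * ?h x + (?h x) ^ 4 / \<tau>\<^sup>2)"
  proof (rule integral_mono[OF i(2)])
    show "integrable unit_cube (\<lambda>x. \<tau> * ?h x + (?h x) ^ 4 / \<tau>\<^sup>2)"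
      by (intro integrable_unit_cube continuous_intros continuous_trig_poly) (use \<tau>(1) in simp)
    fix x
    show "(?h x)\<^sup>2 \<le> \<tau> * ?h x + (?h x) ^ 4 / \<tau>\<^sup>2"
    proof (cases "?h x \<le> \<tau>")
      case True
      then have "?h x * ?h x \<le> \<tau> * ?h x" by (intro mult_right_mono) auto
      moreover have "0 \<le> (?h x) ^ 4 / \<tau>\<^sup>2" by simp
      ultimately show ?thesis unfolding power2_eq_square by linarith
    next
      case False
      then have "\<tau>\<^sup>2 \<le> (?h x)\<^sup>2" using \<tau>(1) by (intro power_mono) auto
      then have "(?h x)\<^sup>2 * \<tau>\<^sup>2 \<le> (?h x)\<^sup>2 * (?h x)\<^sup>2" by (intro mult_left_mono) auto
      then have "(?h x)\<^sup>2 \<le> (?h x) ^ 4 / \<tau>\<^sup>2" using \<tau>(1) by (simp add: pos_le_divide_eq power_add[symmetric])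
      moreover have "0 \<le> \<tau> * ?h x" using \<tau>(1) by simp
      ultimately show ?thesis by linarith
    qed
  qed
  also have "\<dots> = \<tau> * ?I + (LINT x|unit_cube. (?h x) ^ 4) / \<tau>\<^sup>2"
    using i by (subst L_integral_add) auto
  finally have "N / 2 \<le> \<tau> * ?I + (LINT x|unit_cube. (?h x) ^ 4) / \<tau>\<^sup>2" using L2 by linarith
  moreover have "(LINT x|unit_cube. (?h x) ^ 4) / \<tau>\<^sup>2 \<le> 16 * C * N\<^sup>2 / \<tau>\<^sup>2" by (intro divide_right_mono L4) simp
  \<comment> \<open>With this \<tau> the fourth-power term uses at most half of the L_2 mass N /
    2.\<close>
  moreover have "16 * C * N\<^sup>2 / \<tau>\<^sup>2 = N / 4" unfolding \<tau>(2) using C N by (simp add: power2_eq_square)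
  ultimately have 1: "N / 4 \<le> \<tau> * ?I" by linarith
  have "\<tau> * (sqrt N / (32 * sqrt C)) = N / 4" using C N by (simp add: \<tau>_def)
  then have "\<tau> * (sqrt N / (32 * sqrt C)) \<le> \<tau> * ?I" using 1 by simp
  then show ?thesis using \<tau>(1) unfolding N_def by (rule mult_left_le_imp_le)
qed

lemma trig_deriv_scale: "trig_deriv J (\<lambda>k. t * c k) m x = of_real t * trig_deriv J c m x"
  by (simp add: trig_deriv_def sum_distrib_left mult.assoc)

lemma fam_pn_trig_scale:
  assumes "t \<ge> 0"
  shows "fam_pn r p (trig_deriv J (\<lambda>k. t * c k)) x = ennreal (t powr p) * fam_pn r p (trig_deriv J c) x"
  unfolding fam_pn_def trig_deriv_scale pn_mult sum_distrib_left using assms by (simp add: pn_def)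

section \<open>Random polynomials in the Sobolev ball\<close>

context hc_setting
begin

lemma trig_in_ball:
  assumes le: "(\<integral>\<^sup>+x. fam_pn r p (trig_deriv J c) x \<partial>\<mu>) \<le> 1"
  shows "trig_poly J c \<in> sobolev_ball r p \<mu>"
proof -
  have int: "interior (space \<mu>) = UNIV" by (simp add: space_weight_measure)
  have E: "trig_deriv J c m \<in> Lp p \<mu>" if "m \<in> multi_idx r" for m
  proof -
    have "(\<integral>\<^sup>+x. pn p (trig_deriv J c m x) \<partial>\<mu>) \<le> (\<integral>\<^sup>+x. fam_pn r p (trig_deriv J c) x \<partial>\<mu>)"
      by (intro nn_integral_mono pn_le_fam_pn that)
    also have "\<dots> < \<infinity>" using le by (rule le_less_trans) simp
    finally show ?thesis by (simp add: Lp_iff measurable_weight)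
  qed
  have wd: "has_weak_deriv UNIV m (trig_poly J c) (trig_deriv J c m)" if "m \<in> multi_idx r" for m
    using weak_family_has_weak_deriv[OF trig_deriv_weak_family[of r J c] that] unfolding trig_deriv_0 .
  have 0: "(0 :: nat ^ 'd) \<in> multi_idx r" by (simp add: multi_idx_def)
  have "trig_poly J c \<in> sobolev r p \<mu>"
    unfolding sobolev_def int using E[OF 0] E wd by (auto simp: trig_deriv_0 multi_idx_def)
  moreover have "sobolev_norm r p \<mu> (trig_poly J c) \<le> 1"
  proof -
    have "ennreal (sobolev_norm r p \<mu> (trig_poly J c) powr p) = (\<Sum>m\<in>multi_idx r. \<integral>\<^sup>+x. pn p (trig_deriv J c m x) \<partial>\<mu>)"
      by (rule sobolev_norm_eq[OF part \<theta>0 p0(1)]) (use E wd in \<open>auto simp: int AE_weight\<close>)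
    also have "\<dots> = (\<integral>\<^sup>+x. fam_pn r p (trig_deriv J c) x \<partial>\<mu>)"
      unfolding fam_pn_def by (rule nn_integral_sum[symmetric]) (simp add: measurable_weight)
    finally have "ennreal (sobolev_norm r p \<mu> (trig_poly J c) powr p) \<le> ennreal 1" using le by simp
    then have "sobolev_norm r p \<mu> (trig_poly J c) powr p \<le> 1" by (subst (asm) ennreal_le_iff) auto
    then have "(sobolev_norm r p \<mu> (trig_poly J c) powr p) powr (1 / p) \<le> 1 powr (1 / p)"
      using p0 by (intro powr_mono2) auto
    moreover have "sobolev_norm r p \<mu> (trig_poly J c) \<ge> 0" by (simp add: sobolev_norm_def)
    ultimately show ?thesis using p0 by (simp add: powr_powr)
  qed
  ultimately show ?thesis by (simp add: sobolev_ball_def)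
qed

abbreviation (input) good where
  "good C1 C4 M J \<equiv> {s \<in> signs J.
        (\<integral>\<^sup>+x. fam_pn r p (trig_deriv J s) x \<partial>\<mu>) \<le> ennreal ((C1 * M ^ r * sqrt (real (card J))) powr p) \<and>
        (LINT x|unit_cube. (norm (trig_poly J s x)) ^ 4) \<le> C4 * (real (card J))\<^sup>2}"

text \<open>At each point x Khintchine's inequality bounds the sum over all signs, for every
  derivative and for the fourth power; integration gives the means of the Sobolev mass and of the
  fourth moment. Markov's inequality discards at most a quarter of the signs for each, so half
  remain.\<close>

lemma good_signs:
  obtains C1 C4 :: real where "C1 > 0" "C4 > 0"
    "\<And>M J. M \<ge> 1 \<Longrightarrow> J = hyp_points (UNIV :: 'd set) M \<Longrightarrow> J \<noteq> {} \<Longrightarrow>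
      2 ^ card J \<le> 2 * card (good C1 C4 M J)"
proof -
  obtain Kp where Kp: "Kp \<ge> 1" "\<And>(I :: ('d \<Rightarrow> nat) set) (c :: ('d \<Rightarrow> nat) \<Rightarrow> complex) v. finite I \<Longrightarrow> v > 0 \<Longrightarrow>
      (\<Sum>k\<in>I. (norm (c k))\<^sup>2) \<le> v\<^sup>2 \<Longrightarrow> (\<Sum>s\<in>signs I. norm (\<Sum>k\<in>I. of_real (s k) * c k) powr p) \<le> 2 ^ card I * Kp * v powr p"
    by (rule khintchine[OF p0(1)], rule that; assumption)
  have four: "(4::real) > 0" by simp
  obtain K4 where K4: "K4 \<ge> 1" "\<And>(I :: ('d \<Rightarrow> nat) set) (c :: ('d \<Rightarrow> nat) \<Rightarrow> complex) v. finite I \<Longrightarrow> v > 0 \<Longrightarrow>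
      (\<Sum>k\<in>I. (norm (c k))\<^sup>2) \<le> v\<^sup>2 \<Longrightarrow> (\<Sum>s\<in>signs I. norm (\<Sum>k\<in>I. of_real (s k) * c k) powr 4) \<le> 2 ^ card I * K4 * v powr 4"
    by (rule khintchine[OF four], rule that; assumption)
  \<comment> \<open>The summand 1 makes W positive without a lower bound for the total mass.\<close>
  define W where "W = 1 + enn2real (emeasure \<mu> UNIV)"
  have W: "W > 0" "emeasure \<mu> UNIV \<le> ennreal W"
  proof -
    show "W > 0" by (simp add: W_def add_pos_nonneg)
    have "emeasure \<mu> UNIV = ennreal (enn2real (emeasure \<mu> UNIV))"
      using emeasure_weight_finite[OF lam a, of b, where 'd='d] by (simp add: less_top)
    also have "\<dots> \<le> ennreal W" unfolding W_def by (rule ennreal_leI) simp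
    finally show "emeasure \<mu> UNIV \<le> ennreal W" .
  qed
  define mm where "mm = real (card (multi_idx r :: (nat ^ 'd) set))"
  have "(0 :: nat ^ 'd) \<in> multi_idx r" by (simp add: multi_idx_def)
  then have mm: "mm > 0" unfolding mm_def using finite_multi_idx[of r, where 'd='d] by (auto simp: card_gt_0_iff)
  \<comment> \<open>The 4 comes from Markov's inequality; the rest is total mass times number of
    multi-indices times Khintchine constant.\<close>
  define T where "T = 4 * (W * (mm * Kp))"
  have T: "T > 0" using W mm Kp by (simp add: T_def)
  show ?thesis
  proof (rule that[of "T powr (1 / p) * ((2 * pi) ^ CARD('d)) ^ r" "4 * K4"])
    show "T powr (1 / p) * ((2 * pi) ^ CARD('d)) ^ r > 0" "4 * K4 > 0" using T K4 by auto
    fix M and J :: "('d \<Rightarrow> nat) set" assume M: "M \<ge> 1" and J: "J = hyp_points UNIV M" and ne: "J \<noteq> {}"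
    have f: "finite J" unfolding J by (rule finite_hyp_points) simp
    define N where "N = real (card J)"
    have N: "N > 0" using f ne by (simp add: N_def card_gt_0_iff)
    define H where "H = ((2 * pi) ^ CARD('d) * M) ^ r"
    define v where "v = H * sqrt N"
    have H: "H > 0" using M by (simp add: H_def)
    have v: "v > 0" using H N by (simp add: v_def)
    have fs: "finite (signs J)" "card (signs J) = 2 ^ card J" by (rule finite_signs[OF f], rule card_signs[OF f])
    define V where "V = W * (mm * Kp) * v powr p"
    have V: "V > 0" using W mm Kp v by (simp add: V_def)
    have 4: "4 * V = (T powr (1 / p) * ((2 * pi) ^ CARD('d)) ^ r * M ^ r * sqrt (real (card J))) powr p"
    proof -
      have "T powr (1 / p) * ((2 * pi) ^ CARD('d)) ^ r * M ^ r * sqrt (real (card J)) = T powr (1 / p) * v"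
        by (simp add: v_def H_def N_def power_mult_distrib mult.assoc)
      moreover have "(T powr (1 / p) * v) powr p = T * v powr p" using T v p0 by (simp add: powr_mult powr_powr)
      moreover have "T * v powr p = 4 * V" by (simp add: V_def T_def)
      ultimately show ?thesis by (simp only:)
    qed
    have pt: "(\<Sum>s\<in>signs J. pn p (trig_deriv J s m x)) \<le> ennreal (2 ^ card J * Kp * v powr p)" if m: "m \<in> multi_idx r" for m x
    proof -
      have "(\<Sum>k\<in>J. (norm (trig_coeff k m * trig k x))\<^sup>2) \<le> (\<Sum>k\<in>J. H\<^sup>2)"
        using norm_trig_coeff_le[OF _ m, of _ M] by (intro sum_mono power_mono) (auto simp: J H_def norm_mult norm_trig)
      also have "\<dots> = v\<^sup>2" using N by (simp add: v_def N_def power_mult_distrib)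
      finally show ?thesis unfolding pn_def trig_deriv_def
        by (subst sum_ennreal) (auto intro!: ennreal_leI Kp(2)[OF f v])
    qed
    have "(\<Sum>s\<in>signs J. \<integral>\<^sup>+x. fam_pn r p (trig_deriv J s) x \<partial>\<mu>) = (\<integral>\<^sup>+x. (\<Sum>s\<in>signs J. fam_pn r p (trig_deriv J s) x) \<partial>\<mu>)"
      by (rule nn_integral_sum[symmetric]) (simp add: measurable_weight fam_pn_measurable[OF trig_deriv_weak_family])
    also have "\<dots> \<le> (\<integral>\<^sup>+x. ennreal (mm * (2 ^ card J * Kp * v powr p)) \<partial>\<mu>)"
    proof (rule nn_integral_mono)
      fix x
      have "(\<Sum>s\<in>signs J. fam_pn r p (trig_deriv J s) x) = (\<Sum>m\<in>multi_idx r. \<Sum>s\<in>signs J. pn p (trig_deriv J s m x))"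
        unfolding fam_pn_def by (rule sum.swap)
      also have "\<dots> \<le> (\<Sum>m\<in>(multi_idx r :: (nat ^ 'd) set). ennreal (2 ^ card J * Kp * v powr p))"
        by (rule sum_mono) (rule pt)
      also have "\<dots> = ennreal (mm * (2 ^ card J * Kp * v powr p))"
        using Kp(1) by (simp add: mm_def ennreal_mult ennreal_of_nat_eq_real_of_nat)
      finally show "(\<Sum>s\<in>signs J. fam_pn r p (trig_deriv J s) x) \<le> ennreal (mm * (2 ^ card J * Kp * v powr p))" .
    qed
    also have "\<dots> = ennreal (mm * (2 ^ card J * Kp * v powr p)) * emeasure \<mu> UNIV" by (simp add: space_weight_measure)
    also have "\<dots> \<le> ennreal (mm * (2 ^ card J * Kp * v powr p)) * ennreal W" by (intro mult_left_mono W) simp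
    also have "\<dots> = ennreal (real (card (signs J)) * V)"
      using W(1) mm Kp(1) unfolding fs(2) V_def by (subst ennreal_mult[symmetric]) (auto simp: mult_ac)
    finally have bad1: "4 * card {s \<in> signs J. (\<integral>\<^sup>+x. fam_pn r p (trig_deriv J s) x \<partial>\<mu>) > ennreal (4 * V)} \<le> card (signs J)"
      by (rule markov_count[OF fs(1) V])
    have i4: "integrable unit_cube (\<lambda>x. norm (trig_poly J s x) ^ 4)" for s
      by (intro integrable_unit_cube continuous_intros continuous_trig_poly)
    have "(\<Sum>s\<in>signs J. LINT x|unit_cube. norm (trig_poly J s x) ^ 4) = (LINT x|unit_cube. (\<Sum>s\<in>signs J. norm (trig_poly J s x) ^ 4))"
      by (rule L_integral_sum[symmetric]) (rule i4)
    also have "\<dots> \<le> (LINT x|(unit_cube :: (real ^ 'd) measure). 2 ^ card J * K4 * N\<^sup>2)"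
    proof (rule integral_mono)
      show "integrable unit_cube (\<lambda>x. \<Sum>s\<in>signs J. norm (trig_poly J s x) ^ 4)"
        by (rule L_integrable_sum) (rule i4)
      show "integrable (unit_cube :: (real ^ 'd) measure) (\<lambda>x. 2 ^ card J * K4 * N\<^sup>2)" by (intro integrable_unit_cube continuous_intros)
      fix x :: "real ^ 'd"
      have "(\<Sum>k\<in>J. (norm (trig k x))\<^sup>2) \<le> (sqrt N)\<^sup>2" using N by (simp add: norm_trig N_def)
      then have "(\<Sum>s\<in>signs J. norm (trig_poly J s x) powr 4) \<le> 2 ^ card J * K4 * sqrt N powr 4"
        unfolding trig_poly_def using N by (intro K4(2)[OF f]) auto
      moreover have "sqrt N powr 4 = N\<^sup>2" using N by (simp add: power2_eq_square power4_eq_xxxx)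
      ultimately show "(\<Sum>s\<in>signs J. norm (trig_poly J s x) ^ 4) \<le> 2 ^ card J * K4 * N\<^sup>2" by simp
    qed
    also have "\<dots> = real (card (signs J)) * (K4 * N\<^sup>2)"
      unfolding fs(2) by (simp add: measure_def emeasure_unit_cube)
    finally have "(\<Sum>s\<in>signs J. ennreal (LINT x|unit_cube. norm (trig_poly J s x) ^ 4)) \<le> ennreal (real (card (signs J)) * (K4 * N\<^sup>2))"
      by (subst sum_ennreal) (auto intro!: ennreal_leI)
    then have bad2: "4 * card {s \<in> signs J. ennreal (LINT x|unit_cube. norm (trig_poly J s x) ^ 4) > ennreal (4 * (K4 * N\<^sup>2))} \<le> card (signs J)"
      by (rule markov_count[OF fs(1), rotated]) (use K4 N in simp)
    let ?G = "{s \<in> signs J. (\<integral>\<^sup>+x. fam_pn r p (trig_deriv J s) x \<partial>\<mu>) \<le> ennreal (4 * V) \<and>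
        (LINT x|unit_cube. (norm (trig_poly J s x)) ^ 4) \<le> 4 * K4 * N\<^sup>2}"
    let ?B1 = "{s \<in> signs J. (\<integral>\<^sup>+x. fam_pn r p (trig_deriv J s) x \<partial>\<mu>) > ennreal (4 * V)}"
    let ?B2 = "{s \<in> signs J. ennreal (LINT x|unit_cube. norm (trig_poly J s x) ^ 4) > ennreal (4 * (K4 * N\<^sup>2))}"
    have "signs J \<subseteq> ?G \<union> (?B1 \<union> ?B2)"
    proof
      fix s assume s: "s \<in> signs J"
      have "(LINT x|unit_cube. norm (trig_poly J s x) ^ 4) \<le> 4 * K4 * N\<^sup>2"
        if "\<not> ennreal (LINT x|unit_cube. norm (trig_poly J s x) ^ 4) > ennreal (4 * (K4 * N\<^sup>2))"
        using that K4(1) unfolding not_less mult.assoc by (subst (asm) ennreal_le_iff) auto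
      then show "s \<in> ?G \<union> (?B1 \<union> ?B2)" using s by (auto simp: not_le)
    qed
    then have "card (signs J) \<le> card (?G \<union> (?B1 \<union> ?B2))" by (rule card_mono[rotated]) (use fs(1) in auto)
    also have "\<dots> \<le> card ?G + (card ?B1 + card ?B2)" by (rule order_trans[OF card_Un_le add_left_mono[OF card_Un_le]])
    finally have "card (signs J) \<le> 2 * card ?G" using bad1 bad2 by linarith
    then show "2 ^ card J \<le> 2 * card (good (T powr (1 / p) * ((2 * pi) ^ CARD('d)) ^ r) (4 * K4) M J)"
      unfolding fs(2) 4 N_def .
  qed
qed

text \<open>The weight is bounded below on the unit cube, so the weighted L_q norm controls the
  unweighted one there, and the power mean on measure 1 passes to L_1.\<close>

lemma L1_le_Lq:
  obtains C :: real where "C > 0" "\<And>f. f \<in> Lp q \<mu> \<Longrightarrow> integrable unit_cube f"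
    "\<And>f. f \<in> Lp q \<mu> \<Longrightarrow> (LINT x|unit_cube. norm (f x)) \<le> C * Lp_norm q \<mu> f"
proof -
  let ?w = "1 / weight_low lam a b (0 :: int ^ 'd)"
  have w: "?w > 0" using weight_low_pos[of lam a b "0 :: int ^ 'd"] by simp
  define C where "C = ?w powr (1 / q)"
  have C: "C > 0" using w by (simp add: C_def)
  have key: "v \<le> C * Lp_norm q \<mu> f" if f: "f \<in> Lp q \<mu>" and v: "v \<ge> 0" "ennreal v \<le> (\<integral>\<^sup>+x. ennreal (norm (f x)) \<partial>unit_cube)" for f v
  proof -
    have fm[measurable]: "f \<in> borel_fun" using f by (simp add: Lp_iff measurable_weight)
    have "ennreal (v powr q) \<le> ennreal (1 powr (q - 1)) * (\<integral>\<^sup>+x. ennreal (norm (f x) powr q) \<partial>unit_cube)"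
      by (rule power_mean) (use q v in \<open>auto simp: emeasure_unit_cube intro!: measurable_leb_on\<close>)
    also have "\<dots> = (\<integral>\<^sup>+x. pn q (f x) * indicator (cube 1 0) x \<partial>lborel)"
      by (simp add: nn_integral_leb_on cube_borel pn_def)
    also have "\<dots> \<le> (\<integral>\<^sup>+x. pn q (f x) * indicator (cube 4 (int_vec (0 :: int ^ 'd))) x \<partial>lborel)"
    proof (intro nn_integral_mono mult_left_mono)
      fix x :: "real ^ 'd"
      have "x \<in> cube 1 0 \<Longrightarrow> x \<in> cube 4 (int_vec (0 :: int ^ 'd))"
      proof -
        assume "x \<in> cube 1 0"
        then have "\<bar>x $ i\<bar> \<le> 1 / 2" for i by (auto simp: cube_def)
        then have "\<bar>x $ i\<bar> \<le> 2" for i using order_trans[of "\<bar>x $ i\<bar>" "1 / 2" 2] by simp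
        then show ?thesis by (simp add: cube_def int_vec_def)
      qed
      then show "(indicator (cube 1 0) x :: ennreal) \<le> indicator (cube 4 (int_vec (0 :: int ^ 'd))) x" by (simp add: indicator_def)
    qed simp
    also have "\<dots> \<le> ennreal ?w * (\<integral>\<^sup>+x. pn q (f x) \<partial>\<mu>)" by (rule local_integral_le[OF a lam0]) measurable
    also have "\<dots> = ennreal (?w * Lp_norm q \<mu> f powr q)"
      unfolding Lp_norm_powr[OF f q0(1), symmetric] using w by (intro ennreal_mult[symmetric]) auto
    finally have "v powr q \<le> ?w * Lp_norm q \<mu> f powr q" using w by (subst (asm) ennreal_le_iff) auto
    then have "(v powr q) powr (1 / q) \<le> (?w * Lp_norm q \<mu> f powr q) powr (1 / q)" using q0 by (intro powr_mono2) auto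
    then show ?thesis using q0 v(1) w Lp_norm_nonneg[of q \<mu> f] unfolding C_def
      by (subst (asm) powr_mult) (auto simp: powr_powr)
  qed
  show ?thesis
  proof (rule that[OF C])
    fix f assume f: "f \<in> Lp q \<mu>"
    have fm[measurable]: "f \<in> borel_fun" using f by (simp add: Lp_iff measurable_weight)
    let ?I = "\<integral>\<^sup>+x. ennreal (norm (f x)) \<partial>unit_cube"
    have C0: "C * Lp_norm q \<mu> f \<ge> 0" using C Lp_norm_nonneg[of q \<mu> f] by simp
    have fin: "?I < \<infinity>"
    proof (rule ccontr)
      assume "\<not> ?thesis"
      \<comment> \<open>\<open>key\<close> bounds every finite minorant of the integral, so an
        infinite integral would violate it.\<close>
      then have ge: "ennreal (C * Lp_norm q \<mu> f + 1) \<le> ?I" by (simp add: not_less top_unique)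
      show False using key[OF f _ ge] C0 by simp
    qed
    show i: "integrable unit_cube f" by (rule integrableI_bounded) (use fin in \<open>auto intro: measurable_leb_on\<close>)
    have "ennreal (LINT x|unit_cube. norm (f x)) \<le> ?I" using i by (subst nn_integral_eq_integral) auto
    then show "(LINT x|unit_cube. norm (f x)) \<le> C * Lp_norm q \<mu> f" by (intro key[OF f]) auto
  qed
qed

end

section \<open>The lower bound for the Kolmogorov width\<close>

context hc_setting
begin

text \<open>Suppose an n-dimensional space approximates the ball better than c / M^r. The
  polynomials of a separated set P of good signs, scaled into the ball, have approximants that are
  still separated in L_1 after scaling back. Packing gives card P <= w0^(2 n), while P has at least
  (4/3)^N / 2 elements; N >= K n makes this impossible.\<close>

lemma kolmogorov_lower:
  obtains c K :: real where "c > 0" "K > 0"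
    "\<And>M n. M \<ge> 1 \<Longrightarrow> n \<ge> 1 \<Longrightarrow> K * real n \<le> real (card (hyp_points (UNIV :: 'd set) M)) \<Longrightarrow>
      ennreal (c / M ^ r) \<le> kolmogorov_width n (sobolev_ball r p \<mu>) q \<mu>"
proof -
  obtain C1 C4 where C: "C1 > 0" "C4 > 0" and good: "\<And>M J. M \<ge> 1 \<Longrightarrow> J = hyp_points (UNIV :: 'd set) M \<Longrightarrow> J \<noteq> {} \<Longrightarrow>
      2 ^ card J \<le> 2 * card (good C1 C4 M J)"
    by (rule good_signs, rule that; assumption)
  obtain C7 where C7: "C7 > 0" and Li: "\<And>f. f \<in> Lp q \<mu> \<Longrightarrow> integrable unit_cube f"
    and L1: "\<And>f. f \<in> Lp q \<mu> \<Longrightarrow> (LINT x|unit_cube. norm (f x)) \<le> C7 * Lp_norm q \<mu> f"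
    by (rule L1_le_Lq, rule that; assumption)
  define c1 where "c1 = 1 / (32 * sqrt C4)"
  \<comment> \<open>The packing ratio (R + r)/r for R = sqrt N + R0 and r = R0 = c1 sqrt N / 4, from
    which N cancels.\<close>
  define w0 where "w0 = (1 + c1 / 2) / (c1 / 4)"
  \<comment> \<open>From the logarithm of (4/3)^N <= 2 w0^(2 n); the final 1 makes the contradiction
    strict.\<close>
  define K where "K = (ln 2 + 2 * ln w0) / ln (4 / 3) + 1"
  \<comment> \<open>Chosen so that an error below c / M^r, measured in L_1 and scaled back by 1/t,
    is at most R0.\<close>
  define c where "c = c1 / (4 * C7 * C1)"
  have c1: "c1 > 0" using C by (simp add: c1_def)
  have w0: "w0 > 1" using c1 by (simp add: w0_def pos_less_divide_eq)
  have K: "K > 0" using w0 by (simp add: K_def add_nonneg_pos)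
  have c: "c > 0" using c1 C7 C by (simp add: c_def)
  show ?thesis
  proof (rule that[OF c K], rule ccontr)
    fix M :: real and n :: nat
    assume M: "M \<ge> 1" and n: "n \<ge> 1" and count: "K * real n \<le> real (card (hyp_points (UNIV :: 'd set) M))"
      and "\<not> ennreal (c / M ^ r) \<le> kolmogorov_width n (sobolev_ball r p \<mu>) q \<mu>"
    then have "kolmogorov_width n (sobolev_ball r p \<mu>) q \<mu> < ennreal (c / M ^ r)" by (simp add: not_le)
    then obtain L where Lsub: "linear_subspace (Lp q \<mu>) L" and dim: "dim_at_most \<mu> n L"
      and Llt: "(SUP f\<in>sobolev_ball r p \<mu>. INF g\<in>L. ennreal (Lp_norm q \<mu> (\<lambda>x. f x - g x))) < ennreal (c / M ^ r)"
      unfolding kolmogorov_width_def INF_less_iff by blast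
    define J where "J = hyp_points (UNIV :: 'd set) M"
    define N where "N = real (card J)"
    have fJ: "finite J" unfolding J_def by (rule finite_hyp_points) simp
    have N: "N > 0" "K * real n \<le> N"
    proof -
      show "K * real n \<le> N" using count by (simp add: N_def J_def)
      moreover have "K * real n > 0" using K n by simp
      ultimately show "N > 0" by linarith
    qed
    have ne: "J \<noteq> {}" using N by (auto simp: N_def)
    \<comment> \<open>Scales the good polynomials into the Sobolev ball.\<close>
    define t where "t = 1 / (C1 * M ^ r * sqrt N)"
    have t: "t > 0" using C M N by (simp add: t_def)
    define G where "G = good C1 C4 M J"
    have Gsub: "G \<subseteq> signs J" by (auto simp: G_def)
    have cG: "2 ^ card J \<le> 2 * card G" unfolding G_def by (rule good[OF M J_def ne])
    obtain P where P: "P \<subseteq> G" "\<And>s s'. s \<in> P \<Longrightarrow> s' \<in> P \<Longrightarrow> s \<noteq> s' \<Longrightarrow> card J \<le> 8 * hamming J s s'"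
      "real (card G) \<le> real (card P) * (3 / 2) ^ card J"
      by (rule separated_signs[OF fJ Gsub], rule that; assumption)
    have fP: "finite P" by (rule finite_subset[OF P(1) finite_subset[OF Gsub finite_signs[OF fJ]]])
    define u where "u s = trig_poly J (\<lambda>k. t * s k)" for s
    have u_eq: "u s x = of_real t * trig_poly J s x" for s x
      unfolding u_def using trig_deriv_scale[of J t s 0 x] by (simp add: trig_deriv_0)
    have u_ball: "u s \<in> sobolev_ball r p \<mu>" if s: "s \<in> P" for s
      unfolding u_def
    proof (rule trig_in_ball)
      have sG: "(\<integral>\<^sup>+x. fam_pn r p (trig_deriv J s) x \<partial>\<mu>) \<le> ennreal ((C1 * M ^ r * sqrt N) powr p)"
        using s P(1) by (auto simp: G_def N_def)
      have "(\<integral>\<^sup>+x. fam_pn r p (trig_deriv J (\<lambda>k. t * s k)) x \<partial>\<mu>) = ennreal (t powr p) * (\<integral>\<^sup>+x. fam_pn r p (trig_deriv J s) x \<partial>\<mu>)"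
        using t fam_pn_measurable[OF trig_deriv_weak_family[of r J s]]
        by (simp add: fam_pn_trig_scale nn_integral_cmult measurable_weight)
      also have "\<dots> \<le> ennreal (t powr p) * ennreal ((C1 * M ^ r * sqrt N) powr p)" by (intro mult_left_mono sG) simp
      also have "\<dots> = ennreal ((t * (C1 * M ^ r * sqrt N)) powr p)"
        using t C M N by (subst powr_mult) (simp_all add: ennreal_mult)
      also have "t * (C1 * M ^ r * sqrt N) = 1" using C M N by (simp add: t_def)
      finally show "(\<integral>\<^sup>+x. fam_pn r p (trig_deriv J (\<lambda>k. t * s k)) x \<partial>\<mu>) \<le> 1" by simp
    qed
    have "\<forall>s\<in>P. \<exists>g. g \<in> L \<and> Lp_norm q \<mu> (\<lambda>x. u s x - g x) < c / M ^ r"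
    proof
      fix s assume s: "s \<in> P"
      have "(INF g\<in>L. ennreal (Lp_norm q \<mu> (\<lambda>x. u s x - g x))) < ennreal (c / M ^ r)"
        by (rule le_less_trans[OF SUP_upper[OF u_ball[OF s]] Llt])
      then obtain g where "g \<in> L" and "ennreal (Lp_norm q \<mu> (\<lambda>x. u s x - g x)) < ennreal (c / M ^ r)"
        unfolding INF_less_iff by blast
      then show "\<exists>g. g \<in> L \<and> Lp_norm q \<mu> (\<lambda>x. u s x - g x) < c / M ^ r"
        using Lp_norm_nonneg[of q \<mu>] by (intro exI[of _ g]) (simp add: ennreal_less_iff)
    qed
    then have "\<exists>g. \<forall>s\<in>P. g s \<in> L \<and> Lp_norm q \<mu> (\<lambda>x. u s x - g s x) < c / M ^ r" by (rule bchoice)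
    then obtain g where gP: "\<forall>s\<in>P. g s \<in> L \<and> Lp_norm q \<mu> (\<lambda>x. u s x - g s x) < c / M ^ r" by (elim exE) (rule that)
    have g: "g s \<in> L" "Lp_norm q \<mu> (\<lambda>x. u s x - g s x) < c / M ^ r" if "s \<in> P" for s
      using bspec[OF gP that] by simp_all
    obtain B where B: "B \<subseteq> L" "finite B" "card B \<le> n" and span: "\<forall>g\<in>L. \<exists>c. AE x in \<mu>. g x = (\<Sum>h\<in>B. c h * h x)"
      using dim unfolding dim_at_most_def by (elim exE conjE) (rule that)
    have "\<forall>s\<in>P. \<exists>c. AE x in \<mu>. g s x = (\<Sum>h\<in>B. c h * h x)"
    proof
      fix s assume "s \<in> P"
      show "\<exists>c. AE x in \<mu>. g s x = (\<Sum>h\<in>B. c h * h x)" by (rule bspec[OF span g(1)[OF \<open>s \<in> P\<close>]])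
    qed
    then have "\<exists>cf0. \<forall>s\<in>P. AE x in \<mu>. g s x = (\<Sum>h\<in>B. cf0 s h * h x)" by (rule bchoice)
    then obtain cf0 where cf0: "\<forall>s\<in>P. AE x in \<mu>. g s x = (\<Sum>h\<in>B. cf0 s h * h x)" by (elim exE) (rule that)
    \<comment> \<open>Division by t returns to the unscaled polynomials, for which separation is
      known.\<close>
    define cf where "cf s h = cf0 s h / of_real t" for s h
    have LLp: "h \<in> L \<Longrightarrow> h \<in> Lp q \<mu>" for h using Lsub by (auto simp: linear_subspace_def)
    have Bi: "integrable unit_cube h" if "h \<in> B" for h using that B(1) by (intro Li LLp) blast
    have lin_i: "integrable unit_cube (\<lambda>x. \<Sum>h\<in>B. k h * h x)" for k
      by (intro L_integrable_sum integrable_mult_right Bi)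
    have trig_i: "integrable unit_cube (trig_poly J s)" for s
      using continuous_set_integrable[OF continuous_trig_poly[of J s] compact_cube[of 1 "0 :: real ^ 'd"]]
      unfolding leb_on_def set_integrable_def by (subst integrable_restrict_space) (simp_all add: cube_borel)
    define nn where "nn k = (LINT x|unit_cube. norm (\<Sum>h\<in>B. k h * h x))" for k :: "(real ^ 'd \<Rightarrow> complex) \<Rightarrow> complex"
    let ?D = "\<lambda>s x. trig_poly J s x - (\<Sum>h\<in>B. cf s h * h x)"
    define R0 where "R0 = c1 * sqrt N / 4"
    have R0: "R0 > 0" using c1 N by (simp add: R0_def)
    have close: "(LINT x|unit_cube. norm (?D s x)) \<le> R0" if s: "s \<in> P" for s
    proof -
      have ug: "(\<lambda>x. u s x - g s x) \<in> Lp q \<mu>"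
        using Lp_add[OF ball_Lp[OF u_ball[OF s]] Lp_cmult[OF LLp[OF g(1)[OF s]], of "- 1"] q0(2)] by simp
      have "AE x in lborel. g s x = (\<Sum>h\<in>B. cf0 s h * h x)" using bspec[OF cf0 s] by (simp add: AE_weight)
      then have "AE x in unit_cube. g s x = (\<Sum>h\<in>B. cf0 s h * h x)" unfolding AE_leb_on[OF cube_borel] by eventually_elim simp
      then have "AE x in unit_cube. norm (?D s x) = (1 / t) * norm (u s x - g s x)"
      proof eventually_elim
        fix x assume e: "g s x = (\<Sum>h\<in>B. cf0 s h * h x)"
        have "(\<Sum>h\<in>B. cf s h * h x) = g s x / of_real t"
          unfolding e cf_def sum_divide_distrib by (intro sum.cong) auto
        moreover have "trig_poly J s x = u s x / of_real t" using t by (simp add: u_eq)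
        ultimately have "?D s x = (u s x - g s x) / of_real t" by (simp add: diff_divide_distrib)
        then show "norm (?D s x) = (1 / t) * norm (u s x - g s x)"
          using t by (simp add: norm_divide)
      qed
      then have "(LINT x|unit_cube. norm (?D s x)) = (LINT x|unit_cube. (1 / t) * norm (u s x - g s x))"
        using trig_i[of s] lin_i[of "cf s"] Li[OF ug]
        by (intro integral_cong_AE borel_measurable_norm borel_measurable_diff borel_measurable_times borel_measurable_const
            borel_measurable_integrable) auto
      also have "\<dots> = (1 / t) * (LINT x|unit_cube. norm (u s x - g s x))" by simp
      also have "\<dots> \<le> (1 / t) * (C7 * (c / M ^ r))"
        using t C7 less_imp_le[OF g(2)[OF s]] by (intro mult_left_mono order_trans[OF L1[OF ug]]) auto
      also have "\<dots> = R0"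
        using C C7 M unfolding t_def c_def R0_def by (simp add: field_simps)
      finally show ?thesis .
    qed
    have card_le: "real (card P) \<le> ((sqrt N + R0 + R0) / R0) ^ (2 * card B)"
    proof (rule seminorm_packing[where nu = nn and cf = cf and K = "\<Sum>h\<in>B. LINT x|unit_cube. norm (h x)"])
      show "nn \<in> borel_measurable (PiM B (\<lambda>_. lborel))"
      proof -
        interpret Q: finite_measure "unit_cube :: (real ^ 'd) measure" by (rule finite_measureI) (simp add: emeasure_unit_cube)
        have "(\<lambda>z. norm (\<Sum>h\<in>B. (fst z) h * h (snd z))) \<in> borel_measurable (PiM B (\<lambda>_. lborel :: complex measure) \<Otimes>\<^sub>M unit_cube)"
        proof (rule measurable_compose[OF _ borel_measurable_norm], intro borel_measurable_sum borel_measurable_times)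
          fix h assume h: "h \<in> B"
          have "(\<lambda>z. fst z h) \<in> measurable (PiM B (\<lambda>_. lborel :: complex measure) \<Otimes>\<^sub>M (unit_cube :: (real ^ 'd) measure)) lborel"
            by (rule measurable_compose[OF measurable_fst measurable_component_singleton[OF h]])
          then show "(\<lambda>z. fst z h) \<in> borel_measurable (PiM B (\<lambda>_. lborel :: complex measure) \<Otimes>\<^sub>M (unit_cube :: (real ^ 'd) measure))" by simp
          show "(\<lambda>z. h (snd z)) \<in> borel_measurable (PiM B (\<lambda>_. lborel :: complex measure) \<Otimes>\<^sub>M unit_cube)"
            by (rule measurable_compose[OF measurable_snd borel_measurable_integrable[OF Bi[OF h]]])
        qed
        then show ?thesis unfolding nn_def[abs_def]
          by (intro Q.borel_measurable_lebesgue_integral) (simp add: split_beta')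
      qed
      show "nn k = nn l" if "\<And>h. h \<in> B \<Longrightarrow> k h = l h" for k l
      proof -
        have "(\<Sum>h\<in>B. k h * h x) = (\<Sum>h\<in>B. l h * h x)" for x using that by (intro sum.cong) auto
        then show ?thesis by (simp add: nn_def)
      qed
      show "nn (\<lambda>h. k h + l h) \<le> nn k + nn l" for k l
      proof -
        have "nn (\<lambda>h. k h + l h) \<le> (LINT x|unit_cube. norm (\<Sum>h\<in>B. k h * h x) + norm (\<Sum>h\<in>B. l h * h x))"
          unfolding nn_def
        proof (rule integral_mono)
          fix x show "norm (\<Sum>h\<in>B. (k h + l h) * h x) \<le> norm (\<Sum>h\<in>B. k h * h x) + norm (\<Sum>h\<in>B. l h * h x)"
            unfolding distrib_right sum.distrib by (rule norm_triangle_ineq)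
        qed (intro integrable_norm L_integrable_add lin_i)+
        also have "\<dots> = nn k + nn l" unfolding nn_def by (intro L_integral_add integrable_norm lin_i)
        finally show ?thesis .
      qed
      show "nn (\<lambda>h. s *\<^sub>R k h) = \<bar>s\<bar> * nn k" for s k
      proof -
        have "norm (\<Sum>h\<in>B. (s *\<^sub>R k h) * h x) = \<bar>s\<bar> * norm (\<Sum>h\<in>B. k h * h x)" for x
          by (simp add: scaleR_sum_right[symmetric])
        then show ?thesis by (simp add: nn_def)
      qed
      show "nn k \<le> (\<Sum>h\<in>B. LINT x|unit_cube. norm (h x)) * T" if kT: "\<And>h. h \<in> B \<Longrightarrow> norm (k h) \<le> T" for k T
      proof -
        have "nn k \<le> (LINT x|unit_cube. (\<Sum>h\<in>B. T * norm (h x)))"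
          unfolding nn_def
        proof (rule integral_mono)
          show "integrable unit_cube (\<lambda>x. \<Sum>h\<in>B. T * norm (h x))"
            by (intro L_integrable_sum integrable_mult_right integrable_norm Bi)
          fix x :: "real ^ 'd"
          have "norm (\<Sum>h\<in>B. k h * h x) \<le> (\<Sum>h\<in>B. norm (k h * h x))" by (rule norm_sum)
          also have "\<dots> \<le> (\<Sum>h\<in>B. T * norm (h x))" unfolding norm_mult by (intro sum_mono mult_right_mono kT) auto
          finally show "norm (\<Sum>h\<in>B. k h * h x) \<le> (\<Sum>h\<in>B. T * norm (h x))" .
        qed (intro integrable_norm lin_i)
        also have "\<dots> = (\<Sum>h\<in>B. LINT x|unit_cube. T * norm (h x))"
          by (intro L_integral_sum integrable_mult_right integrable_norm Bi)
        finally show ?thesis by (simp add: sum_distrib_left[symmetric] mult.commute)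
      qed
      show "0 \<le> (\<Sum>h\<in>B. LINT x|unit_cube. norm (h x))" by (intro sum_nonneg integral_nonneg_AE) auto
      show "nn (cf s) \<le> sqrt N + R0" if s: "s \<in> P" for s
      proof -
        have sS: "s \<in> signs J" using s P(1) Gsub by blast
        have "nn (cf s) \<le> (LINT x|unit_cube. norm (trig_poly J s x) + norm (?D s x))"
          unfolding nn_def
        proof (rule integral_mono)
          fix x show "norm (\<Sum>h\<in>B. cf s h * h x) \<le> norm (trig_poly J s x) + norm (?D s x)"
            using norm_triangle_ineq4[of "trig_poly J s x" "?D s x"] by simp
        qed (intro integrable_norm L_integrable_add L_integrable_diff lin_i trig_i)+
        also have "\<dots> = (LINT x|unit_cube. norm (trig_poly J s x)) + (LINT x|unit_cube. norm (?D s x))"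
          by (intro L_integral_add integrable_norm L_integrable_diff lin_i trig_i)
        also have "\<dots> \<le> sqrt N + R0" unfolding N_def by (intro add_mono trig_poly_L1_le fJ ne sS close s)
        finally show ?thesis .
      qed
      show "2 * R0 \<le> nn (\<lambda>h. cf s h - cf s' h)" if s: "s \<in> P" "s' \<in> P" "s \<noteq> s'" for s s'
      proof -
        \<comment> \<open>The polynomials are 4 R0 apart; two errors of at most R0 leave 2 R0 for
          the approximants.\<close>
        have "4 * R0 = sqrt (real (card J)) / (32 * sqrt C4)" by (simp add: R0_def c1_def N_def)
        also have "\<dots> \<le> (LINT x|unit_cube. norm (trig_poly J s x - trig_poly J s' x))"
          by (rule trig_poly_L1_separated[OF fJ ne _ _ C(2) _ _ P(2)[OF s]]) (use s P(1) in \<open>auto simp: G_def\<close>)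
        also have "\<dots> \<le> (LINT x|unit_cube. norm (\<Sum>h\<in>B. (cf s h - cf s' h) * h x) + (norm (?D s x) + norm (?D s' x)))"
        proof (rule integral_mono)
          fix x
          have "trig_poly J s x - trig_poly J s' x = (\<Sum>h\<in>B. (cf s h - cf s' h) * h x) + (?D s x - ?D s' x)"
            by (simp add: left_diff_distrib sum_subtractf)
          then have "norm (trig_poly J s x - trig_poly J s' x) \<le> norm (\<Sum>h\<in>B. (cf s h - cf s' h) * h x) + norm (?D s x - ?D s' x)"
            by (simp only: norm_triangle_ineq)
          then show "norm (trig_poly J s x - trig_poly J s' x) \<le> norm (\<Sum>h\<in>B. (cf s h - cf s' h) * h x) + (norm (?D s x) + norm (?D s' x))"
            using norm_triangle_ineq4[of "?D s x" "?D s' x"] by linarith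
        qed (intro integrable_norm L_integrable_add L_integrable_diff lin_i trig_i)+
        also have "\<dots> = nn (\<lambda>h. cf s h - cf s' h) + ((LINT x|unit_cube. norm (?D s x)) + (LINT x|unit_cube. norm (?D s' x)))"
        proof -
          have i: "integrable unit_cube (\<lambda>x. norm (\<Sum>h\<in>B. (cf s h - cf s' h) * h x))"
            "integrable unit_cube (\<lambda>x. norm (?D s x))" "integrable unit_cube (\<lambda>x. norm (?D s' x))"
            by (intro integrable_norm L_integrable_diff lin_i trig_i)+
          show ?thesis unfolding nn_def
            using L_integral_add[OF i(1) L_integrable_add[OF i(2,3)]]
              L_integral_add[OF i(2,3)] by simp
        qed
        finally show ?thesis using close[OF s(1)] close[OF s(2)] by linarith
      qed
      show "0 < sqrt N + R0" using N R0 by (simp add: add_pos_pos)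
    qed (use B fP R0 in auto)
    have "(sqrt N + R0 + R0) / R0 = w0"
    proof -
      have "(w + c1 * w / 4 + c1 * w / 4) / (c1 * w / 4) = (1 + c1 / 2) / (c1 / 4)" if "w > 0" for w
        using that c1 by (simp add: field_simps)
      then show ?thesis unfolding R0_def w0_def by this (use N in simp)
    qed
    with card_le have "real (card P) \<le> w0 ^ (2 * card B)" by (simp only:)
    also have "\<dots> \<le> w0 ^ (2 * n)" using B(3) w0 by (intro power_increasing) auto
    finally have "real (card P) \<le> w0 ^ (2 * n)" .
    then have "real (card G) \<le> w0 ^ (2 * n) * (3 / 2) ^ card J"
      by (intro order_trans[OF P(3)] mult_right_mono) auto
    moreover have "(2::real) ^ card J \<le> 2 * real (card G)"
    proof -
      have "real (2 ^ card J) \<le> real (2 * card G)" using cG by (simp only: of_nat_le_iff)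
      then show ?thesis by simp
    qed
    ultimately have "(2::real) ^ card J \<le> 2 * w0 ^ (2 * n) * (3 / 2) ^ card J" by linarith
    \<comment> \<open>Of the 2^N signs the separation uses up a factor (3/2)^N, and (4/3)^N
      remains.\<close>
    moreover have "(2::real) ^ card J = (4 / 3) ^ card J * (3 / 2) ^ card J" by (simp add: power_mult_distrib[symmetric])
    ultimately have "(4 / 3 :: real) ^ card J \<le> 2 * w0 ^ (2 * n)" by simp
    then have "ln ((4 / 3 :: real) ^ card J) \<le> ln (2 * w0 ^ (2 * n))" using w0 by (subst ln_le_cancel_iff) auto
    then have "N * ln (4 / 3) \<le> ln 2 + 2 * real n * ln w0"
      using w0 by (simp add: ln_realpow ln_mult N_def)
    also have "\<dots> \<le> (ln 2 + 2 * ln w0) * real n"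
      using n mult_left_mono[of 1 "real n" "ln 2"] by (simp add: algebra_simps)
    also have "\<dots> = (K - 1) * real n * ln (4 / 3)" by (simp add: K_def)
    also have "\<dots> < K * real n * ln (4 / 3)" using n by simp
    finally have "N < K * real n" by (simp add: mult_less_cancel_right)
    then show False using N(2) by simp
  qed
qed

end

section \<open>The widths\<close>

text \<open>Keeps the size M of the cross above sqrt n, which bounds log M below by half of log
  n.\<close>

lemma max_ln_power_le:
  assumes n: "(n::real) \<ge> 1"
  shows "max 1 (ln n) ^ e \<le> max 1 ((2 * real e) ^ e) * sqrt n"
proof -
  have s: "sqrt n \<ge> 1" using n by simp
  show ?thesis
  proof (cases "e = 0 \<or> ln n \<le> 1")
    case True
    then have "max 1 (ln n) ^ e = 1" by (auto simp: max_def)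
    also have "1 \<le> max 1 ((2 * real e) ^ e) * sqrt n" using mult_mono[of 1 "max 1 ((2 * real e) ^ e)" 1 "sqrt n"] s by simp
    finally show ?thesis .
  next
    case False
    then have e: "e > 0" by simp
    have "(ln n / 2 / real e) ^ e \<le> exp (ln n / 2)" by (rule power_le_exp) (use n e in auto)
    also have "\<dots> = sqrt n" using n by (simp add: ln_sqrt[symmetric])
    finally have le: "(ln n / 2 / real e) ^ e \<le> sqrt n" .
    have "max 1 (ln n) ^ e = (2 * real e) ^ e * (ln n / 2 / real e) ^ e"
      unfolding power_mult_distrib[symmetric] using e False by (simp add: max_def)
    also have "\<dots> \<le> (2 * real e) ^ e * sqrt n" using le by (rule mult_left_mono) simp
    also have "(2 * real e) ^ e * sqrt n \<le> max 1 ((2 * real e) ^ e) * sqrt n" by (intro mult_right_mono) (use s in auto)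
    finally show ?thesis .
  qed
qed

text \<open>A is linear only almost everywhere, so its range need not be a subspace. Closing the
  range under equality almost everywhere gives a genuine subspace with the same dimension bound,
  which approximates at least as well as A.\<close>

lemma kolmogorov_le_linear:
  "kolmogorov_width n W q M \<le> linear_width n W q M" if WX: "W \<subseteq> Lp q M" and q: "q \<ge> 0"
  unfolding linear_width_def
proof (rule INF_greatest)
  fix A assume "A \<in> {A. linear_operator M (Lp q M) A \<and> rank_le M (Lp q M) n A}"
  then have lin: "linear_operator M (Lp q M) A" and rank: "rank_le M (Lp q M) n A" by auto
  note lo = lin[unfolded linear_operator_def]
  have A_in: "A f \<in> Lp q M" if "f \<in> Lp q M" for f by (rule bspec[OF conjunct1[OF lo] that])
  have A_add: "AE x in M. A (\<lambda>y. f y + g y) x = A f x + A g x" if "f \<in> Lp q M" "g \<in> Lp q M" for f g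
    by (rule bspec[OF bspec[OF conjunct1[OF conjunct2[OF conjunct2[OF lo]]] that(1)] that(2)])
  have A_mult: "AE x in M. A (\<lambda>y. c * f y) x = c * A f x" if "f \<in> Lp q M" for f c
    by (rule spec[OF bspec[OF conjunct2[OF conjunct2[OF conjunct2[OF lo]]] that]])
  define L where "L = {g \<in> Lp q M. \<exists>f\<in>Lp q M. AE x in M. g x = A f x}"
  have LI: "g \<in> L" if "g \<in> Lp q M" "f \<in> Lp q M" "AE x in M. g x = A f x" for f g
    unfolding L_def using that by (intro CollectI conjI bexI)
  have LE: "\<exists>f\<in>Lp q M. AE x in M. g x = A f x" "g \<in> Lp q M" if "g \<in> L" for g
    using that unfolding L_def by simp_all
  have AL: "A f \<in> L" if "f \<in> Lp q M" for f by (rule LI[OF A_in[OF that] that]) simp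
  have "linear_subspace (Lp q M) L"
    unfolding linear_subspace_def
  proof (intro conjI ballI allI)
    show "L \<subseteq> Lp q M" using LE(2) by (rule subsetI)
    show "(\<lambda>_. 0) \<in> L"
    proof (rule LI[OF Lp_zero Lp_zero])
      show "AE x in M. 0 = A (\<lambda>_. 0) x" using A_mult[OF Lp_zero, of 0] by eventually_elim simp
    qed
  next
    fix f g assume "f \<in> L" "g \<in> L"
    note fg = this
    obtain f' where f: "f' \<in> Lp q M" "AE x in M. f x = A f' x" using LE(1)[OF fg(1)] by (elim bexE) (rule that)
    obtain g' where g: "g' \<in> Lp q M" "AE x in M. g x = A g' x" using LE(1)[OF fg(2)] by (elim bexE) (rule that)
    from A_add[OF f(1) g(1)] have "AE x in M. f x + g x = A (\<lambda>y. f' y + g' y) x" using f(2) g(2) by eventually_elim simp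
    then show "(\<lambda>x. f x + g x) \<in> L" by (rule LI[OF Lp_add[OF LE(2)[OF fg(1)] LE(2)[OF fg(2)] q] Lp_add[OF f(1) g(1) q]])
  next
    fix f and c :: complex assume fL: "f \<in> L"
    obtain f' where f: "f' \<in> Lp q M" "AE x in M. f x = A f' x" using LE(1)[OF fL] by (elim bexE) (rule that)
    from A_mult[OF f(1), of c] have "AE x in M. c * f x = A (\<lambda>y. c * f' y) x" using f(2) by eventually_elim simp
    then show "(\<lambda>x. c * f x) \<in> L" by (rule LI[OF Lp_cmult[OF LE(2)[OF fL]] Lp_cmult[OF f(1)]])
  qed
  moreover have "dim_at_most M n L"
  proof -
    obtain B where B: "B \<subseteq> A ` Lp q M" "finite B" "card B \<le> n"
      and sp: "\<forall>g\<in>A ` Lp q M. \<exists>c. AE x in M. g x = (\<Sum>h\<in>B. c h * h x)"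
      using rank unfolding rank_le_def dim_at_most_def by (elim exE conjE) (rule that)
    show ?thesis
      unfolding dim_at_most_def
    proof (rule exI[of _ B], intro conjI ballI)
      show "B \<subseteq> L" using B(1) AL by blast
      show "finite B" "card B \<le> n" by fact+
      fix g assume gL: "g \<in> L"
      obtain f where f: "f \<in> Lp q M" "AE x in M. g x = A f x" using LE(1)[OF gL] by (elim bexE) (rule that)
      obtain c where "AE x in M. A f x = (\<Sum>h\<in>B. c h * h x)" using bspec[OF sp imageI[OF f(1)]] by (elim exE) (rule that)
      with f(2) have "AE x in M. g x = (\<Sum>h\<in>B. c h * h x)" by eventually_elim simp
      then show "\<exists>c. AE x in M. g x = (\<Sum>h\<in>B. c h * h x)" by (rule exI[of _ c])
    qed
  qed
  ultimately have "kolmogorov_width n W q M \<le> (SUP f\<in>W. INF g\<in>L. ennreal (Lp_norm q M (\<lambda>x. f x - g x)))"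
    unfolding kolmogorov_width_def by (intro INF_lower) simp
  also have "\<dots> \<le> op_error W q M A"
    unfolding op_error_def
  proof (rule SUP_mono)
    fix f assume f: "f \<in> W"
    then have "A f \<in> L" using WX AL by blast
    then show "\<exists>m\<in>W. (INF g\<in>L. ennreal (Lp_norm q M (\<lambda>x. f x - g x))) \<le> ennreal (Lp_norm q M (\<lambda>x. m x - A m x))"
      using f by (intro bexI[of _ f] INF_lower2[of "A f"]) auto
  qed
  finally show "kolmogorov_width n W q M \<le> op_error W q M A" .
qed

context hc_setting
begin

text \<open>A cross of size M has at least a constant times M log^(d-1) M points. With M = D n /
  log^(d-1) n this exceeds K n, and M^(-r) is the rate up to a constant.\<close>

lemma kolmogorov_rate:
  "\<exists>c>0. \<forall>n\<ge>1. ennreal (c * rate CARD('d) r n) \<le> kolmogorov_width (nat \<lfloor>n\<rfloor>) (sobolev_ball r p \<mu>) q \<mu>"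
proof -
  let ?e = "CARD('d) - 1"
  obtain c K where c: "c > 0" and K: "K > 0" and low: "\<And>M n. M \<ge> 1 \<Longrightarrow> n \<ge> 1 \<Longrightarrow>
      K * real n \<le> real (card (hyp_points (UNIV :: 'd set) M)) \<Longrightarrow>
      ennreal (c / M ^ r) \<le> kolmogorov_width n (sobolev_ball r p \<mu>) q \<mu>"
    by (rule kolmogorov_lower, rule that; assumption)
  obtain ch where ch: "ch > 0" "\<And>M. M \<ge> 1 \<Longrightarrow> ch * M * max 1 (ln M) ^ ?e \<le> real (card (hyp_points (UNIV :: 'd set) M))"
    using hyperbolic_count[of "UNIV :: 'd set"] by auto
  define Cd where "Cd = max 1 ((2 * real ?e) ^ ?e)"
  \<comment> \<open>The first summand gives M >= sqrt n; the second lets the count exceed K n after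
    the bound log M >= (log n)/2 has cost 2^(d-1).\<close>
  define D where "D = Cd + K * 2 ^ ?e / ch"
  have D: "D \<ge> Cd" "K * 2 ^ ?e \<le> ch * D" "D > 0" "Cd \<ge> 1"
  proof -
    show 1: "Cd \<ge> 1" by (simp add: Cd_def)
    show 2: "D \<ge> Cd" using K ch by (simp add: D_def)
    show "D > 0" using 1 2 by linarith
    have "ch * D = ch * Cd + K * 2 ^ ?e" using ch by (simp add: D_def distrib_left)
    then show "K * 2 ^ ?e \<le> ch * D" using ch 1 by simp
  qed
  show ?thesis
  proof (intro exI[of _ "c / D ^ r"] conjI allI impI)
    show "c / D ^ r > 0" using c D by simp
    fix n :: real assume n: "n \<ge> 1"
    let ?L = "max 1 (ln n)"
    define M where "M = D * n / ?L ^ ?e"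
    have Le: "?L ^ ?e > 0" by (simp add: zero_less_power)
    have s: "sqrt n \<ge> 1" "sqrt n * sqrt n = n" using n by auto
    have Mn: "sqrt n \<le> M"
    proof -
      have "sqrt n * ?L ^ ?e \<le> sqrt n * (Cd * sqrt n)"
        unfolding Cd_def using s by (intro mult_left_mono max_ln_power_le n) auto
      also have "\<dots> = Cd * (sqrt n * sqrt n)" by (simp only: mult_ac)
      also have "\<dots> \<le> D * n" unfolding s(2) using D n by (intro mult_right_mono) auto
      finally show ?thesis unfolding M_def using Le by (subst pos_le_divide_eq) auto
    qed
    have M: "M \<ge> 1" using Mn s by linarith
    have "ln (sqrt n) \<le> ln M" using Mn s by (intro ln_mono) linarith+
    then have "ln n / 2 \<le> ln M" using n by (simp add: ln_sqrt)
    then have "?L / 2 \<le> max 1 (ln M)" by (simp add: max_def)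
    then have Lp: "(?L / 2) ^ ?e \<le> max 1 (ln M) ^ ?e" by (intro power_mono) auto
    have "K * real (nat \<lfloor>n\<rfloor>) \<le> K * n" using K n by (intro mult_left_mono) auto
    also have "\<dots> = K * 2 ^ ?e * n / 2 ^ ?e" by simp
    also have "\<dots> \<le> ch * D * n / 2 ^ ?e" using D n by (intro divide_right_mono mult_right_mono) auto
    also have "\<dots> = ch * M * (?L / 2) ^ ?e"
    proof -
      have "ch * D * n / t = ch * (D * n / l) * (l / t)" if "l > 0" for l t using that by simp
      then show ?thesis unfolding M_def power_divide using Le by blast
    qed
    also have "\<dots> \<le> ch * M * max 1 (ln M) ^ ?e" using ch M by (intro mult_left_mono Lp) auto
    also have "\<dots> \<le> real (card (hyp_points (UNIV :: 'd set) M))" by (rule ch(2)[OF M])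
    finally have "ennreal (c / M ^ r) \<le> kolmogorov_width (nat \<lfloor>n\<rfloor>) (sobolev_ball r p \<mu>) q \<mu>"
      using n by (intro low[OF M]) (auto simp: le_nat_iff le_floor_iff)
    moreover have "c / D ^ r * rate CARD('d) r n = c / M ^ r"
    proof -
      have "n powr (- real r) = 1 / n ^ r" using n by (simp add: powr_minus_divide powr_realpow)
      moreover have "M ^ r = D ^ r * n ^ r / ?L ^ (?e * r)" unfolding M_def by (simp add: power_divide power_mult_distrib power_mult)
      ultimately show ?thesis unfolding rate_def by simp
    qed
    ultimately show "ennreal (c / D ^ r * rate CARD('d) r n) \<le> kolmogorov_width (nat \<lfloor>n\<rfloor>) (sobolev_ball r p \<mu>) q \<mu>" by simp
  qed
qed

end

text \<open>Two functions squeezed between the same multiples of h are comparable, with constants c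
  / C and C / c.\<close>

lemma asymp_eqI:
  fixes h :: "real \<Rightarrow> real"
  assumes "c > 0" "C > 0" and "\<And>n. n \<ge> 1 \<Longrightarrow> ennreal (c * h n) \<le> F n" "\<And>n. n \<ge> 1 \<Longrightarrow> F n \<le> ennreal (C * h n)"
    and "\<And>n. n \<ge> 1 \<Longrightarrow> ennreal (c * h n) \<le> G n" "\<And>n. n \<ge> 1 \<Longrightarrow> G n \<le> ennreal (C * h n)"
  shows "asymp_eq F G"
  unfolding asymp_eq_def
proof (rule exI[of _ "c / C"], rule exI[of _ "C / c"], intro conjI allI impI)
  show "c / C > 0" "C / c > 0" using assms(1,2) by auto
  fix n :: real assume n: "n \<ge> 1"
  have cC: "ennreal (c / C) * ennreal (C * h n) = ennreal (c * h n)" "ennreal (C / c) * ennreal (c * h n) = ennreal (C * h n)"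
    using assms(1,2) by (simp_all add: ennreal_mult'[symmetric])
  have "ennreal (c / C) * G n \<le> ennreal (c / C) * ennreal (C * h n)" by (intro mult_left_mono assms(6) n) simp
  then show "ennreal (c / C) * G n \<le> F n" unfolding cC using assms(3)[OF n] by (rule order_trans)
  have "ennreal (C / c) * ennreal (c * h n) \<le> ennreal (C / c) * G n" by (intro mult_left_mono assms(5) n) simp
  then show "F n \<le> ennreal (C / c) * G n" unfolding cC using assms(4)[OF n] by (rule order_trans[rotated])
qed

theorem theorem3p8:
  fixes lam a b p q \<theta> :: real
    and r :: nat
    and A :: "nat \<Rightarrow> (real ^ 'd \<Rightarrow> complex) \<Rightarrow> real ^ 'd \<Rightarrow> complex"
    and \<phi> :: "int ^ 'd \<Rightarrow> real ^ 'd \<Rightarrow> real"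
  defines "\<mu> \<equiv> (weight_measure lam a b :: (real ^ 'd) measure)"
  assumes "lam > 1" and "a > 0"
    and "r \<ge> 1"
    and "1 \<le> q" and "q < p"
    and "1 < \<theta>" and "\<theta> < 2"
    and "smooth_partition r p \<theta> \<phi>"
    and "\<And>m. m \<ge> 1 \<Longrightarrow> linear_operator (leb_on (cube 1 0)) (Lp_per 1 q) (A m)"
    and "\<And>m. m \<ge> 1 \<Longrightarrow> rank_le (leb_on (cube 1 0)) (Lp_per 1 q) m (A m)"
    and "\<And>m. m \<ge> 1 \<Longrightarrow> \<exists>G. hyperbolic_cross G \<and>
           (\<forall>f \<in> Lp_per 1 q. AE x in leb_on (cube 1 0). A m f x = fourier_truncation G f x)"
    and "\<exists>C. \<forall>m\<ge>1. \<forall>f \<in> sobolev_per 1 r p.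
           Lp_norm q (leb_on (cube 1 0)) (\<lambda>x. f x - A m f x)
             \<le> C * rate CARD('d) r (real m) * sobolev_norm r p (leb_on (cube 1 0)) f"
  shows "\<exists>\<delta>\<^sub>0>0. \<forall>\<delta>. 0 < \<delta> \<and> \<delta> < \<delta>\<^sub>0 \<longrightarrow>
     (\<forall>n\<ge>1. linear_operator \<mu> (Lp q \<mu>) (assembled_op A \<phi> \<theta> lam a r \<delta> n) \<and>
             rank_le \<mu> (Lp q \<mu>) (nat \<lfloor>n\<rfloor>) (assembled_op A \<phi> \<theta> lam a r \<delta> n)) \<and>
     asymp_eq (\<lambda>n. op_error (sobolev_ball r p \<mu>) q \<mu> (assembled_op A \<phi> \<theta> lam a r \<delta> n))
              (\<lambda>n. linear_width (nat \<lfloor>n\<rfloor>) (sobolev_ball r p \<mu>) q \<mu>) \<and>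
     asymp_eq (\<lambda>n. linear_width (nat \<lfloor>n\<rfloor>) (sobolev_ball r p \<mu>) q \<mu>)
              (\<lambda>n. kolmogorov_width (nat \<lfloor>n\<rfloor>) (sobolev_ball r p \<mu>) q \<mu>) \<and>
     asymp_eq (\<lambda>n. kolmogorov_width (nat \<lfloor>n\<rfloor>) (sobolev_ball r p \<mu>) q \<mu>)
              (\<lambda>n. ennreal (rate CARD('d) r n))"
proof -
  interpret hc: hc_setting lam a b p q \<theta> r A \<phi>
    by (rule hc_setting.intro) (rule assms; assumption)+
  let ?W = "sobolev_ball r p \<mu>" and ?S = "assembled_op A \<phi> \<theta> lam a r" and ?rate = "rate CARD('d) r"
  let ?rh = "rho CARD('d) lam a r"
  obtain \<delta>1 where d1: "\<delta>1 > 0" "\<And>\<delta>. 0 < \<delta> \<Longrightarrow> \<delta> < \<delta>1 \<Longrightarrow> ?rh \<delta> > 0"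
    "\<And>\<delta> F. 0 < \<delta> \<Longrightarrow> \<delta> < \<delta>1 \<Longrightarrow> finite (F :: (int ^ 'd) set) \<Longrightarrow>
       (\<Sum>k\<in>F. ?rh \<delta> * exp (- (a * \<delta> / real r) * norm (int_vec k) powr lam)) \<le> 1"
    using rank_budget[OF hc.lam hc.a hc.r, where 'd='d] by blast
  obtain \<delta>2 where d2: "\<delta>2 > 0" and up: "\<forall>\<delta>. 0 < \<delta> \<and> \<delta> < \<delta>2 \<and> ?rh \<delta> > 0 \<and> (\<forall>n k. n \<ge> 1 \<longrightarrow> local_rank lam a r \<delta> n (k :: int ^ 'd) \<le> n) \<longrightarrow>
    (\<exists>C\<ge>0. \<forall>n\<ge>1. \<forall>f\<in>?W. Lp_norm q \<mu> (\<lambda>x. f x - ?S \<delta> n f x) \<le> C * ?rate n)"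
    using hc.upper_bound[folded \<mu>_def] by (elim exE conjE) (rule that)
  obtain c where c: "c > 0" and low: "\<And>n. n \<ge> 1 \<Longrightarrow> ennreal (c * ?rate n) \<le> kolmogorov_width (nat \<lfloor>n\<rfloor>) ?W q \<mu>"
    using hc.kolmogorov_rate[folded \<mu>_def] by blast
  show ?thesis
  \<comment> \<open>Below \<open>\<delta>1\<close> the local ranks fit into n, below
    \<open>\<delta>2\<close> the sum over the cubes converges; both thresholds are independent of
    n.\<close>
  proof (rule exI[of _ "min \<delta>1 \<delta>2"], intro conjI[of "min \<delta>1 \<delta>2 > 0"] allI[of "\<lambda>\<delta>. _ \<delta> \<longrightarrow> _ \<delta>"] impI)
    show "min \<delta>1 \<delta>2 > 0" using d1 d2 by simp
    fix \<delta> assume "0 < \<delta> \<and> \<delta> < min \<delta>1 \<delta>2"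
    then have \<delta>: "0 < \<delta>" "\<delta> < \<delta>1" "\<delta> < \<delta>2" by auto
    have rh: "?rh \<delta> > 0" by (rule d1(2)[OF \<delta>(1,2)])
    have budget: "(\<Sum>k\<in>F. local_rank lam a r \<delta> n k) \<le> n" if "finite F" "n \<ge> 1" for F :: "(int ^ 'd) set" and n
    proof -
      have "(\<Sum>k\<in>F. local_rank lam a r \<delta> n k) = n * (\<Sum>k\<in>F. ?rh \<delta> * exp (- (a * \<delta> / real r) * norm (int_vec k) powr lam))"
        unfolding local_rank_def sum_distrib_left by (intro sum.cong refl) (simp only: mult_ac)
      also have "\<dots> \<le> n * 1" using that by (intro mult_left_mono d1(3)[OF \<delta>(1,2)]) auto
      finally show ?thesis by simp
    qed
    have pos: "local_rank lam a r \<delta> n k \<ge> 0" if "n \<ge> 1" for n and k :: "int ^ 'd"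
      using that rh by (simp add: local_rank_def)
    \<comment> \<open>The budget of a single cube bounds its index by n; the upper bound needs this
      to compare logarithms.\<close>
    have "local_rank lam a r \<delta> n k \<le> n" if "n \<ge> 1" for n and k :: "int ^ 'd" using budget[of "{k}" n] that by simp
    then obtain C where C: "C \<ge> 0" "\<And>n f. n \<ge> 1 \<Longrightarrow> f \<in> ?W \<Longrightarrow> Lp_norm q \<mu> (\<lambda>x. f x - ?S \<delta> n f x) \<le> C * ?rate n"
      using up[rule_format, of \<delta>] \<delta> rh by blast
    have lin: "linear_operator \<mu> (Lp q \<mu>) (?S \<delta> n)" for n unfolding \<mu>_def by (rule hc.assembled_linear)
    have rank: "rank_le \<mu> (Lp q \<mu>) (nat \<lfloor>n\<rfloor>) (?S \<delta> n)" if n: "n \<ge> 1" for n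
      unfolding \<mu>_def by (rule hc.assembled_rank[OF n pos[OF n] budget[OF hc.finite_active n]])
    \<comment> \<open>C may be 0; adding c yields the strictly positive constant that
      \<open>asymp_eq\<close> demands.\<close>
    have op: "op_error ?W q \<mu> (?S \<delta> n) \<le> ennreal ((C + c) * ?rate n)" if n: "n \<ge> 1" for n
      unfolding op_error_def
    proof (rule SUP_least, rule ennreal_leI)
      fix f assume f: "f \<in> ?W"
      have "C * ?rate n \<le> (C + c) * ?rate n" using c rate_pos[OF n, of "CARD('d)" r] by (intro mult_right_mono) auto
      then show "Lp_norm q \<mu> (\<lambda>x. f x - ?S \<delta> n f x) \<le> (C + c) * ?rate n" using C(2)[OF n f] by linarith
    qed
    have lw: "linear_width (nat \<lfloor>n\<rfloor>) ?W q \<mu> \<le> op_error ?W q \<mu> (?S \<delta> n)" if n: "n \<ge> 1" for n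
      unfolding linear_width_def by (rule INF_lower) (use lin rank[OF n] in simp)
    have kl: "kolmogorov_width (nat \<lfloor>n\<rfloor>) ?W q \<mu> \<le> linear_width (nat \<lfloor>n\<rfloor>) ?W q \<mu>" for n
      by (rule kolmogorov_le_linear) (use hc.ball_Lp hc.q0 in \<open>auto simp: \<mu>_def\<close>)
    have Cc: "C + c > 0" using C c by simp
    have bounds: "ennreal (c * ?rate n) \<le> linear_width (nat \<lfloor>n\<rfloor>) ?W q \<mu>" "ennreal (c * ?rate n) \<le> op_error ?W q \<mu> (?S \<delta> n)"
      "linear_width (nat \<lfloor>n\<rfloor>) ?W q \<mu> \<le> ennreal ((C + c) * ?rate n)"
      "kolmogorov_width (nat \<lfloor>n\<rfloor>) ?W q \<mu> \<le> ennreal ((C + c) * ?rate n)" if n: "n \<ge> 1" for n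
      using low[OF n] kl[of n] lw[OF n] op[OF n] by (auto intro: order_trans)
    note asy = asymp_eqI[OF c Cc, where h = ?rate]
    show "(\<forall>n\<ge>1. linear_operator \<mu> (Lp q \<mu>) (?S \<delta> n) \<and> rank_le \<mu> (Lp q \<mu>) (nat \<lfloor>n\<rfloor>) (?S \<delta> n)) \<and>
     asymp_eq (\<lambda>n. op_error ?W q \<mu> (?S \<delta> n)) (\<lambda>n. linear_width (nat \<lfloor>n\<rfloor>) ?W q \<mu>) \<and>
     asymp_eq (\<lambda>n. linear_width (nat \<lfloor>n\<rfloor>) ?W q \<mu>) (\<lambda>n. kolmogorov_width (nat \<lfloor>n\<rfloor>) ?W q \<mu>) \<and>
     asymp_eq (\<lambda>n. kolmogorov_width (nat \<lfloor>n\<rfloor>) ?W q \<mu>) (\<lambda>n. ennreal (?rate n))"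
    proof (intro conjI)
      show "\<forall>n\<ge>1. linear_operator \<mu> (Lp q \<mu>) (?S \<delta> n) \<and> rank_le \<mu> (Lp q \<mu>) (nat \<lfloor>n\<rfloor>) (?S \<delta> n)" using lin rank by blast
      show "asymp_eq (\<lambda>n. op_error ?W q \<mu> (?S \<delta> n)) (\<lambda>n. linear_width (nat \<lfloor>n\<rfloor>) ?W q \<mu>)"
        by (rule asy) (rule bounds op; assumption)+
      show "asymp_eq (\<lambda>n. linear_width (nat \<lfloor>n\<rfloor>) ?W q \<mu>) (\<lambda>n. kolmogorov_width (nat \<lfloor>n\<rfloor>) ?W q \<mu>)"
        by (rule asy) (rule bounds low; assumption)+
      show "asymp_eq (\<lambda>n. kolmogorov_width (nat \<lfloor>n\<rfloor>) ?W q \<mu>) (\<lambda>n. ennreal (?rate n))"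
        unfolding asymp_eq_def
        by (rule exI[of _ c], rule exI[of _ "C + c"])
          (use c Cc low bounds(4) in \<open>simp add: ennreal_mult'[symmetric]\<close>)
    qed
  qed
qed

end
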